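(* Let $(x_1,\dots,x_6)\in\mathbb R^6$ be the edge lengths of a decorated ideal hyperbolic tetrahedron $\Delta$, and for $b\in(0,1)$ and $k\in\{1,\dots,6\}$ let $a_k=\frac Q2+\mathbf i\frac{x_k}{2\pi b}$, where $Q=b+\frac1b$. Then as $b\to 0$, $$\bigg|\begin{matrix} a_1 & a_2 & a_3 \\ a_4 & a_5 & a_6 \end{matrix} \bigg|_b=\frac{1}{2}\,\frac{e^{\frac{-\mathrm{Cov}(\Delta)}{\pi b^2}}}{\sqrt[4]{-\det\mathrm{Gram}(\Delta)}}\Big(1+O\big(b^2\big)\Big),$$ where $|\cdots|_b$ is the ideal $\mathrm U_{q\tilde q}\mathfrak{sl}(2;\mathbb R)$-$6j$ symbol, $\mathrm{Cov}(\Delta)$ is the co-volume of $\Delta$, and $\mathrm{Gram}(\Delta)$ is the Gram matrix of $\Delta$ in the edge lengths.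
   Context: Ideal $6j$ symbol. For $b\in(0,1)$ let $Q=b+\frac1b$. For $z\in\mathbb C$ let $T_b(z)=e^{-\frac{\pi\mathbf i}{2}(z^2-Qz+\frac{Q^2+1}{6})}$, with the convention $T_b(z)^{1/2}=e^{-\frac{\pi\mathbf i}{4}(z^2-Qz+\frac{Q^2+1}{6})}$ (square roots of products/quotients of $T_b$'s are the corresponding products/quotients of these square roots). For $0<\mathrm{Re}(z)<Q$ let $S_b(z)=\exp\Big(\int_\Omega\frac{\sinh((\frac Q2-z)t)}{4t\sinh(\frac{bt}2)\sinh(\frac t{2b})}dt\Big)$, where $\Omega$ goes along the real line and passes above the pole at the origin. For $(a_1,\dots,a_6)\in(\frac Q2+\mathbf i\mathbb R)^6$ let $t_1=a_1+a_2+a_3$, $t_2=a_1+a_5+a_6$, $t_3=a_2+a_4+a_6$, $t_4=a_3+a_4+a_5$, $q_1=a_1+a_2+a_4+a_5$, $q_2=a_1+a_3+a_4+a_6$, $q_3=a_2+a_3+a_5+a_6$. The ideal $\mathrm U_{q\tilde q}\mathfrak{sl}(2;\mathbb R)$-$6j$ symbol is $$\bigg|\begin{matrix} a_1 & a_2 & a_3 \\ a_4 & a_5 & a_6 \end{matrix} \bigg|_b=\Bigg(\frac{\prod_{i=1}^4 T_b(2Q-t_i)}{\prod_{i=1}^4\prod_{j=1}^3 T_b(q_j-t_i)}\Bigg)^{\frac12}\int_\Gamma \frac{\prod_{i=1}^4 T_b(u-t_i)}{T_b(2Q-u)}\prod_{j=1}^3S_b(q_j-u)\,d\mathrm{Im}u,$$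 where $\Gamma$ is any vertical line passing through the interval $(\frac{11Q}6,2Q)$, oriented upward (the integral does not depend on the choice of $\Gamma$). Decorated ideal tetrahedra. An ideal hyperbolic tetrahedron is the convex hull in $\mathbb H^3$ of four points $v_1,\dots,v_4\in\partial\mathbb H^3$ not lying in the same totally geodesic plane; $e_{ij}$ is the geodesic joining $v_i,v_j$ and $\theta_{ij}$ the dihedral angle at $e_{ij}$. A decoration assigns a horosphere $H_i$ at each $v_i$. The edge length $x_{ij}$ is the signed distance between $e_{ij}\cap H_i$ and $e_{ij}\cap H_j$: positive if $H_i,H_j$ are disjoint, $0$ if they are tangent, negative if they intersect transversely. The identifications $(x_1,\dots,x_6)=(x_{12},x_{13},x_{23},x_{34},x_{24},x_{14})$, and likewise for the $\theta$'s, are used. The co-volume is $\mathrm{Cov}(\Delta)=\mathrm{Vol}(\Delta)+\frac12\sum_{\{i,j\}\subset\{1,2,3,4\}}\theta_{ij}x_{ij}$, with $\mathrm{Vol}$ the hyperbolic volume. $\mathrm{Gram}(\Delta)$ is the symmetric $4\times4$ matrix with diagonal entries $0$ and $(i,j)$ entry $-\frac{e^{x_{ij}}}2$ for $i\ne j$; its determinant is negative. *)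

theory Defs
  imports "HOL-Complex_Analysis.Complex_Analysis" "HOL-Library.Landau_Symbols"
begin

section \<open>The ideal 6j-symbol\<close>

definition Qb :: "real \<Rightarrow> real" where
  "Qb b = b + 1 / b"

definition Tb :: "real \<Rightarrow> complex \<Rightarrow> complex" where
  "Tb b z = exp (- (of_real pi * \<i> / 2) * (z\<^sup>2 - of_real (Qb b) * z + of_real (((Qb b)\<^sup>2 + 1) / 6)))"

definition Tb_sqrt :: "real \<Rightarrow> complex \<Rightarrow> complex" where
  "Tb_sqrt b z = exp (- (of_real pi * \<i> / 4) * (z\<^sup>2 - of_real (Qb b) * z + of_real (((Qb b)\<^sup>2 + 1) / 6)))"

definition Sb_integrand :: "real \<Rightarrow> complex \<Rightarrow> complex \<Rightarrow> complex" where
  "Sb_integrand b z t =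
     sinh ((of_real (Qb b / 2) - z) * t) /
       (4 * t * sinh (of_real b * t / 2) * sinh (t / of_real (2 * b)))"

text \<open>The contour \<open>\<Omega>\<close> follows the real line, except that it goes around the origin along the upper
  half circle of radius \<open>pi * b\<close>, from \<open>- pi * b\<close> to \<open>pi * b\<close>. For \<open>0 < b < 1\<close> the nonzero poles of
  the integrand have modulus at least \<open>2 * pi * b\<close>, so every radius in \<open>(0, 2 * pi * b)\<close> gives the
  same value. For \<open>0 < Re z < Qb b\<close> the integrals over the two half lines converge absolutely.\<close>

definition Sb :: "real \<Rightarrow> complex \<Rightarrow> complex" where
  "Sb b z = exp
     ((LINT t:{..- (pi * b)}|lborel. Sb_integrand b z (of_real t)) +
      contour_integral (part_circlepath 0 (pi * b) pi 0) (Sb_integrand b z) +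
      (LINT t:{pi * b..}|lborel. Sb_integrand b z (of_real t)))"

definition sixj_t :: "(nat \<Rightarrow> complex) \<Rightarrow> complex list" where
  "sixj_t a = [a 1 + a 2 + a 3, a 1 + a 5 + a 6, a 2 + a 4 + a 6, a 3 + a 4 + a 5]"

definition sixj_q :: "(nat \<Rightarrow> complex) \<Rightarrow> complex list" where
  "sixj_q a = [a 1 + a 2 + a 4 + a 5, a 1 + a 3 + a 4 + a 6, a 2 + a 3 + a 5 + a 6]"

text \<open>The parameter \<open>c\<close> is the abscissa of the vertical line \<open>\<Gamma>\<close>, which is parametrised by \<open>s = Im u\<close>.
  It is meant to lie in \<open>(11 * Qb b / 6, 2 * Qb b)\<close>.\<close>

definition ideal_sixj :: "real \<Rightarrow> real \<Rightarrow> (nat \<Rightarrow> complex) \<Rightarrow> complex" where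
  "ideal_sixj c b a =
     (\<Prod>t\<leftarrow>sixj_t a. Tb_sqrt b (of_real (2 * Qb b) - t)) /
     (\<Prod>t\<leftarrow>sixj_t a. \<Prod>q\<leftarrow>sixj_q a. Tb_sqrt b (q - t)) *
     (LINT s|lborel.
        (let u = Complex c s in
          (\<Prod>t\<leftarrow>sixj_t a. Tb b (u - t)) / Tb b (of_real (2 * Qb b) - u) *
          (\<Prod>q\<leftarrow>sixj_q a. Sb b (q - u))))"


section \<open>Hyperbolic space: the hyperboloid model\<close>

type_synonym minkowski = "(real^3) \<times> real"

definition lor :: "minkowski \<Rightarrow> minkowski \<Rightarrow> real" where
  "lor x y = fst x \<bullet> fst y - snd x * snd y"

definition H3 :: "minkowski set" where
  "H3 = {x. lor x x = - 1 \<and> snd x > 0}"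

definition hdist :: "minkowski \<Rightarrow> minkowski \<Rightarrow> real" where
  "hdist x y = arcosh (- lor x y)"

text \<open>A point of the ideal boundary of \<^term>\<open>H3\<close> is a ray in the future light cone; it is given
  here by a vector spanning the ray. All notions below depend on the ray only.\<close>

definition ideal_rep :: "minkowski \<Rightarrow> bool" where
  "ideal_rep p \<longleftrightarrow> lor p p = 0 \<and> snd p > 0"

text \<open>The totally geodesic planes are the sets \<open>{x \<in> H3. lor x n = 0}\<close> with \<open>n\<close> spacelike, and the
  ideal points of such a plane are the light rays orthogonal to \<open>n\<close>.\<close>

definition ideal_coplanar :: "minkowski set \<Rightarrow> bool" where
  "ideal_coplanar P \<longleftrightarrow> (\<exists>n. lor n n > 0 \<and> (\<forall>p\<in>P. lor p n = 0))"

definition ideal_geodesic :: "minkowski \<Rightarrow> minkowski \<Rightarrow> minkowski set" where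
  "ideal_geodesic p q = {x \<in> H3. \<exists>s t. s > 0 \<and> t > 0 \<and> x = s *\<^sub>R p + t *\<^sub>R q}"

definition horosphere_at :: "minkowski \<Rightarrow> minkowski set \<Rightarrow> bool" where
  "horosphere_at p S \<longleftrightarrow> (\<exists>r>0. S = {x \<in> H3. lor x p = - r})"

text \<open>The convex hull in \<^term>\<open>H3\<close> is the radial projection of the affine convex hull, as in the
  Klein model.\<close>

definition ideal_hull :: "minkowski set \<Rightarrow> minkowski set" where
  "ideal_hull P = {x \<in> H3. \<exists>s>0. s *\<^sub>R x \<in> convex hull P}"

text \<open>The hyperboloid is the graph of \<open>y \<mapsto> sqrt (1 + y \<bullet> y)\<close>. In the coordinate \<open>y\<close> the metric
  induced by \<^term>\<open>lor\<close> has matrix \<open>1 - y y\<^sup>T / (1 + y \<bullet> y)\<close>, whose determinant is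
  \<open>1 / (1 + y \<bullet> y)\<close>.\<close>

definition hvolume :: "minkowski set \<Rightarrow> real" where
  "hvolume A = (LINT y:{y. (y, sqrt (1 + y \<bullet> y)) \<in> A}|lborel. 1 / sqrt (1 + y \<bullet> y))"


section \<open>Decorated ideal tetrahedra\<close>

text \<open>The four vertices are indexed by the type \<^typ>\<open>4\<close>, whose elements are \<open>1\<close>, \<open>2\<close>, \<open>3\<close> and
  \<open>4\<close> (the latter also denoted by \<open>0\<close>).\<close>

definition decorated_ideal_tetrahedron ::
    "(4 \<Rightarrow> minkowski) \<Rightarrow> (4 \<Rightarrow> minkowski set) \<Rightarrow> bool" where
  "decorated_ideal_tetrahedron p H \<longleftrightarrow>
     (\<forall>i. ideal_rep (p i)) \<and> \<not> ideal_coplanar (range p) \<and> (\<forall>i. horosphere_at (p i) (H i))"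

text \<open>The geodesic from \<open>p i\<close> to \<open>p j\<close> meets \<open>H i\<close> in exactly one point. When the two horospheres
  are tangent these points coincide and the length is \<open>0\<close>.\<close>

definition edge_length ::
    "(4 \<Rightarrow> minkowski) \<Rightarrow> (4 \<Rightarrow> minkowski set) \<Rightarrow> 4 \<Rightarrow> 4 \<Rightarrow> real" where
  "edge_length p H i j =
     (let d = hdist (the_elem (ideal_geodesic (p i) (p j) \<inter> H i))
                    (the_elem (ideal_geodesic (p i) (p j) \<inter> H j))
      in if H i \<inter> H j = {} then d else - d)"

definition outward_normal :: "(4 \<Rightarrow> minkowski) \<Rightarrow> 4 \<Rightarrow> minkowski" where
  "outward_normal p k =
     (THE n. lor n n = 1 \<and> (\<forall>j. j \<noteq> k \<longrightarrow> lor n (p j) = 0) \<and> lor n (p k) < 0)"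

text \<open>The two faces containing the edge \<open>ij\<close> are those opposite to the remaining vertices \<open>k\<close> and
  \<open>l\<close>; the interior dihedral angle is \<open>pi\<close> minus the angle between their outward normals.\<close>

definition dihedral_angle :: "(4 \<Rightarrow> minkowski) \<Rightarrow> 4 \<Rightarrow> 4 \<Rightarrow> real" where
  "dihedral_angle p i j =
     (THE \<theta>. \<exists>k l. k \<noteq> l \<and> {k, l} = - {i, j} \<and>
        \<theta> = pi - arccos (lor (outward_normal p k) (outward_normal p l)))"

definition covolume :: "(4 \<Rightarrow> minkowski) \<Rightarrow> (4 \<Rightarrow> minkowski set) \<Rightarrow> real" where
  "covolume p H =
     hvolume (ideal_hull (range p)) +
     1 / 2 * (\<Sum>(i, j)\<in>{(i, j). i < j}. dihedral_angle p i j * edge_length p H i j)"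

definition gram :: "(4 \<Rightarrow> minkowski) \<Rightarrow> (4 \<Rightarrow> minkowski set) \<Rightarrow> real^4^4" where
  "gram p H = (\<chi> i j. if i = j then 0 else - exp (edge_length p H i j) / 2)"

definition edge_lengths ::
    "(4 \<Rightarrow> minkowski) \<Rightarrow> (4 \<Rightarrow> minkowski set) \<Rightarrow> nat \<Rightarrow> real" where
  "edge_lengths p H k =
     (case [(1, 2), (1, 3), (2, 3), (3, 4), (2, 4), (1, 4)] ! (k - 1)
        of (i, j) \<Rightarrow> edge_length p H i j)"

end

theory Submission
  imports Defs "HOL-Complex_Analysis.Complex_Analysis" "HOL-Probability.Distributions" "HOL-Real_Asymp.Real_Asymp"
begin

text \<open>Put e = b^2. In the variable w = 2 pi b (2Q - u) - pi e the defining integral becomes,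
  up to an explicit factor, the integral of exp (V(w) / e - i w + O(e)) along a vertical line, with
  a potential V made of dilogarithms. The asymptotics is the saddle point formula for this integral;
  the geometry of the tetrahedron appears when the critical point, the critical value and the second
  derivative are computed in closed form.

  Double sine function. Rescaling t = 2 b s and subtracting the double pole at the origin writes
  S_b(z) as exp (\<open>Theta e a\<close> / e) with a = 1 + e - 2 b z (\<open>Sb_eq_Theta\<close>),
  where \<open>Theta e\<close> is an absolutely convergent real integral that makes sense at e = 0
  as well. Its kernel is even in e, so Theta e = Theta 0 + O(e^2) uniformly on closed substrips of
  |Re a| < 1 (\<open>Theta_approx\<close>), that is, log S_b is known up to O(e).
  \<open>Theta 0\<close> has derivative - log (2 cos (pi a / 2)) / 2 (\<open>Theta1_0\<close>) and
  is a dilogarithm plus a quadratic polynomial (\<open>Fa_upper\<close>).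

  Reduction. All factors T_b are exponentials of quadratic polynomials. Their exponents add up to an
  expression in w and in y1, y2, y3 only (\<open>tb_exponent_identity\<close>), which gives the
  exact formula \<open>ideal_sixj_eq_saddle_integral\<close>. Thus only the sums l1, l2, l3 of the
  lengths of opposite edges matter, since y1 = l1 + l2 and so on. The range (11Q/6, 2Q) for the line
  is where the integrand decays in both directions, and within it the line may be moved freely
  (\<open>Sexp_integral_shift\<close>).

  Triangle. For light vectors p_i at the vertices, the products of - lor p_i p_j over the three
  pairs of opposite edges are the squares of the sides of a Euclidean triangle. Its angles are the
  dihedral angles, equal at opposite edges, and the law of sines says that l_k = kappa + 2 ln sin
  (angle_k) with one common kappa; the Gram determinant is a multiple of Heron's polynomial
  (\<open>tetrahedron_geometry\<close>).

  Critical point. In these coordinates V' = 0 has the explicit solution \<open>critw\<close>,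
  translated by - 2 i kappa. Each of the three logarithmic terms of V' equals ln rho + i (pi / 2 -
  angle) there; the three ratios rho have product 1 and the angles have sum pi. The real part of the
  critical point is positive and smaller than every angle, hence below pi / 3, so for small e the
  line through it is admissible. On vertical lines Re V is strictly concave
  (\<open>Re_phi2_pos\<close>), so Laplace's method applies on this very line. The first correction
  is odd and integrates to zero, which is why the relative error is O(e)
  (\<open>laplace_expansion\<close>).

  Critical value. Along a path of triangles the motion of the critical point does not contribute to
  the derivative of V, and what remains is the derivative of the covolume in the manner of
  Schlaefli. Degeneration to the triangle (0, pi / 2, pi / 2) fixes the constant, so the real part
  of the critical value is - Cov / pi, with the volume expressed by the Lobachevsky function
  (\<open>critV_eq_critJ\<close>). The imaginary part cancels against the prefactor.

  Second derivative. At the critical point V'' = N^2 / (pi P), with P the product of the three sines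
  and N = \<open>critN\<close> (\<open>Vf2_w0\<close>, from \<open>critN_square\<close>). The N in
  the denominator of the Gaussian factor cancels the N in exp (- i w0), and the rest is the fourth
  root of the Gram determinant (\<open>leading_term\<close>).

  Volume. The volume of the ideal tetrahedron is obtained from its definition in the hyperboloid
  model by measuring a truncated cone twice, once in polar coordinates and once in the linear
  coordinates given by the vertices (\<open>tetrahedron_volume\<close>). The resulting integral over
  the positive octant is elementary up to a last integral of a logarithm, which the Lobachevsky
  function evaluates (\<open>Lob_angle_integral\<close>).\<close>

section \<open>Parameter integrals and bounds for the hyperbolic functions\<close>

text \<open>Only the derivative has to be dominated: on a convex set the mean value inequality turns
  its bound into a bound for the difference quotients, and dominated convergence applies along every
  sequence tending to the point.\<close>

lemma has_field_derivative_lebesgue_integral: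
  fixes f f' :: "complex \<Rightarrow> 'b \<Rightarrow> complex"
  assumes S: "open S" "convex S" "a \<in> S"
    and int: "\<And>z. z \<in> S \<Longrightarrow> integrable M (f z)"
    and der: "\<And>z s. z \<in> S \<Longrightarrow> ((\<lambda>z. f z s) has_field_derivative f' z s) (at z)"
    and bound: "\<And>z s. z \<in> S \<Longrightarrow> norm (f' z s) \<le> B s"
    and meas: "f' a \<in> borel_measurable M"
    and B: "integrable M B"
  shows "((\<lambda>z. LINT s|M. f z s) has_field_derivative (LINT s|M. f' a s)) (at a)"
proof -
  have "((\<lambda>y. ((LINT s|M. f y s) - (LINT s|M. f a s)) / (y - a)) \<longlongrightarrow> (LINT s|M. f' a s)) (at a within S)"
    unfolding tendsto_at_iff_sequentially comp_def
  proof (intro allI impI)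
    fix X :: "nat \<Rightarrow> complex"
    assume X: "\<forall>i. X i \<in> S - {a}" and lim: "X \<longlonglongrightarrow> a"
    have XS: "X i \<in> S" "X i \<noteq> a" for i using X by auto
    have eq: "((LINT s|M. f (X i) s) - (LINT s|M. f a s)) / (X i - a)
        = (LINT s|M. (f (X i) s - f a s) / (X i - a))" for i
      using int[OF XS(1)] int[OF S(3)] by (simp add: Bochner_Integration.integral_diff)
    show "(\<lambda>i. ((LINT s|M. f (X i) s) - (LINT s|M. f a s)) / (X i - a)) \<longlonglongrightarrow> (LINT s|M. f' a s)"
      unfolding eq
    proof (rule integral_dominated_convergence[where w = B])
      show "f' a \<in> borel_measurable M" by (rule meas)
      show "(\<lambda>s. (f (X i) s - f a s) / (X i - a)) \<in> borel_measurable M" for i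
        using int[OF XS(1)] int[OF S(3)] by (intro borel_measurable_integrable integrable_diff integrable_divide_zero) auto
      show "integrable M B" by (rule B)
      show "AE s in M. (\<lambda>i. (f (X i) s - f a s) / (X i - a)) \<longlonglongrightarrow> f' a s"
      proof (rule AE_I2)
        fix s
        from der[OF S(3), of s] have "((\<lambda>y. (f y s - f a s) / (y - a)) \<longlongrightarrow> f' a s) (at a)"
          by (simp add: has_field_derivative_iff)
        then show "(\<lambda>i. (f (X i) s - f a s) / (X i - a)) \<longlonglongrightarrow> f' a s"
          unfolding tendsto_at_iff_sequentially comp_def using XS lim by simp
      qed
      show "AE s in M. norm ((f (X i) s - f a s) / (X i - a)) \<le> B s" for i
      proof (rule AE_I2)
        fix s
        have "norm (f (X i) s - f a s) \<le> B s * norm (X i - a)"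
          by (rule field_differentiable_bound[OF S(2), where f' = "\<lambda>z. f' z s"])
             (use der bound XS S in \<open>auto intro: has_field_derivative_at_within\<close>)
        then show "norm ((f (X i) s - f a s) / (X i - a)) \<le> B s"
          using XS(2)[of i] by (simp add: norm_divide divide_simps)
      qed
    qed
  qed
  then show ?thesis
    unfolding has_field_derivative_iff at_within_open[OF S(3,1)] .
qed

text \<open>The common majorant for all the integrands of the \<open>Theta\<close> family.\<close>

lemma integrable_inverse_1_plus_square: "integrable lborel (\<lambda>s::real. C * inverse (1 + s\<^sup>2))"
proof -
  have "set_integrable lborel (einterval (-\<infinity>) \<infinity>) (\<lambda>s::real. inverse (1 + s\<^sup>2))"
  proof (rule interval_integral_FTC_nonneg(1)[where F = arctan and A = "-pi/2" and B = "pi/2"])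
    show "DERIV arctan x :> inverse (1 + x\<^sup>2)" for x by (rule DERIV_arctan)
    show "isCont (\<lambda>s::real. inverse (1 + s\<^sup>2)) x" for x
      by (intro continuous_intros) (auto simp: add_nonneg_eq_0_iff)
    show "((arctan \<circ> real_of_ereal) \<longlongrightarrow> - pi / 2) (at_right (- \<infinity>))"
      "((arctan \<circ> real_of_ereal) \<longlongrightarrow> pi / 2) (at_left \<infinity>)"
      using tendsto_arctan_at_bot tendsto_arctan_at_top by (simp_all add: ereal_tendsto_simps)
  qed auto
  then have "integrable lborel (\<lambda>s::real. inverse (1 + s\<^sup>2))"
    by (simp add: set_integrable_def)
  then show ?thesis by simp
qed

lemma norm_cosh_le: "norm (cosh w) \<le> exp \<bar>Re w\<bar>" for w :: complex
proof -
  have "norm (cosh w) \<le> (norm (exp w) + norm (exp (-w))) / 2"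
    using norm_triangle_ineq[of "exp w" "exp (-w)"] by (simp add: cosh_field_def norm_divide)
  also have "\<dots> \<le> exp \<bar>Re w\<bar>" by (auto simp: norm_exp_eq_Re abs_if)
  finally show ?thesis .
qed

lemma norm_sinh_le: "norm (sinh w) \<le> exp \<bar>Re w\<bar>" for w :: complex
proof -
  have "norm (sinh w) \<le> (norm (exp w) + norm (exp (-w))) / 2"
    using norm_triangle_ineq4[of "exp w" "exp (-w)"] by (simp add: sinh_field_def norm_divide)
  also have "\<dots> \<le> exp \<bar>Re w\<bar>" by (auto simp: norm_exp_eq_Re abs_if)
  finally show ?thesis .
qed

lemma closed_segment_0_bounds:
  fixes z w :: complex
  assumes "z \<in> closed_segment 0 w"
  shows "\<bar>Re z\<bar> \<le> \<bar>Re w\<bar>" "norm z \<le> norm w"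
  using assms by (auto simp: in_segment abs_mult mult_left_le_one_le)

text \<open>Each bound follows from the preceding one by the mean value inequality on the segment
  from 0 to w. The orders of vanishing 1, 2, 3 at the origin match the divisions by s, s^2, s^3 in
  \<open>ths2\<close>, \<open>ths1\<close>, \<open>ths\<close>.\<close>

lemma sinh_estimates:
  fixes w :: complex
  shows norm_sinh_le_mult: "norm (sinh w) \<le> norm w * exp \<bar>Re w\<bar>"
    and norm_cosh_minus_1_le: "norm (cosh w - 1) \<le> (norm w)\<^sup>2 * exp \<bar>Re w\<bar>"
    and norm_sinh_minus_le: "norm (sinh w - w) \<le> (norm w)^3 * exp \<bar>Re w\<bar>"
proof -
  note seg = closed_segment_0_bounds
  have 1: "norm (sinh z) \<le> norm z * exp \<bar>Re z\<bar>" for z :: complex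
  proof -
    have "norm (sinh z - sinh 0) \<le> exp \<bar>Re z\<bar> * norm (z - 0)"
    proof (rule field_differentiable_bound[where S = "closed_segment 0 z" and f' = cosh])
      show "norm (cosh u) \<le> exp \<bar>Re z\<bar>" if "u \<in> closed_segment 0 z" for u
        using norm_cosh_le[of u] seg[OF that] by (smt (verit) exp_le_cancel_iff)
    qed (auto intro!: derivative_eq_intros)
    then show ?thesis by (simp add: mult.commute)
  qed
  have 2: "norm (cosh z - 1) \<le> (norm z)\<^sup>2 * exp \<bar>Re z\<bar>" for z :: complex
  proof -
    have "norm (cosh z - cosh 0) \<le> (norm z * exp \<bar>Re z\<bar>) * norm (z - 0)"
    proof (rule field_differentiable_bound[where S = "closed_segment 0 z" and f' = sinh])
      show "norm (sinh u) \<le> norm z * exp \<bar>Re z\<bar>" if "u \<in> closed_segment 0 z" for u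
        using 1[of u] seg[OF that] by (smt (verit) exp_le_cancel_iff mult_mono exp_ge_zero norm_ge_zero)
    qed (auto intro!: derivative_eq_intros)
    then show ?thesis by (simp add: mult_ac power2_eq_square)
  qed
  have 3: "norm (sinh z - z) \<le> (norm z)^3 * exp \<bar>Re z\<bar>" for z :: complex
  proof -
    have "norm ((sinh z - z) - (sinh 0 - 0)) \<le> ((norm z)\<^sup>2 * exp \<bar>Re z\<bar>) * norm (z - 0)"
    proof (rule field_differentiable_bound[where S = "closed_segment 0 z" and f' = "\<lambda>z. cosh z - 1"])
      show "norm (cosh u - 1) \<le> (norm z)\<^sup>2 * exp \<bar>Re z\<bar>" if "u \<in> closed_segment 0 z" for u
      proof -
        have "norm (cosh u - 1) \<le> (norm u)\<^sup>2 * exp \<bar>Re u\<bar>" by (rule 2)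
        also have "\<dots> \<le> (norm z)\<^sup>2 * exp \<bar>Re z\<bar>"
          using seg[OF that] by (intro mult_mono power_mono) auto
        finally show ?thesis .
      qed
    qed (auto intro!: derivative_eq_intros)
    then show ?thesis by (simp add: mult_ac power3_eq_cube power2_eq_square)
  qed
  show "norm (sinh w) \<le> norm w * exp \<bar>Re w\<bar>" "norm (cosh w - 1) \<le> (norm w)\<^sup>2 * exp \<bar>Re w\<bar>"
    "norm (sinh w - w) \<le> (norm w)^3 * exp \<bar>Re w\<bar>" by (fact 1 2 3)+
qed

section \<open>The function s / sinh s\<close>

definition shi :: "real \<Rightarrow> real" where
  "shi s = (if s = 0 then 1 else s / sinh s)"

lemma shi_minus [simp]: "shi (- s) = shi s"
  by (simp add: shi_def)

lemma shi_abs [simp]: "shi \<bar>s\<bar> = shi s"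
  by (simp add: abs_if)

lemma nonneg_from_deriv:
  fixes f f' :: "real \<Rightarrow> real"
  assumes "\<And>x. x \<ge> 0 \<Longrightarrow> (f has_real_derivative f' x) (at x)" "\<And>x. x \<ge> 0 \<Longrightarrow> f' x \<ge> 0"
    "f 0 = 0" "s \<ge> 0"
  shows "f s \<ge> 0"
  using DERIV_nonneg_imp_nondecreasing[of 0 s f] assms by force

lemma sinh_real_ge: "s \<ge> 0 \<Longrightarrow> sinh s \<ge> (s::real)"
  using nonneg_from_deriv[of "\<lambda>s. sinh s - s" "\<lambda>s. cosh s - 1" s] cosh_real_ge_1
  by (force intro!: derivative_eq_intros)

lemma cosh_real_ge: "s \<ge> 0 \<Longrightarrow> cosh s \<ge> 1 + s\<^sup>2 / (2::real)"
  using nonneg_from_deriv[of "\<lambda>s. cosh s - 1 - s\<^sup>2/2" "\<lambda>s. sinh s - s" s] sinh_real_ge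
  by (force intro!: derivative_eq_intros)

lemma sinh_real_ge_cubic: "s \<ge> 0 \<Longrightarrow> sinh s \<ge> s + s^3 / (6::real)"
  using nonneg_from_deriv[of "\<lambda>s. sinh s - s - s^3/6" "\<lambda>s. cosh s - 1 - s\<^sup>2/2" s] cosh_real_ge
  by (force intro!: derivative_eq_intros)

lemma sinh_le_mult_cosh: "s \<ge> 0 \<Longrightarrow> sinh s \<le> s * cosh (s::real)"
  using nonneg_from_deriv[of "\<lambda>s. s * cosh s - sinh s" "\<lambda>s. s * sinh s" s]
  by (force intro!: derivative_eq_intros)

text \<open>This is s / sinh s >= 1 - s^2 / 6 without the division. The difference of the two sides
  and its derivative both vanish at 0, and the second derivative is nonnegative because sinh s <= s
  cosh s.\<close>

lemma sinh_real_le_shi: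
  assumes "s \<ge> (0::real)" shows "(1 - s\<^sup>2 / 6) * sinh s \<le> s"
proof -
  have 1: "1 - (1 - s\<^sup>2/6) * cosh s + s/3 * sinh s \<ge> 0" if "s \<ge> 0" for s :: real
  proof (rule nonneg_from_deriv[where f = "\<lambda>s. 1 - (1 - s\<^sup>2/6) * cosh s + s/3 * sinh s" and s = s and f' = "\<lambda>s. (s\<^sup>2/6) * sinh s + 2/3 * (s * cosh s - sinh s)"])
    show "((\<lambda>s. 1 - (1 - s\<^sup>2/6) * cosh s + s/3 * sinh s) has_real_derivative
       (x\<^sup>2/6) * sinh x + 2/3 * (x * cosh x - sinh x)) (at x)" for x :: real
      by (auto intro!: derivative_eq_intros simp: field_simps power2_eq_square)
    show "0 \<le> x\<^sup>2 / 6 * sinh x + 2 / 3 * (x * cosh x - sinh x)" if "x \<ge> 0" for x :: real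
      using that sinh_le_mult_cosh[of x] by simp
  qed (use that in auto)
  have "s - (1 - s\<^sup>2/6) * sinh s \<ge> 0"
  proof (rule nonneg_from_deriv[where f = "\<lambda>s. s - (1 - s\<^sup>2/6) * sinh s" and s = s and f' = "\<lambda>s. 1 - (1 - s\<^sup>2/6) * cosh s + s/3 * sinh s"])
    show "((\<lambda>s. s - (1 - s\<^sup>2/6) * sinh s) has_real_derivative
       1 - (1 - x\<^sup>2/6) * cosh x + x/3 * sinh x) (at x)" for x :: real
      by (auto intro!: derivative_eq_intros simp: field_simps power2_eq_square)
  qed (use 1 assms in auto)
  then show ?thesis by simp
qed

lemma shi_pos: "shi s > 0"
  by (cases "s > 0") (auto simp: shi_def divide_neg_neg)

text \<open>The polynomial bounds enclose s / sinh s between its second Taylor polynomial and the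
  same with a cubic error, for all s > 0 at once; they produce the expansion in e. The last bound
  carries the exponential decay that determines the strip of convergence.\<close>

lemma shi_bounds_pos:
  assumes "s > 0"
  shows "shi s \<le> 1" "shi s \<ge> 1 - s\<^sup>2 / 6" "shi s \<le> 1 - s\<^sup>2 / 6 + s^3" "shi s \<le> (1 + 2 * s) * exp (- s)"
proof -
  have p: "sinh s > 0" using assms by simp
  show le1: "shi s \<le> 1" using sinh_real_ge[of s] assms p by (simp add: shi_def)
  show "shi s \<ge> 1 - s\<^sup>2 / 6" using sinh_real_le_shi[of s] assms p by (simp add: shi_def field_simps)
  show "shi s \<le> 1 - s\<^sup>2 / 6 + s^3"
  proof (cases "s \<ge> 1")
    case True
    then have "s\<^sup>2 * 1 \<le> s\<^sup>2 * s" by (intro mult_left_mono) auto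
    then have "s\<^sup>2 / 6 \<le> s^3" using True by (simp add: power3_eq_cube power2_eq_square)
    then show ?thesis using le1 by linarith
  next
    case False
    have "shi s = s / sinh s" using assms by (simp add: shi_def)
    also have "\<dots> \<le> s / (s + s^3/6)"
      using sinh_real_ge_cubic[of s] assms by (intro divide_left_mono mult_pos_pos) (auto simp: add_pos_pos)
    also have "\<dots> = 1 / (1 + s\<^sup>2/6)"
    proof -
      have "s + s^3/6 = s * (1 + s\<^sup>2/6)" by (simp add: eval_nat_numeral algebra_simps)
      then show ?thesis using assms by (simp del: distrib_left)
    qed
    also have "\<dots> \<le> 1 - s\<^sup>2/6 + s^4/36"
    proof -
      have "(1 - s\<^sup>2/6 + s^4/36) * (1 + s\<^sup>2/6) = 1 + s^6/216" by (simp add: field_simps eval_nat_numeral)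
      then have "(1 - s\<^sup>2/6 + s^4/36) * (1 + s\<^sup>2/6) \<ge> 1" using assms by simp
      moreover have "1 + s\<^sup>2/6 > 0" by (simp add: add_pos_nonneg)
      ultimately show ?thesis by (simp only: pos_divide_le_eq)
    qed
    also have "s^4/36 \<le> s^3"
    proof -
      have "s^3 * s \<le> s^3 * 36" using False assms by (intro mult_left_mono) auto
      then show ?thesis by (simp add: eval_nat_numeral algebra_simps)
    qed
    finally show ?thesis by simp
  qed
  show "shi s \<le> (1 + 2 * s) * exp (- s)"
  proof -
    have "1 + 2 * s \<le> exp (2 * s)" by (rule exp_ge_add_one_self)
    then have "(1 + 2 * s) * exp (- s) * exp (-s) \<le> exp (2 * s) * exp (-s) * exp (-s)"
      by (intro mult_right_mono) auto
    also have "exp (2 * s) * exp (-s) * exp (-s) = 1" by (simp only: exp_add[symmetric]) simp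
    finally have *: "(1 + 2 * s) * (exp (- s) * exp (-s)) \<le> 1" by (simp only: mult.assoc)
    have "(1 + 2 * s) * exp (- s) * sinh s = ((1 + 2 * s) - (1 + 2 * s) * (exp (- s) * exp (-s))) / 2"
      by (simp add: sinh_field_def field_simps exp_minus)
    also have "\<dots> \<ge> s" using * by simp
    finally show ?thesis using p assms by (simp add: shi_def pos_divide_le_eq)
  qed
qed

lemma shi_le_1: "shi s \<le> 1"
  and shi_ge_quadratic: "shi s \<ge> 1 - s\<^sup>2 / 6"
  and shi_le_cubic: "shi s \<le> 1 - s\<^sup>2 / 6 + \<bar>s\<bar>^3"
  and shi_le_exp: "shi s \<le> (1 + 2 * \<bar>s\<bar>) * exp (- \<bar>s\<bar>)"
proof -
  have "shi s \<le> 1 \<and> shi s \<ge> 1 - s\<^sup>2 / 6 \<and> shi s \<le> 1 - s\<^sup>2 / 6 + \<bar>s\<bar>^3 \<and> shi s \<le> (1 + 2 * \<bar>s\<bar>) * exp (- \<bar>s\<bar>)"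
  proof (cases "s = 0")
    case False
    then show ?thesis using shi_bounds_pos[of "\<bar>s\<bar>"] by auto
  qed (simp add: shi_def)
  then show "shi s \<le> 1" "shi s \<ge> 1 - s\<^sup>2 / 6" "shi s \<le> 1 - s\<^sup>2 / 6 + \<bar>s\<bar>^3"
    "shi s \<le> (1 + 2 * \<bar>s\<bar>) * exp (- \<bar>s\<bar>)" by auto
qed

lemma shi_measurable [measurable]: "shi \<in> borel_measurable borel"
  unfolding shi_def sinh_field_def by measurable

lemma power_times_exp_bounded:
  assumes "c > 0"
  obtains C where "C > 0" "\<And>x. x \<ge> 0 \<Longrightarrow> (1 + x)^n * exp (- c * x) \<le> (C::real)"
proof (cases "n = 0")
  case True
  then show ?thesis using assms by (intro that[of 1]) auto
next
  case False
  \<comment> \<open>With m <= 1 and m <= c / n one has m (1 + x) <= 1 + (c / n) x <= exp (c x / n);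
    the n-th power of this is the claim.\<close>
  define m where "m = min 1 (c / n)"
  have m: "m > 0" "m \<le> 1" "m \<le> c / n" using assms False by (auto simp: m_def)
  have "(1 + x)^n * exp (- c * x) \<le> (1/m)^n" if "x \<ge> 0" for x
  proof -
    have "m * (1 + x) \<le> 1 + c / n * x" using m that by (simp add: distrib_left add_mono mult_right_mono del: times_divide_eq_left)
    also have "\<dots> \<le> exp (c / n * x)" by (rule exp_ge_add_one_self)
    finally have "(m * (1+x))^n \<le> exp (c / n * x)^n" using m that by (intro power_mono) auto
    also have "\<dots> = exp (c * x)" using False by (simp add: exp_of_nat_mult[symmetric])
    finally have "(m * (1+x))^n * exp (- c * x) \<le> exp (c * x) * exp (- c * x)"
      by (intro mult_right_mono) auto
    then have "m^n * ((1+x)^n * exp (- c * x)) \<le> 1"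
      by (simp add: exp_add[symmetric] power_mult_distrib mult.assoc)
    then show ?thesis using m by (simp add: power_divide pos_le_divide_eq mult.commute)
  qed
  then show ?thesis using m by (intro that[of "(1/m)^n"]) auto
qed

section \<open>The regularised exponent of the double sine function\<close>

text \<open>With t = 2 b s and e = b^2 the hyperbolic sines in the denominator of the integrand of
  S_b are sinh (e s) sinh s = e s^2 / \<open>thk e s\<close>. In this form the value e = 0 is
  allowed and is the classical limit.\<close>

definition thk :: "real \<Rightarrow> real \<Rightarrow> real" where
  "thk e s = shi (e * s) * shi s"

lemma shi_0 [simp]: "shi 0 = 1"
  by (simp add: shi_def)

lemma thk_pos: "thk e s > 0"
  by (simp add: thk_def shi_pos)

lemma thk_le_1: "thk e s \<le> 1"
  unfolding thk_def using shi_le_1[of s] shi_le_1[of "e * s"] shi_pos[of s] shi_pos[of "e * s"]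
  by (simp add: mult_le_one)

lemma thk_0 [simp]: "thk 0 s = shi s"
  by (simp add: thk_def shi_def)

lemma thk_minus [simp]: "thk e (- s) = thk e s"
  by (simp add: thk_def)

lemma thk_measurable [measurable]: "thk e \<in> borel_measurable borel"
  unfolding thk_def by measurable

lemma abs_thk_minus_1_le: "\<bar>thk e s - 1\<bar> \<le> (1 + e\<^sup>2) * s\<^sup>2"
proof -
  have "1 - thk e s = (1 - shi (e * s)) * shi s + (1 - shi s)"
    by (simp add: thk_def algebra_simps)
  also have "\<dots> \<le> (e * s)\<^sup>2 / 6 * 1 + s\<^sup>2 / 6"
    using shi_ge_quadratic[of s] shi_ge_quadratic[of "e * s"] shi_le_1[of s] shi_pos[of s] shi_le_1[of "e * s"]
    by (intro add_mono mult_mono) auto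
  also have "\<dots> = (1 + e\<^sup>2) * s\<^sup>2 / 6" by (simp add: algebra_simps power_mult_distrib)
  also have "\<dots> \<le> (1 + e\<^sup>2) * s\<^sup>2" by simp
  finally show ?thesis using thk_le_1[of e s] by simp
qed

lemma abs_thk_minus_1_div_le: "\<bar>(thk e s - 1) / (4 * s\<^sup>2)\<bar> \<le> (1 + e\<^sup>2) * inverse (1 + s\<^sup>2)"
proof (cases "s\<^sup>2 \<le> 1")
  case True
  have p: "1 + s\<^sup>2 > 0" by (simp add: add_pos_nonneg)
  have "\<bar>(thk e s - 1) / (4 * s\<^sup>2)\<bar> \<le> (1 + e\<^sup>2) / 4"
    using abs_thk_minus_1_le[of e s] by (cases "s = 0") (auto simp: abs_divide divide_simps mult_ac)
  also have "\<dots> \<le> (1 + e\<^sup>2) / 2 " by (simp add: field_simps)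
  also have "\<dots> \<le> (1 + e\<^sup>2) / (1 + s\<^sup>2)"
    using True p by (intro divide_left_mono mult_pos_pos) (auto simp: add_nonneg_nonneg)
  finally show ?thesis by (simp only: divide_inverse[of "1 + e\<^sup>2" "1 + s\<^sup>2"])
next
  case False
  have p: "1 + s\<^sup>2 > 0" by (simp add: add_pos_nonneg)
  have "\<bar>(thk e s - 1) / (4 * s\<^sup>2)\<bar> \<le> 1 / (4 * s\<^sup>2)"
    using thk_le_1[of e s] thk_pos[of e s] by (simp add: abs_divide divide_right_mono)
  also have "\<dots> \<le> 1 / (1 + s\<^sup>2)" using False p by (intro divide_left_mono mult_pos_pos) auto
  also have "\<dots> \<le> (1 + e\<^sup>2) / (1 + s\<^sup>2)" using p by (intro divide_right_mono) auto
  finally show ?thesis by (simp only: divide_inverse[of "1 + e\<^sup>2" "1 + s\<^sup>2"])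
qed

text \<open>Up to a polynomial factor the kernel decays like exp (- (1 + e) |s|), so it beats every
  growth rate p < 1 + e. This is the origin of the strip |Re a| < 1 + e.\<close>

lemma thk_exp_dominated:
  assumes "0 \<le> e" "p < 1 + e"
  obtains C where "C > 0" "\<And>s. thk e s * exp (p * \<bar>s\<bar>) \<le> C * inverse (1 + s\<^sup>2)"
proof -
  obtain C where C: "C > 0" "\<And>x. x \<ge> 0 \<Longrightarrow> (1 + x)^4 * exp (- (1 + e - p) * x) \<le> (C::real)"
    using power_times_exp_bounded[of "1 + e - p" 4] assms by auto
  define K where "K = (1 + 2 * e) * 2"
  have K: "K > 0" using assms by (simp add: K_def)
  have "thk e s * exp (p * \<bar>s\<bar>) \<le> (K * C) * inverse (1 + s\<^sup>2)" for s
  proof -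
    define x where "x = \<bar>s\<bar>"
    have x: "x \<ge> 0" "\<bar>e * s\<bar> = e * x" "s\<^sup>2 = x\<^sup>2" using assms by (auto simp: x_def abs_mult)
    have "thk e s \<le> ((1 + 2 * (e * x)) * exp (- (e * x))) * ((1 + 2 * x) * exp (- x))"
      unfolding thk_def using shi_le_exp[of s] shi_le_exp[of "e * s"] shi_pos[of s] shi_pos[of "e * s"] x assms
      by (intro mult_mono) (auto simp: x_def)
    also have "\<dots> = (1 + 2 * (e * x)) * (1 + 2 * x) * exp (- (1 + e) * x)"
      by (simp add: exp_add[symmetric] algebra_simps)
    also have "\<dots> \<le> ((1 + 2 * e) * (1 + x)) * (2 * (1 + x)) * exp (- (1 + e) * x)"
      using x assms by (intro mult_right_mono mult_mono) (auto simp: algebra_simps)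
    also have "\<dots> = K * (1 + x)^2 * exp (- (1 + e) * x)" by (simp add: K_def power2_eq_square algebra_simps)
    finally have "thk e s * exp (p * x) \<le> K * (1 + x)^2 * exp (- (1 + e) * x) * exp (p * x)"
      by (intro mult_right_mono) auto
    also have "\<dots> = K * (1 + x)^2 * exp (- (1 + e - p) * x)"
      by (simp add: exp_add[symmetric] algebra_simps)
    finally have 1: "thk e s * exp (p * x) \<le> K * (1 + x)^2 * exp (- (1 + e - p) * x)" .
    have "thk e s * exp (p * x) * (1 + x\<^sup>2) \<le> K * (1 + x)^2 * exp (- (1 + e - p) * x) * (1 + x)^2"
      using x K by (intro mult_mono 1) (auto simp: power2_eq_square algebra_simps)
    also have "\<dots> = K * ((1 + x)^4 * exp (- (1 + e - p) * x))" by (simp add: eval_nat_numeral mult_ac)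
    also have "\<dots> \<le> K * C" using C(2)[OF x(1)] K by (intro mult_left_mono) auto
    finally have "thk e s * exp (p * x) \<le> K * C / (1 + x\<^sup>2)"
      by (subst pos_le_divide_eq) (simp_all add: add_pos_nonneg)
    then show ?thesis unfolding x(3) by (simp only: x_def divide_inverse)
  qed
  then show ?thesis using K C by (intro that[of "K * C"]) auto
qed

text \<open>The rescaled integrand of log S_b minus its double pole, in the shape of
  \<open>ths_eq\<close> for nonzero s. It is arranged as two summands each of which is bounded near
  s = 0, so that no principal value is involved. \<open>ths1\<close> and \<open>ths2\<close> are its
  first and second derivatives in a.\<close>

definition ths :: "real \<Rightarrow> complex \<Rightarrow> real \<Rightarrow> complex" where
  "ths e a s = (sinh (a * of_real s) - a * of_real s) / of_real (4 * s^3) * of_real (thk e s)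
     + a * of_real ((thk e s - 1) / (4 * s\<^sup>2))"

definition ths1 :: "real \<Rightarrow> complex \<Rightarrow> real \<Rightarrow> complex" where
  "ths1 e a s = (cosh (a * of_real s) - 1) / of_real (4 * s\<^sup>2) * of_real (thk e s)
     + of_real ((thk e s - 1) / (4 * s\<^sup>2))"

definition ths2 :: "real \<Rightarrow> complex \<Rightarrow> real \<Rightarrow> complex" where
  "ths2 e a s = sinh (a * of_real s) / of_real (4 * s) * of_real (thk e s)"

lemma ths_measurable [measurable]: "ths e a \<in> borel_measurable borel" "ths1 e a \<in> borel_measurable borel"
  "ths2 e a \<in> borel_measurable borel"
  unfolding ths_def ths1_def ths2_def sinh_field_def cosh_field_def by measurable

lemma ths_eq: "s \<noteq> 0 \<Longrightarrow> ths e a s = sinh (a * of_real s) * of_real (thk e s) / of_real (4 * s^3) - a / of_real (4 * s\<^sup>2)"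
  by (simp add: ths_def field_simps eval_nat_numeral)

lemma ths1_eq: "s \<noteq> 0 \<Longrightarrow> ths1 e a s = (cosh (a * of_real s) * of_real (thk e s) - 1) / of_real (4 * s\<^sup>2)"
  by (simp add: ths1_def field_simps)

lemma ths_deriv: "((\<lambda>a. ths e a s) has_field_derivative ths1 e a s) (at a)"
proof (cases "s = 0")
  case False
  have "((\<lambda>a. ths e a s) has_field_derivative
     (cosh (a * of_real s) * of_real s - of_real s) / of_real (4 * s^3) * of_real (thk e s) + of_real ((thk e s - 1) / (4 * s\<^sup>2))) (at a)"
    unfolding ths_def by (auto intro!: derivative_eq_intros simp: False) (simp add: False field_simps eval_nat_numeral)
  also have "(cosh (a * of_real s) * of_real s - of_real s) / of_real (4 * s^3) * of_real (thk e s) + of_real ((thk e s - 1) / (4 * s\<^sup>2)) = ths1 e a s"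
    using False by (simp add: ths1_def power3_eq_cube power2_eq_square field_simps)
  finally show ?thesis .
qed (simp add: ths_def ths1_def)

lemma ths1_deriv: "((\<lambda>a. ths1 e a s) has_field_derivative ths2 e a s) (at a)"
proof (cases "s = 0")
  case False
  have "((\<lambda>a. ths1 e a s) has_field_derivative
     (sinh (a * of_real s) * of_real s) / of_real (4 * s^2) * of_real (thk e s)) (at a)"
    unfolding ths1_def by (auto intro!: derivative_eq_intros simp: False) (simp add: False field_simps eval_nat_numeral)
  also have "(sinh (a * of_real s) * of_real s) / of_real (4 * s^2) * of_real (thk e s) = ths2 e a s"
    using False by (simp add: ths2_def power2_eq_square field_simps)
  finally show ?thesis .
qed (simp add: ths1_def ths2_def)

lemma exp_Re_mult_le: "\<bar>Re a\<bar> \<le> p \<Longrightarrow> exp \<bar>Re (a * of_real s)\<bar> \<le> exp (p * \<bar>s\<bar>)"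
  by (simp add: abs_mult mult_right_mono)

lemma norm_ths_le:
  assumes "\<bar>Re a\<bar> \<le> p" "norm a \<le> M"
  shows "norm (ths e a s) \<le> M^3 * (thk e s * exp (p * \<bar>s\<bar>)) + M * ((1 + e\<^sup>2) * inverse (1 + s\<^sup>2))"
    and "norm (ths1 e a s) \<le> M^2 * (thk e s * exp (p * \<bar>s\<bar>)) + ((1 + e\<^sup>2) * inverse (1 + s\<^sup>2))"
    and "norm (ths2 e a s) \<le> M * (thk e s * exp (p * \<bar>s\<bar>))"
proof -
  note E = exp_Re_mult_le[OF assms(1), of s]
  have M: "M \<ge> 0" using assms(2) norm_ge_zero order_trans by blast
  have *: "norm (z / of_real (4 * s^n) * of_real (thk e s)) \<le> M^n * (thk e s * exp (p * \<bar>s\<bar>))"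
    if "norm z \<le> (norm (a * of_real s))^n * exp \<bar>Re (a * of_real s)\<bar>" for z :: complex and n
  proof -
    have p: "M^n * (thk e s * exp (p * \<bar>s\<bar>)) \<ge> 0" using M thk_pos[of e s] by simp
    have "norm z \<le> (M * \<bar>s\<bar>)^n * exp (p * \<bar>s\<bar>)"
      by (rule order_trans[OF that]) (use E assms(2) M in \<open>auto intro!: mult_mono power_mono simp: norm_mult\<close>)
    then have "norm z / (4 * \<bar>s\<bar>^n) * thk e s \<le> (M * \<bar>s\<bar>)^n * exp (p * \<bar>s\<bar>) / (4 * \<bar>s\<bar>^n) * thk e s"
      using thk_pos[of e s] by (intro mult_right_mono divide_right_mono) auto
    also have "\<dots> \<le> M^n * (thk e s * exp (p * \<bar>s\<bar>))"
      using p by (cases "s = 0 \<and> n \<noteq> 0") (auto simp: power_mult_distrib field_simps)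
    finally show ?thesis using thk_pos[of e s] by (simp add: norm_mult norm_divide norm_power)
  qed
  note k = abs_thk_minus_1_div_le[of e s]
  show "norm (ths e a s) \<le> M^3 * (thk e s * exp (p * \<bar>s\<bar>)) + M * ((1 + e\<^sup>2) * inverse (1 + s\<^sup>2))"
    unfolding ths_def
  proof (intro norm_triangle_mono *)
    show "norm (a * of_real ((thk e s - 1) / (4 * s\<^sup>2))) \<le> M * ((1 + e\<^sup>2) * inverse (1 + s\<^sup>2))"
      unfolding norm_mult norm_of_real using k assms(2) M by (intro mult_mono) auto
  qed (rule norm_sinh_minus_le)
  show "norm (ths1 e a s) \<le> M^2 * (thk e s * exp (p * \<bar>s\<bar>)) + ((1 + e\<^sup>2) * inverse (1 + s\<^sup>2))"
    unfolding ths1_def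
  proof (intro norm_triangle_mono *)
    show "norm (of_real ((thk e s - 1) / (4 * s\<^sup>2)) :: complex) \<le> ((1 + e\<^sup>2) * inverse (1 + s\<^sup>2))"
      unfolding norm_of_real by (rule k)
  qed (rule norm_cosh_minus_1_le)
  show "norm (ths2 e a s) \<le> M * (thk e s * exp (p * \<bar>s\<bar>))"
    unfolding ths2_def using *[of "sinh (a * of_real s)" 1] norm_sinh_le_mult[of "a * of_real s"] by simp
qed

lemma ths_dominated:
  assumes "0 \<le> e" "p < 1 + e" "M \<ge> 0"
  obtains C where "\<And>a s. \<bar>Re a\<bar> \<le> p \<Longrightarrow> norm a \<le> M \<Longrightarrow> norm (ths e a s) \<le> C * inverse (1 + s\<^sup>2)"
    "\<And>a s. \<bar>Re a\<bar> \<le> p \<Longrightarrow> norm a \<le> M \<Longrightarrow> norm (ths1 e a s) \<le> C * inverse (1 + s\<^sup>2)"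
    "\<And>a s. \<bar>Re a\<bar> \<le> p \<Longrightarrow> norm a \<le> M \<Longrightarrow> norm (ths2 e a s) \<le> C * inverse (1 + s\<^sup>2)"
proof -
  obtain C where C: "C > 0" "\<And>s. thk e s * exp (p * \<bar>s\<bar>) \<le> C * inverse (1 + s\<^sup>2)"
    using thk_exp_dominated[OF assms(1,2)] by blast
  define K where "K = M^3 * C + M * (1 + e\<^sup>2) + (M^2 * C + (1 + e\<^sup>2)) + M * C"
  have nn: "M^3 * C \<ge> 0" "M * (1 + e\<^sup>2) \<ge> 0" "M^2 * C \<ge> 0" "M * C \<ge> 0" "1 + e\<^sup>2 \<ge> 0"
    using assms C by (auto intro!: mult_nonneg_nonneg)
  have i: "inverse (1 + s\<^sup>2) \<ge> 0" for s :: real by (simp add: add_nonneg_nonneg)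
  have up: "x * (thk e s * exp (p * \<bar>s\<bar>)) \<le> (x * C) * inverse (1 + s\<^sup>2)" if "x \<ge> 0" for x s
    using C(2)[of s] that by (simp add: mult.assoc mult_left_mono)
  have bd: "norm (ths e a s) \<le> K * inverse (1 + s\<^sup>2) \<and> norm (ths1 e a s) \<le> K * inverse (1 + s\<^sup>2) \<and> norm (ths2 e a s) \<le> K * inverse (1 + s\<^sup>2)"
    if a: "\<bar>Re a\<bar> \<le> p" "norm a \<le> M" for a s
  proof (intro conjI)
    have "norm (ths e a s) \<le> (M^3 * C) * inverse (1 + s\<^sup>2) + (M * (1 + e\<^sup>2)) * inverse (1 + s\<^sup>2)"
      using norm_ths_le(1)[OF a, of e s] up[of "M^3" s] assms(3) by (simp add: mult.assoc)
    also have "\<dots> = (M^3 * C + M * (1 + e\<^sup>2)) * inverse (1 + s\<^sup>2)" by (simp add: distrib_right)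
    also have "\<dots> \<le> K * inverse (1 + s\<^sup>2)" unfolding K_def using nn by (intro mult_right_mono i) auto
    finally show "norm (ths e a s) \<le> K * inverse (1 + s\<^sup>2)" .
    have "norm (ths1 e a s) \<le> (M^2 * C) * inverse (1 + s\<^sup>2) + (1 + e\<^sup>2) * inverse (1 + s\<^sup>2)"
      using norm_ths_le(2)[OF a, of e s] up[of "M^2" s] assms(3) by simp
    also have "\<dots> = (M^2 * C + (1 + e\<^sup>2)) * inverse (1 + s\<^sup>2)" by (simp add: distrib_right)
    also have "\<dots> \<le> K * inverse (1 + s\<^sup>2)" unfolding K_def using nn by (intro mult_right_mono i) auto
    finally show "norm (ths1 e a s) \<le> K * inverse (1 + s\<^sup>2)" .
    have "norm (ths2 e a s) \<le> (M * C) * inverse (1 + s\<^sup>2)"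
      using norm_ths_le(3)[OF a, of e s] up[of "M" s] assms(3) by simp
    also have "\<dots> \<le> K * inverse (1 + s\<^sup>2)" unfolding K_def using nn by (intro mult_right_mono i) auto
    finally show "norm (ths2 e a s) \<le> K * inverse (1 + s\<^sup>2)" .
  qed
  show ?thesis by (rule that[of K]) (use bd in blast)+
qed

lemma ths_integrable:
  assumes "0 \<le> e" "\<bar>Re a\<bar> < 1 + e"
  shows "integrable lborel (ths e a)" "integrable lborel (ths1 e a)" "integrable lborel (ths2 e a)"
proof -
  obtain C where C: "\<And>b s. \<bar>Re b\<bar> \<le> \<bar>Re a\<bar> \<Longrightarrow> norm b \<le> norm a \<Longrightarrow> norm (ths e b s) \<le> C * inverse (1 + s\<^sup>2)"
    "\<And>b s. \<bar>Re b\<bar> \<le> \<bar>Re a\<bar> \<Longrightarrow> norm b \<le> norm a \<Longrightarrow> norm (ths1 e b s) \<le> C * inverse (1 + s\<^sup>2)"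
    "\<And>b s. \<bar>Re b\<bar> \<le> \<bar>Re a\<bar> \<Longrightarrow> norm b \<le> norm a \<Longrightarrow> norm (ths2 e b s) \<le> C * inverse (1 + s\<^sup>2)"
    using ths_dominated[OF assms, of "norm a"] by (metis norm_ge_zero)
  show "integrable lborel (ths e a)"
    by (rule Bochner_Integration.integrable_bound[OF integrable_inverse_1_plus_square[of C]])
       (use C(1)[of a] in \<open>auto intro!: AE_I2 order_trans[OF _ abs_ge_self]\<close>)
  show "integrable lborel (ths1 e a)"
    by (rule Bochner_Integration.integrable_bound[OF integrable_inverse_1_plus_square[of C]])
       (use C(2)[of a] in \<open>auto intro!: AE_I2 order_trans[OF _ abs_ge_self]\<close>)
  show "integrable lborel (ths2 e a)"
    by (rule Bochner_Integration.integrable_bound[OF integrable_inverse_1_plus_square[of C]])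
       (use C(3)[of a] in \<open>auto intro!: AE_I2 order_trans[OF _ abs_ge_self]\<close>)
qed

text \<open>For e = b^2 this is e times the logarithm of S_b at the point z with a = 1 + e - 2 b z,
  see \<open>Sb_eq_Theta\<close>.\<close>

definition Theta :: "real \<Rightarrow> complex \<Rightarrow> complex" where
  "Theta e a = (LINT s|lborel. ths e a s)"

definition Theta1 :: "real \<Rightarrow> complex \<Rightarrow> complex" where
  "Theta1 e a = (LINT s|lborel. ths1 e a s)"

definition Theta2 :: "real \<Rightarrow> complex \<Rightarrow> complex" where
  "Theta2 e a = (LINT s|lborel. ths2 e a s)"

lemma convex_Re_strip: "convex {z. a < Re z \<and> Re z < b}"
  using convex_Int[OF convex_halfspace_Re_gt[of a] convex_halfspace_Re_lt[of b]]
  by (simp add: Collect_conj_eq)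

lemma open_Re_strip: "open {z. a < Re z \<and> Re z < b}"
  using open_Int[OF open_halfspace_Re_gt[of a] open_halfspace_Re_lt[of b]]
  by (simp add: Collect_conj_eq)

lemma Theta_deriv:
  assumes "0 \<le> e" "\<bar>Re a\<bar> < 1 + e"
  shows "(Theta e has_field_derivative Theta1 e a) (at a)"
    and "(Theta1 e has_field_derivative Theta2 e a) (at a)"
proof -
  obtain p where p: "\<bar>Re a\<bar> < p" "p < 1 + e" using dense assms(2) by blast
  define M where "M = norm a + 1"
  define S where "S = {z. -p < Re z \<and> Re z < p} \<inter> ball 0 M"
  have S: "open S" "convex S" "a \<in> S"
    using p by (auto simp: S_def M_def open_Re_strip convex_Re_strip convex_Int)
  have SD: "\<bar>Re z\<bar> \<le> p" "norm z \<le> M" "\<bar>Re z\<bar> < 1 + e" if "z \<in> S" for z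
    using that p by (auto simp: S_def)
  obtain C where C: "\<And>a s. \<bar>Re a\<bar> \<le> p \<Longrightarrow> norm a \<le> M \<Longrightarrow> norm (ths e a s) \<le> C * inverse (1 + s\<^sup>2)"
    "\<And>a s. \<bar>Re a\<bar> \<le> p \<Longrightarrow> norm a \<le> M \<Longrightarrow> norm (ths1 e a s) \<le> C * inverse (1 + s\<^sup>2)"
    "\<And>a s. \<bar>Re a\<bar> \<le> p \<Longrightarrow> norm a \<le> M \<Longrightarrow> norm (ths2 e a s) \<le> C * inverse (1 + s\<^sup>2)"
    using ths_dominated[OF assms(1) p(2), of M] by (metis M_def add_nonneg_nonneg norm_ge_zero zero_le_one)
  show "(Theta e has_field_derivative Theta1 e a) (at a)"
    unfolding Theta_def[abs_def] Theta1_def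
    by (rule has_field_derivative_lebesgue_integral[OF S, where f' = "ths1 e" and B = "\<lambda>s. C * inverse (1 + s\<^sup>2)"])
       (use C(2) SD assms integrable_inverse_1_plus_square[of C] in \<open>auto intro!: ths_integrable ths_deriv\<close>)
  show "(Theta1 e has_field_derivative Theta2 e a) (at a)"
    unfolding Theta1_def[abs_def] Theta2_def
    by (rule has_field_derivative_lebesgue_integral[OF S, where f' = "ths2 e" and B = "\<lambda>s. C * inverse (1 + s\<^sup>2)"])
       (use C(3) SD assms integrable_inverse_1_plus_square[of C] in \<open>auto intro!: ths_integrable ths1_deriv\<close>)
qed

lemma Theta_minus: "Theta e (- a) = - Theta e a"
  unfolding Theta_def integral_minus[symmetric]
  by (rule Bochner_Integration.integral_cong) (auto simp: ths_def divide_simps algebra_simps)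

lemma Theta_cnj: "Theta e (cnj a) = cnj (Theta e a)"
proof -
  have "ths e (cnj a) s = cnj (ths e a s)" for s
    by (simp add: ths_def sinh_field_def exp_cnj)
  then show ?thesis using Bochner_Integration.integral_cnj[of lborel "ths e a"] by (simp add: Theta_def)
qed

lemma of_real_sinh: "complex_of_real (sinh x) = sinh (of_real x)"
  and of_real_cosh: "complex_of_real (cosh x) = cosh (of_real x)"
  by (simp_all add: sinh_field_def cosh_field_def exp_of_real flip: of_real_minus)

lemma AE_neq_0: "AE s in lborel. s \<noteq> (0::real)"
  by (rule AE_lborel_singleton)

text \<open>The functional equation of the double sine function. By the addition theorem the
  difference of integrands contains 2 cosh (a s) sinh (e s), and sinh (e s) cancels the e-dependent
  factor of the kernel. Hence the right-hand side has parameter 0 exactly, not just to leading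
  order.\<close>

lemma Theta_shift:
  assumes e: "0 \<le> e" and a: "\<bar>Re a\<bar> < 1"
  shows "Theta e (a + e) - Theta e (a - e) = 2 * e * Theta1 0 a"
proof -
  have i: "integrable lborel (ths e (a + e))" "integrable lborel (ths e (a - e))" "integrable lborel (ths1 0 a)"
    using assms by (auto intro!: ths_integrable)
  have "Theta e (a + e) - Theta e (a - e) = (LINT s|lborel. ths e (a + e) s - ths e (a - e) s)"
    unfolding Theta_def using i by simp
  also have "\<dots> = (LINT s|lborel. 2 * e * ths1 0 a s)"
  proof (rule integral_cong_AE)
    have "ths e (a + e) s - ths e (a - e) s = 2 * e * ths1 0 a s" if s: "s \<noteq> 0" for s
    proof -
      have *: "sinh (e * s) * shi (e * s) = e * s" by (simp add: shi_def)
      have "sinh ((a + e) * s) - sinh ((a - e) * s) = 2 * cosh (a * s) * complex_of_real (sinh (e * s))"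
        by (simp add: distrib_right left_diff_distrib sinh_add sinh_diff of_real_sinh of_real_cosh)
      then have "ths e (a + e) s - ths e (a - e) s =
        2 * cosh (a * s) * complex_of_real (sinh (e * s) * shi (e * s) * shi s) / of_real (4 * s^3) - 2 * e / of_real (4 * s\<^sup>2)"
        using s by (simp add: ths_eq thk_def diff_divide_distrib[symmetric] field_simps)
      also have "\<dots> = 2 * e * ths1 0 a s" unfolding *
        using s by (simp add: ths1_eq field_simps eval_nat_numeral)
      finally show ?thesis .
    qed
    then show "AE s in lborel. ths e (a + e) s - ths e (a - e) s = 2 * e * ths1 0 a s"
      using AE_neq_0 by auto
  qed auto
  finally show ?thesis by (simp add: Theta1_def)
qed

text \<open>The kernel depends on e through the even function s / sinh s at e s, which is 1 - (e
  s)^2 / 6 + O(|e s|^3); so there is no term of first order in e. After division by s^3 the cubic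
  remainder leaves e^3 times \<open>shi s\<close> exp (p |s|), integrable because p < 1.\<close>

lemma Theta_expansion:
  assumes p: "p < 1"
  obtains C where "C > 0"
    "\<And>e a. 0 \<le> e \<Longrightarrow> \<bar>Re a\<bar> \<le> p \<Longrightarrow> norm (Theta e a - Theta 0 a + of_real (e\<^sup>2 / 6) * Theta2 0 a) \<le> C * e^3"
proof -
  obtain C where C: "C > 0" "\<And>s. thk 0 s * exp (p * \<bar>s\<bar>) \<le> C * inverse (1 + s\<^sup>2)"
    using thk_exp_dominated[of 0 p] p by auto
  define K where "K = (LINT s|lborel. C * inverse (1 + s\<^sup>2)) + 1"
  have K: "K > 0" unfolding K_def using C by (intro add_nonneg_pos integral_nonneg) (auto simp: add_nonneg_nonneg)
  have "norm (Theta e a - Theta 0 a + of_real (e\<^sup>2 / 6) * Theta2 0 a) \<le> K * e^3"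
    if e: "0 \<le> e" and a: "\<bar>Re a\<bar> \<le> p" for e a
  proof -
    have i: "integrable lborel (ths e a)" "integrable lborel (ths 0 a)" "integrable lborel (ths2 0 a)"
      using e a p by (auto intro!: ths_integrable)
    have "Theta e a - Theta 0 a + of_real (e\<^sup>2 / 6) * Theta2 0 a = (LINT s|lborel. ths e a s - ths 0 a s + of_real (e\<^sup>2 / 6) * ths2 0 a s)"
      unfolding Theta_def Theta2_def using i by simp
    also have "norm \<dots> \<le> (LINT s|lborel. e^3 * (C * inverse (1 + s\<^sup>2)))"
    proof (rule Bochner_Integration.integral_norm_bound_integral)
      show "integrable lborel (\<lambda>s. ths e a s - ths 0 a s + of_real (e\<^sup>2 / 6) * ths2 0 a s)"
        using i by auto
      show "integrable lborel (\<lambda>s. e^3 * (C * inverse (1 + s\<^sup>2)))"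
        using integrable_inverse_1_plus_square[of "e^3 * C"] by (simp add: mult.assoc)
      show "norm (ths e a s - ths 0 a s + of_real (e\<^sup>2 / 6) * ths2 0 a s) \<le> e^3 * (C * inverse (1 + s\<^sup>2))" for s
      proof (cases "s = 0")
        case True
        then show ?thesis using e C by (simp add: ths_def ths2_def)
      next
        case s: False
        define d where "d = shi (e * s) - 1 + (e * s)\<^sup>2 / 6"
        have d: "\<bar>d\<bar> \<le> \<bar>e * s\<bar>^3"
          using shi_ge_quadratic[of "e * s"] shi_le_cubic[of "e * s"] by (simp add: d_def)
        have "ths e a s - ths 0 a s + of_real (e\<^sup>2 / 6) * ths2 0 a s = sinh (a * s) * of_real (shi s * d / (4 * s^3))"
          using s by (simp add: ths_eq ths2_def thk_def d_def shi_0 field_simps eval_nat_numeral)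
        also have "norm \<dots> \<le> exp (p * \<bar>s\<bar>) * (shi s * \<bar>e * s\<bar>^3 / (4 * \<bar>s\<bar>^3))"
          unfolding norm_mult norm_of_real
        proof (rule mult_mono)
          show "norm (sinh (a * of_real s)) \<le> exp (p * \<bar>s\<bar>)"
            using norm_sinh_le exp_Re_mult_le[OF a] by (rule order_trans)
          have "\<bar>shi s * d\<bar> \<le> shi s * \<bar>e * s\<bar>^3"
            using d shi_pos[of s] by (simp add: abs_mult[of "shi s"] del: abs_mult)
          then show "\<bar>shi s * d / (4 * s^3)\<bar> \<le> shi s * \<bar>e * s\<bar>^3 / (4 * \<bar>s\<bar>^3)"
            unfolding abs_divide by (intro divide_mono) (use s in \<open>auto simp: abs_mult power_abs\<close>)
        qed auto
        also have "\<dots> = e^3 * (shi s * exp (p * \<bar>s\<bar>)) / 4"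
          using s e by (simp add: abs_mult power_mult_distrib)
        also have "\<dots> \<le> e^3 * (shi s * exp (p * \<bar>s\<bar>))"
          using e shi_pos[of s] by simp
        also have "\<dots> \<le> e^3 * (C * inverse (1 + s\<^sup>2))"
          using C(2)[of s] e by (intro mult_left_mono) auto
        finally show ?thesis .
      qed
    qed
    also have "\<dots> \<le> K * e^3" using e by (simp add: K_def algebra_simps)
    finally show ?thesis .
  qed
  then show ?thesis using K that by blast
qed

section \<open>Closed forms at e = 0\<close>

lemma exp_mult_neg_tendsto_0: "r > 0 \<Longrightarrow> ((\<lambda>s. exp (- (r * s))) \<longlongrightarrow> (0::real)) at_top"
proof -
  assume "r > 0"
  then have "filterlim (\<lambda>s. - r * s) at_bot at_top"
    by (intro filterlim_tendsto_neg_mult_at_bot[OF tendsto_const _ filterlim_ident]) auto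
  from filterlim_compose[OF exp_at_bot this] show ?thesis by simp
qed

lemma set_integral_exp_neg:
  fixes c :: complex
  assumes "Re c > 0"
  shows "set_integrable lborel {0<..} (\<lambda>s. exp (- (c * of_real s)))"
    and "(LINT s:{0<..}|lborel. exp (- (c * of_real s))) = 1 / c"
proof -
  define r where "r = Re c"
  have r: "r > 0" "c \<noteq> 0" using assms by (auto simp: r_def)
  have ei: "einterval (ereal 0) \<infinity> = {0<..}" by (auto simp: einterval_def)
  have nr: "norm (exp (- (c * of_real s))) = exp (- (r * s))" for s
    by (simp add: norm_exp_eq_Re r_def)
  have "set_integrable lborel (einterval (ereal 0) \<infinity>) (\<lambda>s. exp (- (r * s)))"
  proof (rule interval_integral_FTC_nonneg(1)[where F = "\<lambda>s. - exp (- (r * s)) / r" and A = "-1/r" and B = "0"])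
    show "((\<lambda>s. - exp (- (r * s)) / r) has_real_derivative exp (- (r * x))) (at x)" for x
      using r by (auto intro!: derivative_eq_intros)
    have "((\<lambda>s. - exp (- (r * s)) / r) \<longlongrightarrow> - exp (- (r * 0)) / r) (at_right 0)"
      by (intro tendsto_intros) (use r in auto)
    then show "(((\<lambda>s. - exp (- (r * s)) / r) \<circ> real_of_ereal) \<longlongrightarrow> - 1 / r) (at_right (ereal 0))"
      by (simp add: ereal_tendsto_simps)
    have "((\<lambda>s. - exp (- (r * s)) / r) \<longlongrightarrow> - 0 / r) at_top"
      by (intro tendsto_intros exp_mult_neg_tendsto_0) (use r in auto)
    then show "(((\<lambda>s. - exp (- (r * s)) / r) \<circ> real_of_ereal) \<longlongrightarrow> 0) (at_left \<infinity>)"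
      by (simp add: ereal_tendsto_simps)
  qed auto
  then have "set_integrable lborel {0<..} (\<lambda>s. exp (- (r * s)))" by (simp add: ei)
  then show int: "set_integrable lborel {0<..} (\<lambda>s. exp (- (c * of_real s)))"
    by (rule set_integrable_bound) (auto simp: set_borel_measurable_def r_def intro!: AE_I2)
  have "(LBINT s=ereal 0..\<infinity>. exp (- (c * of_real s))) = 0 - (- 1 / c)"
  proof (rule interval_integral_FTC_integrable[where F = "\<lambda>s. - exp (- (c * of_real s)) / c"])
    show "((\<lambda>s. - exp (- (c * of_real s)) / c) has_vector_derivative exp (- (c * of_real x))) (at x)" for x
    proof -
      have "((\<lambda>s. - exp (- (c * s)) / c) has_field_derivative exp (- (c * of_real x))) (at (of_real x))"
        using r by (auto intro!: derivative_eq_intros)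
      from has_vector_derivative_real_field[OF this] show ?thesis by simp
    qed
    show "isCont (\<lambda>s. exp (- (c * complex_of_real s))) x" for x by (intro continuous_intros)
    show "set_integrable lborel (einterval (ereal 0) \<infinity>) (\<lambda>s. exp (- (c * of_real s)))" using int by (simp add: ei)
    have "((\<lambda>s. - exp (- (c * of_real s)) / c) \<longlongrightarrow> - exp (- (c * of_real 0)) / c) (at_right 0)"
      by (intro tendsto_intros) (use r in auto)
    then show "(((\<lambda>s. - exp (- (c * of_real s)) / c) \<circ> real_of_ereal) \<longlongrightarrow> - 1 / c) (at_right (ereal 0))"
      by (simp add: ereal_tendsto_simps)
    have "((\<lambda>s. exp (- (c * of_real s))) \<longlongrightarrow> 0) at_top"
      by (rule tendsto_norm_zero_cancel) (simp only: nr, rule exp_mult_neg_tendsto_0[OF r(1)])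
    then have "((\<lambda>s. - exp (- (c * of_real s)) / c) \<longlongrightarrow> - 0 / c) at_top"
      by (intro tendsto_intros) (use r in auto)
    then show "(((\<lambda>s. - exp (- (c * of_real s)) / c) \<circ> real_of_ereal) \<longlongrightarrow> 0) (at_left \<infinity>)"
      by (simp add: ereal_tendsto_simps)
  qed auto
  then show "(LINT s:{0<..}|lborel. exp (- (c * of_real s))) = 1 / c"
    by (simp add: interval_lebesgue_integral_def ei)
qed

text \<open>Differentiate Gamma z Gamma (1 - z) = pi / sin (pi z) on both sides and compare.\<close>

lemma Digamma_reflection_complex:
  fixes z :: complex
  assumes "z \<notin> \<int>"
  shows "Digamma (1 - z) - Digamma z = of_real pi * cot (of_real pi * z)"
proof -
  have z: "z \<notin> \<int>\<^sub>\<le>\<^sub>0" "1 - z \<notin> \<int>\<^sub>\<le>\<^sub>0"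
    using assms by (auto dest!: nonpos_Ints_Int)
  have s: "sin (of_real pi * z) \<noteq> 0"
    using assms by (auto simp: sin_eq_0)
  have "((\<lambda>z. Gamma z * Gamma (1 - z)) has_field_derivative
      Gamma z * Digamma z * Gamma (1 - z) - Gamma z * (Gamma (1 - z) * Digamma (1 - z))) (at z)"
    using z by (auto intro!: derivative_eq_intros simp: algebra_simps)
  moreover have "((\<lambda>z. Gamma z * Gamma (1 - z)) has_field_derivative
      - (of_real pi * (cos (of_real pi * z) * of_real pi)) / (sin (of_real pi * z))\<^sup>2) (at z)"
    unfolding Gamma_reflection_complex using s by (auto intro!: derivative_eq_intros simp: power2_eq_square)
  ultimately have "Gamma z * Digamma z * Gamma (1 - z) - Gamma z * (Gamma (1 - z) * Digamma (1 - z))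
     = - (of_real pi * (cos (of_real pi * z) * of_real pi)) / (sin (of_real pi * z))\<^sup>2"
    by (rule DERIV_unique)
  then have "(Gamma z * Gamma (1 - z)) * (Digamma (1 - z) - Digamma z)
     = (of_real pi * (cos (of_real pi * z) * of_real pi)) / (sin (of_real pi * z))\<^sup>2"
    by (simp add: algebra_simps)
  then have "of_real pi / sin (of_real pi * z) * (Digamma (1 - z) - Digamma z)
     = of_real pi / sin (of_real pi * z) * (of_real pi * cot (of_real pi * z))"
    unfolding Gamma_reflection_complex by (simp add: cot_def power2_eq_square mult_ac)
  then show ?thesis
    by (rule mult_left_cancel[THEN iffD1, rotated]) (use s in auto)
qed

lemma half_strip_not_Ints:
  fixes a :: complex
  assumes "\<bar>Re a\<bar> < 1"
  shows "(1 - a) / 2 \<notin> \<int>" "(1 + a) / 2 \<notin> \<int>"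
proof -
  have False if "(1 - b) / 2 \<in> \<int>" "\<bar>Re b\<bar> < 1" for b :: complex
  proof -
    obtain k where k: "(1 - b) / 2 = of_int k" using \<open>(1 - b) / 2 \<in> \<int>\<close> by (auto elim: Ints_cases)
    then have "(1 - Re b) / 2 = of_int k" by (metis Re_divide_numeral minus_complex.sel(1) of_int_def one_complex.sel(1) Re_complex_of_real of_real_of_int_eq)
    then have "0 < real_of_int k" "real_of_int k < 1" using that by auto
    then have "0 < k" "k < 1" by linarith+
    then show False by simp
  qed
  from this[of a] this[of "-a"] assms show "(1 - a) / 2 \<notin> \<int>" "(1 + a) / 2 \<notin> \<int>" by auto
qed

text \<open>The partial sums are half the difference of the approximants to the digamma function at
  (1 + a) / 2 and (1 - a) / 2; the logarithms of N cancel, and the reflection formula turns the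
  limit into a tangent.\<close>

lemma tan_partial_fractions:
  fixes a :: complex
  assumes a: "\<bar>Re a\<bar> < 1"
  shows "(\<lambda>N. \<Sum>n<N. 1 / (of_nat (2 * n + 1) - a) - 1 / (of_nat (2 * n + 1) + a)) \<longlonglongrightarrow> of_real (pi / 2) * tan (of_real (pi / 2) * a)"
proof -
  define u v where "u = (1 - a) / 2" and "v = (1 + a) / 2"
  have uv: "u \<notin> \<int>" "v \<notin> \<int>" "v = 1 - u" using half_strip_not_Ints[OF a] by (auto simp: u_def v_def field_simps)
  then have nz: "u \<noteq> 0" "v \<noteq> 0" by auto
  have lim: "(\<lambda>N. (of_real (ln (real N)) - (\<Sum>n<N. inverse (v + of_nat n))) - (of_real (ln (real N)) - (\<Sum>n<N. inverse (u + of_nat n)))) \<longlonglongrightarrow> Digamma v - Digamma u"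
    by (intro tendsto_diff Digamma_LIMSEQ nz)
  have eq: "(\<Sum>n<N. 1 / (of_nat (2 * n + 1) - a) - 1 / (of_nat (2 * n + 1) + a)) =
     1/2 * ((of_real (ln (real N)) - (\<Sum>n<N. inverse (v + of_nat n))) - (of_real (ln (real N)) - (\<Sum>n<N. inverse (u + of_nat n))))" for N
  proof -
    have E: "1 / (of_nat (2 * n + 1) - a) = 1/2 * inverse (u + of_nat n)"
      "1 / (of_nat (2 * n + 1) + a) = 1/2 * inverse (v + of_nat n)" for n
    proof -
      have "u + of_nat n = (of_nat (2 * n + 1) - a) / 2" "v + of_nat n = (of_nat (2 * n + 1) + a) / 2"
        by (simp_all add: u_def v_def add_divide_distrib diff_divide_distrib)
      then show "1 / (of_nat (2 * n + 1) - a) = 1/2 * inverse (u + of_nat n)"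
        "1 / (of_nat (2 * n + 1) + a) = 1/2 * inverse (v + of_nat n)"
        by (simp_all only: inverse_eq_divide) simp_all
    qed
    show ?thesis unfolding E sum_subtractf sum_distrib_left[symmetric] by (simp add: algebra_simps)
  qed
  have "Digamma v - Digamma u = of_real pi * cot (of_real pi * u)"
    unfolding uv(3) by (rule Digamma_reflection_complex[OF uv(1)])
  also have "of_real pi * u = of_real pi / 2 - of_real (pi / 2) * a"
    by (simp add: u_def field_simps)
  also have "cot (of_real pi / 2 - of_real (pi / 2) * a) = tan (of_real (pi / 2) * a)"
    by (simp add: cot_def tan_def sin_diff cos_diff cos_of_real[symmetric] sin_of_real[symmetric] del: of_real_divide)
  finally have fin: "1/2 * (Digamma v - Digamma u) = of_real (pi / 2) * tan (of_real (pi / 2) * a)"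
    by simp
  show ?thesis using tendsto_mult_left[OF lim, of "1/2"] unfolding eq fin .
qed

lemma integral_even_function:
  fixes f :: "real \<Rightarrow> complex"
  assumes f: "integrable lborel f" and even: "\<And>s. f (- s) = f s"
  shows "(LINT s|lborel. f s) = 2 * (LINT s:{0<..}|lborel. f s)"
proof -
  have i: "integrable lborel (\<lambda>s. indicator {0<..} s *\<^sub>R f s)" "integrable lborel (\<lambda>s. indicator {..<0} s *\<^sub>R f s)"
    using f by (auto intro!: integrable_mult_indicator)
  have "(LINT s|lborel. f s) = (LINT s|lborel. indicator {0<..} s *\<^sub>R f s + indicator {..<0} s *\<^sub>R f s)"
    by (rule integral_cong_AE) (use AE_neq_0 f i in \<open>auto intro!: borel_measurable_integrable simp: indicator_def\<close>)
  also have "\<dots> = (LINT s|lborel. indicator {0<..} s *\<^sub>R f s) + (LINT s|lborel. indicator {..<0} s *\<^sub>R f s)"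
    using i by simp
  also have "(LINT s|lborel. indicator {..<0} s *\<^sub>R f s) = (LINT s|lborel. indicator {..<0} (0 + (-1) * s) *\<^sub>R f (0 + (-1) * s))"
    using lborel_integral_real_affine[of "-1" "\<lambda>s. indicator {..<0} s *\<^sub>R f s" 0] by simp
  also have "\<dots> = (LINT s|lborel. indicator {0<..} s *\<^sub>R f s)"
    by (rule Bochner_Integration.integral_cong) (auto simp: even indicator_def)
  finally show ?thesis by (simp add: set_lebesgue_integral_def)
qed

text \<open>The integrand is sinh (a s) / (4 sinh s). Expanding 1 / sinh s in a geometric series on
  s > 0 and integrating term by term gives the partial fractions of the tangent.\<close>

lemma Theta2_0:
  assumes a: "\<bar>Re a\<bar> < 1"
  shows "Theta2 0 a = of_real (pi / 4) * tan (of_real (pi / 2) * a)"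
proof -
  have i: "integrable lborel (ths2 0 a)" using a by (intro ths_integrable) auto
  have eq: "ths2 0 a s = sinh (a * s) / (4 * sinh s)" if "s \<noteq> 0" for s
    using that by (simp add: ths2_def shi_def of_real_sinh field_simps)
  \<comment> \<open>The factor 1 - exp (- 2 N s) cuts the geometric series of 1 / sinh s after N
    terms. In this form the partial sums are visibly dominated by the full integrand.\<close>
  define S where "S = (\<lambda>N s. indicator {0<..} s *\<^sub>R (ths2 0 a s * (1 - exp (- (2 * real N * s)))))"
  have geo: "sinh s * (\<Sum>n<N. 2 * exp (- ((2 * real n + 1) * s))) = 1 - exp (- (2 * real N * s))" for s N
  proof (induction N)
    case (Suc N)
    have "sinh s * (2 * exp (- ((2 * real N + 1) * s))) = exp (- (2 * real N * s)) - exp (- (2 * real (Suc N) * s))"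
      by (simp add: sinh_field_def algebra_simps exp_add[symmetric] diff_divide_distrib)
    with Suc show ?case by (simp add: distrib_left)
  qed simp
  have S_eq: "S N s = 1/4 * (\<Sum>n<N. indicator {0<..} s *\<^sub>R exp (- ((of_nat (2 * n + 1) - a) * of_real s)) -
      indicator {0<..} s *\<^sub>R exp (- ((of_nat (2 * n + 1) + a) * of_real s)))" for N s
  proof (cases "s > 0")
    case True
    have sh: "complex_of_real (sinh s) \<noteq> 0" using True by simp
    have "S N s = sinh (a * s) / (4 * of_real (sinh s)) * of_real (sinh s * (\<Sum>n<N. 2 * exp (- ((2 * real n + 1) * s))))"
      unfolding geo using True eq[of s] by (simp add: S_def of_real_sinh)
    also have "\<dots> = sinh (a * s) / 4 * (\<Sum>n<N. 2 * exp (- ((2 * of_nat n + 1) * of_real s)))"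
      using sh by (simp add: of_real_sum exp_of_real[symmetric])
    also have "\<dots> = 1/4 * (\<Sum>n<N. 2 * sinh (a * s) * exp (- ((2 * of_nat n + 1) * of_real s)))"
      by (simp add: sum_distrib_left mult_ac)
    also have "(\<lambda>n. 2 * sinh (a * s) * exp (- ((2 * of_nat n + 1) * of_real s))) = (\<lambda>n. exp (- ((of_nat (2 * n + 1) - a) * of_real s)) -
      exp (- ((of_nat (2 * n + 1) + a) * of_real s)))"
      by (simp add: sinh_field_def algebra_simps exp_add[symmetric] diff_divide_distrib)
    finally show ?thesis using True by simp
  qed (simp add: S_def)
  have int_S: "(LINT s|lborel. S N s) = 1/4 * (\<Sum>n<N. 1 / (of_nat (2 * n + 1) - a) - 1 / (of_nat (2 * n + 1) + a))" for N
  proof -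
    have re: "Re (of_nat (2 * n + 1) - a) > 0" "Re (of_nat (2 * n + 1) + a) > 0" for n
      using a by auto
    note 1 = set_integral_exp_neg[OF re(1)] and 2 = set_integral_exp_neg[OF re(2)]
    show ?thesis unfolding S_eq
      using 1(1) 2(1) unfolding 1(2)[symmetric] 2(2)[symmetric]
      by (simp add: set_integrable_def set_lebesgue_integral_def del: of_nat_add of_nat_mult)
  qed
  have "(\<lambda>N. LINT s|lborel. S N s) \<longlonglongrightarrow> (LINT s|lborel. indicator {0<..} s *\<^sub>R ths2 0 a s)"
  proof (rule integral_dominated_convergence[where w = "\<lambda>s. norm (ths2 0 a s)"])
    show "integrable lborel (\<lambda>s. norm (ths2 0 a s))" using i by simp
    show "AE s in lborel. (\<lambda>N. S N s) \<longlonglongrightarrow> indicator {0<..} s *\<^sub>R ths2 0 a s"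
    proof (rule AE_I2)
      fix s :: real
      show "(\<lambda>N. S N s) \<longlonglongrightarrow> indicator {0<..} s *\<^sub>R ths2 0 a s"
      proof (cases "s > 0")
        case True
        have "(\<lambda>N. exp (- (2 * s * real N))) \<longlonglongrightarrow> 0"
          using filterlim_compose[OF exp_mult_neg_tendsto_0[of "2 * s"] filterlim_real_sequentially] True by simp
        then have "(\<lambda>N. exp (- (2 * real N * s))) \<longlonglongrightarrow> 0" by (simp add: mult_ac)
        then have "(\<lambda>N. ths2 0 a s * (1 - of_real (exp (- (2 * real N * s))))) \<longlonglongrightarrow> ths2 0 a s * (1 - of_real 0)"
          by (intro tendsto_intros)
        then show ?thesis using True by (simp add: S_def)
      qed (simp add: S_def)
    qed
    show "AE s in lborel. norm (S N s) \<le> norm (ths2 0 a s)" for N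
    proof (rule AE_I2)
      fix s :: real
      show "norm (S N s) \<le> norm (ths2 0 a s)"
      proof (cases "s > 0")
        case True
        have "norm (1 - complex_of_real (exp (- (2 * real N * s)))) = \<bar>1 - exp (- (2 * real N * s))\<bar>"
          by (metis norm_of_real of_real_1 of_real_diff)
        also have "\<dots> \<le> 1" using True by (simp add: abs_le_iff)
        finally show ?thesis using True by (simp add: S_def norm_mult mult_left_le)
      qed (simp add: S_def)
    qed
  qed (auto simp: S_def)
  moreover have "(\<lambda>N. LINT s|lborel. S N s) \<longlonglongrightarrow> 1/4 * (of_real (pi / 2) * tan (of_real (pi / 2) * a))"
    unfolding int_S by (intro tendsto_mult_left tan_partial_fractions a)
  ultimately have "(LINT s:{0<..}|lborel. ths2 0 a s) = 1/4 * (of_real (pi / 2) * tan (of_real (pi / 2) * a))"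
    unfolding set_lebesgue_integral_def by (rule LIMSEQ_unique)
  moreover have "Theta2 0 a = 2 * (LINT s:{0<..}|lborel. ths2 0 a s)"
    unfolding Theta2_def by (rule integral_even_function[OF i]) (simp add: ths2_def)
  ultimately show ?thesis by (simp add: field_simps)
qed

text \<open>Keeps the argument of the principal logarithm in \<open>Theta1_0\<close> away from the
  branch cut on the whole strip.\<close>

lemma Re_cos_pos:
  assumes "\<bar>Re a\<bar> < 1"
  shows "Re (2 * cos (of_real (pi / 2) * a)) > 0"
proof -
  have "Re a < 1" "-1 < Re a" using assms by auto
  from mult_strict_left_mono[OF this(1), of "pi/2"] mult_strict_left_mono[OF this(2), of "pi/2"]
  have b: "pi / 2 * Re a < pi / 2" "- (pi / 2) < pi / 2 * Re a" by simp_all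
  have "Re (cos (of_real (pi / 2) * a)) = cos (pi / 2 * Re a) * cosh (pi / 2 * Im a)"
    by (simp add: Re_cos cosh_field_def)
  moreover have "cos (pi / 2 * Re a) > 0" using b by (intro cos_gt_zero_pi) auto
  ultimately show ?thesis by (simp add: cosh_real_pos)
qed

text \<open>Both sides have the derivative \<open>Theta2 0\<close>, so they differ by a constant on
  the strip. A duplication formula relating the values at 0 and at 1/2 forces the constant to be
  0.\<close>

lemma Theta1_0:
  assumes a: "\<bar>Re a\<bar> < 1"
  shows "Theta1 0 a = - Ln (2 * cos (of_real (pi / 2) * a)) / 2"
proof -
  define S where "S = {z. -1 < Re z \<and> Re z < 1}"
  have S: "convex S" "\<And>z. z \<in> S \<Longrightarrow> \<bar>Re z\<bar> < 1" unfolding S_def by (auto simp: convex_Re_strip)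
  define g where "g = (\<lambda>a. Theta1 0 a + Ln (2 * cos (of_real (pi / 2) * a)) / 2)"
  have der: "(g has_field_derivative 0) (at z within S)" if z: "z \<in> S" for z
  proof -
    have *: "2 * cos (of_real (pi / 2) * z) \<notin> \<real>\<^sub>\<le>\<^sub>0" "cos (of_real (pi / 2) * z) \<noteq> 0"
      using Re_cos_pos[OF S(2)[OF z]] by (auto simp: complex_nonpos_Reals_iff)
    define K where "K = complex_of_real (pi / 2)"
    have d1: "(Theta1 0 has_field_derivative Theta2 0 z) (at z)"
      using Theta_deriv(2)[of 0 z] S(2)[OF z] by simp
    have "((\<lambda>a. 2 * cos (K * a)) has_field_derivative - (2 * sin (K * z) * K)) (at z)"
      by (auto intro!: derivative_eq_intros)
    from DERIV_chain2[OF has_field_derivative_Ln[OF *(1)[folded K_def]] this]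
    have "((\<lambda>a. Ln (2 * cos (K * a)) / 2) has_field_derivative
        inverse (2 * cos (K * z)) * - (2 * sin (K * z) * K) / 2) (at z)"
      by (rule DERIV_cdivide)
    also have "inverse (2 * cos (K * z)) * - (2 * sin (K * z) * K) / 2 = - (K / 2 * tan (K * z))"
      using *(2)[folded K_def] by (simp add: tan_def field_simps)
    finally have "(g has_field_derivative Theta2 0 z + - (K / 2 * tan (K * z))) (at z)"
      unfolding g_def K_def[symmetric] by (rule DERIV_add[OF d1])
    also have "Theta2 0 z + - (K / 2 * tan (K * z)) = 0"
      unfolding Theta2_0[OF S(2)[OF z]] by (simp add: K_def)
    finally show ?thesis by (rule has_field_derivative_at_within)
  qed
  have "\<exists>c. \<forall>z\<in>S. g z = c"
    using has_field_derivative_zero_constant[OF S(1) der] by auto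
  then obtain c where c: "\<And>z. z \<in> S \<Longrightarrow> g z = c" by blast
  \<comment> \<open>Substitute s / 2 for s and use cosh (s / 2) \<open>shi s\<close> =
    \<open>shi (s / 2)\<close>. Combined with the values of the logarithm at 0 and 1/2, this gives c
    + c = c for the unknown constant c.\<close>
  have dup: "2 * Theta1 0 (1/2) = Theta1 0 0"
  proof -
    have "Theta1 0 0 = \<bar>1/2\<bar> *\<^sub>R (LINT s|lborel. ths1 0 0 (0 + 1/2 * s))"
      unfolding Theta1_def by (rule lborel_integral_real_affine) simp
    also have "(LINT s|lborel. ths1 0 0 (0 + 1/2 * s)) = (LINT s|lborel. 4 * ths1 0 (1/2) s)"
    proof (rule integral_cong_AE)
      have "ths1 0 0 (0 + 1/2 * s) = 4 * ths1 0 (1/2) s" if s: "s \<noteq> 0" for s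
      proof -
        have "cosh (s/2) * shi s = shi (s/2)"
          using s sinh_double[of "s/2"] cosh_real_pos[of "s/2"] by (simp add: shi_def field_simps)
        then have "cosh (complex_of_real s/2) * of_real (shi s) = of_real (shi (s/2))"
          by (metis of_real_cosh of_real_mult of_real_divide of_real_numeral)
        then show ?thesis using s by (simp add: ths1_eq field_simps)
      qed
      then show "AE s in lborel. ths1 0 0 (0 + 1 / 2 * s) = 4 * ths1 0 (1 / 2) s" using AE_neq_0 by auto
    qed auto
    also have "\<dots> = 4 * Theta1 0 (1/2)" by (simp add: Theta1_def)
    finally show ?thesis by (simp add: scaleR_conv_of_real)
  qed
  have "g (1/2) = c" "g 0 = c" by (auto intro!: c simp: S_def)
  moreover have "g (1/2) = Theta1 0 (1/2) + Ln (of_real (sqrt 2)) / 2"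
  proof -
    have 1: "complex_of_real (pi / 2) * (1/2) = of_real (pi / 4)" by simp
    have 2: "2 * cos (complex_of_real (pi / 4)) = of_real (sqrt 2)"
      unfolding cos_of_real cos_45 by simp
    show ?thesis unfolding g_def 1 2 by (rule refl)
  qed
  moreover have "g 0 = Theta1 0 0 + Ln (of_real 2) / 2" by (simp add: g_def)
  moreover have "Ln (complex_of_real (sqrt 2)) = of_real (ln 2 / 2)" by (subst Ln_of_real) (auto simp: ln_sqrt)
  moreover have "Ln (complex_of_real 2) = of_real (ln 2)" by (subst Ln_of_real) auto
  ultimately have "Theta1 0 (1/2) + of_real (ln 2 / 2) / 2 = c" "Theta1 0 0 + of_real (ln 2) / 2 = c" by simp_all
  moreover have "c + c = (Theta1 0 (1/2) + of_real (ln 2 / 2) / 2) + (Theta1 0 (1/2) + of_real (ln 2 / 2) / 2)"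
    by (simp only: calculation)
  moreover have "\<dots> = 2 * Theta1 0 (1/2) + of_real (ln 2) / 2" by simp
  ultimately have "c + c = c" using dup by simp
  then have "c = 0" by simp
  then have "g a = 0" using c[of a] a by (auto simp: S_def abs_less_iff)
  then show ?thesis by (simp add: g_def add_eq_0_iff)
qed

section \<open>The contour around the origin and the double sine function\<close>

lemma sinh_complex_nonzero:
  fixes w :: complex
  assumes "w \<noteq> 0" "norm w < pi"
  shows "sinh w \<noteq> 0"
proof
  assume "sinh w = 0"
  then have "exp w = exp (- w)" by (simp add: sinh_field_def)
  then have "exp w * exp w = exp w * exp (- w)" by simp
  then have "exp (2 * w) = 1" by (simp flip: exp_add)
  then obtain n :: int where n: "Re w = 0" "2 * Im w = of_int (2 * n) * pi"
    unfolding exp_eq_1 by auto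
  then have im: "Im w = of_int n * pi" by simp
  have "n \<noteq> 0" using im n assms(1) by (auto simp: complex_eq_iff)
  then have "1 * pi \<le> \<bar>of_int n\<bar> * pi" by (intro mult_right_mono) auto
  also have "\<dots> = \<bar>Im w\<bar>" using im by (simp add: abs_mult)
  also have "\<dots> \<le> norm w" by (rule abs_Im_le_cmod)
  finally show False using assms(2) by simp
qed

definition shc :: "complex \<Rightarrow> complex" where
  "shc t = (if t = 0 then 1 else sinh t / t)"

lemma sinh_eq_shc: "sinh t = t * shc t"
  by (simp add: shc_def)

lemma shc_minus [simp]: "shc (- t) = shc t"
  by (simp add: shc_def)

lemma shc_holomorphic [holomorphic_intros]: "f holomorphic_on A \<Longrightarrow> (\<lambda>t. shc (f t)) holomorphic_on A"
proof -
  have "((\<lambda>t. sinh t / t) \<longlongrightarrow> cosh 0) (at (0::complex))"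
  proof -
    have "(sinh has_field_derivative cosh 0) (at (0::complex))" by (auto intro!: derivative_eq_intros)
    then show ?thesis by (simp add: has_field_derivative_iff)
  qed
  then have "(\<lambda>t::complex. if t = 0 then 1 else sinh t / t) holomorphic_on UNIV"
    by (intro removable_singularity) (auto intro!: holomorphic_intros simp: sinh_field_def)
  then have "shc holomorphic_on UNIV" by (simp add: shc_def[abs_def])
  then show "f holomorphic_on A \<Longrightarrow> (\<lambda>t. shc (f t)) holomorphic_on A"
    using holomorphic_on_compose_gen[of f A shc UNIV] by (simp add: o_def)
qed

lemma shc_nonzero: "norm t < pi \<Longrightarrow> shc t \<noteq> 0"
  using sinh_complex_nonzero[of t] by (auto simp: shc_def)

text \<open>An even function has no linear Taylor coefficient, so a zero at the origin is at least
  double and k / t^2 extends. Applied to the integrand of S_b it says that the pole at 0 is purely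
  of order two, with no residue.\<close>

lemma even_holomorphic_double_zero:
  assumes r: "r > 0" and k: "k holomorphic_on ball 0 r" and even: "\<And>t. k (- t) = k t" and k0: "k 0 = 0"
  obtains G where "G holomorphic_on ball 0 r" "\<And>t. t \<in> ball 0 r \<Longrightarrow> t \<noteq> 0 \<Longrightarrow> G t = k t / t\<^sup>2"
proof -
  have 0: "0 \<in> ball (0::complex) r" using r by simp
  obtain d where d: "(k has_field_derivative d) (at 0)"
    using holomorphic_on_imp_differentiable_at[OF k open_ball 0] by (auto simp: field_differentiable_def)
  then have "((\<lambda>t. k (- t)) has_field_derivative d * (-1)) (at 0)"
    by (intro DERIV_chain2[where f = k]) (auto intro!: derivative_eq_intros)
  then have "(k has_field_derivative d * (-1)) (at 0)" unfolding even .
  then have "d = d * (-1)" by (rule DERIV_unique[OF d])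
  then have "d = 0" by simp
  have "((\<lambda>t. k t / t) \<longlongrightarrow> d) (at 0)"
    using d by (simp add: has_field_derivative_iff k0)
  then have k1: "(\<lambda>t. if t = 0 then 0 else k t / t) holomorphic_on ball 0 r" (is "?k1 holomorphic_on _")
    unfolding \<open>d = 0\<close> by (intro removable_singularity) (auto intro!: holomorphic_intros holomorphic_on_subset[OF k])
  obtain L where L: "(?k1 has_field_derivative L) (at 0)"
    using holomorphic_on_imp_differentiable_at[OF k1 open_ball 0] by (auto simp: field_differentiable_def)
  then have "((\<lambda>t. ?k1 t / t) \<longlongrightarrow> L) (at 0)" by (simp add: has_field_derivative_iff)
  then have "(\<lambda>t. if t = 0 then L else ?k1 t / t) holomorphic_on ball 0 r"
    by (intro removable_singularity) (auto intro!: holomorphic_intros holomorphic_on_subset[OF k1])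
  then show ?thesis by (rule that) (simp add: power2_eq_square)
qed

text \<open>The radius 2 pi b is the distance to the nearest other zero of the denominator: for b <
  1 the zeros of sinh (t / (2 b)) come before those of sinh (b t / 2).\<close>

lemma Sb_regular_part:
  assumes b: "0 < b" "b < 1"
  obtains G where "G holomorphic_on ball 0 (2 * pi * b)"
    "\<And>t. t \<in> ball 0 (2 * pi * b) \<Longrightarrow> t \<noteq> 0 \<Longrightarrow> Sb_integrand b z t = (of_real (Qb b / 2) - z) / t\<^sup>2 + G t"
proof -
  define w where "w = of_real (Qb b / 2) - z"
  define k where "k = (\<lambda>t::complex. w * shc (w * t) / (shc (b * t / 2) * shc (t / of_real (2 * b))) - w)"
  have nz: "shc (b * t / 2) \<noteq> 0" "shc (t / of_real (2 * b)) \<noteq> 0" if t: "t \<in> ball 0 (2 * pi * b)" for t :: complex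
  proof -
    have nt: "norm t < 2 * pi * b" using t by simp
    have "norm (t / of_real (2 * b)) < pi" using nt b by (simp add: norm_divide norm_mult field_simps)
    then show "shc (t / of_real (2 * b)) \<noteq> 0" by (rule shc_nonzero)
    have "norm (b * t / 2) = b / 2 * norm t" using b by (simp add: norm_divide norm_mult)
    also have "\<dots> < b / 2 * (2 * pi * b)" using nt b by (intro mult_strict_left_mono) auto
    also have "\<dots> = pi * (b * b)" by simp
    also have "\<dots> \<le> pi * 1" using b by (intro mult_left_mono mult_le_one) auto
    finally show "shc (b * t / 2) \<noteq> 0" by (intro shc_nonzero) simp
  qed
  have hol: "k holomorphic_on ball 0 (2 * pi * b)"
    unfolding k_def using nz b by (auto intro!: holomorphic_intros)
  obtain G where G: "G holomorphic_on ball 0 (2 * pi * b)" "\<And>t. t \<in> ball 0 (2 * pi * b) \<Longrightarrow> t \<noteq> 0 \<Longrightarrow> G t = k t / t\<^sup>2"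
    by (rule even_holomorphic_double_zero[OF _ hol]) (use b in \<open>auto simp: k_def shc_def\<close>)
  have "Sb_integrand b z t = w / t\<^sup>2 + G t" if t: "t \<in> ball 0 (2 * pi * b)" "t \<noteq> 0" for t
  proof -
    have "Sb_integrand b z t = (w * t * shc (w * t)) / (4 * t * (b * t / 2 * shc (b * t / 2)) * (t / of_real (2 * b) * shc (t / of_real (2 * b))))"
      unfolding Sb_integrand_def w_def[symmetric] sinh_eq_shc[of "w * t"] sinh_eq_shc[of "of_real b * t / 2"]
        sinh_eq_shc[of "t / of_real (2 * b)"] ..
    also have "\<dots> = (w + k t) / t\<^sup>2"
      using nz[OF t(1)] t b by (simp add: k_def field_simps power2_eq_square)
    finally show ?thesis using G(2)[OF t] by (simp add: add_divide_distrib)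
  qed
  then show ?thesis using that G(1) by (auto simp: w_def)
qed

text \<open>The substitution t = 2 b s including its Jacobian, applied after removal of the double
  pole.\<close>

lemma Sb_integrand_scaled:
  assumes b: "0 < b" and s: "s \<noteq> 0"
  shows "of_real (2 * b) * (Sb_integrand b z (of_real (2 * b * s)) - (of_real (Qb b / 2) - z) / of_real (2 * b * s)^2)
    = ths (b\<^sup>2) (of_real (1 + b\<^sup>2) - of_real (2 * b) * z) s / of_real (b\<^sup>2)"
proof -
  define a where "a = of_real (1 + b\<^sup>2) - of_real (2 * b) * z"
  define w where "w = of_real (Qb b / 2) - z"
  have w: "w = a / of_real (2 * b)"
    using b by (simp add: w_def a_def Qb_def field_simps power2_eq_square)
  have args: "w * of_real (2 * b * s) = a * s" "of_real b * of_real (2 * b * s) / 2 = complex_of_real (b\<^sup>2 * s)"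
    "of_real (2 * b * s) / of_real (2 * b) = complex_of_real s"
    using b by (simp_all add: w power2_eq_square)
  have nz: "complex_of_real (sinh s) \<noteq> 0" "complex_of_real (sinh (b\<^sup>2 * s)) \<noteq> 0" using b s by auto
  have thk: "thk (b\<^sup>2) s = b\<^sup>2 * s * s / (sinh (b\<^sup>2 * s) * sinh s)"
    using b s by (simp add: thk_def shi_def)
  have h: "Sb_integrand b z (of_real (2 * b * s)) = sinh (a * s) / (4 * of_real (2 * b * s) * of_real (sinh (b\<^sup>2 * s)) * of_real (sinh s))"
    unfolding Sb_integrand_def w_def[symmetric] args of_real_sinh ..
  show ?thesis unfolding h w_def[symmetric] a_def[symmetric] ths_eq[OF s] thk
    unfolding w using b s nz by (simp add: divide_simps eval_nat_numeral)
qed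

lemma Sb_strip:
  assumes b: "0 < b" "b < 1" and z: "0 < Re z" "Re z < Qb b"
  shows "\<bar>Re (of_real (1 + b\<^sup>2) - of_real (2 * b) * z)\<bar> < 1 + b\<^sup>2"
proof -
  have "2 * b * Re z < 2 * b * Qb b" "2 * b * Re z > 0" using b z by auto
  moreover have "2 * b * Qb b = 2 * (1 + b\<^sup>2)" using b by (simp add: Qb_def field_simps power2_eq_square)
  ultimately have "2 * b * Re z < 2 * (1 + b\<^sup>2)" "2 * b * Re z > 0" by simp_all
  moreover have third: "Re (of_real (1 + b\<^sup>2) - of_real (2 * b) * z) = 1 + b\<^sup>2 - 2 * b * Re z"
    by (simp only: minus_complex.sel Re_complex_of_real times_complex.sel Im_complex_of_real mult_zero_left diff_zero)
  ultimately show ?thesis unfolding third abs_less_iff by auto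
qed

lemma set_integral_inverse_square:
  assumes r: "0 < (r::real)"
  shows "set_integrable lborel {r..} (\<lambda>t. inverse (t\<^sup>2))" "(LINT t:{r..}|lborel. inverse (t\<^sup>2)) = 1 / r"
proof -
  have ei: "einterval (ereal r) \<infinity> = {r<..}" by simp
  have d: "((\<lambda>t. - inverse t) has_real_derivative inverse (x\<^sup>2)) (at x)" if "ereal r < ereal x" for x
    using that r by (auto intro!: derivative_eq_intros simp: power2_eq_square)
  have c: "isCont (\<lambda>t. inverse (t\<^sup>2)) x" if "ereal r < ereal x" for x
    using that r by (intro continuous_intros) auto
  have "((\<lambda>t. - inverse t) \<longlongrightarrow> - inverse r) (at_right r)"
    by (intro tendsto_intros) (use r in auto)
  then have A: "(((\<lambda>t. - inverse t) \<circ> real_of_ereal) \<longlongrightarrow> - 1 / r) (at_right (ereal r))"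
    by (simp add: ereal_tendsto_simps divide_inverse)
  have "((\<lambda>t. - inverse t) \<longlongrightarrow> - (0::real)) at_top"
    by (intro tendsto_intros tendsto_inverse_0_at_top filterlim_ident)
  then have B: "(((\<lambda>t. - inverse t) \<circ> real_of_ereal) \<longlongrightarrow> 0) (at_left \<infinity>)"
    by (simp add: ereal_tendsto_simps)
  have *: "set_integrable lborel (einterval (ereal r) \<infinity>) (\<lambda>t. inverse (t\<^sup>2))" "(LBINT t=ereal r..\<infinity>. inverse (t\<^sup>2)) = 0 - (- 1 / r)"
    by (rule interval_integral_FTC_nonneg[OF _ d c _ A B]; simp)+
  have AE: "AE t in lborel. (indicator {r<..} t *\<^sub>R inverse (t\<^sup>2) :: real) = indicator {r..} t *\<^sub>R inverse (t\<^sup>2)"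
    using AE_lborel_singleton[of r] by eventually_elim (auto simp: indicator_def)
  show "set_integrable lborel {r..} (\<lambda>t. inverse (t\<^sup>2))"
    using *(1) integrable_cong_AE[OF _ _ AE] unfolding ei set_integrable_def by simp
  show "(LINT t:{r..}|lborel. inverse (t\<^sup>2)) = 1 / r"
    using *(2) integral_cong_AE[OF _ _ AE] by (simp add: interval_lebesgue_integral_def set_lebesgue_integral_def)
qed

lemma set_integral_inverse_square_left:
  assumes r: "0 < (r::real)"
  shows "set_integrable lborel {..-r} (\<lambda>t. inverse (t\<^sup>2))" "(LINT t:{..-r}|lborel. inverse (t\<^sup>2)) = 1 / r"
proof -
  have eq: "(\<lambda>t. indicator {..-r} (0 + (-1) * t) *\<^sub>R inverse ((0 + (-1) * t)\<^sup>2) :: real) = (\<lambda>t. indicator {r..} t *\<^sub>R inverse (t\<^sup>2))"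
    by (auto simp: indicator_def)
  show "set_integrable lborel {..-r} (\<lambda>t. inverse (t\<^sup>2))"
    using set_integral_inverse_square(1)[OF r] unfolding set_integrable_def eq[symmetric]
    by (subst (asm) lborel_integrable_real_affine_iff) auto
  show "(LINT t:{..-r}|lborel. inverse (t\<^sup>2)) = 1 / r"
    using set_integral_inverse_square(2)[OF r] unfolding set_lebesgue_integral_def eq[symmetric]
    by (subst lborel_integral_real_affine[where c = "-1" and t = 0]) auto
qed

text \<open>Split the integrand into the double pole w / t^2 and the rest g. The rest extends
  holomorphically over the origin, so its integral over the half circle may be replaced by the one
  over [- r, r], and the three pieces add up to the integral of g over the real line. The pole
  contributes w / r from each half line and - 2 w / r from the half circle, in total
  nothing.\<close>

lemma Sb_eq_Theta:
  assumes b: "0 < b" "b < 1" and z: "0 < Re z" "Re z < Qb b"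
  shows "Sb b z = exp (Theta (b\<^sup>2) (of_real (1 + b\<^sup>2) - of_real (2 * b) * z) / of_real (b\<^sup>2))"
proof -
  define r where "r = pi * b"
  define w where "w = of_real (Qb b / 2) - z"
  define a where "a = of_real (1 + b\<^sup>2) - of_real (2 * b) * z"
  define h where "h = Sb_integrand b z"
  define g where "g = (\<lambda>t::real. h (of_real t) - w / of_real t ^ 2)"
  have r: "r > 0" "r < 2 * pi * b" using b by (simp_all add: r_def)
  have a: "\<bar>Re a\<bar> < 1 + b\<^sup>2" unfolding a_def by (rule Sb_strip[OF b z])
  have ia: "integrable lborel (ths (b\<^sup>2) a)" using a by (intro ths_integrable) auto
  obtain G where G: "G holomorphic_on ball 0 (2 * pi * b)"
    "\<And>t. t \<in> ball 0 (2 * pi * b) \<Longrightarrow> t \<noteq> 0 \<Longrightarrow> h t = w / t\<^sup>2 + G t"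
    using Sb_regular_part[OF b, of z] unfolding h_def w_def by blast
  obtain P where P: "\<And>t. t \<in> ball 0 (2 * pi * b) \<Longrightarrow> (P has_field_derivative G t) (at t within ball 0 (2 * pi * b))"
    using holomorphic_convex_primitive'[OF convex_ball open_ball G(1)] by blast

  have gm: "g \<in> borel_measurable borel"
    unfolding g_def h_def Sb_integrand_def sinh_field_def by measurable
  have scaled: "of_real (2 * b) * g (0 + (2 * b) * s) = ths (b\<^sup>2) a s / of_real (b\<^sup>2)" if "s \<noteq> 0" for s
    using Sb_integrand_scaled[OF b(1) that, of z] by (simp only: g_def h_def w_def a_def add_0)
  have AE_scaled: "AE s in lborel. of_real (2 * b) * g (0 + (2 * b) * s) = ths (b\<^sup>2) a s / of_real (b\<^sup>2)"
    using AE_neq_0 by eventually_elim (rule scaled)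
  have m1: "(\<lambda>s. of_real (2 * b) * g (0 + (2 * b) * s)) \<in> borel_measurable lborel"
    using gm by measurable
  have "integrable lborel (\<lambda>s. of_real (2 * b) * g (0 + (2 * b) * s))"
    using integrable_cong_AE[OF m1 _ AE_scaled] ia by simp
  then have "integrable lborel (\<lambda>s. inverse (of_real (2 * b)) * (of_real (2 * b) * g (0 + (2 * b) * s)))"
    by - (rule integrable_mult_right, assumption)
  moreover have "(\<lambda>s. inverse (of_real (2 * b)) * (of_real (2 * b) * g (0 + (2 * b) * s))) = (\<lambda>s. g (0 + (2 * b) * s))"
    using b by (simp add: fun_eq_iff)
  ultimately have "integrable lborel (\<lambda>s. g (0 + (2 * b) * s))" by (simp only:)
  then have gi: "integrable lborel g"
    by (subst (asm) lborel_integrable_real_affine_iff) (use b in auto)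
  have "(LINT t|lborel. g t) = \<bar>2 * b\<bar> *\<^sub>R (LINT s|lborel. g (0 + (2 * b) * s))"
    by (rule lborel_integral_real_affine) (use b in auto)
  also have "\<dots> = (LINT s|lborel. of_real (2 * b) * g (0 + (2 * b) * s))"
    using b by (simp add: scaleR_conv_of_real)
  also have "\<dots> = (LINT s|lborel. ths (b\<^sup>2) a s / of_real (b\<^sup>2))"
    by (rule integral_cong_AE[OF m1 _ AE_scaled]) simp
  also have "\<dots> = Theta (b\<^sup>2) a / of_real (b\<^sup>2)" by (simp add: Theta_def)
  finally have total: "(LINT t|lborel. g t) = Theta (b\<^sup>2) a / of_real (b\<^sup>2)" .

  have gs: "set_integrable lborel A g" if "A \<in> sets borel" for A
    unfolding set_integrable_def using gi that by (intro integrable_mult_indicator) auto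
  have tail: "(LINT t:A|lborel. h (of_real t)) = (LINT t:A|lborel. g t) + w / r"
    if A: "A \<in> sets borel" "set_integrable lborel A (\<lambda>t. inverse (t\<^sup>2))" "(LINT t:A|lborel. inverse (t\<^sup>2)) = 1 / r" for A
  proof -
    have c: "set_integrable lborel A (\<lambda>t. w * of_real (inverse (t\<^sup>2)))"
    proof -
      have "integrable lborel (\<lambda>t. w * of_real (indicator A t *\<^sub>R inverse (t\<^sup>2)))"
        using A(2) unfolding set_integrable_def by (intro integrable_mult_right integrable_of_real)
      then show ?thesis by (simp add: set_integrable_def scaleR_conv_of_real mult_ac)
    qed
    have "(LINT t:A|lborel. h (of_real t)) = (LINT t:A|lborel. g t + w * of_real (inverse (t\<^sup>2)))"
      by (simp add: g_def divide_inverse)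
    also have "\<dots> = (LINT t:A|lborel. g t) + (LINT t:A|lborel. w * of_real (inverse (t\<^sup>2)))"
      by (rule set_integral_add(2)[OF gs[OF A(1)] c])
    also have "(LINT t:A|lborel. w * of_real (inverse (t\<^sup>2))) = w * (LINT t:A|lborel. of_real (inverse (t\<^sup>2)))"
      by (rule set_integral_mult_right)
    also have "(LINT t:A|lborel. complex_of_real (inverse (t\<^sup>2))) = of_real (LINT t:A|lborel. inverse (t\<^sup>2))"
      by (rule set_integral_complex_of_real)
    finally show ?thesis using A(3) by simp
  qed

  let ?c = "part_circlepath 0 r pi 0"
  have sph: "t \<in> ball 0 (2 * pi * b)" "t \<noteq> 0" if "t \<in> path_image ?c" for t
    using path_image_part_circlepath_subset'[of r 0 pi 0] that r by auto
  then have sub: "path_image ?c \<subseteq> ball 0 (2 * pi * b)" "path_image ?c \<subseteq> - {0}" by auto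
  have ends: "pathstart ?c = - of_real r" "pathfinish ?c = of_real r" by auto
  have c1: "((\<lambda>t. w / t\<^sup>2) has_contour_integral (- w / of_real r - (- w / (- of_real r)))) ?c"
  proof -
    have "((\<lambda>t. - w / t) has_field_derivative w / x\<^sup>2) (at x within - {0})" if "x \<in> - {0}" for x
      using that by (auto intro!: derivative_eq_intros simp: power2_eq_square)
    from contour_integral_primitive[OF this valid_path_part_circlepath sub(2)] show ?thesis unfolding ends .
  qed
  have c2: "(G has_contour_integral (P (of_real r) - P (- of_real r))) ?c"
    using contour_integral_primitive[OF P, of ?c] sub(1) unfolding ends by auto
  have "((\<lambda>t. w / t\<^sup>2 + G t) has_contour_integral (- w / of_real r - (- w / (- of_real r)) + (P (of_real r) - P (- of_real r)))) ?c"
    by (rule has_contour_integral_add[OF c1 c2])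
  then have "(h has_contour_integral (- w / of_real r - (- w / (- of_real r)) + (P (of_real r) - P (- of_real r)))) ?c"
    by (rule has_contour_integral_eq) (use G(2) sph in auto)
  then have mid: "contour_integral ?c h = - 2 * w / of_real r + (P (of_real r) - P (- of_real r))"
    by (simp add: contour_integral_unique)

  have "(G has_contour_integral (P (of_real r) - P (- of_real r))) (linepath (- of_real r) (of_real r))"
    using contour_integral_primitive[OF P, of "linepath (- of_real r) (of_real r)"] r
      closed_segment_subset[of "- complex_of_real r" "ball 0 (2 * pi * b)" "of_real r"] by auto
  then have "((\<lambda>t. G (of_real t)) has_integral (P (of_real r) - P (- of_real r))) {-r..r}"
    by (subst (asm) has_contour_integral_linepath_Reals_iff) (use r in auto)
  then have "(g has_integral (P (of_real r) - P (- of_real r))) {-r..r}"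
  proof (rule has_integral_spike_finite[of "{0}", rotated -1])
    fix t assume "t \<in> {-r..r} - {0}"
    then show "g t = G (of_real t)" using G(2)[of "of_real t"] r by (auto simp: g_def)
  qed auto
  then have midg: "(LINT t:{-r..r}|lborel. g t) = P (of_real r) - P (- of_real r)"
    using set_borel_integral_eq_integral(2)[OF gs[of "{-r..r}"]] by (simp add: integral_unique)

  have "(LINT t|lborel. g t) = (LINT t:({..-r} \<union> {-r..r}) \<union> {r..}|lborel. g t)"
  proof -
    have "({..-r} \<union> {-r..r}) \<union> {r..} = UNIV" using r by auto
    then show ?thesis by (simp add: set_lebesgue_integral_def)
  qed
  also have "\<dots> = (LINT t:({..-r} \<union> {-r..r})|lborel. g t) + (LINT t:{r..}|lborel. g t)"
    by (rule set_integral_Un_AE) (use AE_lborel_singleton[of r] gs r in \<open>auto elim!: eventually_mono\<close>)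
  also have "(LINT t:({..-r} \<union> {-r..r})|lborel. g t) = (LINT t:{..-r}|lborel. g t) + (LINT t:{-r..r}|lborel. g t)"
    by (rule set_integral_Un_AE) (use AE_lborel_singleton[of "-r"] gs r in \<open>auto elim!: eventually_mono\<close>)
  finally have split: "(LINT t|lborel. g t) = (LINT t:{..-r}|lborel. g t) + (P (of_real r) - P (- of_real r)) + (LINT t:{r..}|lborel. g t)"
    by (simp add: midg)
  have "(LINT t:{..- r}|lborel. h (of_real t)) + contour_integral ?c h + (LINT t:{r..}|lborel. h (of_real t)) = (LINT t|lborel. g t)"
    unfolding split mid tail[OF _ set_integral_inverse_square[OF r(1)], simplified]
      tail[OF _ set_integral_inverse_square_left[OF r(1)], simplified] by (simp add: field_simps)
  then show ?thesis unfolding Sb_def r_def[symmetric] h_def[symmetric] total a_def[symmetric] by simp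
qed

section \<open>The classical limit as a dilogarithm\<close>

text \<open>The limit e = 0 in the variable w = 2 pi b z - pi b^2, for which 1 + b^2 - 2 b z = 1 - w
  / pi.\<close>

definition Fa :: "complex \<Rightarrow> complex" where
  "Fa w = Theta 0 (1 - w / of_real pi)"

lemma Fa_strip:
  assumes "0 < Re w" "Re w < 2 * pi"
  shows "\<bar>Re (1 - w / of_real pi)\<bar> < 1"
proof -
  have "Re (1 - w / of_real pi) = 1 - Re w / pi" by simp
  moreover have "0 < Re w / pi" "Re w / pi < 2" using assms by (simp_all add: divide_simps)
  ultimately show ?thesis by linarith
qed

lemma Fa_deriv:
  assumes "0 < Re w" "Re w < 2 * pi"
  shows "(Fa has_field_derivative Ln (2 * sin (w / 2)) / of_real (2 * pi)) (at w)"
proof -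
  note st = Fa_strip[OF assms]
  have "((\<lambda>w. 1 - w / of_real pi) has_field_derivative - (1 / of_real pi)) (at w)"
    by (auto intro!: derivative_eq_intros)
  from DERIV_chain2[OF Theta_deriv(1) this] st
  have "(Fa has_field_derivative Theta1 0 (1 - w / of_real pi) * - (1 / of_real pi)) (at w)"
    unfolding Fa_def[abs_def] by simp
  moreover have "complex_of_real (pi / 2) * (1 - w / of_real pi) = of_real (pi / 2) - w / 2"
    by (simp add: field_simps)
  then have "cos (complex_of_real (pi / 2) * (1 - w / of_real pi)) = sin (w / 2)"
    by (simp only: cos_diff cos_of_real sin_of_real cos_pi_half sin_pi_half) simp
  ultimately show ?thesis unfolding Theta1_0[OF st] by simp
qed

lemma Fa_reflect: "Fa (2 * of_real pi - w) = - Fa w"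
proof -
  have "1 - (2 * of_real pi - w) / of_real pi = - (1 - w / of_real pi)" by (simp add: field_simps)
  then show ?thesis unfolding Fa_def by (simp only: Theta_minus)
qed

lemma Fa_cnj: "Fa (cnj w) = cnj (Fa w)"
  unfolding Fa_def Theta_cnj[symmetric] by simp

lemma Fa_pi: "Fa (of_real pi) = 0"
  using Fa_reflect[of "of_real pi"] by simp

text \<open>The term n = 0 is a division by zero and hence 0, so this is the usual series
  Li_2.\<close>

definition dilog :: "complex \<Rightarrow> complex" where
  "dilog q = (\<Sum>n. q ^ n / of_nat n ^ 2)"

lemma squares_sums: "(\<lambda>n. 1 / real n ^ 2) sums (pi\<^sup>2 / 6)"
  using sums_Suc[of "\<lambda>n. 1 / real n ^ 2" "pi\<^sup>2 / 6"] inverse_squares_sums by (simp add: add_ac)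

lemma norm_dilog_term: "norm q \<le> 1 \<Longrightarrow> norm (q ^ n / of_nat n ^ 2 :: complex) \<le> norm q * (1 / real n ^ 2)"
proof (cases n)
  case (Suc m)
  assume "norm q \<le> 1"
  then have "norm q ^ m * norm q \<le> 1 * norm q" by (intro mult_right_mono power_le_one) auto
  then have "norm q ^ n \<le> norm q" by (simp add: Suc mult.commute)
  then show ?thesis by (simp add: norm_divide norm_power divide_right_mono)
qed simp

lemma dilog_sums:
  assumes "norm q \<le> 1" shows "(\<lambda>n. q ^ n / of_nat n ^ 2) sums dilog q"
proof -
  have "summable (\<lambda>n. norm q * (1 / real n ^ 2))"
    by (rule summable_mult[OF sums_summable[OF squares_sums]])
  then have "summable (\<lambda>n. q ^ n / of_nat n ^ 2)"
    by (rule summable_comparison_test'[where N = 0]) (rule norm_dilog_term[OF assms])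
  then show ?thesis unfolding dilog_def by (rule summable_sums)
qed

lemma norm_dilog_le:
  assumes "norm q \<le> 1" shows "norm (dilog q) \<le> norm q * (pi\<^sup>2 / 6)"
proof -
  have s: "(\<lambda>n. norm q * (1 / real n ^ 2)) sums (norm q * (pi\<^sup>2 / 6))" by (intro sums_mult squares_sums)
  have "norm (dilog q) \<le> (\<Sum>n. norm q * (1 / real n ^ 2))"
    unfolding dilog_def by (rule norm_suminf_le[OF norm_dilog_term[OF assms] sums_summable[OF s]])
  also have "\<dots> = norm q * (pi\<^sup>2 / 6)" by (rule sums_unique[OF s, symmetric])
  finally show ?thesis .
qed

text \<open>The closed disc is needed because real w correspond to the unit circle, where
  \<open>Fa\<close> is normalised and where its limit at 0 is read off.\<close>

lemma continuous_on_dilog: "continuous_on (cball 0 1) dilog"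
proof (rule uniform_limit_theorem)
  show "uniform_limit (cball 0 1) (\<lambda>n q. \<Sum>i<n. q ^ i / of_nat i ^ 2) dilog sequentially"
    unfolding dilog_def
  proof (rule Weierstrass_m_test)
    show "norm (q ^ n / of_nat n ^ 2) \<le> 1 / real n ^ 2" if "q \<in> cball 0 1" for n and q :: complex
      using norm_dilog_term[of q n] that mult_right_mono[of "norm q" 1 "1 / real n ^ 2"] by auto
  qed (rule sums_summable[OF squares_sums])
  show "\<forall>\<^sub>F n in sequentially. continuous_on (cball 0 1) (\<lambda>q. \<Sum>i<n. q ^ i / (of_nat i ^ 2 :: complex))"
    unfolding divide_inverse by (intro always_eventually allI continuous_intros)
qed auto

text \<open>The derivative D is specified through D q in order to include q = 0, where - Ln (1 - q)
  / q is not a meaningful formula.\<close>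

lemma dilog_deriv:
  assumes q: "norm q < 1"
  shows "\<exists>D. (dilog has_field_derivative D) (at q) \<and> D * q = - Ln (1 - q)"
proof -
  define c where "c = (\<lambda>n. 1 / of_nat n ^ 2 :: complex)"
  have dl: "dilog = (\<lambda>q. \<Sum>n. c n * q ^ n)" by (simp add: dilog_def c_def fun_eq_iff)
  have "((\<lambda>z. \<Sum>n. c n * z ^ n) has_field_derivative (\<Sum>n. diffs c n * q ^ n)) (at q)"
  proof (rule termdiffs_strong')
    show "summable (\<lambda>n. c n * z ^ n)" if "norm z < 1" for z
      using sums_summable[OF dilog_sums[of z]] that by (simp add: c_def)
  qed (rule q)
  moreover have dc: "diffs c n = 1 / of_nat (Suc n)" for n
    by (simp add: diffs_def c_def power2_eq_square del: of_nat_Suc)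
  have L: "(\<lambda>n. q ^ n / of_nat n) sums (- Ln (1 - q))"
    using sums_minus[OF Ln_series'[of "-q"]] q by simp
  then have "(\<lambda>n. q ^ Suc n / of_nat (Suc n)) sums (- Ln (1 - q))"
    by (subst sums_Suc_iff) simp
  then have S: "(\<lambda>n. (diffs c n * q ^ n) * q) sums (- Ln (1 - q))"
    by (simp add: dc mult.commute)
  have "(\<Sum>n. diffs c n * q ^ n) * q = - Ln (1 - q)"
  proof (cases "q = 0")
    case False
    from sums_divide[OF S, of q] have "summable (\<lambda>n. diffs c n * q ^ n)" using False by (auto simp: sums_iff)
    then show ?thesis using suminf_mult2[of "\<lambda>n. diffs c n * q ^ n" q] S by (simp add: sums_iff)
  qed simp
  ultimately show ?thesis unfolding dl by blast
qed

text \<open>Adding 1 / n^2 to (-1)^n / n^2 doubles the even terms and removes the odd ones, leaving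
  half of pi^2 / 6.\<close>

lemma dilog_minus_1: "dilog (- 1) = - of_real (pi\<^sup>2 / 12)"
proof -
  have "(\<lambda>m. (1 + (-1) ^ (2 * m)) / real (2 * m) ^ 2) sums (1/2 * (pi\<^sup>2 / 6))"
    using sums_mult[OF squares_sums, of "1/2"] by (simp add: power_mult_distrib)
  moreover have "strict_mono (\<lambda>m::nat. 2 * m)" by (simp add: strict_mono_def)
  moreover have "(1 + (-1) ^ n) / real n ^ 2 = 0" if "n \<notin> range (\<lambda>m. 2 * m)" for n
  proof -
    have "odd n" using that by (auto elim!: evenE)
    then show ?thesis by simp
  qed
  ultimately have "(\<lambda>n. (1 + (-1) ^ n) / real n ^ 2) sums (1/2 * (pi\<^sup>2 / 6))"
    using sums_mono_reindex[of "\<lambda>m. 2 * m" "\<lambda>n. (1 + (-1) ^ n) / real n ^ 2" "1/2 * (pi\<^sup>2 / 6)"] by simp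
  from sums_diff[OF this squares_sums] have "(\<lambda>n. (-1) ^ n / real n ^ 2) sums (- (pi\<^sup>2 / 12))"
    by (simp add: diff_divide_distrib[symmetric])
  from sums_of_real[OF this, where 'a = complex] have "(\<lambda>n. (-1) ^ n / of_nat n ^ 2) sums (of_real (- (pi\<^sup>2 / 12)) :: complex)"
    by simp
  then show ?thesis using sums_unique2[OF dilog_sums[of "-1"]] by simp
qed

text \<open>The quadratic polynomial to which \<open>Fa\<close> tends exponentially fast as Im w
  grows. The constant term is forced by \<open>Fa\<close> vanishing at pi together with the value of
  the dilogarithm at -1.\<close>

definition Fasym :: "complex \<Rightarrow> complex" where
  "Fasym w = \<i> * w / 4 - \<i> * w\<^sup>2 / of_real (8 * pi) - \<i> * of_real pi / 12"

lemma norm_exp_i: "norm (exp (\<i> * w)) = exp (- Im w)"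
  by (simp add: norm_exp_eq_Re)

text \<open>The factorisation 2 sin (w / 2) = i exp (- i w / 2) (1 - exp (i w)). The imaginary parts
  of the three logarithms add up to a number in (- pi, pi], so no multiple of 2 pi i has to be
  corrected.\<close>

lemma Ln_2_sin:
  assumes "0 < Re w" "Re w < 2 * pi" "Im w > 0"
  shows "Ln (2 * sin (w / 2)) = \<i> * of_real pi / 2 - \<i> * w / 2 + Ln (1 - exp (\<i> * w))"
proof (rule Ln_unique)
  define q where "q = exp (\<i> * w)"
  have q: "norm q < 1" using assms by (simp add: q_def norm_exp_i)
  then have re: "Re (1 - q) > 0" using complex_Re_le_cmod[of q] by simp
  then have nz: "1 - q \<noteq> 0" by force
  have "exp (\<i> * of_real pi / 2 - \<i> * w / 2 + Ln (1 - q)) = exp (\<i> * of_real pi / 2) * exp (- (\<i> * w / 2)) * (1 - q)"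
    using exp_Ln[OF nz] by (simp only: exp_add diff_conv_add_uminus)
  also have "exp (\<i> * of_real pi / 2) = \<i>"
    by (metis exp_pi_i' cis_conv_exp cis_pi_half mult.commute of_real_divide of_real_numeral times_divide_eq_right)
  also have "\<i> * exp (- (\<i> * w / 2)) * (1 - q) = \<i> * (exp (- (\<i> * w / 2)) - exp (\<i> * w / 2))"
  proof -
    have "exp (- (\<i> * w / 2)) * q = exp (\<i> * w / 2)" by (simp add: q_def exp_add[symmetric])
    then show ?thesis by (simp add: algebra_simps)
  qed
  also have "\<dots> = 2 * sin (w / 2)" by (simp add: sin_exp_eq field_simps)
  finally show "exp (\<i> * of_real pi / 2 - \<i> * w / 2 + Ln (1 - exp (\<i> * w))) = 2 * sin (w / 2)" by (simp add: q_def)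
  have "\<bar>Im (Ln (1 - q))\<bar> < pi / 2" using Re_Ln_pos_lt[OF nz] re by simp
  moreover have "Im (\<i> * of_real pi / 2 - \<i> * w / 2 + Ln (1 - q)) = pi / 2 - Re w / 2 + Im (Ln (1 - q))" by simp
  ultimately show "- pi < Im (\<i> * of_real pi / 2 - \<i> * w / 2 + Ln (1 - exp (\<i> * w)))"
     "Im (\<i> * of_real pi / 2 - \<i> * w / 2 + Ln (1 - exp (\<i> * w))) \<le> pi"
    using assms unfolding q_def[symmetric] by linarith+
qed

text \<open>In the open upper half strip both sides have the same derivative. The constant
  difference passes to the real boundary by continuity, and at w = pi both sides vanish.\<close>

lemma Fa_upper:
  assumes w: "0 < Re w" "Re w < 2 * pi" "Im w \<ge> 0"
  shows "Fa w = Fasym w + \<i> / of_real (2 * pi) * dilog (exp (\<i> * w))"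
proof -
  define U where "U = {z. 0 < Re z \<and> Re z < 2 * pi} \<inter> {z. Im z > 0}"
  define V where "V = {z. 0 < Re z \<and> Re z < 2 * pi} \<inter> {z. Im z \<ge> 0}"
  define g where "g = (\<lambda>w. Fa w - (Fasym w + \<i> / of_real (2 * pi) * dilog (exp (\<i> * w))))"
  have U: "convex U" unfolding U_def by (intro convex_Int convex_Re_strip convex_halfspace_Im_gt)
  have der: "(g has_field_derivative 0) (at z within U)" if z: "z \<in> U" for z
  proof -
    have zz: "0 < Re z" "Re z < 2 * pi" "Im z > 0" using z by (auto simp: U_def)
    obtain D where D: "(dilog has_field_derivative D) (at (exp (\<i> * z)))" "D * exp (\<i> * z) = - Ln (1 - exp (\<i> * z))"
      using dilog_deriv[of "exp (\<i> * z)"] zz by (auto simp: norm_exp_i)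
    have e: "((\<lambda>z. exp (\<i> * z)) has_field_derivative exp (\<i> * z) * \<i>) (at z)"
      by (auto intro!: derivative_eq_intros)
    have d1: "((\<lambda>w. \<i> / of_real (2 * pi) * dilog (exp (\<i> * w))) has_field_derivative \<i> / of_real (2 * pi) * (D * (exp (\<i> * z) * \<i>))) (at z)"
      by (intro DERIV_cmult DERIV_chain2[OF D(1) e])
    have d2: "(Fasym has_field_derivative \<i> / 4 - \<i> * z / of_real (4 * pi)) (at z)"
      unfolding Fasym_def[abs_def] by (auto intro!: derivative_eq_intros simp: field_simps)
    have "(g has_field_derivative Ln (2 * sin (z / 2)) / of_real (2 * pi) - (\<i> / 4 - \<i> * z / of_real (4 * pi) + \<i> / of_real (2 * pi) * (D * (exp (\<i> * z) * \<i>)))) (at z)"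
      unfolding g_def by (intro DERIV_diff DERIV_add d1 d2 Fa_deriv zz)
    also have "D * (exp (\<i> * z) * \<i>) = - Ln (1 - exp (\<i> * z)) * \<i>" using D(2) by (simp add: mult.assoc[symmetric])
    also have "Ln (2 * sin (z / 2)) / of_real (2 * pi) - (\<i> / 4 - \<i> * z / of_real (4 * pi) + \<i> / of_real (2 * pi) * (- Ln (1 - exp (\<i> * z)) * \<i>)) = 0"
      unfolding Ln_2_sin[OF zz] by (simp add: field_simps)
    finally show ?thesis by (rule has_field_derivative_at_within)
  qed
  obtain c where c: "\<And>z. z \<in> U \<Longrightarrow> g z = c"
    using has_field_derivative_zero_constant[OF U der] by auto
  have cont: "continuous_on V g"
  proof -
    have "continuous_on V (\<lambda>w. dilog (exp (\<i> * w)))"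
      by (rule continuous_on_compose2[OF continuous_on_dilog]) (auto intro!: continuous_intros simp: V_def norm_exp_i)
    moreover have "continuous_on V Fa"
      by (intro continuous_at_imp_continuous_on ballI DERIV_isCont[OF Fa_deriv]) (auto simp: V_def)
    ultimately show ?thesis unfolding g_def Fasym_def by (intro continuous_intros) auto
  qed
  have gV: "g z = c" if z: "z \<in> V" for z
  proof -
    define X where "X = (\<lambda>n. z + \<i> * of_real (inverse (real (Suc n))))"
    have XU: "X n \<in> U" for n using z by (auto simp: X_def U_def V_def add_nonneg_pos)
    have "X \<longlonglongrightarrow> z + \<i> * of_real 0" unfolding X_def by (intro tendsto_intros LIMSEQ_inverse_real_of_nat)
    then have "(\<lambda>n. g (X n)) \<longlonglongrightarrow> g z"
      using continuous_on_sequentially[of V g] cont z XU by (auto simp: U_def V_def o_def less_imp_le)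
    then show ?thesis using c[OF XU] by (simp add: LIMSEQ_const_iff)
  qed
  have "g (of_real pi) = c" by (rule gV) (auto simp: V_def)
  moreover have "g (of_real pi) = 0"
  proof -
    have "exp (\<i> * complex_of_real pi) = -1" by simp
    then have 1: "dilog (exp (\<i> * of_real pi)) = - of_real (pi\<^sup>2 / 12)" by (simp only: dilog_minus_1)
    show ?thesis unfolding g_def Fa_pi 1 Fasym_def by (simp add: field_simps power2_eq_square)
  qed
  ultimately show ?thesis using gV[of w] w by (simp add: V_def g_def)
qed

lemma Fa_asymptotic:
  assumes w: "0 < Re w" "Re w < 2 * pi" "Im w \<ge> 0"
  shows "norm (Fa w - Fasym w) \<le> exp (- Im w)"
proof -
  have "norm (Fa w - Fasym w) = norm (dilog (exp (\<i> * w))) / (2 * pi)"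
    unfolding Fa_upper[OF w] by (simp add: norm_mult norm_divide)
  also have "\<dots> \<le> exp (- Im w) * (pi\<^sup>2 / 6) / (2 * pi)"
    using norm_dilog_le[of "exp (\<i> * w)"] w by (intro divide_right_mono) (auto simp: norm_exp_i)
  also have "\<dots> = exp (- Im w) * (pi / 12)" by (simp add: power2_eq_square)
  also have "\<dots> \<le> exp (- Im w) * 1" using pi_less_4 by (intro mult_left_mono) auto
  finally show ?thesis by simp
qed

text \<open>The formula of \<open>Fa_upper\<close> is continuous on the closed upper half plane and
  is 0 at the origin, because - i pi / 12 cancels i / (2 pi) times pi^2 / 6. The lower half is
  reached by conjugation, which is the purpose of reflecting w to \<open>up w\<close>.\<close>

lemma Fa_tendsto_0: "(Fa \<longlongrightarrow> 0) (at 0 within {w. 0 < Re w \<and> Re w < 2 * pi})"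
proof -
  define g where "g = (\<lambda>w. Fasym w + \<i> / of_real (2 * pi) * dilog (exp (\<i> * w)))"
  define up where "up = (\<lambda>w. Complex (Re w) \<bar>Im w\<bar>)"
  have "continuous_on {w. Im w \<ge> 0} g"
  proof -
    have "continuous_on {w. Im w \<ge> 0} (\<lambda>w. dilog (exp (\<i> * w)))"
      by (rule continuous_on_compose2[OF continuous_on_dilog]) (auto intro!: continuous_intros simp: norm_exp_i)
    then show ?thesis unfolding g_def Fasym_def by (intro continuous_intros) auto
  qed
  moreover have "continuous_on UNIV up" unfolding up_def
    by (subst complex_eq[symmetric] | simp add: Complex_eq)+ (intro continuous_intros)
  ultimately have "continuous_on UNIV (\<lambda>w. g (up w))"
    by (rule continuous_on_compose2) (auto simp: up_def)
  then have "isCont (\<lambda>w. g (up w)) 0" by (simp add: continuous_on_eq_continuous_at)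
  moreover have "g (up 0) = 0"
  proof -
    have "dilog 1 = of_real (pi\<^sup>2 / 6)"
      using sums_of_real[OF squares_sums, where 'a = complex] by (intro sums_unique2[OF dilog_sums]) auto
    then show ?thesis by (simp add: g_def up_def Fasym_def field_simps power2_eq_square flip: zero_complex.code)
  qed
  ultimately have "((\<lambda>w. norm (g (up w))) \<longlongrightarrow> 0) (at 0)"
    using isCont_def tendsto_norm_zero by metis
  then have "((\<lambda>w. norm (g (up w))) \<longlongrightarrow> 0) (at 0 within {w. 0 < Re w \<and> Re w < 2 * pi})"
    by (rule tendsto_within_subset) auto
  moreover have "norm (Fa w) = norm (g (up w))" if "0 < Re w" "Re w < 2 * pi" for w
  proof (cases "Im w \<ge> 0")
    case True
    then have "up w = w" by (simp add: up_def complex_eq_iff)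
    then show ?thesis using Fa_upper[of w] that True by (simp add: g_def)
  next
    case False
    then have "up w = cnj w" by (simp add: up_def complex_eq_iff)
    have "norm (Fa w) = norm (Fa (cnj w))" by (simp only: Fa_cnj complex_mod_cnj)
    also have "Fa (cnj w) = g (cnj w)" using Fa_upper[of "cnj w"] that False by (simp add: g_def)
    finally show ?thesis using \<open>up w = cnj w\<close> by simp
  qed
  then have "\<forall>\<^sub>F w in at 0 within {w. 0 < Re w \<and> Re w < 2 * pi}. norm (g (up w)) = norm (Fa w)"
    by (auto simp: eventually_at_filter)
  ultimately have "((\<lambda>w. norm (Fa w)) \<longlongrightarrow> 0) (at 0 within {w. 0 < Re w \<and> Re w < 2 * pi})"
    by (rule Lim_transform_eventually)
  then show ?thesis by (rule tendsto_norm_zero_cancel)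
qed

section \<open>Gaussian integrals and Laplace's method\<close>

lemma real_gaussian_integral:
  fixes c :: real
  assumes "c > 0"
  shows "integrable lborel (\<lambda>x. exp (- (c * x\<^sup>2)))" "(LINT x|lborel. exp (- x\<^sup>2)) = sqrt pi"
proof -
  have *: "has_bochner_integral lborel (\<lambda>x::real. exp (- x\<^sup>2)) (2 * (sqrt pi / 2))"
    using has_bochner_integral_even_function[OF gaussian_moment_0] by simp
  then show "(LINT x|lborel. exp (- x\<^sup>2)) = sqrt pi" by (simp add: has_bochner_integral_integral_eq)
  have "integrable lborel (\<lambda>x. exp (- (0 + sqrt c * x)\<^sup>2))"
    using * assms by (intro lborel_integrable_real_affine[where f = "\<lambda>x. exp (- x\<^sup>2)"]) (auto simp: has_bochner_integral_iff)
  then show "integrable lborel (\<lambda>x. exp (- (c * x\<^sup>2)))"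
    using assms by (simp add: power_mult_distrib)
qed

lemma square_times_exp_le:
  assumes "r > (0::real)"
  shows "x\<^sup>2 * exp (- (r * x\<^sup>2)) \<le> 2 / r * exp (- (r / 2 * x\<^sup>2))"
proof -
  have "r / 2 * x\<^sup>2 \<le> exp (r / 2 * x\<^sup>2)" using exp_ge_add_one_self[of "r / 2 * x\<^sup>2"] by linarith
  then have "r / 2 * x\<^sup>2 * exp (- (r * x\<^sup>2)) \<le> exp (r / 2 * x\<^sup>2) * exp (- (r * x\<^sup>2))"
    by (intro mult_right_mono) auto
  also have "\<dots> = exp (- (r / 2 * x\<^sup>2))" by (simp flip: exp_add)
  finally show ?thesis using assms by (simp add: field_simps)
qed

lemma mult_exp_square_tendsto_0:
  fixes a :: complex
  assumes a: "Re a > 0" and F: "F = at_top \<or> F = at_bot"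
  shows "((\<lambda>x. of_real x * exp (- (a * of_real (x\<^sup>2)))) \<longlongrightarrow> 0) F"
proof (rule Lim_null_comparison)
  show "\<forall>\<^sub>F x in F. norm (of_real x * exp (- (a * of_real (x\<^sup>2)))) \<le> 1 / Re a * \<bar>inverse x\<bar>"
  proof (rule always_eventually, rule allI)
    fix x :: real
    show "norm (of_real x * exp (- (a * of_real (x\<^sup>2)))) \<le> 1 / Re a * \<bar>inverse x\<bar>"
    proof (cases "x = 0")
      case False
      have "Re a * x\<^sup>2 \<le> exp (Re a * x\<^sup>2)" using exp_ge_add_one_self[of "Re a * x\<^sup>2"] by linarith
      then have "exp (- (Re a * x\<^sup>2)) \<le> 1 / (Re a * x\<^sup>2)"
        using False a by (simp add: exp_minus field_simps)
      then have "\<bar>x\<bar> * exp (- (Re a * x\<^sup>2)) \<le> \<bar>x\<bar> * (1 / (Re a * x\<^sup>2))" by (intro mult_left_mono) auto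
      also have "\<dots> = 1 / Re a * \<bar>inverse x\<bar>" using False by (simp add: power2_eq_square abs_if field_simps)
      finally show ?thesis by (simp add: norm_mult norm_exp_eq_Re)
    qed simp
  qed
  have "(inverse \<longlongrightarrow> (0::real)) F"
    using F tendsto_mono[OF at_top_le_at_infinity tendsto_inverse_0] tendsto_mono[OF at_bot_le_at_infinity tendsto_inverse_0] by auto
  then have "((\<lambda>x. 1 / Re a * \<bar>inverse x\<bar>) \<longlongrightarrow> 1 / Re a * \<bar>0\<bar>) F"
    by (intro tendsto_intros)
  then show "((\<lambda>x. 1 / Re a * \<bar>inverse x\<bar>) \<longlongrightarrow> 0) F" by simp
qed

lemma complex_gaussian_integrable:
  fixes a :: complex
  assumes "Re a > 0"
  shows "integrable lborel (\<lambda>x. exp (- (a * of_real (x\<^sup>2))))"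
    "integrable lborel (\<lambda>x. - of_real (x\<^sup>2) * exp (- (a * of_real (x\<^sup>2))))"
proof -
  show "integrable lborel (\<lambda>x. exp (- (a * of_real (x\<^sup>2))))"
    by (rule Bochner_Integration.integrable_bound[OF real_gaussian_integral(1)[OF assms]])
       (auto simp: norm_exp_eq_Re)
  have "integrable lborel (\<lambda>x. 2 / Re a * exp (- (Re a / 2 * x\<^sup>2)))"
    using real_gaussian_integral(1)[of "Re a / 2"] assms by simp
  then show "integrable lborel (\<lambda>x. - of_real (x\<^sup>2) * exp (- (a * of_real (x\<^sup>2))))"
  proof (rule Bochner_Integration.integrable_bound)
    show "AE x in lborel. norm (- of_real (x\<^sup>2) * exp (- (a * of_real (x\<^sup>2)))) \<le> norm (2 / Re a * exp (- (Re a / 2 * x\<^sup>2)))"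
      using square_times_exp_le[OF assms] assms by (intro AE_I2) (auto simp: norm_mult norm_exp_eq_Re norm_power)
  qed auto
qed

text \<open>Differentiation under the integral sign and integration by parts give G + 2 a G' = 0, so
  G(a) csqrt a is constant on the right half plane; its value is known at a = 1. This also settles
  the branch of the square root.\<close>

lemma complex_gaussian_integral:
  fixes a :: complex
  assumes a: "Re a > 0"
  shows "(LINT x|lborel. exp (- (a * of_real (x\<^sup>2)))) = of_real (sqrt pi) / csqrt a"
proof -
  define G where "G = (\<lambda>a. LINT x|lborel. exp (- (a * complex_of_real (x\<^sup>2))))"
  define G1 where "G1 = (\<lambda>a. LINT x|lborel. - of_real (x\<^sup>2) * exp (- (a * complex_of_real (x\<^sup>2))))"
  define S where "S = {z::complex. Re z > 0}"
  have S: "convex S" unfolding S_def by (rule convex_halfspace_Re_gt)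
  have deriv: "(G has_field_derivative G1 a) (at a)" if a: "Re a > 0" for a
  proof -
    define r where "r = Re a / 2"
    have r: "r > 0" "r < Re a" using a by (auto simp: r_def)
    show ?thesis unfolding G_def G1_def
    proof (rule has_field_derivative_lebesgue_integral[where S = "{z. Re z > r}" and B = "\<lambda>x. 2 / r * exp (- (r / 2 * x\<^sup>2))"])
      show "open {z. Re z > r}" "convex {z. Re z > r}" by (rule open_halfspace_Re_gt convex_halfspace_Re_gt)+
      show "a \<in> {z. Re z > r}" using r by simp
      show "integrable lborel (\<lambda>x. exp (- (z * complex_of_real (x\<^sup>2))))" if "z \<in> {z. Re z > r}" for z
        using that r by (intro complex_gaussian_integrable) auto
      show "((\<lambda>z. exp (- (z * complex_of_real (x\<^sup>2)))) has_field_derivative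
         - of_real (x\<^sup>2) * exp (- (z * complex_of_real (x\<^sup>2)))) (at z)" for z x
        by (auto intro!: derivative_eq_intros)
      show "norm (- of_real (x\<^sup>2) * exp (- (z * complex_of_real (x\<^sup>2)))) \<le> 2 / r * exp (- (r / 2 * x\<^sup>2))"
        if "z \<in> {z. Re z > r}" for z x
      proof -
        have "norm (- of_real (x\<^sup>2) * exp (- (z * complex_of_real (x\<^sup>2)))) = x\<^sup>2 * exp (- (Re z * x\<^sup>2))"
          by (simp add: norm_mult norm_exp_eq_Re norm_power)
        also have "\<dots> \<le> x\<^sup>2 * exp (- (r * x\<^sup>2))"
          using that by (auto intro!: mult_left_mono mult_right_mono)
        also have "\<dots> \<le> 2 / r * exp (- (r / 2 * x\<^sup>2))" by (rule square_times_exp_le[OF r(1)])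
        finally show ?thesis .
      qed
      show "(\<lambda>x. - of_real (x\<^sup>2) * exp (- (a * complex_of_real (x\<^sup>2)))) \<in> borel_measurable lborel"
        by measurable
      show "integrable lborel (\<lambda>x. 2 / r * exp (- (r / 2 * x\<^sup>2)))"
        using real_gaussian_integral(1)[of "r / 2"] r by simp
    qed
  qed
  have parts: "G a + 2 * a * G1 a = 0" if a: "Re a > 0" for a
  proof -
    note i = complex_gaussian_integrable[OF a]
    have "(LBINT x=-\<infinity>..\<infinity>. exp (- (a * of_real (x\<^sup>2))) + 2 * a * (- of_real (x\<^sup>2) * exp (- (a * of_real (x\<^sup>2))))) = 0 - 0"
    proof (rule interval_integral_FTC_integrable[where F = "\<lambda>x. of_real x * exp (- (a * of_real (x\<^sup>2)))"])
      show "((\<lambda>x. of_real x * exp (- (a * of_real (x\<^sup>2)))) has_vector_derivative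
         exp (- (a * of_real (x\<^sup>2))) + 2 * a * (- of_real (x\<^sup>2) * exp (- (a * of_real (x\<^sup>2))))) (at x)" for x
      proof -
        have "((\<lambda>x. x * exp (- (a * x\<^sup>2))) has_field_derivative
         exp (- (a * of_real (x\<^sup>2))) + 2 * a * (- of_real (x\<^sup>2) * exp (- (a * of_real (x\<^sup>2))))) (at (of_real x))"
          by (auto intro!: derivative_eq_intros simp: power2_eq_square algebra_simps)
        from has_vector_derivative_real_field[OF this] show ?thesis by simp
      qed
      show "isCont (\<lambda>x. exp (- (a * complex_of_real (x\<^sup>2))) + 2 * a * (- of_real (x\<^sup>2) * exp (- (a * of_real (x\<^sup>2))))) x" for x
        by (intro continuous_intros)
      show "set_integrable lborel (einterval (- \<infinity>) \<infinity>) (\<lambda>x. exp (- (a * of_real (x\<^sup>2))) + 2 * a * (- of_real (x\<^sup>2) * exp (- (a * of_real (x\<^sup>2)))))"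
        using i unfolding set_integrable_def einterval_eq_UNIV indicator_UNIV scaleR_one
        by (intro Bochner_Integration.integrable_add integrable_mult_right)
    qed (use mult_exp_square_tendsto_0[OF a] in \<open>auto simp: ereal_tendsto_simps\<close>)
    then have "(LINT x|lborel. exp (- (a * of_real (x\<^sup>2))) + 2 * a * (- of_real (x\<^sup>2) * exp (- (a * of_real (x\<^sup>2))))) = 0"
      by (simp add: interval_lebesgue_integral_def set_lebesgue_integral_def)
    then show ?thesis
      unfolding G_def G1_def using i
      by (subst (asm) Bochner_Integration.integral_add) (auto simp del: mult_minus_left)
  qed
  define H where "H = (\<lambda>a. G a * csqrt a)"
  have der: "(H has_field_derivative 0) (at z within S)" if z: "z \<in> S" for z
  proof -
    have z': "Re z > 0" "z \<notin> \<real>\<^sub>\<le>\<^sub>0" "z \<noteq> 0" using z by (auto simp: S_def complex_nonpos_Reals_iff)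
    have "(H has_field_derivative (G1 z * csqrt z + inverse (2 * csqrt z) * G z)) (at z)"
      unfolding H_def by (rule DERIV_mult[OF deriv[OF z'(1)] has_field_derivative_csqrt[OF z'(2)], THEN DERIV_cong]) simp
    also have "G1 z * csqrt z + inverse (2 * csqrt z) * G z = (G z + 2 * (csqrt z * csqrt z) * G1 z) / (2 * csqrt z)"
      using z'(3) by (simp add: field_simps)
    also have "csqrt z * csqrt z = z" by (metis power2_csqrt power2_eq_square)
    finally show ?thesis using parts[OF z'(1)] by (simp add: has_field_derivative_at_within)
  qed
  obtain c where c: "\<And>z. z \<in> S \<Longrightarrow> H z = c"
    using has_field_derivative_zero_constant[OF S der] by auto
  have "c = H 1" using c[of 1] by (simp add: S_def)
  also have "H 1 = of_real (LINT x|lborel. exp (- x\<^sup>2))"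
    unfolding H_def G_def by (simp flip: integral_complex_of_real add: exp_of_real[symmetric])
  also have "\<dots> = of_real (sqrt pi)" using real_gaussian_integral(2)[of 1] by simp
  finally have "G a * csqrt a = of_real (sqrt pi)" using c[of a] a by (simp add: S_def H_def)
  moreover have "csqrt a \<noteq> 0" using a by auto
  ultimately show ?thesis by (simp add: G_def field_simps)
qed

text \<open>The factor max 1 (exp (Re z)) is essential in place of exp (norm z): in Laplace's method
  only the real part of the exponent is controlled by the Gaussian decay.\<close>

lemma norm_exp_minus_1_minus_le:
  fixes z :: complex
  shows "norm (exp z - 1 - z) \<le> (norm z)\<^sup>2 * max 1 (exp (Re z))"
proof -
  have seg: "norm u \<le> norm w" "Re u \<le> max 0 (Re w)" if u: "u \<in> closed_segment 0 w" for u w :: complex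
  proof -
    obtain t where t: "u = t *\<^sub>R w" "0 \<le> t" "t \<le> 1" using u by (auto simp: in_segment)
    have "t * Re w \<le> max 0 (Re w)"
    proof (cases "Re w \<ge> 0")
      case True
      then show ?thesis using t mult_right_mono[of t 1 "Re w"] by simp
    next
      case False
      then have "t * Re w \<le> 0" using t by (intro mult_nonneg_nonpos) auto
      then show ?thesis by simp
    qed
    then show "norm u \<le> norm w" "Re u \<le> max 0 (Re w)" using t by (auto simp: mult_left_le_one_le)
  qed
  have em: "exp x \<le> max 1 (exp y)" if "x \<le> max 0 y" for x y :: real
  proof -
    have "exp x \<le> exp (max 0 y)" using that by simp
    also have "\<dots> = max 1 (exp y)" by (simp add: max_def)
    finally show ?thesis .
  qed
  have 1: "norm (exp w - 1) \<le> norm w * max 1 (exp (Re w))" for w :: complex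
  proof -
    have "norm (exp w - exp 0) \<le> max 1 (exp (Re w)) * norm (w - 0)"
    proof (rule field_differentiable_bound[where S = "closed_segment 0 w" and f' = exp])
      show "norm (exp u) \<le> max 1 (exp (Re w))" if "u \<in> closed_segment 0 w" for u
        using seg(2)[OF that] em by (simp add: norm_exp_eq_Re)
    qed (auto intro!: derivative_eq_intros)
    then show ?thesis by (simp add: mult.commute)
  qed
  have "norm ((exp z - z) - (exp 0 - 0)) \<le> (norm z * max 1 (exp (Re z))) * norm (z - 0)"
  proof (rule field_differentiable_bound[where S = "closed_segment 0 z" and f' = "\<lambda>z. exp z - 1"])
    show "norm (exp u - 1) \<le> norm z * max 1 (exp (Re z))" if "u \<in> closed_segment 0 z" for u
    proof -
      have "norm (exp u - 1) \<le> norm u * max 1 (exp (Re u))" by (rule 1)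
      also have "\<dots> \<le> norm z * max 1 (exp (Re z))"
        using seg[OF that] em[of "Re u" "Re z"] by (intro mult_mono) auto
      finally show ?thesis .
    qed
  qed (auto intro!: derivative_eq_intros)
  also have "(exp z - z) - (exp 0 - 0) = exp z - 1 - z" by simp
  finally show ?thesis by (simp only: power2_eq_square mult_ac diff_zero)
qed

lemma integral_odd_function:
  fixes f :: "real \<Rightarrow> complex"
  assumes odd: "\<And>x. f (- x) = - f x"
  shows "(LINT x|lborel. f x) = 0"
proof -
  have "(LINT x|lborel. f x) = (LINT x|lborel. f (0 + (-1) * x))"
    using lborel_integral_real_affine[of "-1" f 0] by simp
  also have "\<dots> = - (LINT x|lborel. f x)" by (simp add: odd)
  finally show ?thesis by simp
qed

lemma exp_abs_integrable:
  assumes "k > 0" shows "integrable lborel (\<lambda>x::real. exp (- (k * \<bar>x\<bar>)))"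
proof -
  obtain C where C: "C > 0" "\<And>x. x \<ge> 0 \<Longrightarrow> (1 + x)^2 * exp (- k * x) \<le> (C::real)"
    using power_times_exp_bounded[OF assms, of 2] by auto
  show ?thesis
  proof (rule Bochner_Integration.integrable_bound[OF integrable_inverse_1_plus_square[of C]])
    show "AE x in lborel. norm (exp (- (k * \<bar>x\<bar>))) \<le> norm (C * inverse (1 + x\<^sup>2))"
    proof (rule AE_I2)
      fix x :: real
      have p: "1 + x\<^sup>2 > 0" by (simp add: add_pos_nonneg)
      have "(1 + x\<^sup>2) * exp (- (k * \<bar>x\<bar>)) \<le> (1 + \<bar>x\<bar>)^2 * exp (- (k * \<bar>x\<bar>))"
        by (intro mult_right_mono) (auto simp: power2_sum)
      also have "\<dots> \<le> C" using C(2)[of "\<bar>x\<bar>"] by simp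
      finally have "exp (- (k * \<bar>x\<bar>)) \<le> C / (1 + x\<^sup>2)" using p by (simp add: pos_le_divide_eq mult.commute)
      then show "norm (exp (- (k * \<bar>x\<bar>))) \<le> norm (C * inverse (1 + x\<^sup>2))" using p C(1) by (simp add: divide_inverse)
    qed
  qed auto
qed

text \<open>The integrand is compared with g (1 + l), where g is the Gaussian and l collects the
  linear and the cubic term of the exponent. In terms of y = x^2 / e the difference is e times an
  integrable majorant whose integral is O(sqrt e). The product g l is odd and integrates to 0, so
  the correction of relative order sqrt e disappears and the relative error is O(e).\<close>

lemma laplace_expansion:
  fixes p :: "real \<Rightarrow> complex" and R :: "real \<Rightarrow> real \<Rightarrow> complex" and A B :: complex
  assumes A: "Re A > 0" and d: "d > 0" and k: "k > 0" and e0: "e0 > 0"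
    and meas [measurable]: "p \<in> borel_measurable borel" "\<And>e. R e \<in> borel_measurable borel"
    and taylor: "\<And>x. \<bar>x\<bar> \<le> d \<Longrightarrow> norm (p x + A * of_real (x\<^sup>2) - B * of_real (x^3)) \<le> C * x^4"
    and near: "\<And>x. \<bar>x\<bar> \<le> d \<Longrightarrow> Re (p x) \<le> - (k * x\<^sup>2)"
    and far: "\<And>x. \<bar>x\<bar> \<ge> d \<Longrightarrow> Re (p x) \<le> - (k * \<bar>x\<bar>)"
    and R: "\<And>e x. 0 < e \<Longrightarrow> e < e0 \<Longrightarrow> norm (R e x) \<le> C * e"
  shows "\<exists>K e1. e1 > 0 \<and> (\<forall>e. 0 < e \<and> e < e1 \<longrightarrow>
    norm ((LINT x|lborel. exp (p x / of_real e + of_real x + R e x)) - of_real (sqrt e) * (of_real (sqrt pi) / csqrt A)) \<le> K * (e * sqrt e))"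
proof -
  define c0 where "c0 = min k (Re A)"
  have c0: "c0 > 0" "c0 \<le> k" "c0 \<le> Re A" using A k by (auto simp: c0_def)
  have C: "C \<ge> 0" using R[of "e0/2" 0] e0 by (smt (verit) norm_ge_zero half_gt_zero field_sum_of_halves zero_le_mult_iff)
  define b where "b = norm B"
  have b: "b \<ge> 0" by (simp add: b_def)
  define K1 where "K1 = 1 + b + 2 * C"
  have K1: "K1 > 0" using b C by (simp add: K1_def)
  obtain K2 where K2: "K2 > 0" "\<And>x. x \<ge> 0 \<Longrightarrow> (1 + x)^4 * exp (- (c0 / 2) * x) \<le> (K2::real)"
    using power_times_exp_bounded[of "c0 / 2" 4] c0 by auto
  define Ka where "Ka = (K1\<^sup>2 + C) * exp (d + C) * K2"
  define Kb where "Kb = exp C * (4 / (k * d))"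
  define Kc where "Kc = (2 + b) / d\<^sup>2 * K2"
  define K where "K = Ka + Kb + Kc"
  have Kpos: "Ka \<ge> 0" "Kb \<ge> 0" "Kc \<ge> 0" "K \<ge> 0"
    using K1 K2 C b d k by (auto simp: Ka_def Kb_def Kc_def K_def)
  \<comment> \<open>The condition e < k / 2 allows the linear term x to be absorbed by half of the
    decay k |x| / e.\<close>
  define e1 where "e1 = min (min 1 e0) (k / 2)"
  have e1: "e1 > 0" using e0 k by (simp add: e1_def)
  define M1 where "M1 = (LINT x|lborel. exp (- (c0 / 2 * x\<^sup>2)))"
  define M2 where "M2 = (LINT x|lborel. exp (- (k / 4 * \<bar>x\<bar>)))"
  have M: "M1 \<ge> 0" "M2 \<ge> 0" by (simp_all add: M1_def M2_def)
  have main: "norm ((LINT x|lborel. exp (p x / of_real e + of_real x + R e x)) - of_real (sqrt e) * (of_real (sqrt pi) / csqrt A)) \<le> (K * (M1 + M2)) * (e * sqrt e)"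
    if "0 < e" "e < e1" for e
  proof -
    have e: "0 < e" "e < 1" "e < e0" "e < k / 2" using that by (auto simp: e1_def)
    have se: "e \<le> sqrt e" "sqrt e > 0" "sqrt e * sqrt e = e"
      using e real_le_rsqrt[of e e] by (auto simp: power2_eq_square mult_left_le)
    \<comment> \<open>Both summands have size sqrt e when x has size sqrt e, the width of the
      Gaussian.\<close>
    define l where "l = (\<lambda>x. complex_of_real x + B * of_real (x^3) / of_real e)"
    define g where "g = (\<lambda>x. exp (- (A * of_real (x\<^sup>2) / of_real e)))"
    define f where "f = (\<lambda>x. exp (p x / of_real e + of_real x + R e x))"
    define bd where "bd = (\<lambda>x. exp (- (c0 / 2 * (x\<^sup>2 / e))))"
    define bd2 where "bd2 = (\<lambda>x. exp (- (k / 4 * (\<bar>x\<bar> / e))))"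
    have gn: "norm (g x) = exp (- (Re A * (x\<^sup>2 / e)))" for x
      by (simp add: g_def norm_exp_eq_Re Re_divide_of_real)
    have gle: "norm (g x) \<le> exp (- (c0 * (x\<^sup>2 / e)))" for x
      unfolding gn using c0(3) e by (auto intro!: divide_right_mono mult_right_mono)
    have split: "(1 + y)^4 * exp (- (c0 * y)) \<le> K2 * exp (- (c0 / 2 * y))" if "y \<ge> 0" for y
    proof -
      have "(1 + y)^4 * exp (- (c0 * y)) = ((1 + y)^4 * exp (- (c0 / 2) * y)) * exp (- (c0 / 2 * y))"
        by (simp add: mult.assoc flip: exp_add)
      also have "\<dots> \<le> K2 * exp (- (c0 / 2 * y))" using K2(2)[OF that] by (intro mult_right_mono) auto
      finally show ?thesis .
    qed
    \<comment> \<open>All powers of x are measured by the scale-free quantity y = x^2 / e: odd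
      powers cost a factor sqrt e, the fourth power divided by e a factor e, and the rest is a
      polynomial in y that the Gaussian absorbs.\<close>
    have powers: "\<bar>x\<bar> \<le> sqrt e * (1 + y)\<^sup>2" "\<bar>x\<bar>^3 / e \<le> sqrt e * (1 + y)\<^sup>2" "x^4 / e = e * y\<^sup>2" "y \<ge> 0"
      if y: "y = x\<^sup>2 / e" for x y
    proof -
      define u where "u = \<bar>x\<bar> / sqrt e"
      have u: "\<bar>x\<bar> = sqrt e * u" "u \<ge> 0" using se e by (simp_all add: u_def)
      have yu: "y = u\<^sup>2" using e se by (simp add: y u_def power_divide)
      show "y \<ge> 0" by (simp add: yu)
      have "0 \<le> (u - 1)\<^sup>2" by simp
      then have u1: "u \<le> 1 + y" using u(2) by (simp add: yu power2_eq_square algebra_simps)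
      have y1: "1 + y \<le> (1 + y)\<^sup>2" using \<open>y \<ge> 0\<close> by (simp add: power2_eq_square algebra_simps)
      show "\<bar>x\<bar> \<le> sqrt e * (1 + y)\<^sup>2" unfolding u(1) using u1 y1 se by (intro mult_left_mono) auto
      have "\<bar>x\<bar>^3 / e = sqrt e * (u * y)"
        unfolding u(1) using e se(3) by (simp add: yu power3_eq_cube power2_eq_square field_simps)
      also have "u * y \<le> (1 + y)\<^sup>2" unfolding power2_eq_square using u1 u(2) \<open>y \<ge> 0\<close> by (intro mult_mono) auto
      finally show "\<bar>x\<bar>^3 / e \<le> sqrt e * (1 + y)\<^sup>2" using se by (simp add: mult_left_mono)
      show "x^4 / e = e * y\<^sup>2" using e by (simp add: y eval_nat_numeral)
    qed
    have ln: "norm (l x) \<le> (1 + b) * (sqrt e * (1 + y)\<^sup>2)" if y: "y = x\<^sup>2 / e" for x y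
    proof -
      have "norm (l x) \<le> \<bar>x\<bar> + b * (\<bar>x\<bar>^3 / e)"
        unfolding l_def b_def using e norm_triangle_ineq[of "of_real x" "B * of_real (x^3) / of_real e"]
        by (simp add: norm_mult norm_divide norm_power power_abs)
      also have "\<dots> \<le> sqrt e * (1 + y)\<^sup>2 + b * (sqrt e * (1 + y)\<^sup>2)"
        using powers[OF y] b by (intro add_mono mult_left_mono) auto
      finally show ?thesis by (simp add: algebra_simps)
    qed
    \<comment> \<open>For |x| <= d the second-order remainder of exp is used together with the
      Taylor bound on p. For |x| > d there is no cancellation to exploit: \<open>f\<close> and g (1
      + l) are bounded separately, each with a factor e extracted from its decay.\<close>
    have pw: "norm (f x - g x * (1 + l x)) \<le> K * e * (bd x + bd2 x)" for x
    proof -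
      define y where "y = x\<^sup>2 / e"
      note P = powers[OF y_def]
      have y2: "1 + y\<^sup>2 \<le> (1 + y)^4" "1 \<le> 1 + y" "(1 + y)^2 \<le> (1 + y)^4" "(1 + y)^3 \<le> (1 + y)^4"
      proof -
        show "1 \<le> 1 + y" using P(4) by simp
        then show "(1 + y)^2 \<le> (1 + y)^4" "(1 + y)^3 \<le> (1 + y)^4" by (intro power_increasing; simp)+
        then show "1 + y\<^sup>2 \<le> (1 + y)^4" using P(4) by (simp add: power2_eq_square algebra_simps)
      qed
      show ?thesis
      proof (cases "\<bar>x\<bar> \<le> d")
        case True
        define z where "z = (p x + A * of_real (x\<^sup>2)) / of_real e + of_real x + R e x"
        define r where "r = (p x + A * of_real (x\<^sup>2) - B * of_real (x^3)) / of_real e + R e x"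
        have fz: "f x = g x * exp z"
          unfolding f_def g_def z_def exp_add[symmetric] by (simp add: field_simps add_divide_distrib)
        have zl: "z = l x + r" unfolding z_def l_def r_def by (simp add: field_simps add_divide_distrib diff_divide_distrib)
        have "norm r \<le> C * x^4 / e + C * e"
          unfolding r_def using taylor[OF True] R[OF e(1,3), of x] e
          by (intro norm_triangle_mono) (auto simp: norm_divide divide_right_mono)
        also have "C * x^4 / e = C * (x^4 / e)" by simp
        also have "C * (x^4 / e) + C * e = C * e * (1 + y\<^sup>2)" unfolding P(3) by (simp add: algebra_simps)
        finally have r1: "norm r \<le> C * e * (1 + y\<^sup>2)" .
        also have "\<dots> \<le> C * e * (1 + y)^4" using y2 C e by (intro mult_left_mono) auto
        finally have r: "norm r \<le> C * e * (1 + y)^4" .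
        have "norm r \<le> (2 * C) * (sqrt e * (1 + y)\<^sup>2)"
        proof -
          have "1 + y\<^sup>2 \<le> (1 + y)\<^sup>2" using P(4) by (simp add: power2_eq_square algebra_simps)
          then have "C * e * (1 + y\<^sup>2) \<le> C * sqrt e * (1 + y)\<^sup>2"
            using se C e by (intro mult_mono) auto
          moreover have "0 \<le> C * sqrt e * (1 + y)\<^sup>2" using C se by simp
          ultimately show ?thesis using r1 by (simp add: algebra_simps)
        qed
        then have "norm z \<le> (1 + b) * (sqrt e * (1 + y)\<^sup>2) + (2 * C) * (sqrt e * (1 + y)\<^sup>2)"
          unfolding zl using ln[OF y_def] by (intro norm_triangle_mono)
        then have "norm z \<le> K1 * (sqrt e * (1 + y)\<^sup>2)" by (simp add: K1_def algebra_simps)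
        then have "(norm z)\<^sup>2 \<le> (K1 * (sqrt e * (1 + y)\<^sup>2))\<^sup>2" by (intro power_mono) auto
        also have "\<dots> = K1\<^sup>2 * e * (1 + y)^4"
          using e by (simp add: power_mult_distrib flip: power_mult)
        finally have z2: "(norm z)\<^sup>2 \<le> K1\<^sup>2 * e * (1 + y)^4" .
        have ge: "norm (g x) * max 1 (exp (Re z)) \<le> exp (d + C) * exp (- (c0 * y))"
        proof -
          have "norm (g x) * exp (Re z) = exp (Re (p x) / e + x + Re (R e x))"
            using fz by (metis (no_types, lifting) f_def norm_exp_eq_Re norm_mult plus_complex.sel(1) Re_complex_of_real Re_divide_of_real)
          also have "\<dots> \<le> exp (- (c0 * y) + d + C)"
          proof -
            have "Re (p x) \<le> - (c0 * x\<^sup>2)" using near[OF True] c0(2) mult_right_mono[of c0 k "x\<^sup>2"] by simp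
            then have "Re (p x) / e \<le> - (c0 * y)" using e by (simp add: y_def divide_right_mono[of _ _ e] flip: minus_divide_left) (simp add: divide_le_eq)
            moreover have "Re (R e x) \<le> C * 1" using R[OF e(1,3), of x] complex_Re_le_cmod[of "R e x"] C e mult_left_mono[of e 1 C] by linarith
            ultimately show ?thesis using True by simp
          qed
          also have "\<dots> = exp (d + C) * exp (- (c0 * y))" by (simp flip: exp_add)
          finally have 1: "norm (g x) * exp (Re z) \<le> exp (d + C) * exp (- (c0 * y))" .
          have "norm (g x) \<le> 1 * exp (- (c0 * y))" using gle[of x] by (simp add: y_def)
          also have "\<dots> \<le> exp (d + C) * exp (- (c0 * y))" using C d by (intro mult_right_mono) auto
          finally show ?thesis using 1 by (simp add: max_def)
        qed
        define T where "T = norm (g x) * max 1 (exp (Re z))"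
        have T: "T \<ge> 0" "norm (g x) \<le> T"
          using mult_left_mono[of 1 "max 1 (exp (Re z))" "norm (g x)"] by (auto simp: T_def le_max_iff_disj)
        have "f x - g x * (1 + l x) = g x * (exp z - 1 - z) + g x * r"
          unfolding fz zl by (simp add: algebra_simps)
        also have "norm \<dots> \<le> norm (g x) * ((norm z)\<^sup>2 * max 1 (exp (Re z))) + norm (g x) * norm r"
          using norm_exp_minus_1_minus_le[of z] by (intro norm_triangle_mono) (auto simp: norm_mult mult_left_mono)
        also have "\<dots> \<le> (norm z)\<^sup>2 * T + norm r * T"
          using T(2) by (intro add_mono) (auto simp: T_def mult_ac intro!: mult_left_mono)
        also have "\<dots> \<le> (K1\<^sup>2 * e * (1 + y)^4) * (exp (d + C) * exp (- (c0 * y))) + (C * e * (1 + y)^4) * (exp (d + C) * exp (- (c0 * y)))"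
          using z2 r ge C e T by (intro add_mono mult_mono) (auto simp: T_def[symmetric])
        also have "\<dots> = (K1\<^sup>2 + C) * e * exp (d + C) * ((1 + y)^4 * exp (- (c0 * y)))" by (simp add: algebra_simps)
        also have "\<dots> \<le> (K1\<^sup>2 + C) * e * exp (d + C) * (K2 * bd x)"
          using split[OF P(4)] C e unfolding bd_def y_def[symmetric] by (intro mult_left_mono) auto
        also have "\<dots> = Ka * e * bd x" by (simp add: Ka_def)
        also have "\<dots> \<le> K * e * (bd x + bd2 x)"
          using Kpos e by (intro mult_mono) (auto simp: K_def bd_def bd2_def)
        finally show ?thesis .
      next
        case False
        then have xd: "\<bar>x\<bar> \<ge> d" by simp
        have "norm (f x) = exp (Re (p x) / e + x + Re (R e x))" by (simp add: f_def norm_exp_eq_Re Re_divide_of_real)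
        \<comment> \<open>The decay k |x| / e is shared out: one half absorbs the linear term, one
          quarter is evaluated at |x| >= d and will give the factor e, and the last quarter remains
          as the majorant \<open>bd2\<close>.\<close>
        also have "\<dots> \<le> exp (C + (- (k / 4 * (d / e)) + - (k / 4 * (\<bar>x\<bar> / e))))"
        proof -
          have "Re (p x) / e \<le> - (k * \<bar>x\<bar>) / e" using far[OF xd] e by (intro divide_right_mono) auto
          moreover have "x \<le> k / 2 * (\<bar>x\<bar> / e)"
          proof -
            have "\<bar>x\<bar> * e \<le> \<bar>x\<bar> * (k / 2)" using e by (intro mult_left_mono) auto
            then have "\<bar>x\<bar> \<le> k / 2 * (\<bar>x\<bar> / e)" using e by (simp add: field_simps)
            then show ?thesis by linarith
          qed
          moreover have "Re (R e x) \<le> C * 1" using R[OF e(1,3), of x] complex_Re_le_cmod[of "R e x"] C e mult_left_mono[of e 1 C] by linarith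
          moreover have "k / 4 * (d / e) \<le> k / 4 * (\<bar>x\<bar> / e)" using xd e k by (intro mult_left_mono divide_right_mono) auto
          moreover have "- (k * \<bar>x\<bar>) / e = - (k / 2 * (\<bar>x\<bar> / e)) - 2 * (k / 4 * (\<bar>x\<bar> / e))" by simp
          ultimately show ?thesis by simp
        qed
        also have "\<dots> = exp C * (exp (- (k / 4 * (d / e))) * bd2 x)" unfolding bd2_def exp_add ..
        also have "\<dots> \<le> exp C * ((4 / (k * d) * e) * bd2 x)"
        proof -
          define w where "w = k / 4 * (d / e)"
          have w: "w > 0" using k d e by (simp add: w_def)
          have "w \<le> exp w" using exp_ge_add_one_self[of w] by linarith
          then have "exp (- w) \<le> 1 / w" using w by (simp add: exp_minus field_simps)
          also have "1 / w = 4 / (k * d) * e" using k d e by (simp add: w_def field_simps)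
          finally show ?thesis unfolding w_def by (intro mult_left_mono mult_right_mono) (auto simp: bd2_def)
        qed
        also have "\<dots> = Kb * e * bd2 x" by (simp add: Kb_def)
        finally have 1: "norm (f x) \<le> Kb * e * bd2 x" .
        \<comment> \<open>Since x^2 >= d^2 here, one additional power of 1 + y can be traded for the
          missing factor e.\<close>
        have ey: "1 \<le> e * (1 + y) / d\<^sup>2"
        proof -
          have "d\<^sup>2 \<le> x\<^sup>2" using xd d by (metis abs_ge_zero abs_le_square_iff abs_of_pos)
          also have "x\<^sup>2 = e * y" using e by (simp add: y_def)
          also have "\<dots> \<le> e * (1 + y)" using e by simp
          finally show ?thesis using d by (simp add: pos_le_divide_eq)
        qed
        have "norm (1 + l x) \<le> 1 + (1 + b) * (sqrt e * (1 + y)\<^sup>2)"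
          using ln[OF y_def] norm_triangle_ineq[of 1 "l x"] by simp
        also have "\<dots> \<le> 1 * (1 + y)\<^sup>2 + (1 + b) * (1 * (1 + y)\<^sup>2)"
          using e b P(4) y2(2) by (intro add_mono mult_left_mono mult_right_mono) (auto simp: one_le_power)
        finally have "norm (1 + l x) \<le> (2 + b) * (1 + y)\<^sup>2" by (simp add: algebra_simps)
        also have "\<dots> \<le> (2 + b) * (1 + y)\<^sup>2 * (e * (1 + y) / d\<^sup>2)"
          using ey b mult_left_mono[OF ey, of "(2 + b) * (1 + y)\<^sup>2"] by simp
        also have "\<dots> = (2 + b) / d\<^sup>2 * e * (1 + y)^3" by (simp add: power3_eq_cube power2_eq_square)
        also have "\<dots> \<le> (2 + b) / d\<^sup>2 * e * (1 + y)^4" using y2(4) b e by (intro mult_left_mono) auto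
        finally have "norm (g x) * norm (1 + l x) \<le> exp (- (c0 * y)) * ((2 + b) / d\<^sup>2 * e * (1 + y)^4)"
          using gle[of x] by (intro mult_mono) (auto simp: y_def)
        also have "\<dots> = (2 + b) / d\<^sup>2 * e * ((1 + y)^4 * exp (- (c0 * y)))" by simp
        also have "\<dots> \<le> (2 + b) / d\<^sup>2 * e * (K2 * bd x)"
          using split[OF P(4)] b e unfolding bd_def y_def[symmetric] by (intro mult_left_mono) auto
        also have "\<dots> = Kc * e * bd x" by (simp add: Kc_def)
        finally have 2: "norm (g x * (1 + l x)) \<le> Kc * e * bd x" by (simp add: norm_mult)
        have "norm (f x - g x * (1 + l x)) \<le> Kb * e * bd2 x + Kc * e * bd x"
          using norm_triangle_ineq4[of "f x" "g x * (1 + l x)"] 1 2 by linarith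
        also have "\<dots> \<le> K * e * bd2 x + K * e * bd x"
          using Kpos e by (intro add_mono mult_right_mono) (auto simp: K_def bd_def bd2_def)
        finally show ?thesis by (simp add: algebra_simps)
      qed
    qed
    have ibd: "integrable lborel bd" "(LINT x|lborel. bd x) = sqrt e * M1"
    proof -
      have i: "integrable lborel (\<lambda>x. exp (- (c0 / 2 * x\<^sup>2)))" using c0 by (intro real_gaussian_integral) auto
      have eq: "bd x = exp (- (c0 / 2 * (0 + (1 / sqrt e) * x)\<^sup>2))" for x
        using e by (simp add: bd_def power_divide)
      show "integrable lborel bd" unfolding eq[abs_def]
        by (rule lborel_integrable_real_affine[where f = "\<lambda>x. exp (- (c0 / 2 * x\<^sup>2))", OF i]) (use se in auto)
      show "(LINT x|lborel. bd x) = sqrt e * M1" unfolding M1_def eq[abs_def]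
        by (subst lborel_integral_real_affine[where f = "\<lambda>x. exp (- (c0 / 2 * x\<^sup>2))" and c = "1 / sqrt e" and t = 0])
           (use se in auto)
    qed
    have ibd2: "integrable lborel bd2" "(LINT x|lborel. bd2 x) = e * M2"
    proof -
      have i: "integrable lborel (\<lambda>x. exp (- (k / 4 * \<bar>x\<bar>)))" using k by (intro exp_abs_integrable) auto
      have eq: "bd2 x = exp (- (k / 4 * \<bar>0 + (1 / e) * x\<bar>))" for x
        using e by (simp add: bd2_def abs_divide)
      show "integrable lborel bd2" unfolding eq[abs_def]
        by (rule lborel_integrable_real_affine[where f = "\<lambda>x. exp (- (k / 4 * \<bar>x\<bar>))", OF i]) (use e in auto)
      show "(LINT x|lborel. bd2 x) = e * M2" unfolding M2_def eq[abs_def]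
        by (subst lborel_integral_real_affine[where f = "\<lambda>x. exp (- (k / 4 * \<bar>x\<bar>))" and c = "1 / e" and t = 0])
           (use e in auto)
    qed
    have g_eq: "g x = exp (- (A * of_real ((0 + (1 / sqrt e) * x)\<^sup>2)))" for x
      using e by (simp add: g_def power_divide flip: of_real_power)
    have ig: "integrable lborel g"
      unfolding g_eq[abs_def]
      by (rule lborel_integrable_real_affine[OF complex_gaussian_integrable(1)[OF A]]) (use se in auto)
    have Ig: "(LINT x|lborel. g x) = of_real (sqrt e) * (of_real (sqrt pi) / csqrt A)"
      unfolding complex_gaussian_integral[OF A, symmetric] g_eq[abs_def]
      by (subst lborel_integral_real_affine[where f = "\<lambda>x. exp (- (A * of_real (x\<^sup>2)))" and c = "1 / sqrt e" and t = 0])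
         (use se in \<open>auto simp: scaleR_conv_of_real\<close>)
    have mg: "g \<in> borel_measurable borel" "l \<in> borel_measurable borel" "f \<in> borel_measurable borel"
      unfolding g_def l_def f_def by measurable
    have igl: "integrable lborel (\<lambda>x. g x * l x)"
    proof (rule Bochner_Integration.integrable_bound)
      show "integrable lborel (\<lambda>x. (1 + b) * K2 * bd x)" using ibd(1) by simp
      show "AE x in lborel. norm (g x * l x) \<le> norm ((1 + b) * K2 * bd x)"
      proof (rule AE_I2)
        fix x
        define y where "y = x\<^sup>2 / e"
        note P = powers[OF y_def]
        have "norm (l x) \<le> (1 + b) * (sqrt e * (1 + y)\<^sup>2)" by (rule ln[OF y_def])
        also have "\<dots> \<le> (1 + b) * (1 * (1 + y)^4)"
          using e b P(4) by (intro mult_left_mono mult_mono power_increasing) auto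
        finally have "norm (g x) * norm (l x) \<le> exp (- (c0 * y)) * ((1 + b) * (1 * (1 + y)^4))"
          using gle[of x] by (intro mult_mono) (auto simp: y_def)
        also have "\<dots> = (1 + b) * ((1 + y)^4 * exp (- (c0 * y)))" by simp
        also have "\<dots> \<le> (1 + b) * (K2 * bd x)"
          using split[OF P(4)] b unfolding bd_def y_def[symmetric] by (intro mult_left_mono) auto
        finally show "norm (g x * l x) \<le> norm ((1 + b) * K2 * bd x)"
          using b K2 by (simp add: norm_mult bd_def abs_mult)
      qed
    qed (use mg in measurable)
    have odd: "(LINT x|lborel. g x * l x) = 0"
      by (rule integral_odd_function) (simp add: g_def l_def field_simps)
    have igg: "integrable lborel (\<lambda>x. g x * (1 + l x))"
      using Bochner_Integration.integrable_add[OF ig igl] by (simp add: distrib_left)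
    have Igg: "(LINT x|lborel. g x * (1 + l x)) = of_real (sqrt e) * (of_real (sqrt pi) / csqrt A)"
      using Bochner_Integration.integral_add[OF ig igl] odd Ig by (simp add: distrib_left)
    have ib: "integrable lborel (\<lambda>x. K * e * (bd x + bd2 x))" using ibd(1) ibd2(1) by simp
    have idf: "integrable lborel (\<lambda>x. f x - g x * (1 + l x))"
    proof (rule Bochner_Integration.integrable_bound[OF ib])
      show "AE x in lborel. norm (f x - g x * (1 + l x)) \<le> norm (K * e * (bd x + bd2 x))"
        by (rule AE_I2) (rule order_trans[OF pw], simp)
    qed (use mg in measurable)
    have iff: "integrable lborel f"
      using Bochner_Integration.integrable_add[OF idf igg] by simp
    have "(LINT x|lborel. f x) - (LINT x|lborel. g x * (1 + l x)) = (LINT x|lborel. f x - g x * (1 + l x))"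
      using Bochner_Integration.integral_diff[OF iff igg] by simp
    also have "norm \<dots> \<le> (LINT x|lborel. K * e * (bd x + bd2 x))"
      by (rule Bochner_Integration.integral_norm_bound_integral[OF idf ib]) (rule pw)
    also have "\<dots> = K * e * (sqrt e * M1 + e * M2)"
      using ibd ibd2 by simp
    also have "\<dots> \<le> K * e * (sqrt e * M1 + sqrt e * M2)"
      using se M Kpos e by (intro mult_left_mono add_mono mult_right_mono) auto
    also have "\<dots> = (K * (M1 + M2)) * (e * sqrt e)" by (simp add: algebra_simps)
    finally show ?thesis unfolding Igg f_def .
  qed
  then show ?thesis using e1 by blast
qed

section \<open>Logarithms at the critical point and the Lobachevsky function\<close>

lemma Im_Ln_neg:
  assumes "Im z < 0" shows "- pi < Im (Ln z)" "Im (Ln z) < 0"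
proof -
  have z: "z \<noteq> 0" using assms by auto
  show "- pi < Im (Ln z)" using mpi_less_Im_Ln[OF z] .
  show "Im (Ln z) < 0"
  proof (rule ccontr)
    assume "\<not> Im (Ln z) < 0"
    then have "0 \<le> sin (Im (Ln z))" using Im_Ln_le_pi[OF z] by (intro sin_ge_zero) auto
    moreover have "Im z = norm z * sin (Im (Ln z))"
      using exp_Ln[OF z] z by (metis Im_exp Re_Ln exp_ln norm_eq_zero zero_less_norm_iff)
    ultimately show False using assms by (simp add: mult_nonneg_nonneg not_le[symmetric])
  qed
qed

lemma sin_half_plane:
  assumes "0 < Re w" "Re w < pi" shows "Re (2 * sin (w / 2)) > 0"
proof -
  have "Re (sin (w / 2)) = sin (Re w / 2) * cosh (Im w / 2)" by (simp add: Re_sin cosh_field_def)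
  moreover have "sin (Re w / 2) > 0" using assms by (intro sin_gt_zero) auto
  ultimately show ?thesis by (simp add: cosh_real_pos)
qed

lemma exp_Ln_2_sin:
  assumes "0 < Re w" "Re w < pi"
  shows "exp (Ln (2 * sin (w / 2)) - \<i> * w / 2) = \<i> * (exp (- (\<i> * w)) - 1)"
proof -
  have nz: "2 * sin (w / 2) \<noteq> 0" using sin_half_plane[OF assms] by force
  have "exp (Ln (2 * sin (w / 2)) - \<i> * w / 2) = exp (Ln (2 * sin (w / 2))) * exp (- (\<i> * w / 2))"
    by (simp add: exp_add[symmetric])
  also have "\<dots> = 2 * sin (w / 2) * exp (- (\<i> * w / 2))" using exp_Ln[OF nz] by simp
  also have "2 * sin (w / 2) * exp (- (\<i> * w / 2)) = - \<i> * (exp (\<i> * w / 2) - exp (- (\<i> * w / 2))) * exp (- (\<i> * w / 2))"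
    by (simp add: sin_exp_eq field_simps)
  also have "- \<i> * (exp (\<i> * w / 2) - exp (- (\<i> * w / 2))) * exp (- (\<i> * w / 2)) =
     - \<i> * (exp (\<i> * w / 2) * exp (- (\<i> * w / 2)) - exp (- (\<i> * w / 2)) * exp (- (\<i> * w / 2)))"
    by (simp add: algebra_simps)
  also have "exp (\<i> * w / 2) * exp (- (\<i> * w / 2)) = 1" by (simp flip: exp_add)
  also have "exp (- (\<i> * w / 2)) * exp (- (\<i> * w / 2)) = exp (- (\<i> * w))" by (simp flip: exp_add)
  finally show ?thesis by (simp add: algebra_simps)
qed

text \<open>As a positive combination of 1 and cis (- c), z has argument between - c and 0, and Re w
  is minus this argument. For the last identity the exponentials of both sides equal i (z - 1), and
  the imaginary parts differ by less than 2 pi, so the sides agree without a choice of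
  branch.\<close>

lemma dilog_angle:
  assumes r: "r > 0" and c: "0 < c" "c < pi"
  defines "z \<equiv> 1 + of_real r * cis (- c)"
  defines "w \<equiv> \<i> * Ln z"
  shows "0 < Re w" "Re w < c" "exp (- (\<i> * w)) = z" "z \<noteq> 0"
    "Ln (2 * sin (w / 2)) - \<i> * w / 2 = of_real (ln r) + \<i> * of_real (pi / 2 - c)"
proof -
  have s: "sin c > 0" using c by (intro sin_gt_zero) auto
  have im: "Im z < 0" using r s by (simp add: z_def)
  then show nz: "z \<noteq> 0" by auto
  show ez: "exp (- (\<i> * w)) = z" using nz by (simp add: w_def)
  have rew: "Re w = - Im (Ln z)" by (simp add: w_def)
  show re0: "0 < Re w" using Im_Ln_neg[OF im] rew by simp
  have rpi: "Re w < pi" using Im_Ln_neg[OF im] rew by simp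
  show reg: "Re w < c"
  proof (rule ccontr)
    assume "\<not> Re w < c"
    then have "sin (Im (Ln z) + c) \<le> 0"
      using Im_Ln_neg[OF im] c rew sin_ge_zero[of "- (Im (Ln z) + c)"] by (simp only: sin_minus) auto
    moreover have "Im (z * cis c) = norm z * sin (Im (Ln z) + c)"
    proof -
      have "z * cis c = exp (Ln z + \<i> * of_real c)" using nz by (simp add: exp_add cis_conv_exp)
      also have "Im \<dots> = exp (Re (Ln z)) * sin (Im (Ln z) + c)" by (simp add: Im_exp)
      finally show ?thesis using nz by simp
    qed
    moreover have "Im (z * cis c) = sin c"
    proof -
      have "z * cis c = cis c + of_real r" by (simp add: z_def distrib_right mult.assoc cis_mult)
      then show ?thesis by simp
    qed
    ultimately show False using s by (smt (verit) mult_nonneg_nonpos norm_ge_zero)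
  qed
  define U where "U = Ln (2 * sin (w / 2)) - \<i> * w / 2"
  define V where "V = complex_of_real (ln r) + \<i> * of_real (pi / 2 - c)"
  have "exp U = \<i> * (z - 1)" unfolding U_def exp_Ln_2_sin[OF re0 rpi] ez ..
  also have "\<dots> = of_real r * (\<i> * cis (- c))" by (simp add: z_def)
  also have "\<i> * cis (- c) = exp (\<i> * of_real (pi / 2 - c))"
    by (metis cis_conv_exp cis_mult cis_pi_half diff_conv_add_uminus)
  also have "of_real r * \<dots> = exp V" using r by (simp add: V_def exp_add exp_of_real)
  finally have e1: "exp U = exp V" .
  have e2: "\<bar>Im U - Im V\<bar> < 2 * pi"
  proof -
    have nz: "2 * sin (w / 2) \<noteq> 0" using sin_half_plane[OF re0 rpi] by force
    have "\<bar>Im (Ln (2 * sin (w / 2)))\<bar> < pi / 2" using Re_Ln_pos_lt[OF nz] sin_half_plane[OF re0 rpi] by simp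
    moreover have "Im U = Im (Ln (2 * sin (w / 2))) - Re w / 2" by (simp add: U_def)
    moreover have "Im V = pi / 2 - c" by (simp add: V_def)
    ultimately show ?thesis using re0 rpi c by linarith
  qed
  show "Ln (2 * sin (w / 2)) - \<i> * w / 2 = of_real (ln r) + \<i> * of_real (pi / 2 - c)"
    using exp_complex_eqI[OF e2 e1] unfolding U_def V_def .
qed

text \<open>One double sine factor in the classical limit, together with the quadratic term that the
  T_b factors contribute for it.\<close>

definition phi :: "complex \<Rightarrow> complex" where
  "phi w = Fa w - \<i> * w\<^sup>2 / of_real (8 * pi)"

lemma phi_deriv:
  assumes "0 < Re w" "Re w < 2 * pi"
  shows "(phi has_field_derivative (Ln (2 * sin (w / 2)) - \<i> * w / 2) / of_real (2 * pi)) (at w)"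
  unfolding phi_def[abs_def]
  by (rule DERIV_cong[OF DERIV_diff[OF Fa_deriv[OF assms]]], (auto intro!: derivative_eq_intros)[1]) (simp add: field_simps)

text \<open>The Lobachevsky function, characterised below by its derivative - ln (2 sin x) and its
  limit 0 at 0. Taking it from \<open>Fa\<close> reuses the limit and the reflection law already
  known there.\<close>

definition Lob :: "real \<Rightarrow> real" where
  "Lob x = - pi * Re (Fa (of_real (2 * x)))"

lemma Lob_deriv:
  assumes "0 < x" "x < pi"
  shows "(Lob has_real_derivative - ln (2 * sin x)) (at x)"
proof -
  have s: "sin x > 0" using assms by (intro sin_gt_zero) auto
  have "((\<lambda>x. Fa (2 * x)) has_field_derivative Ln (2 * sin (2 * of_real x / 2)) / of_real (2 * pi) * 2) (at (of_real x))"
    by (intro DERIV_chain2[OF Fa_deriv]) (use assms in \<open>auto intro!: derivative_eq_intros\<close>)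
  from has_vector_derivative_real_field[OF this]
  have "((\<lambda>x. Fa (of_real (2 * x))) has_vector_derivative Ln (of_real (2 * sin x)) / of_real pi) (at x)"
    by (simp add: sin_of_real)
  then have "((\<lambda>x. Re (Fa (of_real (2 * x)))) has_vector_derivative Re (Ln (of_real (2 * sin x)) / of_real pi)) (at x)"
    by (rule bounded_linear.has_vector_derivative[OF bounded_linear_Re])
  then have "((\<lambda>x. Re (Fa (of_real (2 * x)))) has_real_derivative ln (2 * sin x) / pi) (at x)"
    using s by (simp add: has_real_derivative_iff_has_vector_derivative Ln_of_real)
  from DERIV_cmult[OF this, of "- pi"] show ?thesis unfolding Lob_def[abs_def] by simp
qed

lemma Lob_reflect: "Lob (pi - x) = - Lob x"
  using Fa_reflect[of "of_real (2 * x)"] by (simp add: Lob_def algebra_simps)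

lemma Lob_pi_half: "Lob (pi / 2) = 0"
  using Lob_reflect[of "pi / 2"] by simp

lemma Lob_tendsto_0: "(Lob \<longlongrightarrow> 0) (at_right 0)"
proof -
  have "filterlim (\<lambda>x. complex_of_real (2 * x)) (at 0 within {w. 0 < Re w \<and> Re w < 2 * pi}) (at_right 0)"
    unfolding filterlim_at
  proof
    have "((\<lambda>x. complex_of_real (2 * x)) \<longlongrightarrow> complex_of_real (2 * 0)) (at_right 0)" by (intro tendsto_intros)
    then show "((\<lambda>x. complex_of_real (2 * x)) \<longlongrightarrow> 0) (at_right 0)" by simp
    show "\<forall>\<^sub>F x in at_right 0. complex_of_real (2 * x) \<in> {w. 0 < Re w \<and> Re w < 2 * pi} \<and> complex_of_real (2 * x) \<noteq> 0"
      using eventually_at_right_real[of 0 pi] by (auto elim!: eventually_mono)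
  qed
  then have "((\<lambda>x. Fa (of_real (2 * x))) \<longlongrightarrow> 0) (at_right 0)"
    by (rule filterlim_compose[OF Fa_tendsto_0])
  then have "((\<lambda>x. - pi * Re (Fa (of_real (2 * x)))) \<longlongrightarrow> - pi * Re 0) (at_right 0)"
    by (intro tendsto_intros)
  then show ?thesis by (simp add: Lob_def[abs_def])
qed

section \<open>The critical point attached to a Euclidean triangle\<close>

definition tri :: "real \<Rightarrow> real \<Rightarrow> real \<Rightarrow> bool" where
  "tri a b c \<longleftrightarrow> 0 < a \<and> 0 < b \<and> 0 < c \<and> a + b + c = pi"

lemma tri_rot: "tri a b c \<Longrightarrow> tri b c a"
  by (auto simp: tri_def)

lemma tri_sin_pos: "tri a b c \<Longrightarrow> sin a > 0 \<and> sin b > 0 \<and> sin c > 0"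
  unfolding tri_def by (intro conjI sin_gt_zero) auto

text \<open>A positive multiple of exp (- i w) at the critical point, written symmetrically in the
  three angles; its square gives the second derivative of the potential.\<close>

definition critN :: "real \<Rightarrow> real \<Rightarrow> real \<Rightarrow> complex" where
  "critN a b c = Complex (1 + cos a * cos b * cos c) (- (sin a * sin b * sin c))"

lemma critN_rot: "critN a b c = critN b c a"
  by (simp add: critN_def mult_ac)

text \<open>The right-hand side singles out one angle, but \<open>critN\<close> does not: using cos
  C = - cos (A + B) the same number has three such expressions. This is why one point solves the
  three logarithmic equations simultaneously.\<close>

lemma critN_eq:
  assumes "tri A B C"
  shows "critN A B C = of_real ((sin C)\<^sup>2) + of_real (sin A * sin B) * cis (- C)"
proof -
  have "C = pi - (A + B)" using assms by (simp add: tri_def)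
  then have "cos C = cos (pi - (A + B))" by (simp only:)
  then have c: "cos C = sin A * sin B - cos A * cos B" by (simp add: cos_add)
  have "1 + cos A * cos B * cos C = 1 + (sin A * sin B - cos C) * cos C" using c by simp
  also have "\<dots> = (1 - (cos C)\<^sup>2) + sin A * sin B * cos C" by (simp add: power2_eq_square algebra_simps)
  also have "1 - (cos C)\<^sup>2 = (sin C)\<^sup>2" by (simp add: sin_squared_eq)
  finally show ?thesis by (simp add: critN_def complex_eq_iff)
qed

text \<open>The critical point of the potential when the common constant kappa of the edge lengths
  is 0.\<close>

definition critw :: "real \<Rightarrow> real \<Rightarrow> real \<Rightarrow> complex" where
  "critw a b c = \<i> * Ln (critN a b c / of_real ((sin a * sin b * sin c)\<^sup>2))"

lemma critw_rot: "critw a b c = critw b c a"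
  by (simp add: critw_def critN_rot[of a] mult_ac)

text \<open>The modulus of exp (- i w) - 1 at the shifted critical point. For the angles of a
  triangle the product of \<open>rho\<close> over the three cyclic rotations is 1, one half of the
  critical equation.\<close>

definition rho :: "real \<Rightarrow> real \<Rightarrow> real \<Rightarrow> real" where
  "rho a b c = sin a * sin b / (sin c)\<^sup>2"

text \<open>The imaginary shift multiplies \<open>critN\<close> / (product of sines)^2 by the
  positive number (sin a sin b)^2. A positive factor passes through the principal logarithm, and
  \<open>critN_eq\<close> identifies the product.\<close>

lemma critw_shift:
  assumes t: "tri a b c"
  shows "critw a b c + \<i> * of_real (2 * ln (sin a) + 2 * ln (sin b)) = \<i> * Ln (1 + of_real (rho a b c) * cis (- c))"
proof -
  have s: "sin a > 0" "sin b > 0" "sin c > 0" using tri_sin_pos[OF t] by auto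
  define z where "z = critN a b c / of_real ((sin a * sin b * sin c)\<^sup>2)"
  have z: "z \<noteq> 0" using s by (auto simp: z_def critN_def complex_eq_iff)
  have "of_real ((sin a * sin b)\<^sup>2) * z = 1 + of_real (rho a b c) * cis (- c)"
    unfolding z_def critN_eq[OF t] rho_def using s by (simp add: field_simps power_mult_distrib)
  moreover have "Ln (of_real ((sin a * sin b)\<^sup>2) * z) = of_real (ln ((sin a * sin b)\<^sup>2)) + Ln z"
  proof -
    have p: "(sin a * sin b)\<^sup>2 > 0" using s by simp
    show ?thesis using Ln_times_of_real[OF p z] Ln_of_real[OF p] by (simp only:)
  qed
  ultimately have "Ln (1 + of_real (rho a b c) * cis (- c)) = of_real (ln ((sin a * sin b)\<^sup>2)) + Ln z"
    by (simp only:)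
  also have "ln ((sin a * sin b)\<^sup>2) = 2 * ln (sin a) + 2 * ln (sin b)"
    using s by (simp add: ln_realpow ln_mult)
  finally show ?thesis unfolding critw_def z_def[symmetric] by (simp add: algebra_simps)
qed

lemma crit_point:
  assumes t: "tri a b c"
  defines "w \<equiv> critw a b c + \<i> * of_real (2 * ln (sin a) + 2 * ln (sin b))"
  shows "0 < Re (critw a b c)" "Re (critw a b c) < c" "Re w = Re (critw a b c)"
    "Ln (2 * sin (w / 2)) - \<i> * w / 2 = of_real (ln (rho a b c)) + \<i> * of_real (pi / 2 - c)"
    "exp (- (\<i> * w)) = 1 + of_real (rho a b c) * cis (- c)"
proof -
  have s: "sin a > 0" "sin b > 0" "sin c > 0" using tri_sin_pos[OF t] by auto
  have r: "rho a b c > 0" using s by (simp add: rho_def)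
  have g: "0 < c" "c < pi" using t by (auto simp: tri_def)
  show re: "Re w = Re (critw a b c)" by (simp add: w_def)
  note D = dilog_angle[OF r g, folded critw_shift[OF t], folded w_def]
  show "0 < Re (critw a b c)" "Re (critw a b c) < c" using D(1,2) unfolding re by auto
  show "Ln (2 * sin (w / 2)) - \<i> * w / 2 = of_real (ln (rho a b c)) + \<i> * of_real (pi / 2 - c)" by (rule D(5))
  show "exp (- (\<i> * w)) = 1 + of_real (rho a b c) * cis (- c)" by (rule D(3))
qed

lemma crit_equation:
  assumes t: "tri a b c"
  shows "ln (rho a b c) = ln (sin a) + ln (sin b) - 2 * ln (sin c)"
proof -
  have s: "sin a > 0" "sin b > 0" "sin c > 0" using tri_sin_pos[OF t] by auto
  then show ?thesis by (simp add: rho_def ln_div ln_mult ln_realpow)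
qed

definition lsin :: "real \<Rightarrow> real" where "lsin x = 2 * ln (sin x)"

section \<open>The critical value and the covolume\<close>

text \<open>The value of the potential \<open>Vf\<close> at its critical point in the case kappa =
  0.\<close>

definition critV :: "real \<Rightarrow> real \<Rightarrow> real \<Rightarrow> complex" where
  "critV a b c = phi (critw a b c + \<i> * of_real (lsin a + lsin b))
     + phi (critw a b c + \<i> * of_real (lsin a + lsin c))
     + phi (critw a b c + \<i> * of_real (lsin b + lsin c)) - \<i> * critw a b c / 4"

text \<open>The quadratic form left over from the T_b prefactors. It does not change when the same
  number is added to all three arguments, hence it does not see kappa.\<close>

definition quadJ :: "real \<Rightarrow> real \<Rightarrow> real \<Rightarrow> real" where
  "quadJ y1 y2 y3 = 3 / 4 * (y1\<^sup>2 + y2\<^sup>2 + y3\<^sup>2) - 1 / 4 * (y1 + y2 + y3)\<^sup>2"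

text \<open>The covolume for kappa = 0: the volume in terms of the Lobachevsky function, and 2 ln
  sin of each angle as the sum of the lengths of the two opposite edges carrying it.\<close>

definition covJ :: "real \<Rightarrow> real \<Rightarrow> real \<Rightarrow> real" where
  "covJ a b c = Lob a + Lob b + Lob c + 1 / 2 * (a * lsin a + b * lsin b + c * lsin c)"

definition critJ :: "real \<Rightarrow> real \<Rightarrow> real \<Rightarrow> complex" where
  "critJ a b c = - of_real (covJ a b c / pi)
     + \<i> / of_real (2 * pi) * of_real (quadJ (lsin a + lsin b) (lsin a + lsin c) (lsin b + lsin c)) - \<i> * of_real pi / 12"

text \<open>The value of the derivative is irrelevant, since it gets multiplied by the derivative of
  the potential at a critical point.\<close>

lemma critw_path_differentiable:
  fixes a b c :: "real \<Rightarrow> real"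
  assumes d: "(a has_real_derivative a') (at t)" "(b has_real_derivative b') (at t)" "(c has_real_derivative c') (at t)"
    and t: "tri (a t) (b t) (c t)"
  shows "\<exists>D. ((\<lambda>t. critw (a t) (b t) (c t)) has_vector_derivative D) (at t)"
proof -
  have s: "sin (a t) > 0" "sin (b t) > 0" "sin (c t) > 0" using tri_sin_pos[OF t] by auto
  define u where "u = (\<lambda>t. (1 + cos (a t) * cos (b t) * cos (c t)) / (sin (a t) * sin (b t) * sin (c t))\<^sup>2)"
  define v where "v = (\<lambda>t. - (sin (a t) * sin (b t) * sin (c t)) / (sin (a t) * sin (b t) * sin (c t))\<^sup>2)"
  have "\<exists>D. (u has_real_derivative D) (at t)"
    unfolding u_def using s by (intro exI) (rule derivative_eq_intros d refl | simp)+
  moreover have "\<exists>D. (v has_real_derivative D) (at t)"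
    unfolding v_def using s by (intro exI) (rule derivative_eq_intros d refl | simp)+
  ultimately obtain Du Dv where D: "(u has_real_derivative Du) (at t)" "(v has_real_derivative Dv) (at t)"
    by blast
  have z: "critw (a t) (b t) (c t) = \<i> * Ln (of_real (u t) + \<i> * of_real (v t))" for t
  proof -
    have "critN (a t) (b t) (c t) / of_real ((sin (a t) * sin (b t) * sin (c t))\<^sup>2) = of_real (u t) + \<i> * of_real (v t)"
      by (simp add: complex_eq_iff critN_def u_def v_def Re_divide_of_real Im_divide_of_real del: of_real_power of_real_mult)
    then show ?thesis by (simp only: critw_def)
  qed
  have "((\<lambda>t. of_real (u t) + \<i> * of_real (v t)) has_vector_derivative of_real Du + \<i> * of_real Dv) (at t)"
    by (intro has_vector_derivative_add has_vector_derivative_mult_right has_vector_derivative_of_real D)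
  moreover have "v t < 0" using s by (simp add: v_def divide_neg_pos)
  then have "of_real (u t) + \<i> * of_real (v t) \<notin> \<real>\<^sub>\<le>\<^sub>0" by (simp add: complex_nonpos_Reals_iff)
  ultimately have "((Ln \<circ> (\<lambda>t. of_real (u t) + \<i> * of_real (v t))) has_vector_derivative
      (of_real Du + \<i> * of_real Dv) * inverse (of_real (u t) + \<i> * of_real (v t))) (at t)"
    by (intro field_vector_diff_chain_at has_field_derivative_Ln)
  from has_vector_derivative_mult_right[OF this, of \<i>]
  show ?thesis unfolding z o_def by blast
qed

text \<open>The derivative D of the critical point has coefficient 0 by the critical equation, so
  only the explicit dependence on the shifts is differentiated. On the other side the Lobachevsky
  terms cancel the derivatives of the angles, up to ln 2 times the derivative of the angle sum,
  which is 0; what is left is angle times derivative of length, as in Schlaefli's formula.\<close>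

lemma critV_path_derivative:
  fixes a b c :: "real \<Rightarrow> real"
  assumes d: "(a has_real_derivative a') (at t)" "(b has_real_derivative b') (at t)" "(c has_real_derivative c') (at t)"
    and sum0: "a' + b' + c' = 0"
    and t: "tri (a t) (b t) (c t)"
  shows "((\<lambda>t. critV (a t) (b t) (c t) - critJ (a t) (b t) (c t)) has_vector_derivative 0) (at t)"
proof -
  have s: "sin (a t) > 0" "sin (b t) > 0" "sin (c t) > 0" using tri_sin_pos[OF t] by auto
  have rng: "0 < a t" "a t < pi" "0 < b t" "b t < pi" "0 < c t" "c t < pi" using t by (auto simp: tri_def)
  obtain D where D: "((\<lambda>t. critw (a t) (b t) (c t)) has_vector_derivative D) (at t)"
    using critw_path_differentiable[OF d t] by blast
  define la lb lc where "la = 2 * cos (a t) / sin (a t) * a'" and "lb = 2 * cos (b t) / sin (b t) * b'" and "lc = 2 * cos (c t) / sin (c t) * c'"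
  have L: "((\<lambda>t. lsin (a t)) has_real_derivative la) (at t)" "((\<lambda>t. lsin (b t)) has_real_derivative lb) (at t)" "((\<lambda>t. lsin (c t)) has_real_derivative lc) (at t)"
    unfolding lsin_def la_def lb_def lc_def using s by (auto intro!: derivative_eq_intros d)
  note t2 = tri_rot[OF t] note t3 = tri_rot[OF t2]
  have rot: "critw (b t) (c t) (a t) = critw (a t) (b t) (c t)" "critw (c t) (a t) (b t) = critw (a t) (b t) (c t)"
    by (metis critw_rot)+
  have ph: "((\<lambda>t. phi (critw (a t) (b t) (c t) + \<i> * of_real (f t + g t))) has_vector_derivative
      (D + \<i> * of_real (f' + g')) * ((of_real r + \<i> * of_real (pi / 2 - C)) / of_real (2 * pi))) (at t)"
    if fg: "(f has_real_derivative f') (at t)" "(g has_real_derivative g') (at t)"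
      and eq: "Ln (2 * sin ((critw (a t) (b t) (c t) + \<i> * of_real (f t + g t)) / 2)) - \<i> * (critw (a t) (b t) (c t) + \<i> * of_real (f t + g t)) / 2 = of_real r + \<i> * of_real (pi / 2 - C)"
    for f g :: "real \<Rightarrow> real" and f' g' r C
  proof -
    have v: "((\<lambda>t. critw (a t) (b t) (c t) + \<i> * of_real (f t + g t)) has_vector_derivative D + \<i> * of_real (f' + g')) (at t)"
      by (intro has_vector_derivative_add D has_vector_derivative_mult_right has_vector_derivative_of_real DERIV_add[OF fg])
    have re: "0 < Re (critw (a t) (b t) (c t) + \<i> * of_real (f t + g t))" "Re (critw (a t) (b t) (c t) + \<i> * of_real (f t + g t)) < 2 * pi"
      using crit_point(1,2)[OF t] rng pi_gt_zero by auto
    from field_vector_diff_chain_at[OF v phi_deriv[OF re, unfolded eq]] show ?thesis by (simp only: o_def)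
  qed
  note E1 = crit_point(4)[OF t, folded lsin_def]
  note E2 = crit_point(4)[OF t3, folded lsin_def, unfolded rot]
  note E3 = crit_point(4)[OF t2, folded lsin_def, unfolded rot]
  note P1 = ph[OF L(1,2) E1] note P2 = ph[OF L(3,1) E2] note P3 = ph[OF L(2,3) E3]
  define r1 where "r1 = ln (sin (a t)) + ln (sin (b t)) - 2 * ln (sin (c t))"
  define r2 where "r2 = ln (sin (c t)) + ln (sin (a t)) - 2 * ln (sin (b t))"
  define r3 where "r3 = ln (sin (b t)) + ln (sin (c t)) - 2 * ln (sin (a t))"
  note R = crit_equation[OF t, folded r1_def] crit_equation[OF t3, folded r2_def] crit_equation[OF t2, folded r3_def]
  have V: "((\<lambda>t. critV (a t) (b t) (c t)) has_vector_derivative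
     (D + \<i> * of_real (la + lb)) * ((of_real r1 + \<i> * of_real (pi / 2 - c t)) / of_real (2 * pi))
   + (D + \<i> * of_real (lc + la)) * ((of_real r2 + \<i> * of_real (pi / 2 - b t)) / of_real (2 * pi))
   + (D + \<i> * of_real (lb + lc)) * ((of_real r3 + \<i> * of_real (pi / 2 - a t)) / of_real (2 * pi)) - \<i> * D / 4) (at t)"
    unfolding critV_def add.commute[of "lsin (a _)" "lsin (c _)"]
    using P1 P2 P3 unfolding R
    by (intro has_vector_derivative_diff has_vector_derivative_add has_vector_derivative_divide has_vector_derivative_mult_right D)
  have cov: "((\<lambda>t. covJ (a t) (b t) (c t)) has_real_derivative 1 / 2 * (a t * la + b t * lb + c t * lc)) (at t)"
  proof -
    have lob: "((\<lambda>t. Lob (f t)) has_real_derivative - (ln 2 + lsin (f t) / 2) * f') (at t)"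
      if "(f has_real_derivative f') (at t)" "0 < f t" "f t < pi" "sin (f t) > 0" for f f'
      using DERIV_chain2[OF Lob_deriv[OF that(2,3)] that(1)] that(4) by (simp add: ln_mult lsin_def)
    have "((\<lambda>t. covJ (a t) (b t) (c t)) has_real_derivative
        - (ln 2 + lsin (a t) / 2) * a' + - (ln 2 + lsin (b t) / 2) * b' + - (ln 2 + lsin (c t) / 2) * c'
        + 1 / 2 * ((a' * lsin (a t) + la * a t) + (b' * lsin (b t) + lb * b t) + (c' * lsin (c t) + lc * c t))) (at t)"
      unfolding covJ_def
      by (intro DERIV_add DERIV_cmult DERIV_mult lob d L rng s)
    also have "- (ln 2 + lsin (a t) / 2) * a' + - (ln 2 + lsin (b t) / 2) * b' + - (ln 2 + lsin (c t) / 2) * c'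
        + 1 / 2 * ((a' * lsin (a t) + la * a t) + (b' * lsin (b t) + lb * b t) + (c' * lsin (c t) + lc * c t))
       = 1 / 2 * (a t * la + b t * lb + c t * lc) - ln 2 * (a' + b' + c')"
      by (simp add: field_simps)
    finally show ?thesis by (simp add: sum0)
  qed
  define y1 y2 y3 where "y1 = lsin (a t) + lsin (b t)" and "y2 = lsin (a t) + lsin (c t)" and "y3 = lsin (b t) + lsin (c t)"
  have quad: "((\<lambda>t. quadJ (lsin (a t) + lsin (b t)) (lsin (a t) + lsin (c t)) (lsin (b t) + lsin (c t))) has_real_derivative
     3 / 2 * (y1 * (la + lb) + y2 * (la + lc) + y3 * (lb + lc)) - 1 / 2 * (y1 + y2 + y3) * (2 * (la + lb + lc))) (at t)"
    unfolding quadJ_def y1_def y2_def y3_def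
    by (rule derivative_eq_intros L refl | simp)+ (simp add: field_simps)
  have J: "((\<lambda>t. critJ (a t) (b t) (c t)) has_vector_derivative
     - of_real (1 / 2 * (a t * la + b t * lb + c t * lc) / pi) + \<i> / of_real (2 * pi) *
      of_real (3 / 2 * (y1 * (la + lb) + y2 * (la + lc) + y3 * (lb + lc)) - 1 / 2 * (y1 + y2 + y3) * (2 * (la + lb + lc))) - 0) (at t)"
    unfolding critJ_def
    by (intro has_vector_derivative_diff has_vector_derivative_add has_vector_derivative_minus has_vector_derivative_mult_right
       has_vector_derivative_of_real has_vector_derivative_const
       DERIV_cdivide[OF cov] quad)
  have ct: "c t = pi - a t - b t" using t by (simp add: tri_def)
  \<comment> \<open>After elimination of the third angle this is an identity of polynomials in the
    logarithms and their derivatives; the coefficient of D is (i pi / 2) / (2 pi) - i / 4 =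
    0.\<close>
  have zero: "(D + \<i> * of_real (la + lb)) * ((of_real r1 + \<i> * of_real (pi / 2 - c t)) / of_real (2 * pi))
   + (D + \<i> * of_real (lc + la)) * ((of_real r2 + \<i> * of_real (pi / 2 - b t)) / of_real (2 * pi))
   + (D + \<i> * of_real (lb + lc)) * ((of_real r3 + \<i> * of_real (pi / 2 - a t)) / of_real (2 * pi)) - \<i> * D / 4
   - (- of_real (1 / 2 * (a t * la + b t * lb + c t * lc) / pi) + \<i> / of_real (2 * pi) *
      of_real (3 / 2 * (y1 * (la + lb) + y2 * (la + lc) + y3 * (lb + lc)) - 1 / 2 * (y1 + y2 + y3) * (2 * (la + lb + lc))) - 0) = 0"
    unfolding r1_def r2_def r3_def y1_def y2_def y3_def lsin_def ct complex_eq_iff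
    by (simp add: field_simps)
  show ?thesis using has_vector_derivative_diff[OF V J] unfolding zero .
qed

lemma x_ln_x_tendsto_0: "((\<lambda>x::real. x * ln x) \<longlongrightarrow> 0) (at_right 0)"
  unfolding filterlim_at_right_to_top
proof (rule Lim_transform_eventually)
  show "((\<lambda>x::real. - (ln x / x)) \<longlongrightarrow> 0) at_top"
    using tendsto_minus[OF ln_x_over_x_tendsto_0] by simp
  show "\<forall>\<^sub>F x::real in at_top. - (ln x / x) = inverse x * ln (inverse x)"
    using eventually_gt_at_top[of 0] by eventually_elim (simp add: ln_inverse divide_inverse del: inverse_eq_divide)
qed

lemma x_ln_sin_tendsto_0: "((\<lambda>x::real. x * ln (sin x)) \<longlongrightarrow> 0) (at_right 0)"
proof -
  have ev: "\<forall>\<^sub>F x::real in at_right 0. 0 < x \<and> 0 < sin x"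
    using eventually_at_right_real[of 0 pi] by (auto elim!: eventually_mono intro: sin_gt_zero)
  have "(sin \<longlongrightarrow> sin (0::real)) (at_right 0)" by (intro tendsto_intros)
  then have s: "filterlim (\<lambda>x::real. sin x) (at_right 0) (at_right 0)"
    unfolding filterlim_at using ev by (auto elim!: eventually_mono)
  have "((\<lambda>x::real. sin x / x) \<longlongrightarrow> 1) (at 0)"
    using DERIV_sin[of "0::real"] by (simp add: has_field_derivative_iff)
  then have "((\<lambda>x::real. sin x / x) \<longlongrightarrow> 1) (at_right 0)" by (rule tendsto_mono[rotated]) (simp add: at_le)
  then have "((\<lambda>x::real. (sin x * ln (sin x)) / (sin x / x)) \<longlongrightarrow> 0 / 1) (at_right 0)"
    by (intro tendsto_divide filterlim_compose[OF x_ln_x_tendsto_0 s]) auto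
  then have l: "((\<lambda>x::real. (sin x * ln (sin x)) / (sin x / x)) \<longlongrightarrow> 0) (at_right 0)" by simp
  have "\<forall>\<^sub>F x::real in at_right 0. (sin x * ln (sin x)) / (sin x / x) = x * ln (sin x)"
    using ev by eventually_elim simp
  with l show ?thesis by (rule Lim_transform_eventually)
qed

lemma norm_cis_minus_1_le: "norm (cis x - 1) \<le> \<bar>x\<bar>"
proof -
  have "norm (exp (\<i> * of_real x) - exp 0) \<le> 1 * norm (\<i> * of_real x - 0)"
  proof (rule field_differentiable_bound[where S = "closed_segment 0 (\<i> * of_real x)" and f' = exp])
    show "norm (exp u) \<le> 1" if "u \<in> closed_segment 0 (\<i> * of_real x)" for u
      using closed_segment_0_bounds(1)[OF that] by (simp add: norm_exp_eq_Re)
  qed (auto intro!: derivative_eq_intros)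
  then show ?thesis by (simp add: cis_conv_exp norm_mult)
qed

text \<open>By \<open>critV_path_derivative\<close> the difference is constant along a segment of
  triangles, so it suffices to let the triangle degenerate and to show that the difference tends to
  0. Both sides diverge there, and the divergent parts have to be matched.\<close>

lemma critV_eq_critJ:
  assumes t: "tri l m n"
  shows "critV l m n = critJ l m n"
proof -
  \<comment> \<open>The segment starts at the degenerate triangle (0, pi / 2, pi / 2) for t = 0 and
    ends at (l, m, n) for t = 1. It is chosen since there all sine factors tend to 0 or 1.\<close>
  define a where "a = (\<lambda>t. t * l)"
  define b where "b = (\<lambda>t. pi / 2 + t * (m - pi / 2))"
  define c where "c = (\<lambda>t. pi / 2 + t * (n - pi / 2))"
  define h where "h = (\<lambda>t. critV (a t) (b t) (c t) - critJ (a t) (b t) (c t))"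
  have pos: "0 < l" "0 < m" "0 < n" and sm: "l + m + n = pi" using t by (auto simp: tri_def)
  have tr: "tri (a t) (b t) (c t)" if "0 < t" "t \<le> 1" for t
  proof -
    have "b t = (1 - t) * (pi / 2) + t * m" "c t = (1 - t) * (pi / 2) + t * n"
      by (simp_all add: b_def c_def algebra_simps add_divide_distrib diff_divide_distrib)
    then have "b t > 0" "c t > 0" using that pos by (auto intro!: add_nonneg_pos mult_nonneg_nonneg mult_pos_pos)
    moreover have "a t + b t + c t = pi + t * (l + m + n - pi)" by (simp add: a_def b_def c_def algebra_simps)
    ultimately show ?thesis using that pos sm by (simp add: tri_def a_def)
  qed
  have hder: "(h has_vector_derivative 0) (at t within {0<..1})" if "t \<in> {0<..1}" for t
  proof (rule has_vector_derivative_at_within)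
    show "(h has_vector_derivative 0) (at t)" unfolding h_def
      by (rule critV_path_derivative[where a' = l and b' = "m - pi / 2" and c' = "n - pi / 2"])
         (use tr that sm in \<open>auto simp: a_def[abs_def] b_def[abs_def] c_def[abs_def] intro!: derivative_eq_intros\<close>)
  qed
  obtain k where k: "\<And>t. t \<in> {0<..1} \<Longrightarrow> h t = k"
    using has_vector_derivative_zero_constant[OF _ hder] convex_real_interval by blast
  let ?F = "at_right (0::real)"
  have ev01: "\<forall>\<^sub>F t in ?F. 0 < t \<and> t \<le> 1" using eventually_at_right_real[of 0 1] by (auto elim!: eventually_mono)
  have evt: "\<forall>\<^sub>F t in ?F. tri (a t) (b t) (c t)" using ev01 by eventually_elim (use tr in auto)
  have la: "(a \<longlongrightarrow> 0) ?F"
  proof -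
    have "(a \<longlongrightarrow> 0 * l) ?F" unfolding a_def by (intro tendsto_intros)
    then show ?thesis by simp
  qed
  have lb: "(b \<longlongrightarrow> pi / 2) ?F"
  proof -
    have "(b \<longlongrightarrow> pi / 2 + 0 * (m - pi / 2)) ?F" unfolding b_def by (intro tendsto_intros)
    then show ?thesis by simp
  qed
  have lc: "(c \<longlongrightarrow> pi / 2) ?F"
  proof -
    have "(c \<longlongrightarrow> pi / 2 + 0 * (n - pi / 2)) ?F" unfolding c_def by (intro tendsto_intros)
    then show ?thesis by simp
  qed
  have ra: "filterlim a (at_right 0) ?F"
    unfolding filterlim_at using la evt by (auto elim!: eventually_mono simp: tri_def)
  have sa: "((\<lambda>t. sin (a t)) \<longlongrightarrow> 0) ?F" using tendsto_sin[OF la] by simp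
  have sb: "((\<lambda>t. sin (b t)) \<longlongrightarrow> 1) ?F" using tendsto_sin[OF lb] by simp
  have sc: "((\<lambda>t. sin (c t)) \<longlongrightarrow> 1) ?F" using tendsto_sin[OF lc] by simp
  have lsb: "((\<lambda>t. lsin (b t)) \<longlongrightarrow> 0) ?F" unfolding lsin_def using tendsto_mult_left[OF tendsto_ln[OF sb], of 2] by simp
  have lsc: "((\<lambda>t. lsin (c t)) \<longlongrightarrow> 0) ?F" unfolding lsin_def using tendsto_mult_left[OF tendsto_ln[OF sc], of 2] by simp
  have als: "((\<lambda>t. a t * lsin (a t)) \<longlongrightarrow> 0) ?F"
    unfolding lsin_def using tendsto_mult_left[OF filterlim_compose[OF x_ln_sin_tendsto_0 ra], of 2] by (simp add: mult_ac)
  have covlim: "((\<lambda>t. covJ (a t) (b t) (c t)) \<longlongrightarrow> 0) ?F"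
  proof -
    have "isCont Lob (pi / 2)" by (rule DERIV_isCont[OF Lob_deriv]) auto
    then have "((\<lambda>t. Lob (b t)) \<longlongrightarrow> Lob (pi / 2)) ?F" "((\<lambda>t. Lob (c t)) \<longlongrightarrow> Lob (pi / 2)) ?F"
      using lb lc by (auto intro: isCont_tendsto_compose)
    moreover have "((\<lambda>t. Lob (a t)) \<longlongrightarrow> 0) ?F" by (rule filterlim_compose[OF Lob_tendsto_0 ra])
    ultimately have "((\<lambda>t. covJ (a t) (b t) (c t)) \<longlongrightarrow> 0 + Lob (pi / 2) + Lob (pi / 2) + 1 / 2 * (0 + pi / 2 * 0 + pi / 2 * 0)) ?F"
      unfolding covJ_def by (intro tendsto_intros als lb lc lsb lsc)
    then show ?thesis by (simp add: Lob_pi_half)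
  qed
  \<comment> \<open>This treats the two terms with a ratio \<open>rho\<close> tending to 0: their
    arguments tend to 0 from inside the strip, where \<open>Fa\<close> has limit 0.\<close>
  have small: "((\<lambda>t. phi (\<i> * Ln (1 + of_real (r t) * cis (- g t)))) \<longlongrightarrow> 0) ?F"
    if r: "(r \<longlongrightarrow> 0) ?F" "\<forall>\<^sub>F t in ?F. 0 < r t" "\<forall>\<^sub>F t in ?F. 0 < g t \<and> g t < pi" for r g :: "real \<Rightarrow> real"
  proof -
    define w where "w = (\<lambda>t. \<i> * Ln (1 + of_real (r t) * cis (- g t)))"
    have "((\<lambda>t. of_real (r t) * cis (- g t)) \<longlongrightarrow> 0) ?F"
      by (rule tendsto_norm_zero_cancel) (use r(1) in \<open>simp add: norm_mult tendsto_rabs_zero_iff\<close>)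
    then have "((\<lambda>t. 1 + of_real (r t) * cis (- g t)) \<longlongrightarrow> 1 + 0) ?F" by (intro tendsto_intros)
    then have "((\<lambda>t. Ln (1 + of_real (r t) * cis (- g t))) \<longlongrightarrow> Ln (1 + 0)) ?F"
      by (intro tendsto_Ln) auto
    then have w0: "(w \<longlongrightarrow> 0) ?F" unfolding w_def using tendsto_mult_left[of _ "Ln (1 + 0)" ?F \<i>] by simp
    have "filterlim w (at 0 within {w. 0 < Re w \<and> Re w < 2 * pi}) ?F"
      unfolding filterlim_at
    proof (intro conjI w0)
      show "\<forall>\<^sub>F t in ?F. w t \<in> {w. 0 < Re w \<and> Re w < 2 * pi} \<and> w t \<noteq> 0"
        using r(2,3)
      proof eventually_elim
        case (elim t)
        then have "0 < Re (w t)" "Re (w t) < g t" unfolding w_def using dilog_angle(1,2)[of "r t" "g t"] by auto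
        then show ?case using elim by auto
      qed
    qed
    then have "((\<lambda>t. Fa (w t)) \<longlongrightarrow> 0) ?F" by (rule filterlim_compose[OF Fa_tendsto_0])
    then have "((\<lambda>t. phi (w t)) \<longlongrightarrow> 0 - \<i> * 0\<^sup>2 / of_real (8 * pi)) ?F"
      unfolding phi_def by (intro tendsto_intros w0) auto
    then show ?thesis by (simp add: w_def)
  qed
  have rng: "\<forall>\<^sub>F t in ?F. (0 < a t \<and> a t < pi) \<and> (0 < b t \<and> b t < pi) \<and> (0 < c t \<and> c t < pi)"
    using evt by eventually_elim (auto simp: tri_def)
  define r1 where "r1 = (\<lambda>t. rho (a t) (b t) (c t))"
  define r2 where "r2 = (\<lambda>t. rho (c t) (a t) (b t))"
  define r3 where "r3 = (\<lambda>t. rho (b t) (c t) (a t))"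
  have rpos: "\<forall>\<^sub>F t in ?F. 0 < r1 t \<and> 0 < r2 t \<and> 0 < r3 t \<and> 0 < sin (a t)"
    using evt
  proof eventually_elim
    case (elim t)
    from tri_sin_pos[OF elim] show ?case by (auto simp: r1_def r2_def r3_def rho_def)
  qed
  have "(r1 \<longlongrightarrow> 0 * 1 / 1\<^sup>2) ?F" unfolding r1_def rho_def by (intro tendsto_intros sa sb sc) auto
  then have T1: "((\<lambda>t. phi (\<i> * Ln (1 + of_real (r1 t) * cis (- c t)))) \<longlongrightarrow> 0) ?F"
    by (intro small) (use rpos rng in \<open>auto elim: eventually_mono\<close>)
  have "(r2 \<longlongrightarrow> 1 * 0 / 1\<^sup>2) ?F" unfolding r2_def rho_def by (intro tendsto_intros sa sb sc) auto
  then have T2: "((\<lambda>t. phi (\<i> * Ln (1 + of_real (r2 t) * cis (- b t)))) \<longlongrightarrow> 0) ?F"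
    by (intro small) (use rpos rng in \<open>auto elim: eventually_mono\<close>)
  \<comment> \<open>The third ratio has the square of the vanishing sine in its denominator, so the
    third argument runs off to + i infinity, and \<open>Fa\<close> may be replaced by the polynomial
    \<open>Fasym\<close> there.\<close>
  have r3inf: "filterlim r3 at_top ?F"
  proof -
    have "((\<lambda>t. sin (b t) * sin (c t)) \<longlongrightarrow> 1 * 1) ?F" by (intro tendsto_intros sb sc)
    moreover have "filterlim (\<lambda>t. inverse ((sin (a t))\<^sup>2)) at_top ?F"
    proof (rule filterlim_inverse_at_top)
      show "((\<lambda>t. (sin (a t))\<^sup>2) \<longlongrightarrow> 0) ?F" using tendsto_power[OF sa, of 2] by simp
      show "\<forall>\<^sub>F t in ?F. 0 < (sin (a t))\<^sup>2" using rpos by eventually_elim simp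
    qed
    ultimately show ?thesis unfolding r3_def rho_def divide_inverse
      by (intro filterlim_tendsto_pos_mult_at_top[where c = "1 * 1"]) auto
  qed
  define ir where "ir = (\<lambda>t. inverse (r3 t))"
  have ir0: "(ir \<longlongrightarrow> 0) ?F" unfolding ir_def by (rule tendsto_inverse_0_at_top[OF r3inf])
  define z where "z = (\<lambda>t. of_real (ir t) + cis (- a t) - 1)"
  have z0: "(z \<longlongrightarrow> 0) ?F"
  proof -
    have "(z \<longlongrightarrow> of_real 0 + cis (- 0) - 1) ?F" unfolding z_def cis_conv_exp
      by (intro tendsto_intros ir0 la)
    then show ?thesis by simp
  qed
  have zle: "norm (z t) \<le> \<bar>ir t\<bar> + \<bar>a t\<bar>" for t
  proof -
    have "norm (z t) \<le> norm (complex_of_real (ir t)) + norm (cis (- a t) - 1)"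
      unfolding z_def using norm_triangle_ineq[of "of_real (ir t)" "cis (- a t) - 1"] by (simp add: add_diff_eq)
    also have "norm (cis (- a t) - 1) \<le> \<bar>a t\<bar>"
      using norm_cis_minus_1_le[of "- a t"] by simp
    finally show ?thesis by simp
  qed
  define \<epsilon> where "\<epsilon> = (\<lambda>t. Ln (1 + z t))"
  have e0: "(\<epsilon> \<longlongrightarrow> 0) ?F"
  proof -
    have "(\<epsilon> \<longlongrightarrow> Ln (1 + 0)) ?F" unfolding \<epsilon>_def by (intro tendsto_intros z0) auto
    then show ?thesis by simp
  qed
  have lnr: "\<forall>\<^sub>F t in ?F. ln (r3 t) = (lsin (b t) + lsin (c t)) / 2 - lsin (a t)"
    using evt
  proof eventually_elim
    case (elim t)
    from crit_equation[OF tri_rot[OF elim]] show ?case by (simp add: r3_def lsin_def)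
  qed
  have lnir: "((\<lambda>t. ln (r3 t) * \<bar>ir t\<bar>) \<longlongrightarrow> 0) ?F"
  proof (rule Lim_transform_eventually)
    show "((\<lambda>t. ln (r3 t) / r3 t) \<longlongrightarrow> 0) ?F" by (rule filterlim_compose[OF ln_x_over_x_tendsto_0 r3inf])
    show "\<forall>\<^sub>F t in ?F. ln (r3 t) / r3 t = ln (r3 t) * \<bar>ir t\<bar>"
      using rpos by eventually_elim (simp add: ir_def divide_inverse)
  qed
  have lna: "((\<lambda>t. ln (r3 t) * \<bar>a t\<bar>) \<longlongrightarrow> 0) ?F"
  proof (rule Lim_transform_eventually)
    have "((\<lambda>t. (lsin (b t) + lsin (c t)) / 2 * a t - a t * lsin (a t)) \<longlongrightarrow> (0 + 0) / 2 * 0 - 0) ?F"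
      by (intro tendsto_intros lsb lsc la als) auto
    then show "((\<lambda>t. (lsin (b t) + lsin (c t)) / 2 * a t - a t * lsin (a t)) \<longlongrightarrow> 0) ?F" by simp
    show "\<forall>\<^sub>F t in ?F. (lsin (b t) + lsin (c t)) / 2 * a t - a t * lsin (a t) = ln (r3 t) * \<bar>a t\<bar>"
      using lnr rng
    proof eventually_elim
      case (elim t)
      then have "\<bar>a t\<bar> = a t" by simp
      then show ?case unfolding elim(1) by (simp add: field_simps)
    qed
  qed
  \<comment> \<open>The square of the third argument contains this cross term. It vanishes because
    \<epsilon> is O(1 / r3 + a), and a logarithmic divergence loses against both.\<close>
  have lne: "((\<lambda>t. of_real (ln (r3 t)) * \<epsilon> t) \<longlongrightarrow> 0) ?F"
  proof (rule Lim_null_comparison)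
    have "((\<lambda>t. 2 * (\<bar>ln (r3 t) * \<bar>ir t\<bar>\<bar> + \<bar>ln (r3 t) * \<bar>a t\<bar>\<bar>)) \<longlongrightarrow> 2 * (\<bar>0\<bar> + \<bar>0\<bar>)) ?F"
      by (intro tendsto_intros lnir lna)
    then show "((\<lambda>t. 2 * (\<bar>ln (r3 t) * \<bar>ir t\<bar>\<bar> + \<bar>ln (r3 t) * \<bar>a t\<bar>\<bar>)) \<longlongrightarrow> 0) ?F" by simp
    have "\<forall>\<^sub>F t in ?F. norm (z t) < 1 / 2"
      using tendstoD[OF z0, of "1/2"] by simp
    then show "\<forall>\<^sub>F t in ?F. norm (of_real (ln (r3 t)) * \<epsilon> t) \<le> 2 * (\<bar>ln (r3 t) * \<bar>ir t\<bar>\<bar> + \<bar>ln (r3 t) * \<bar>a t\<bar>\<bar>)"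
    proof eventually_elim
      case (elim t)
      have "norm (\<epsilon> t) \<le> 2 * (\<bar>ir t\<bar> + \<bar>a t\<bar>)"
        unfolding \<epsilon>_def using zle[of t] by (intro order_trans[OF norm_Ln_le[OF elim]]) simp
      then have "\<bar>ln (r3 t)\<bar> * norm (\<epsilon> t) \<le> \<bar>ln (r3 t)\<bar> * (2 * (\<bar>ir t\<bar> + \<bar>a t\<bar>))" by (intro mult_left_mono) auto
      then show ?case by (simp add: norm_mult abs_mult algebra_simps)
    qed
  qed
  define w3 where "w3 = (\<lambda>t. \<i> * Ln (1 + of_real (r3 t) * cis (- a t)))"
  have w3eq: "\<forall>\<^sub>F t in ?F. w3 t = \<i> * (of_real (ln (r3 t)) + \<epsilon> t)"
  proof -
    have "\<forall>\<^sub>F t in ?F. norm (z t) < 1" using tendstoD[OF z0, of 1] by simp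
    then show ?thesis using rpos
    proof eventually_elim
      case (elim t)
      have nz: "1 + z t \<noteq> 0" using elim(1) by (metis add.inverse_unique less_irrefl norm_minus_cancel norm_one)
      have p: "r3 t > 0" using elim by simp
      have "1 + of_real (r3 t) * cis (- a t) = of_real (r3 t) * (1 + z t)"
        using p by (simp add: z_def ir_def field_simps)
      then show ?case unfolding w3_def \<epsilon>_def using Ln_times_of_real[OF p nz] Ln_of_real[OF p] by (simp only:)
    qed
  qed
  have errlim: "((\<lambda>t. Fa (w3 t) - Fasym (w3 t)) \<longlongrightarrow> 0) ?F"
  proof (rule Lim_null_comparison)
    have "filterlim (\<lambda>t. - 1 + r3 t) at_top ?F" using r3inf by (rule filterlim_tendsto_add_at_top[OF tendsto_const])
    then show "((\<lambda>t. inverse (- 1 + r3 t)) \<longlongrightarrow> 0) ?F" by (rule tendsto_inverse_0_at_top)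
    have "\<forall>\<^sub>F t in ?F. r3 t > 2" using r3inf by (simp add: filterlim_at_top_dense)
    then show "\<forall>\<^sub>F t in ?F. norm (Fa (w3 t) - Fasym (w3 t)) \<le> inverse (- 1 + r3 t)"
      using rng
    proof eventually_elim
      case (elim t)
      have p: "0 < r3 t" "0 < a t" "a t < pi" using elim by auto
      note D = dilog_angle[OF p, folded w3_def]
      have "exp (Im (w3 t)) = norm (exp (- (\<i> * w3 t)))" by (simp add: norm_exp_eq_Re)
      also have "\<dots> = norm (1 + of_real (r3 t) * cis (- a t))" unfolding w3_def using D(3) by (simp add: w3_def)
      also have "\<dots> \<ge> r3 t - 1"
        using norm_triangle_ineq2[of "of_real (r3 t) * cis (- a t)" "-1"] p by (simp add: norm_mult add.commute)
      finally have ei: "exp (Im (w3 t)) \<ge> r3 t - 1" .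
      then have im: "Im (w3 t) \<ge> 0" using elim(1) by (smt (verit) exp_le_one_iff)
      have re: "0 < Re (w3 t)" "Re (w3 t) < 2 * pi" using D(1,2) p unfolding w3_def by auto
      have "norm (Fa (w3 t) - Fasym (w3 t)) \<le> exp (- Im (w3 t))" by (rule Fa_asymptotic[OF re im])
      also have "\<dots> = inverse (exp (Im (w3 t)))" by (rule exp_minus)
      also have "\<dots> \<le> inverse (- 1 + r3 t)" using ei elim(1) by (intro le_imp_inverse_le) auto
      finally show ?case .
    qed
  qed
  define B where "B = (\<lambda>t. lsin (b t))"
  define C where "C = (\<lambda>t. lsin (c t))"
  \<comment> \<open>The same difference as \<open>h\<close>, sorted into terms that tend to 0 one by
    one: the square of ln r3 has been combined with \<open>quadJ\<close>, and together they no
    longer involve lsin (a t).\<close>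
  define g where "g = (\<lambda>t. phi (\<i> * Ln (1 + of_real (r1 t) * cis (- c t))) + phi (\<i> * Ln (1 + of_real (r2 t) * cis (- b t)))
     + (Fa (w3 t) - Fasym (w3 t)) - of_real ((B t + C t) / 4)
     + \<i> / of_real (4 * pi) * (2 * (of_real (ln (r3 t)) * \<epsilon> t) + (\<epsilon> t)\<^sup>2)
     + \<i> / of_real (2 * pi) * of_real (3 / 8 * (B t + C t)\<^sup>2 - 3 / 4 * ((B t)\<^sup>2 + (C t)\<^sup>2)) + of_real (covJ (a t) (b t) (c t) / pi))"
  have "(g \<longlongrightarrow> 0 + 0 + 0 - of_real ((0 + 0) / 4) + \<i> / of_real (4 * pi) * (2 * 0 + 0\<^sup>2)
     + \<i> / of_real (2 * pi) * of_real (3 / 8 * (0 + 0)\<^sup>2 - 3 / 4 * (0\<^sup>2 + 0\<^sup>2)) + of_real (0 / pi)) ?F"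
    unfolding g_def B_def C_def by (intro tendsto_intros T1 T2 errlim lsb lsc lne e0 covlim) auto
  then have g0: "(g \<longlongrightarrow> 0) ?F" by simp
  have "\<forall>\<^sub>F t in ?F. g t = h t"
    using evt w3eq lnr
  proof eventually_elim
    case (elim t)
    note t1 = elim(1) note t2 = tri_rot[OF t1] note t3 = tri_rot[OF t2]
    have rot: "critw (b t) (c t) (a t) = critw (a t) (b t) (c t)" "critw (c t) (a t) (b t) = critw (a t) (b t) (c t)"
      by (metis critw_rot)+
    define cw where "cw = critw (a t) (b t) (c t)"
    define L where "L = lsin (a t)"
    have p1: "cw + \<i> * of_real (lsin (a t) + lsin (b t)) = \<i> * Ln (1 + of_real (r1 t) * cis (- c t))"
      using critw_shift[OF t1] by (simp only: cw_def r1_def lsin_def)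
    have p2: "cw + \<i> * of_real (lsin (a t) + lsin (c t)) = \<i> * Ln (1 + of_real (r2 t) * cis (- b t))"
      using critw_shift[OF t3] by (simp only: cw_def r2_def lsin_def rot add.commute)
    have p3: "cw + \<i> * of_real (lsin (b t) + lsin (c t)) = w3 t"
      using critw_shift[OF t2] by (simp only: cw_def r3_def w3_def lsin_def rot)
    have cw: "cw = w3 t - \<i> * of_real (B t + C t)" using p3 by (simp add: B_def C_def algebra_simps)
    have lr: "ln (r3 t) = (B t + C t) / 2 - L" using elim(3) by (simp add: B_def C_def L_def)
    have phi3: "phi (w3 t) = (Fa (w3 t) - Fasym (w3 t)) + \<i> * w3 t / 4 - \<i> * (w3 t)\<^sup>2 / of_real (4 * pi) - \<i> * of_real pi / 12"
      by (simp add: phi_def Fasym_def field_simps)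
    have V: "critV (a t) (b t) (c t) = phi (\<i> * Ln (1 + of_real (r1 t) * cis (- c t))) + phi (\<i> * Ln (1 + of_real (r2 t) * cis (- b t)))
       + phi (w3 t) - \<i> * cw / 4"
      unfolding critV_def cw_def[symmetric] p1 p2 p3 ..
    have w2: "- \<i> * (w3 t)\<^sup>2 / of_real (4 * pi) = \<i> / of_real (4 * pi) * ((of_real (ln (r3 t)))\<^sup>2 + 2 * (of_real (ln (r3 t)) * \<epsilon> t) + (\<epsilon> t)\<^sup>2)"
      unfolding elim(2) by (simp add: power2_eq_square field_simps)
    have q: "\<i> / of_real (4 * pi) * (of_real (ln (r3 t)))\<^sup>2 - \<i> / of_real (2 * pi) * of_real (quadJ (L + B t) (L + C t) (B t + C t))
      = \<i> / of_real (2 * pi) * of_real (3 / 8 * (B t + C t)\<^sup>2 - 3 / 4 * ((B t)\<^sup>2 + (C t)\<^sup>2))"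
      unfolding lr quadJ_def by (simp add: field_simps power2_eq_square)
    have "h t = phi (\<i> * Ln (1 + of_real (r1 t) * cis (- c t))) + phi (\<i> * Ln (1 + of_real (r2 t) * cis (- b t)))
      + (Fa (w3 t) - Fasym (w3 t)) - of_real ((B t + C t) / 4) + (- \<i> * (w3 t)\<^sup>2 / of_real (4 * pi))
      - \<i> / of_real (2 * pi) * of_real (quadJ (L + B t) (L + C t) (B t + C t)) + of_real (covJ (a t) (b t) (c t) / pi)"
      unfolding h_def V phi3 critJ_def cw L_def B_def C_def by (simp add: algebra_simps)
    also have "\<dots> = g t" unfolding w2 g_def q[symmetric] by (simp add: algebra_simps)
    finally show "g t = h t" by simp
  qed
  with g0 have "(h \<longlongrightarrow> 0) ?F" by (rule Lim_transform_eventually)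
  moreover have "(h \<longlongrightarrow> k) ?F"
    by (rule Lim_transform_eventually[OF tendsto_const]) (use ev01 k in \<open>auto elim!: eventually_mono\<close>)
  ultimately have "k = 0" using tendsto_unique[OF trivial_limit_at_right_real] by blast
  then have "h 1 = 0" using k[of 1] by simp
  then show ?thesis by (simp add: h_def a_def b_def c_def)
qed

section \<open>Moving vertical lines and decay of the double sine function\<close>

text \<open>Cauchy's theorem for long rectangles, phrased with a primitive on the convex strip: the
  difference of the truncated integrals is a combination of two horizontal increments of the
  primitive, and these decay exponentially.\<close>

lemma vertical_integral_shift:
  fixes f :: "complex \<Rightarrow> complex"
  assumes hol: "f holomorphic_on {z. a < Re z \<and> Re z < b}"
    and x: "a < x0" "x0 \<le> x1" "x1 < b" and d: "d > 0"
    and bound: "\<And>z. x0 \<le> Re z \<Longrightarrow> Re z \<le> x1 \<Longrightarrow> norm (f z) \<le> M * exp (- (d * \<bar>Im z\<bar>))"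
  shows "(LINT t|lborel. f (Complex x0 t)) = (LINT t|lborel. f (Complex x1 t))"
proof -
  define S where "S = {z. a < Re z \<and> Re z < b}"
  obtain P where P: "\<And>z. z \<in> S \<Longrightarrow> (P has_field_derivative f z) (at z)"
    using holomorphic_convex_primitive'[OF convex_Re_strip open_Re_strip hol] at_within_open[OF _ open_Re_strip]
    unfolding S_def by metis
  have cf: "continuous_on UNIV (\<lambda>t. f (Complex x t))" if "a < x" "x < b" for x
  proof -
    have "continuous_on UNIV (\<lambda>t. f (of_real x + \<i> * of_real t))"
      by (rule continuous_on_compose2[OF holomorphic_on_imp_continuous_on[OF hol]])
         (use that in \<open>auto intro!: continuous_intros\<close>)
    then show ?thesis by (simp add: Complex_eq)
  qed
  have int: "integrable lborel (\<lambda>t. f (Complex x t))" if "x0 \<le> x" "x \<le> x1" for x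
  proof (rule Bochner_Integration.integrable_bound)
    show "integrable lborel (\<lambda>t. M * exp (- (d * \<bar>t\<bar>)))" using exp_abs_integrable[OF d] by simp
    show "(\<lambda>t. f (Complex x t)) \<in> borel_measurable lborel"
      using borel_measurable_continuous_onI[OF cf[of x]] that x by simp
    show "AE t in lborel. norm (f (Complex x t)) \<le> norm (M * exp (- (d * \<bar>t\<bar>)))"
    proof (rule AE_I2)
      fix t
      have "norm (f (Complex x t)) \<le> M * exp (- (d * \<bar>t\<bar>))" using bound[of "Complex x t"] that by simp
      also have "\<dots> \<le> \<bar>M * exp (- (d * \<bar>t\<bar>))\<bar>" by (rule abs_ge_self)
      finally show "norm (f (Complex x t)) \<le> norm (M * exp (- (d * \<bar>t\<bar>)))" by simp
    qed
  qed
  define I where "I = (\<lambda>x N. LINT t|lborel. indicator {- real N..real N} t *\<^sub>R f (Complex x t))"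
  have lim: "(\<lambda>N. I x N) \<longlonglongrightarrow> (LINT t|lborel. f (Complex x t))" if "x0 \<le> x" "x \<le> x1" for x
    unfolding I_def
  proof (rule integral_dominated_convergence[where w = "\<lambda>t. norm (f (Complex x t))"])
    show "integrable lborel (\<lambda>t. norm (f (Complex x t)))" using int[OF that] by simp
    show "(\<lambda>t. f (Complex x t)) \<in> borel_measurable lborel" using int[OF that] by (rule borel_measurable_integrable)
    then show "(\<lambda>t. indicator {- real N..real N} t *\<^sub>R f (Complex x t)) \<in> borel_measurable lborel" for N by measurable
    show "AE t in lborel. (\<lambda>N. indicator {- real N..real N} t *\<^sub>R f (Complex x t)) \<longlonglongrightarrow> f (Complex x t)"
    proof (rule AE_I2)
      fix t
      obtain N0 :: nat where N0: "\<bar>t\<bar> \<le> real N0" using real_arch_simple by blast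
      have "\<forall>\<^sub>F N in sequentially. indicator {- real N..real N} t *\<^sub>R f (Complex x t) = f (Complex x t)"
        using eventually_ge_at_top[of N0] by eventually_elim (use N0 in \<open>auto simp: indicator_def\<close>)
      then show "(\<lambda>N. indicator {- real N..real N} t *\<^sub>R f (Complex x t)) \<longlonglongrightarrow> f (Complex x t)"
        by (rule tendsto_eventually)
    qed
  qed (auto simp: indicator_def)
  have IP: "I x N = (P (Complex x (real N)) - P (Complex x (- real N))) / \<i>" if "a < x" "x < b" for x N
  proof -
    have "I x N = (LBINT t=- real N..real N. f (Complex x t))"
      by (simp add: I_def interval_integral_Icc set_lebesgue_integral_def)
    also have "\<dots> = P (Complex x (real N)) / \<i> - P (Complex x (- real N)) / \<i>"
    proof (rule interval_integral_FTC_finite)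
      show "continuous_on {min (- real N) (real N)..max (- real N) (real N)} (\<lambda>t. f (Complex x t))"
        using cf[OF that] continuous_on_subset by blast
      show "((\<lambda>t. P (Complex x t) / \<i>) has_vector_derivative f (Complex x t)) (at t within A)" for t A
      proof -
        have v: "((\<lambda>t. Complex x t) has_vector_derivative \<i>) (at t)"
          unfolding Complex_eq by (auto intro!: derivative_eq_intros)
        have "((P \<circ> (\<lambda>t. Complex x t)) has_vector_derivative \<i> * f (Complex x t)) (at t)"
          by (rule field_vector_diff_chain_at[OF v P]) (use that in \<open>auto simp: S_def\<close>)
        from has_vector_derivative_divide[OF this, of \<i>] show ?thesis
          by (simp add: o_def has_vector_derivative_at_within)
      qed
    qed
    finally show ?thesis by (simp only: diff_divide_distrib)
  qed
  have seg: "norm (P (Complex x1 r) - P (Complex x0 r)) \<le> M * exp (- (d * \<bar>r\<bar>)) * (x1 - x0)" for r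
  proof -
    have "norm (P (Complex x1 r) - P (Complex x0 r)) \<le> M * exp (- (d * \<bar>r\<bar>)) * norm (Complex x1 r - Complex x0 r)"
    proof (rule field_differentiable_bound[where S = "closed_segment (Complex x0 r) (Complex x1 r)" and f' = f])
      fix u assume "u \<in> closed_segment (Complex x0 r) (Complex x1 r)"
      then obtain s where s: "0 \<le> s" "s \<le> 1" "u = (1 - s) *\<^sub>R Complex x0 r + s *\<^sub>R Complex x1 r"
        by (auto simp: in_segment)
      have re: "Re u = x0 + s * (x1 - x0)" and im: "Im u = r" by (simp_all add: s(3) algebra_simps)
      have "0 \<le> s * (x1 - x0)" "s * (x1 - x0) \<le> 1 * (x1 - x0)"
        using s x mult_right_mono[of s 1 "x1 - x0"] by (simp_all add: mult_nonneg_nonneg)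
      then have r: "x0 \<le> Re u" "Re u \<le> x1" unfolding re by simp_all
      show "norm (f u) \<le> M * exp (- (d * \<bar>r\<bar>))" using bound[OF r] im by simp
      show "(P has_field_derivative f u) (at u within closed_segment (Complex x0 r) (Complex x1 r))"
        by (rule has_field_derivative_at_within[OF P]) (use r x in \<open>auto simp: S_def\<close>)
    qed auto
    also have "norm (Complex x1 r - Complex x0 r) = x1 - x0"
      using x by (simp add: cmod_def)
    finally show ?thesis .
  qed
  have "(\<lambda>N. I x1 N - I x0 N) \<longlonglongrightarrow> 0"
  proof (rule Lim_null_comparison)
    show "\<forall>\<^sub>F N in sequentially. norm (I x1 N - I x0 N) \<le> 2 * (x1 - x0) * M * exp (- (d * real N))"
    proof (rule always_eventually, rule allI)
      fix N
      define p0 p1 m0 m1 where "p0 = P (Complex x0 (real N))" and "p1 = P (Complex x1 (real N))"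
        and "m0 = P (Complex x0 (- real N))" and "m1 = P (Complex x1 (- real N))"
      have "I x1 N - I x0 N = (p1 - m1) / \<i> - (p0 - m0) / \<i>"
        unfolding p0_def p1_def m0_def m1_def using x by (simp only: IP)
      also have "\<dots> = ((p1 - p0) - (m1 - m0)) / \<i>"
        unfolding diff_divide_distrib[symmetric] by (rule arg_cong[where f = "\<lambda>z. z / \<i>"]) simp
      also have "norm \<dots> \<le> norm (p1 - p0) + norm (m1 - m0)"
        by (simp only: norm_divide norm_ii div_by_1 norm_triangle_ineq4)
      also have "\<dots> \<le> 2 * (x1 - x0) * M * exp (- (d * real N))"
        using seg[of "real N"] seg[of "- real N"] unfolding p0_def p1_def m0_def m1_def by (simp add: algebra_simps)
      finally show "norm (I x1 N - I x0 N) \<le> 2 * (x1 - x0) * M * exp (- (d * real N))" .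
    qed
    have "(\<lambda>N. 2 * (x1 - x0) * M * exp (- (d * real N))) \<longlonglongrightarrow> 2 * (x1 - x0) * M * 0"
      by (intro tendsto_mult_left filterlim_compose[OF exp_mult_neg_tendsto_0[OF d] filterlim_real_sequentially])
    then show "(\<lambda>N. 2 * (x1 - x0) * M * exp (- (d * real N))) \<longlonglongrightarrow> 0" by simp
  qed
  moreover have "(\<lambda>N. I x1 N - I x0 N) \<longlonglongrightarrow> (LINT t|lborel. f (Complex x1 t)) - (LINT t|lborel. f (Complex x0 t))"
    using x by (intro tendsto_diff lim) auto
  ultimately have "(LINT t|lborel. f (Complex x1 t)) - (LINT t|lborel. f (Complex x0 t)) = 0"
    using LIMSEQ_unique by blast
  then show ?thesis by simp
qed

lemma norm_cos_ge: "norm (cos w) \<ge> \<bar>cos (Re w)\<bar> * cosh (Im w)"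
proof -
  have re: "Re (cos w) = cos (Re w) * cosh (Im w)" by (simp add: Re_cos cosh_field_def)
  have "\<bar>Re (cos w)\<bar> \<le> norm (cos w)" by (rule abs_Re_le_cmod)
  then show ?thesis by (simp add: re abs_mult)
qed

lemma norm_sin_le: "norm (sin w) \<le> cosh (Im w)"
proof -
  have "norm (sin w) \<le> (norm (exp (\<i> * w)) + norm (exp (- (\<i> * w)))) / 2"
    unfolding sin_exp_eq norm_mult norm_divide using norm_triangle_ineq4[of "exp (\<i> * w)" "exp (- (\<i> * w))"] by simp
  also have "\<dots> = cosh (Im w)" by (simp add: norm_exp_eq_Re cosh_field_def)
  finally show ?thesis .
qed

lemma cos_half_pi_mult_pos:
  assumes "0 \<le> p" "p < (1::real)" shows "cos (pi / 2 * p) > 0"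
proof -
  have "pi / 2 * p < pi / 2 * 1" "0 \<le> pi / 2 * p" using assms by (intro mult_strict_left_mono, auto)
  then show ?thesis using pi_gt_zero by (intro cos_gt_zero_pi) linarith+
qed

lemma norm_tan_le:
  assumes "\<bar>Re a\<bar> \<le> p" "p < 1"
  shows "norm (tan (of_real (pi / 2) * a)) \<le> 1 / cos (pi / 2 * p)"
proof -
  have p: "0 \<le> p" using assms by linarith
  have c: "cos (pi / 2 * p) > 0" using p assms by (intro cos_half_pi_mult_pos)
  define w where "w = of_real (pi / 2) * a"
  have rw: "\<bar>Re w\<bar> \<le> pi / 2 * p" using assms by (simp add: w_def abs_mult)
  have "cos (pi / 2 * p) \<le> cos \<bar>Re w\<bar>" using rw p assms by (intro cos_monotone_0_pi_le) auto
  then have cw: "cos (pi / 2 * p) \<le> cos (Re w)" by simp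
  have "cos (pi / 2 * p) * cosh (Im w) \<le> \<bar>cos (Re w)\<bar> * cosh (Im w)"
    using cw by (intro mult_right_mono) auto
  also have "\<dots> \<le> norm (cos w)" by (rule norm_cos_ge)
  finally have "cos (pi / 2 * p) * cosh (Im w) \<le> norm (cos w)" .
  moreover have "0 < cos (pi / 2 * p) * cosh (Im w)" using c by (simp add: cosh_real_pos)
  ultimately have "norm (tan w) \<le> cosh (Im w) / (cos (pi / 2 * p) * cosh (Im w))"
    unfolding tan_def norm_divide using norm_sin_le[of w] by (intro frac_le) (auto simp: cosh_real_nonneg)
  also have "\<dots> = 1 / cos (pi / 2 * p)" using cosh_real_pos[of "Im w"] by simp
  finally show ?thesis by (simp add: w_def)
qed

text \<open>On a closed substrip the tangent in \<open>Theta2_0\<close> is bounded, so the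
  second-order term of \<open>Theta_expansion\<close> is itself O(e^2).\<close>

lemma Theta_approx:
  assumes p: "0 \<le> p" "p < 1"
  obtains C where "C > 0" "\<And>e a. 0 \<le> e \<Longrightarrow> e \<le> 1 \<Longrightarrow> \<bar>Re a\<bar> \<le> p \<Longrightarrow> norm (Theta e a - Theta 0 a) \<le> C * e\<^sup>2"
proof -
  obtain C where C: "C > 0" "\<And>e a. 0 \<le> e \<Longrightarrow> \<bar>Re a\<bar> \<le> p \<Longrightarrow> norm (Theta e a - Theta 0 a + of_real (e\<^sup>2 / 6) * Theta2 0 a) \<le> C * e^3"
    using Theta_expansion[OF p(2)] by blast
  define K where "K = 1 / cos (pi / 2 * p)"
  have "cos (pi / 2 * p) > 0" using p by (intro cos_half_pi_mult_pos)
  then have K: "K > 0" by (simp add: K_def)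
  have "norm (Theta e a - Theta 0 a) \<le> (C + K) * e\<^sup>2" if e: "0 \<le> e" "e \<le> 1" and a: "\<bar>Re a\<bar> \<le> p" for e a
  proof -
    have a1: "\<bar>Re a\<bar> < 1" using a p by simp
    have "norm (Theta2 0 a) = pi / 4 * norm (tan (of_real (pi / 2) * a))"
      unfolding Theta2_0[OF a1] by (simp only: norm_mult norm_of_real) simp
    also have "\<dots> \<le> 1 * K"
      unfolding K_def using norm_tan_le[OF a p(2)] pi_less_4 by (intro mult_mono) auto
    finally have t2: "norm (of_real (e\<^sup>2 / 6) * Theta2 0 a) \<le> e\<^sup>2 * K"
      unfolding norm_mult norm_of_real by (intro mult_mono) auto
    have "norm (Theta e a - Theta 0 a) \<le> norm (Theta e a - Theta 0 a + of_real (e\<^sup>2 / 6) * Theta2 0 a) + norm (of_real (e\<^sup>2 / 6) * Theta2 0 a)"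
      using norm_triangle_ineq4[of "Theta e a - Theta 0 a + of_real (e\<^sup>2 / 6) * Theta2 0 a" "of_real (e\<^sup>2 / 6) * Theta2 0 a"] by simp
    also have "\<dots> \<le> C * e^3 + e\<^sup>2 * K" using C(2)[OF e(1) a] t2 by (intro add_mono)
    also have "e^3 \<le> e\<^sup>2" using e by (simp add: power3_eq_cube power2_eq_square mult_left_le)
    finally show ?thesis using C(1) by (simp add: algebra_simps)
  qed
  then show ?thesis using that[of "C + K"] C K by auto
qed

text \<open>For Im w >= 0 the main term is the real part of \<open>Fasym\<close>, and the error is
  at most 1; conjugation gives the lower half.\<close>

lemma Re_Fa_le:
  assumes w: "0 < Re w" "Re w < 2 * pi"
  shows "Re (Fa w) \<le> - (\<bar>Im w\<bar> * (pi - Re w) / (4 * pi)) + 1"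
proof -
  have 1: "Re (Fa w) \<le> - (Im w * (pi - Re w) / (4 * pi)) + 1" if w: "0 < Re w" "Re w < 2 * pi" "Im w \<ge> 0" for w
  proof -
    have "Re (Fa w - Fasym w) \<le> exp (- Im w)" using Fa_asymptotic[OF w] complex_Re_le_cmod order_trans by blast
    also have "\<dots> \<le> 1" using w by simp
    finally have "Re (Fa w) \<le> Re (Fasym w) + 1" by simp
    also have "Re (Fasym w) = - (Im w * (pi - Re w) / (4 * pi))"
    proof -
      have "Re (\<i> * w\<^sup>2 / of_real (8 * pi)) = - (2 * Re w * Im w) / (8 * pi)"
        unfolding Re_divide_of_real by (simp add: power2_eq_square)
      then have "Re (Fasym w) = - Im w / 4 + 2 * Re w * Im w / (8 * pi)" by (simp add: Fasym_def)
      then show ?thesis by (simp add: field_simps)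
    qed
    finally show ?thesis .
  qed
  show ?thesis
  proof (cases "Im w \<ge> 0")
    case True
    then show ?thesis using 1[OF w] by simp
  next
    case False
    then show ?thesis using 1[of "cnj w"] w by (simp add: Fa_cnj)
  qed
qed

text \<open>A logarithm of S_b in the new variable: for e = b^2 its exponential is S_b at the point
  (w + i y + pi b^2) / (2 pi b).\<close>

definition Sig :: "real \<Rightarrow> real \<Rightarrow> complex \<Rightarrow> complex" where
  "Sig e y w = Theta e (1 - (w + \<i> * of_real y) / of_real pi) / of_real e"

lemma Sig_strip:
  assumes "0 < e" "- pi * e < Re w" "Re w < pi * (2 + e)"
  shows "\<bar>Re (1 - (w + \<i> * of_real y) / of_real pi)\<bar> < 1 + e"
proof -
  have "Re (1 - (w + \<i> * of_real y) / of_real pi) = 1 - Re w / pi" by simp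
  moreover have "- e < Re w / pi" "Re w / pi < 2 + e" using assms by (simp_all add: field_simps)
  ultimately show ?thesis by linarith
qed

lemma Sig_holomorphic:
  assumes e: "0 < e"
  shows "Sig e y holomorphic_on {w. - pi * e < Re w \<and> Re w < pi * (2 + e)}"
proof -
  have "Theta e holomorphic_on {a. \<bar>Re a\<bar> < 1 + e}"
    unfolding holomorphic_on_def
  proof
    fix a assume "a \<in> {a. \<bar>Re a\<bar> < 1 + e}"
    then show "Theta e field_differentiable at a within {a. \<bar>Re a\<bar> < 1 + e}"
      using Theta_deriv(1)[of e a] e has_field_derivative_at_within unfolding field_differentiable_def by fastforce
  qed
  then have "(\<lambda>w. Theta e (1 - (w + \<i> * of_real y) / of_real pi)) holomorphic_on {w. - pi * e < Re w \<and> Re w < pi * (2 + e)}"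
    by (rule holomorphic_on_compose_gen[where g = "Theta e", unfolded o_def, rotated])
       (use Sig_strip[OF e] in \<open>auto intro!: holomorphic_intros\<close>)
  then show ?thesis unfolding Sig_def[abs_def] by (intro holomorphic_intros) (use e in auto)
qed

text \<open>The given contour may lie as far left as Re w = - pi e, outside the strip where
  \<open>Theta 0\<close> approximates \<open>Theta e\<close>. The functional equation moves w to w +
  2 pi e, at the price of dividing by a cosine. The decay rate lost by the move, exp (|Im w| / 2),
  is exactly the growth of that cosine.\<close>

lemma norm_exp_Sig_le:
  assumes e: "0 < e" "e \<le> 1" and x: "- pi * e < x0" "x1 < pi * (2 - 2 * e)" "x1 \<le> pi"
  obtains M where "M > 0"
    "\<And>w. x0 \<le> Re w \<Longrightarrow> Re w \<le> x1 \<Longrightarrow> norm (exp (Sig e y w)) \<le> M * exp (- (\<bar>Im w\<bar> * (pi - Re w) / (4 * pi * e)))"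
proof (cases "x0 \<le> x1")
  case False
  show ?thesis by (rule that[of 1]) (use False in auto)
next
  case x01: True
  \<comment> \<open>\<open>p\<close> bounds the argument of \<open>Theta\<close> after the shift by
    2 e, and \<open>p2\<close> below the argument of the cosine, which is shifted by e only; a real
    part moving between two endpoints is largest in modulus at one of them.\<close>
  define p where "p = max \<bar>1 - 2 * e - x0 / pi\<bar> \<bar>1 - 2 * e - x1 / pi\<bar>"
  define p2 where "p2 = max \<bar>1 - e - x0 / pi\<bar> \<bar>1 - e - x1 / pi\<bar>"
  have xd: "x0 / pi > - e" "x1 / pi < 2 - 2 * e" "x0 / pi \<le> x1 / pi" using x x01 by (auto simp: field_simps divide_right_mono)
  have p: "0 \<le> p" "p < 1" and p2: "0 \<le> p2" "p2 < 1" using xd e by (auto simp: p_def p2_def)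
  obtain C where C: "C > 0" "\<And>e a. 0 \<le> e \<Longrightarrow> e \<le> 1 \<Longrightarrow> \<bar>Re a\<bar> \<le> p \<Longrightarrow> norm (Theta e a - Theta 0 a) \<le> C * e\<^sup>2"
    using Theta_approx[OF p] by blast
  define k where "k = cos (pi / 2 * p2)"
  have k: "k > 0" unfolding k_def using p2 by (intro cos_half_pi_mult_pos)
  define M0 where "M0 = exp (C * e + 1 / e) / k"
  have M0: "M0 > 0" using k by (simp add: M0_def)
  have main: "norm (exp (Theta e (1 - w / of_real pi) / of_real e)) \<le> M0 * exp (- (\<bar>Im w\<bar> * (pi - Re w) / (4 * pi * e)))"
    if w: "x0 \<le> Re w" "Re w \<le> x1" for w
  proof -
    define a where "a = 1 - w / of_real pi"
    define v where "v = w + of_real (2 * pi * e)"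
    have rw: "x0 / pi \<le> Re w / pi" "Re w / pi \<le> x1 / pi" using w by (auto simp: divide_right_mono)
    have ra: "\<bar>Re (a - of_real e)\<bar> \<le> p2" "\<bar>Re (a - of_real (2 * e))\<bar> \<le> p"
      using rw unfolding a_def p_def p2_def by (simp_all add: abs_le_iff le_max_iff_disj) linarith+
    have av: "a - of_real (2 * e) = 1 - v / of_real pi" by (simp add: a_def v_def field_simps)
    have "Theta e ((a - of_real e) + of_real e) - Theta e ((a - of_real e) - of_real e) = 2 * of_real e * Theta1 0 (a - of_real e)"
      using e ra(1) p2 by (intro Theta_shift) auto
    then have sh: "Theta e a = Theta e (a - of_real (2 * e)) + 2 * of_real e * Theta1 0 (a - of_real e)"
      by (simp add: algebra_simps)
    define cc where "cc = 2 * cos (of_real (pi / 2) * (a - of_real e))"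
    have r1: "\<bar>Re (a - of_real e)\<bar> < 1" using ra p2 by simp
    have cnz: "cc \<noteq> 0" using Re_cos_pos[OF r1] unfolding cc_def by force
    have "exp (Theta e a / of_real e) = exp (Theta e (a - of_real (2 * e)) / of_real e) * exp (- Ln cc)"
    proof -
      have "(Theta e (a - of_real (2 * e)) + 2 * of_real e * (- Ln cc / 2)) / of_real e = Theta e (a - of_real (2 * e)) / of_real e + - Ln cc"
        unfolding add_divide_distrib using e by simp
      then show ?thesis unfolding sh Theta1_0[OF r1] cc_def[symmetric] by (simp only: exp_add)
    qed
    also have "exp (- Ln cc) = 1 / cc" using exp_Ln[OF cnz] by (simp add: exp_minus inverse_eq_divide)
    finally have n: "norm (exp (Theta e a / of_real e)) = exp (Re (Theta e (a - of_real (2 * e))) / e) / norm cc"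
      by (simp add: norm_mult norm_divide norm_exp_eq_Re Re_divide_of_real)
    have "Re (Theta e (a - of_real (2 * e))) \<le> Re (Fa v) + C * e\<^sup>2"
    proof -
      have "norm (Theta e (a - of_real (2 * e)) - Fa v) \<le> C * e\<^sup>2"
        unfolding Fa_def av[symmetric] using e ra(2) by (intro C(2)) auto
      then have "Re (Theta e (a - of_real (2 * e)) - Fa v) \<le> C * e\<^sup>2"
        using complex_Re_le_cmod order_trans by blast
      then show ?thesis by (simp only: minus_complex.sel)
    qed
    also have "Re (Fa v) \<le> - (\<bar>Im w\<bar> * (pi - Re w - 2 * pi * e) / (4 * pi)) + 1"
    proof -
      have rv: "Re v = Re w + 2 * pi * e" by (simp add: v_def)
      have pe: "0 < pi * e" using e by simp
      have "0 < Re v" "Re v < 2 * pi" unfolding rv using w x pe by (simp_all add: algebra_simps)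
      from Re_Fa_le[OF this] show ?thesis by (simp add: v_def algebra_simps)
    qed
    finally have "Re (Theta e (a - of_real (2 * e))) / e \<le> (- (\<bar>Im w\<bar> * (pi - Re w - 2 * pi * e) / (4 * pi)) + 1 + C * e\<^sup>2) / e"
      using e by (intro divide_right_mono) auto
    also have "\<dots> = - (\<bar>Im w\<bar> * (pi - Re w) / (4 * pi * e)) + \<bar>Im w\<bar> / 2 + (C * e + 1 / e)"
      using e by (simp add: field_simps power2_eq_square)
    finally have E: "exp (Re (Theta e (a - of_real (2 * e))) / e) \<le> exp (- (\<bar>Im w\<bar> * (pi - Re w) / (4 * pi * e)) + \<bar>Im w\<bar> / 2 + (C * e + 1 / e))"
      by simp
    have cl: "norm cc \<ge> k * exp (\<bar>Im w\<bar> / 2)"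
    proof -
      define q where "q = of_real (pi / 2) * (a - of_real e)"
      have imq: "\<bar>Im q\<bar> = \<bar>Im w\<bar> / 2" by (simp add: q_def a_def abs_mult)
      have "\<bar>Re q\<bar> \<le> pi / 2 * p2" using ra(1) by (simp add: q_def abs_mult)
      then have "k \<le> cos \<bar>Re q\<bar>" unfolding k_def using p2 by (intro cos_monotone_0_pi_le) auto
      then have "k * cosh (Im q) \<le> \<bar>cos (Re q)\<bar> * cosh (Im q)" by (intro mult_right_mono) auto
      also have "\<dots> \<le> norm (cos q)" by (rule norm_cos_ge)
      finally have 1: "k * (2 * cosh (Im q)) \<le> norm cc" by (simp add: cc_def q_def norm_mult)
      have "exp \<bar>Im q\<bar> \<le> 2 * cosh (Im q)" by (simp add: cosh_field_def abs_if)
      then have "k * exp \<bar>Im q\<bar> \<le> k * (2 * cosh (Im q))" using k by (intro mult_left_mono) auto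
      then show ?thesis using 1 imq by simp
    qed
    have "norm (exp (Theta e a / of_real e)) \<le> exp (- (\<bar>Im w\<bar> * (pi - Re w) / (4 * pi * e)) + \<bar>Im w\<bar> / 2 + (C * e + 1 / e)) / (k * exp (\<bar>Im w\<bar> / 2))"
      unfolding n using E cl k by (intro frac_le) auto
    also have "\<dots> = M0 * exp (- (\<bar>Im w\<bar> * (pi - Re w) / (4 * pi * e)))"
      unfolding M0_def exp_add by simp
    finally show ?thesis by (simp add: a_def)
  qed
  \<comment> \<open>The imaginary translation by y changes |Im w| by at most |y|, which costs a
    constant factor.\<close>
  define M where "M = M0 * exp (\<bar>y\<bar> * (pi - x0) / (4 * pi * e))"
  show ?thesis
  proof (rule that[of M])
    show "M > 0" using M0 by (simp add: M_def)
    fix w assume w: "x0 \<le> Re w" "Re w \<le> x1"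
    have "norm (exp (Sig e y w)) \<le> M0 * exp (- (\<bar>Im w + y\<bar> * (pi - Re w) / (4 * pi * e)))"
      using main[of "w + \<i> * of_real y"] w by (simp add: Sig_def)
    also have "\<dots> \<le> M0 * exp (\<bar>y\<bar> * (pi - x0) / (4 * pi * e) + - (\<bar>Im w\<bar> * (pi - Re w) / (4 * pi * e)))"
    proof -
      have "\<bar>Im w\<bar> * (pi - Re w) \<le> (\<bar>Im w + y\<bar> + \<bar>y\<bar>) * (pi - Re w)" using w x by (intro mult_right_mono) auto
      also have "\<dots> \<le> \<bar>Im w + y\<bar> * (pi - Re w) + \<bar>y\<bar> * (pi - x0)"
        using w by (simp add: distrib_right mult_left_mono)
      finally have "\<bar>Im w\<bar> * (pi - Re w) / (4 * pi * e) \<le> (\<bar>Im w + y\<bar> * (pi - Re w) + \<bar>y\<bar> * (pi - x0)) / (4 * pi * e)"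
        using e by (intro divide_right_mono) auto
      then show ?thesis using M0 by (simp add: add_divide_distrib)
    qed
    also have "\<dots> = M * exp (- (\<bar>Im w\<bar> * (pi - Re w) / (4 * pi * e)))" unfolding M_def exp_add by (simp only: mult.assoc)
    finally show "norm (exp (Sig e y w)) \<le> M * exp (- (\<bar>Im w\<bar> * (pi - Re w) / (4 * pi * e)))" .
  qed
qed

section \<open>The potential and its saddle point\<close>

definition phi1 :: "complex \<Rightarrow> complex" where
  "phi1 w = (Ln (2 * sin (w / 2)) - \<i> * w / 2) / of_real (2 * pi)"

definition phi2 :: "complex \<Rightarrow> complex" where
  "phi2 w = (cos (w / 2) / sin (w / 2) - \<i>) / of_real (4 * pi)"

lemma phi1_deriv:
  assumes "0 < Re w" "Re w < pi"
  shows "(phi1 has_field_derivative phi2 w) (at w)"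
proof -
  have re: "Re (2 * sin (w / 2)) > 0" by (rule sin_half_plane[OF assms])
  then have nz: "sin (w / 2) \<noteq> 0" by force
  have np: "2 * sin (w / 2) \<notin> \<real>\<^sub>\<le>\<^sub>0" using re by (simp add: complex_nonpos_Reals_iff)
  have "((\<lambda>w. 2 * sin (w / 2)) has_field_derivative cos (w / 2)) (at w)"
    by (auto intro!: derivative_eq_intros)
  from DERIV_chain2[OF has_field_derivative_Ln[OF np] this]
  have "((\<lambda>w. Ln (2 * sin (w / 2))) has_field_derivative inverse (2 * sin (w / 2)) * cos (w / 2)) (at w)" .
  then have "((\<lambda>w. (Ln (2 * sin (w / 2)) - \<i> * w / 2) / of_real (2 * pi)) has_field_derivative
     (inverse (2 * sin (w / 2)) * cos (w / 2) - \<i> / 2) / of_real (2 * pi)) (at w)"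
    by (intro DERIV_cdivide DERIV_diff) (auto intro!: derivative_eq_intros)
  also have "(inverse (2 * sin (w / 2)) * cos (w / 2) - \<i> / 2) / of_real (2 * pi) = phi2 w"
    using nz by (simp add: phi2_def divide_simps)
  finally show ?thesis unfolding phi1_def[abs_def] .
qed

lemma phi_deriv': "0 < Re w \<Longrightarrow> Re w < pi \<Longrightarrow> (phi has_field_derivative phi1 w) (at w)"
  unfolding phi1_def using pi_gt_zero by (intro phi_deriv) linarith+

text \<open>The real part of cot s has the sign of sin (Re s) cos (Re s), and the summand - i is
  imaginary. Since differentiating twice in a vertical direction produces a factor -1, the real part
  of the potential is strictly concave on vertical lines.\<close>

lemma Re_phi2_pos:
  assumes "0 < Re w" "Re w < pi"
  shows "Re (phi2 w) > 0"
proof -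
  define s where "s = w / 2"
  have re: "Re (2 * sin s) > 0" unfolding s_def by (rule sin_half_plane[OF assms])
  then have nz: "sin s \<noteq> 0" by force
  have "Re (cos s * cnj (sin s)) = sin (Re s) * cos (Re s) * (cosh (Im s) ^ 2 - sinh (Im s) ^ 2)"
    by (simp add: Re_cos Im_cos Re_sin Im_sin cosh_field_def sinh_field_def field_simps power2_eq_square)
  also have "\<dots> = sin (Re s) * cos (Re s)" by (simp add: cosh_square_eq)
  also have "\<dots> > 0" using assms unfolding s_def by (intro mult_pos_pos sin_gt_zero cos_gt_zero) auto
  finally have p: "Re (cos s * cnj (sin s)) > 0" .
  have "cos s / sin s = cos s * cnj (sin s) / of_real ((norm (sin s))\<^sup>2)"
    by (rule complex_div_cnj)
  then have "Re (cos s / sin s) = Re (cos s * cnj (sin s)) / (norm (sin s))\<^sup>2"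
    by (simp only: Re_divide_of_real)
  also have "\<dots> > 0" using p nz by simp
  finally have "Re (cos s / sin s) > 0" .
  then show ?thesis unfolding phi2_def s_def[symmetric] Re_divide_of_real by simp
qed

text \<open>The leading coefficient in 1 / e of the exponent \<open>Sexp\<close>, see
  \<open>Sexp_eq_Vf\<close>.\<close>

definition Vf :: "real \<Rightarrow> real \<Rightarrow> real \<Rightarrow> complex \<Rightarrow> complex" where
  "Vf y1 y2 y3 w = phi (w + \<i> * of_real y1) + phi (w + \<i> * of_real y2) + phi (w + \<i> * of_real y3) - \<i> * w / 4"

definition Vf1 :: "real \<Rightarrow> real \<Rightarrow> real \<Rightarrow> complex \<Rightarrow> complex" where
  "Vf1 y1 y2 y3 w = phi1 (w + \<i> * of_real y1) + phi1 (w + \<i> * of_real y2) + phi1 (w + \<i> * of_real y3) - \<i> / 4"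

definition Vf2 :: "real \<Rightarrow> real \<Rightarrow> real \<Rightarrow> complex \<Rightarrow> complex" where
  "Vf2 y1 y2 y3 w = phi2 (w + \<i> * of_real y1) + phi2 (w + \<i> * of_real y2) + phi2 (w + \<i> * of_real y3)"

lemma Vf_deriv:
  assumes "0 < Re w" "Re w < pi"
  shows "(Vf y1 y2 y3 has_field_derivative Vf1 y1 y2 y3 w) (at w)"
    and "(Vf1 y1 y2 y3 has_field_derivative Vf2 y1 y2 y3 w) (at w)"
proof -
  have sh: "((\<lambda>w. f (w + \<i> * of_real y)) has_field_derivative f' (w + \<i> * of_real y)) (at w)"
    if "\<And>w. 0 < Re w \<Longrightarrow> Re w < pi \<Longrightarrow> (f has_field_derivative f' w) (at w)" for f f' y
  proof -
    have g: "((\<lambda>w. w + \<i> * of_real y) has_field_derivative 1) (at w)" by (auto intro!: derivative_eq_intros)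
    have f: "(f has_field_derivative f' (w + \<i> * of_real y)) (at (w + \<i> * of_real y))" by (rule that) (use assms in auto)
    show ?thesis using DERIV_chain'[OF g f] by simp
  qed
  show "(Vf y1 y2 y3 has_field_derivative Vf1 y1 y2 y3 w) (at w)"
    unfolding Vf_def[abs_def] Vf1_def
    by (intro DERIV_add DERIV_diff sh phi_deriv') (auto intro!: derivative_eq_intros)
  show "(Vf1 y1 y2 y3 has_field_derivative Vf2 y1 y2 y3 w) (at w)"
    unfolding Vf1_def[abs_def] Vf2_def diff_conv_add_uminus
    by (rule DERIV_cong[OF DERIV_add[OF _ DERIV_const]]) (auto intro!: DERIV_add sh phi1_deriv)
qed

lemma Re_Vf2_pos: "0 < Re w \<Longrightarrow> Re w < pi \<Longrightarrow> Re (Vf2 y1 y2 y3 w) > 0"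
  unfolding Vf2_def plus_complex.sel by (intro add_pos_pos Re_phi2_pos) auto

lemma holomorphic_taylor_4:
  fixes f :: "complex \<Rightarrow> complex"
  assumes f: "f holomorphic_on S" and S: "open S" "w \<in> S"
  obtains d C where "d > 0" "\<And>h. norm h \<le> d \<Longrightarrow>
    norm (f (w + h) - (f w + deriv f w * h + (deriv ^^ 2) f w / 2 * h\<^sup>2 + (deriv ^^ 3) f w / 6 * h^3)) \<le> C * norm h ^ 4"
proof -
  obtain d where d: "d > 0" "cball w d \<subseteq> S" using S open_contains_cball by blast
  have "continuous_on (cball w d) ((deriv ^^ 4) f)"
    using holomorphic_on_imp_continuous_on[OF holomorphic_higher_deriv[OF f S(1)]] d continuous_on_subset by blast
  then have "bounded ((deriv ^^ 4) f ` cball w d)"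
    using compact_continuous_image compact_imp_bounded compact_cball by blast
  then obtain B where B: "\<And>z. z \<in> cball w d \<Longrightarrow> norm ((deriv ^^ 4) f z) \<le> B" unfolding bounded_iff by blast
  have T: "norm ((deriv ^^ 0) f z - (\<Sum>i\<le>3. (deriv ^^ i) f w * (z - w) ^ i / fact i)) \<le> B * norm (z - w) ^ Suc 3 / fact 3"
    if "z \<in> cball w d" for z
  proof (rule complex_Taylor[OF convex_cball])
    show "((deriv ^^ i) f has_field_derivative (deriv ^^ Suc i) f x) (at x within cball w d)" if "x \<in> cball w d" for i x
      using has_field_derivative_higher_deriv[OF f S(1), of x i] that d has_field_derivative_at_within by blast
  qed (use that B d in \<open>auto simp: eval_nat_numeral\<close>)
  show ?thesis
  proof (rule that[OF d(1), of "B / fact 3"])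
    fix h :: complex assume h: "norm h \<le> d"
    have "w + h \<in> cball w d" using h by (simp add: dist_norm)
    from T[OF this] show "norm (f (w + h) - (f w + deriv f w * h + (deriv ^^ 2) f w / 2 * h\<^sup>2 + (deriv ^^ 3) f w / 6 * h^3)) \<le> B / fact 3 * norm h ^ 4"
      by (simp add: eval_nat_numeral algebra_simps)
  qed
qed

text \<open>Integrate the bound on the second derivative twice: this gives quadratic decay up to D,
  and beyond D concavity preserves the slope reached at D, hence linear decay.\<close>

lemma concave_bounds_pos:
  fixes r r1 r2 :: "real \<Rightarrow> real"
  assumes d: "\<And>x. (r has_real_derivative r1 x) (at x)" "\<And>x. (r1 has_real_derivative r2 x) (at x)"
    and z: "r 0 = 0" "r1 0 = 0" and neg: "\<And>x. r2 x \<le> 0" and near: "\<And>x. 0 \<le> x \<Longrightarrow> x \<le> D \<Longrightarrow> r2 x \<le> - 2 * k"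
    and k: "k > 0" "D > 0" and x: "x \<ge> 0"
  shows "x \<le> D \<Longrightarrow> r x \<le> - (k * x\<^sup>2)" "D \<le> x \<Longrightarrow> r x \<le> - (k * D * x)"
proof -
  have 1: "r1 x \<le> - 2 * k * x" if "0 \<le> x" "x \<le> D" for x
  proof -
    have "r1 x + 2 * k * x \<le> r1 0 + 2 * k * 0"
    proof (rule DERIV_nonpos_imp_nonincreasing[OF that(1), of "\<lambda>x. r1 x + 2 * k * x"], intro exI conjI)
      show "((\<lambda>x. r1 x + 2 * k * x) has_real_derivative r2 u + 2 * k) (at u)" for u
        by (auto intro!: derivative_eq_intros d)
      show "r2 u + 2 * k \<le> 0" if "0 \<le> u" "u \<le> x" for u using near[of u] that \<open>x \<le> D\<close> by simp
    qed
    then show ?thesis using z by simp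
  qed
  have 2: "r x \<le> - (k * x\<^sup>2)" if "0 \<le> x" "x \<le> D" for x
  proof -
    have "r x + k * x\<^sup>2 \<le> r 0 + k * 0\<^sup>2"
    proof (rule DERIV_nonpos_imp_nonincreasing[OF that(1), of "\<lambda>x. r x + k * x\<^sup>2"], intro exI conjI)
      show "((\<lambda>x. r x + k * x\<^sup>2) has_real_derivative r1 u + k * (2 * u)) (at u)" for u
        by (auto intro!: derivative_eq_intros d)
      show "r1 u + k * (2 * u) \<le> 0" if "0 \<le> u" "u \<le> x" for u using 1[of u] that \<open>x \<le> D\<close> by simp
    qed
    then show ?thesis using z by simp
  qed
  show "x \<le> D \<Longrightarrow> r x \<le> - (k * x\<^sup>2)" using 2 x by simp
  have 3: "r1 x \<le> - 2 * k * D" if "D \<le> x" for x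
  proof -
    have "r1 x \<le> r1 D" by (rule DERIV_nonpos_imp_nonincreasing[OF that]) (use d neg in blast)
    then show ?thesis using 1[of D] k by simp
  qed
  show "r x \<le> - (k * D * x)" if "D \<le> x"
  proof -
    have "r x + 2 * k * D * x \<le> r D + 2 * k * D * D"
    proof (rule DERIV_nonpos_imp_nonincreasing[OF that, of "\<lambda>x. r x + 2 * k * D * x"], intro exI conjI)
      show "((\<lambda>x. r x + 2 * k * D * x) has_real_derivative r1 u + 2 * k * D) (at u)" for u
        by (auto intro!: derivative_eq_intros d)
      show "r1 u + 2 * k * D \<le> 0" if "D \<le> u" for u using 3[OF that] by simp
    qed
    moreover have "r D \<le> - (k * D\<^sup>2)" using 2[of D] k by simp
    moreover have "k * D * D \<le> k * D * x" using that k by (intro mult_left_mono) auto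
    ultimately show ?thesis by (simp add: power2_eq_square)
  qed
qed

lemma concave_bounds:
  fixes r r1 r2 :: "real \<Rightarrow> real"
  assumes d: "\<And>x. (r has_real_derivative r1 x) (at x)" "\<And>x. (r1 has_real_derivative r2 x) (at x)"
    and z: "r 0 = 0" "r1 0 = 0" and neg: "\<And>x. r2 x \<le> 0" and near: "\<And>x. \<bar>x\<bar> \<le> D \<Longrightarrow> r2 x \<le> - 2 * k"
    and k: "k > 0" "D > 0"
  shows "\<bar>x\<bar> \<le> D \<Longrightarrow> r x \<le> - (k * x\<^sup>2)" "D \<le> \<bar>x\<bar> \<Longrightarrow> r x \<le> - (k * D * \<bar>x\<bar>)"
proof -
  note P = concave_bounds_pos[of r r1 r2 D k, OF d z neg near k]
  have d': "((\<lambda>x. r (- x)) has_real_derivative - r1 (- x)) (at x)" "((\<lambda>x. - r1 (- x)) has_real_derivative r2 (- x)) (at x)" for x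
  proof -
    have g: "((\<lambda>x. - x) has_real_derivative - 1) (at x)" by (auto intro!: derivative_eq_intros)
    show "((\<lambda>x. r (- x)) has_real_derivative - r1 (- x)) (at x)" using DERIV_chain'[OF g d(1)] by simp
    show "((\<lambda>x. - r1 (- x)) has_real_derivative r2 (- x)) (at x)" using DERIV_minus[OF DERIV_chain'[OF g d(2)]] by simp
  qed
  note N = concave_bounds_pos[of "\<lambda>x. r (- x)" "\<lambda>x. - r1 (- x)" "\<lambda>x. r2 (- x)" D k "- x", OF d' _ _ neg near k]
  show "\<bar>x\<bar> \<le> D \<Longrightarrow> r x \<le> - (k * x\<^sup>2)" using P(1)[of x] N(1) z by (cases "x \<ge> 0") auto
  show "D \<le> \<bar>x\<bar> \<Longrightarrow> r x \<le> - (k * D * \<bar>x\<bar>)" using P(2)[of x] N(2) z by (cases "x \<ge> 0") auto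
qed

text \<open>The exact w-dependent exponent of the integrand, before any approximation of the double
  sine functions.\<close>

definition Sexp :: "real \<Rightarrow> real \<Rightarrow> real \<Rightarrow> real \<Rightarrow> complex \<Rightarrow> complex" where
  "Sexp y1 y2 y3 e w = Sig e y1 w + Sig e y2 w + Sig e y3 w
     - \<i> / of_real (8 * pi * e) * ((w + \<i> * of_real y1)\<^sup>2 + (w + \<i> * of_real y2)\<^sup>2 + (w + \<i> * of_real y3)\<^sup>2)
     - \<i> * w / of_real (4 * e) - \<i> * w"

lemma Sexp_eq_Vf:
  assumes "e \<noteq> 0"
  shows "Sexp y1 y2 y3 e w = Vf y1 y2 y3 w / of_real e - \<i> * w
     + ((Sig e y1 w - Fa (w + \<i> * of_real y1) / of_real e) + (Sig e y2 w - Fa (w + \<i> * of_real y2) / of_real e) + (Sig e y3 w - Fa (w + \<i> * of_real y3) / of_real e))"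
  using assms unfolding Sexp_def Vf_def phi_def by (simp add: field_simps)

text \<open>Along w0 + i t the term - i w contributes the linear term t, the potential contributes a
  concave real part with maximum at t = 0, and the three replacements of \<open>Theta e\<close> by
  \<open>Theta 0\<close> contribute a remainder O(e). These are the hypotheses of
  \<open>laplace_expansion\<close>, on the unmodified vertical line.\<close>

lemma saddle_integral:
  assumes w0: "0 < Re w0" "Re w0 < pi" and crit: "Vf1 y1 y2 y3 w0 = 0"
  shows "\<exists>K e1. e1 > 0 \<and> (\<forall>e. 0 < e \<and> e < e1 \<longrightarrow>
    norm ((LINT t|lborel. exp (Sexp y1 y2 y3 e (w0 + \<i> * of_real t))) - exp (Vf y1 y2 y3 w0 / of_real e - \<i> * w0) * (of_real (sqrt e) * (of_real (sqrt pi) / csqrt (Vf2 y1 y2 y3 w0 / 2))))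
      \<le> norm (exp (Vf y1 y2 y3 w0 / of_real e - \<i> * w0)) * (K * (e * sqrt e)))"
proof -
  define S where "S = {w. 0 < Re w \<and> Re w < pi}"
  have S: "open S" "w0 \<in> S" using w0 by (auto simp: S_def open_Re_strip)
  let ?V = "Vf y1 y2 y3" let ?V1 = "Vf1 y1 y2 y3" let ?V2 = "Vf2 y1 y2 y3"
  have hol: "?V holomorphic_on S" "?V1 holomorphic_on S"
    using Vf_deriv S(1) unfolding S_def by (auto simp: holomorphic_on_open) blast+
  define L where "L = (\<lambda>t. w0 + \<i> * of_real t)"
  have LS: "0 < Re (L t)" "Re (L t) < pi" "L t \<in> S" for t using w0 by (auto simp: L_def S_def)
  have L0: "L 0 = w0" by (simp add: L_def)
  have Lv: "(L has_vector_derivative \<i>) (at t)" for t unfolding L_def by (auto intro!: derivative_eq_intros)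
  obtain d1 C1 where T: "d1 > 0" "\<And>h. norm h \<le> d1 \<Longrightarrow>
    norm (?V (w0 + h) - (?V w0 + deriv ?V w0 * h + (deriv ^^ 2) ?V w0 / 2 * h\<^sup>2 + (deriv ^^ 3) ?V w0 / 6 * h^3)) \<le> C1 * norm h ^ 4"
    using holomorphic_taylor_4[OF hol(1) S] by blast
  have D1: "deriv ?V w0 = 0" using DERIV_imp_deriv[OF Vf_deriv(1)[OF w0]] crit by simp
  have D2: "(deriv ^^ 2) ?V w0 = ?V2 w0"
  proof -
    have "(deriv ^^ 2) ?V w0 = deriv (deriv ?V) w0" by (simp add: eval_nat_numeral)
    also have "\<dots> = deriv ?V1 w0"
    proof (rule deriv_cong_ev)
      show "\<forall>\<^sub>F z in nhds w0. deriv ?V z = ?V1 z"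
        unfolding eventually_nhds using S by (intro exI[of _ S]) (auto simp: S_def intro!: DERIV_imp_deriv Vf_deriv)
    qed simp
    also have "\<dots> = ?V2 w0" by (rule DERIV_imp_deriv[OF Vf_deriv(2)[OF w0]])
    finally show ?thesis .
  qed
  define \<psi> where "\<psi> = (\<lambda>t. ?V (L t) - ?V w0)"
  define A where "A = ?V2 w0 / 2"
  \<comment> \<open>The Taylor polynomial is taken at the increment i t: the square turns V'' / 2
    into - A, and i^3 = - i yields this cubic coefficient.\<close>
  define B where "B = - \<i> * (deriv ^^ 3) ?V w0 / 6"
  have i3: "\<i> ^ 3 = - \<i>" by (simp add: power3_eq_cube)
  have A: "Re A > 0" using Re_Vf2_pos[OF w0] by (simp add: A_def)
  have taylor1: "norm (\<psi> t + A * of_real (t\<^sup>2) - B * of_real (t^3)) \<le> C1 * t^4" if "\<bar>t\<bar> \<le> d1" for t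
  proof -
    have "\<psi> t + A * of_real (t\<^sup>2) - B * of_real (t^3) = ?V (w0 + \<i> * of_real t) - (?V w0 + deriv ?V w0 * (\<i> * of_real t) + (deriv ^^ 2) ?V w0 / 2 * (\<i> * of_real t)\<^sup>2 + (deriv ^^ 3) ?V w0 / 6 * (\<i> * of_real t)^3)"
      unfolding D1 D2 \<psi>_def A_def B_def L_def by (simp add: power_mult_distrib i3)
    then show ?thesis using T(2)[of "\<i> * of_real t"] that by (simp add: norm_mult power_mult_distrib)
  qed
  define r where "r = (\<lambda>t. Re (\<psi> t))"
  define r1 where "r1 = (\<lambda>t. Re (\<i> * ?V1 (L t)))"
  define r2 where "r2 = (\<lambda>t. Re (\<i> * (\<i> * ?V2 (L t))))"
  have dr: "(r has_real_derivative r1 t) (at t)" for t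
  proof -
    have "((?V \<circ> L) has_vector_derivative \<i> * ?V1 (L t)) (at t)"
      by (rule field_vector_diff_chain_at[OF Lv Vf_deriv(1)[OF LS(1,2)]])
    from has_vector_derivative_diff[OF this has_vector_derivative_const[of "?V w0"]]
    have "(\<psi> has_vector_derivative \<i> * ?V1 (L t)) (at t)" by (simp add: \<psi>_def o_def)
    from bounded_linear.has_vector_derivative[OF bounded_linear_Re this] show ?thesis
      by (simp add: r_def r1_def has_real_derivative_iff_has_vector_derivative)
  qed
  have dr1: "(r1 has_real_derivative r2 t) (at t)" for t
  proof -
    have "((?V1 \<circ> L) has_vector_derivative \<i> * ?V2 (L t)) (at t)"
      by (rule field_vector_diff_chain_at[OF Lv Vf_deriv(2)[OF LS(1,2)]])
    from bounded_linear.has_vector_derivative[OF bounded_linear_Re has_vector_derivative_mult_right[OF this, of \<i>]]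
    show ?thesis by (simp only: r1_def r2_def has_real_derivative_iff_has_vector_derivative o_def)
  qed
  have r2: "r2 t = - Re (?V2 (L t))" for t by (simp add: r2_def)
  have r2neg: "r2 t < 0" for t using Re_Vf2_pos[OF LS(1,2)] by (simp add: r2)
  define d where "d = min 1 d1"
  have d: "d > 0" "d \<le> 1" "d \<le> d1" using T(1) by (auto simp: d_def)
  obtain k where k: "k > 0" "\<And>t. \<bar>t\<bar> \<le> d \<Longrightarrow> r2 t \<le> - 2 * k"
  proof -
    have "continuous_on S ?V2"
    proof (rule continuous_on_eq[OF holomorphic_on_imp_continuous_on[OF holomorphic_deriv[OF hol(2) S(1)]]])
      show "deriv ?V1 z = ?V2 z" if "z \<in> S" for z using that by (auto simp: S_def intro!: DERIV_imp_deriv Vf_deriv)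
    qed
    moreover have "continuous_on {-d..d} L" unfolding L_def by (intro continuous_intros)
    ultimately have "continuous_on {-d..d} (\<lambda>t. ?V2 (L t))" by (rule continuous_on_compose2) (use LS in auto)
    then have "continuous_on {-d..d} r2" unfolding r2 by (intro continuous_intros)
    then obtain t0 where t0: "\<forall>t\<in>{-d..d}. r2 t \<le> r2 t0"
      using continuous_attains_sup[of "{-d..d}" r2] d by force
    show ?thesis
    proof (rule that[of "- r2 t0 / 2"])
      show "r2 t \<le> - 2 * (- r2 t0 / 2)" if "\<bar>t\<bar> \<le> d" for t using t0 that by (auto simp: abs_le_iff)
    qed (use r2neg[of t0] in simp)
  qed
  have z: "r 0 = 0" "r1 0 = 0" by (simp_all add: r_def r1_def \<psi>_def L0 crit)
  have CB1: "r t \<le> - (k * t\<^sup>2)" if "\<bar>t\<bar> \<le> d" for t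
    by (rule concave_bounds(1)[of r r1 r2]) (use dr dr1 z r2neg k d that in \<open>auto intro: less_imp_le\<close>)
  have CB2: "r t \<le> - (k * d * \<bar>t\<bar>)" if "d \<le> \<bar>t\<bar>" for t
    by (rule concave_bounds(2)[of r r1 r2]) (use dr dr1 z r2neg k d that in \<open>auto intro: less_imp_le\<close>)
  \<comment> \<open>Concavity gives rate k inside and k d outside; because d <= 1 the smaller number
    k d serves for both.\<close>
  define k0 where "k0 = k * d"
  have k0: "k0 > 0" "k0 \<le> k" using k(1) d by (auto simp: k0_def mult_left_le)
  have near: "Re (\<psi> t) \<le> - (k0 * t\<^sup>2)" if "\<bar>t\<bar> \<le> d" for t
    using CB1[OF that] mult_right_mono[OF k0(2), of "t\<^sup>2"] by (simp add: r_def)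
  have far: "Re (\<psi> t) \<le> - (k0 * \<bar>t\<bar>)" if "d \<le> \<bar>t\<bar>" for t
    using CB2[OF that] by (simp add: r_def k0_def)
  \<comment> \<open>The real part of the argument of \<open>Theta\<close> is constant along the line
    and not affected by the shifts y, so one closed substrip serves all three factors.\<close>
  define p where "p = \<bar>1 - Re w0 / pi\<bar>"
  have p: "0 \<le> p" "p < 1" using w0 by (auto simp: p_def abs_less_iff field_simps)
  obtain C2 where C2: "C2 > 0" "\<And>e a. 0 \<le> e \<Longrightarrow> e \<le> 1 \<Longrightarrow> \<bar>Re a\<bar> \<le> p \<Longrightarrow> norm (Theta e a - Theta 0 a) \<le> C2 * e\<^sup>2"
    using Theta_approx[OF p] by blast
  define Rj where "Rj = (\<lambda>e y t. Sig e y (L t) - Fa (L t + \<i> * of_real y) / of_real e)"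
  have Rj: "norm (Rj e y t) \<le> C2 * e" if "0 < e" "e < 1" for e y t
  proof -
    have "Rj e y t = (Theta e (1 - (L t + \<i> * of_real y) / of_real pi) - Theta 0 (1 - (L t + \<i> * of_real y) / of_real pi)) / of_real e"
      by (simp add: Rj_def Sig_def Fa_def diff_divide_distrib)
    also have "norm \<dots> \<le> C2 * e\<^sup>2 / e"
      unfolding norm_divide norm_of_real using that C2(2)[of e "1 - (L t + \<i> * of_real y) / of_real pi"]
      by (simp add: divide_right_mono p_def L_def)
    finally show ?thesis using that by (simp add: power2_eq_square)
  qed
  \<comment> \<open>Set to 0 for e <= 0, since \<open>laplace_expansion\<close> asks for
    measurability at every real e.\<close>
  define R where "R = (\<lambda>e t. if 0 < e then Rj e y1 t + Rj e y2 t + Rj e y3 t else 0)"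
  define C where "C = max \<bar>C1\<bar> (3 * C2)"
  have Lc: "continuous_on UNIV L" unfolding L_def by (intro continuous_intros)
  have Rm: "R e \<in> borel_measurable borel" for e
  proof (cases "0 < e")
    case True
    have "continuous_on UNIV (\<lambda>t. Rj e y t)" for y
    proof -
      have "continuous_on UNIV (\<lambda>t. Sig e y (L t))"
      proof (rule continuous_on_compose2[OF holomorphic_on_imp_continuous_on[OF Sig_holomorphic[OF True]] Lc], safe)
        fix t
        have reL: "Re (L t) = Re w0" by (simp add: L_def)
        have pe: "0 < pi * e" using True by simp
        show "- pi * e < Re (L t)" unfolding reL using w0 pe by linarith
        show "Re (L t) < pi * (2 + e)" unfolding reL distrib_left using w0 pe by linarith
      qed
      moreover have "continuous_on UNIV (\<lambda>t. Fa (L t + \<i> * of_real y))"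
      proof (rule continuous_on_compose2[where g = Fa and f = "\<lambda>t. L t + \<i> * of_real y"])
        show "continuous_on {w. 0 < Re w \<and> Re w < 2 * pi} Fa"
          by (intro continuous_at_imp_continuous_on ballI DERIV_isCont[OF Fa_deriv]) auto
        show "continuous_on UNIV (\<lambda>t. L t + \<i> * of_real y)" by (intro continuous_intros Lc)
      qed (use w0 in \<open>auto simp: L_def\<close>)
      ultimately show ?thesis unfolding Rj_def using True by (intro continuous_intros) auto
    qed
    then have "continuous_on UNIV (\<lambda>t. Rj e y1 t + Rj e y2 t + Rj e y3 t)" by (intro continuous_intros)
    then show ?thesis using True unfolding R_def by (simp add: borel_measurable_continuous_onI)
  qed (simp add: R_def)
  have \<psi>m: "\<psi> \<in> borel_measurable borel"
  proof (rule borel_measurable_continuous_onI)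
    show "continuous_on UNIV \<psi>" unfolding \<psi>_def
      by (intro continuous_intros continuous_on_compose2[OF holomorphic_on_imp_continuous_on[OF hol(1)] Lc]) (use LS in auto)
  qed
  have "\<exists>K e1. e1 > 0 \<and> (\<forall>e. 0 < e \<and> e < e1 \<longrightarrow>
    norm ((LINT x|lborel. exp (\<psi> x / of_real e + of_real x + R e x)) - of_real (sqrt e) * (of_real (sqrt pi) / csqrt A)) \<le> K * (e * sqrt e))"
  proof (rule laplace_expansion[OF A d(1) k0(1) zero_less_one \<psi>m Rm, where B = B and C = C])
    show "norm (\<psi> x + A * of_real (x\<^sup>2) - B * of_real (x^3)) \<le> C * x^4" if "\<bar>x\<bar> \<le> d" for x
    proof -
      have "norm (\<psi> x + A * of_real (x\<^sup>2) - B * of_real (x^3)) \<le> C1 * x^4" using taylor1[of x] that d by simp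
      also have "\<dots> \<le> C * x^4" by (intro mult_right_mono) (auto simp: C_def)
      finally show ?thesis .
    qed
    show "norm (R e x) \<le> C * e" if "0 < e" "e < 1" for e x
    proof -
      have "norm (R e x) \<le> C2 * e + C2 * e + C2 * e"
        using norm_triangle_mono[OF norm_triangle_mono[OF Rj[OF that, of y1 x] Rj[OF that, of y2 x]] Rj[OF that, of y3 x]] that
        by (simp add: R_def)
      also have "\<dots> = 3 * C2 * e" by simp
      also have "\<dots> \<le> C * e" using that by (intro mult_right_mono) (auto simp: C_def)
      finally show ?thesis .
    qed
  qed (use near far in auto)
  then obtain K e1 where K: "e1 > 0" "\<And>e. 0 < e \<Longrightarrow> e < e1 \<Longrightarrow>
    norm ((LINT x|lborel. exp (\<psi> x / of_real e + of_real x + R e x)) - of_real (sqrt e) * (of_real (sqrt pi) / csqrt A)) \<le> K * (e * sqrt e)"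
    by blast
  show ?thesis
  proof (rule exI[of _ K], rule exI[of _ e1], intro conjI allI impI)
    show "e1 > 0" by (rule K(1))
    fix e assume e: "0 < e \<and> e < e1"
    define P where "P = exp (?V w0 / of_real e - \<i> * w0)"
    have "exp (Sexp y1 y2 y3 e (w0 + \<i> * of_real t)) = P * exp (\<psi> t / of_real e + of_real t + R e t)" for t
    proof -
      have "Sexp y1 y2 y3 e (L t) = (?V w0 / of_real e - \<i> * w0) + (\<psi> t / of_real e + of_real t + R e t)"
        using e unfolding R_def Rj_def \<psi>_def by (subst Sexp_eq_Vf) (simp_all add: diff_divide_distrib L_def algebra_simps)
      then show ?thesis unfolding P_def exp_add[symmetric] L_def by simp
    qed
    then have "(LINT t|lborel. exp (Sexp y1 y2 y3 e (w0 + \<i> * of_real t))) = P * (LINT x|lborel. exp (\<psi> x / of_real e + of_real x + R e x))"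
      by simp
    then have "norm ((LINT t|lborel. exp (Sexp y1 y2 y3 e (w0 + \<i> * of_real t))) - P * (of_real (sqrt e) * (of_real (sqrt pi) / csqrt A)))
       = norm P * norm ((LINT x|lborel. exp (\<psi> x / of_real e + of_real x + R e x)) - of_real (sqrt e) * (of_real (sqrt pi) / csqrt A))"
      by (simp add: norm_mult[symmetric] right_diff_distrib)
    also have "\<dots> \<le> norm P * (K * (e * sqrt e))" using K(2) e by (intro mult_left_mono) auto
    finally show "norm ((LINT t|lborel. exp (Sexp y1 y2 y3 e (w0 + \<i> * of_real t))) - exp (?V w0 / of_real e - \<i> * w0) * (of_real (sqrt e) * (of_real (sqrt pi) / csqrt (?V2 w0 / 2))))
      \<le> norm (exp (?V w0 / of_real e - \<i> * w0)) * (K * (e * sqrt e))"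
      by (simp only: P_def A_def)
  qed
qed

section \<open>Reduction of the 6j symbol to a saddle point integral\<close>

text \<open>After completing the square every factor T_b has exponent proportional to E. The
  individual deviations p_k of the arguments from Q / 2 = h occur on the right only through the
  three sums y_j belonging to the quadrilaterals; this is why the asymptotics depends on sums over
  opposite edges.\<close>

lemma tb_exponent_identity:
  fixes h u k p1 p2 p3 p4 p5 p6 :: complex
  defines "E \<equiv> \<lambda>z. (z - h)\<^sup>2 + k"
  defines "t1 \<equiv> (h + p1) + (h + p2) + (h + p3)" and "t2 \<equiv> (h + p1) + (h + p5) + (h + p6)"
    and "t3 \<equiv> (h + p2) + (h + p4) + (h + p6)" and "t4 \<equiv> (h + p3) + (h + p4) + (h + p5)"
    and "q1 \<equiv> (h + p1) + (h + p2) + (h + p4) + (h + p5)" and "q2 \<equiv> (h + p1) + (h + p3) + (h + p4) + (h + p6)"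
    and "q3 \<equiv> (h + p2) + (h + p3) + (h + p5) + (h + p6)"
    and "y1 \<equiv> p1 + p2 + p4 + p5" and "y2 \<equiv> p1 + p3 + p4 + p6" and "y3 \<equiv> p2 + p3 + p5 + p6"
    and "v \<equiv> 4 * h - u"
  shows "- (E (4 * h - t1) + E (4 * h - t2) + E (4 * h - t3) + E (4 * h - t4))
    + (E (q1 - t1) + E (q2 - t1) + E (q3 - t1) + E (q1 - t2) + E (q2 - t2) + E (q3 - t2)
      + E (q1 - t3) + E (q2 - t3) + E (q3 - t3) + E (q1 - t4) + E (q2 - t4) + E (q3 - t4))
    - 2 * (E (u - t1) + E (u - t2) + E (u - t3) + E (u - t4)) + 2 * E (4 * h - u)
    = - 2 * ((v + y1)\<^sup>2 + (v + y2)\<^sup>2 + (v + y3)\<^sup>2) - 4 * h * v + 2 * h\<^sup>2 + 2 * k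
      + 6 * (y1\<^sup>2 + y2\<^sup>2 + y3\<^sup>2) - 2 * (y1 + y2 + y3)\<^sup>2"
  unfolding E_def t1_def t2_def t3_def t4_def q1_def q2_def q3_def y1_def y2_def y3_def v_def
  by algebra

lemma tb_exponent:
  fixes z :: complex
  shows "z\<^sup>2 - of_real (Qb b) * z + of_real (((Qb b)\<^sup>2 + 1) / 6) = (z - of_real (Qb b / 2))\<^sup>2 + of_real (((Qb b)\<^sup>2 + 1) / 6 - (Qb b / 2)\<^sup>2)"
  by (simp add: power2_eq_square field_simps)

text \<open>The part of the exponent that does not depend on w. Its term of order 1 / e is imaginary
  and cancels the imaginary part of the critical value; the last term is a phase of size
  O(e).\<close>

definition Kc :: "real \<Rightarrow> real \<Rightarrow> real \<Rightarrow> real \<Rightarrow> complex" where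
  "Kc y1 y2 y3 e = of_real ((y1 + y2 + y3) / 4) + \<i> / of_real e * of_real (pi / 12 - quadJ y1 y2 y3 / (2 * pi)) - \<i> * of_real (13 * pi / 24 * e)"

text \<open>The translation by pi b^2 hidden in v makes each of the three squares produce - i (w + i
  y) / 4; together with - i w / 4 from the term h v this gives the - i w of \<open>Sexp\<close> and
  the (y1 + y2 + y3) / 4 of \<open>Kc\<close>.\<close>

lemma scaled_exponent_identity:
  fixes b y1 y2 y3 :: real and w :: complex
  assumes b: "b \<noteq> 0"
  defines "e \<equiv> b\<^sup>2" and "h \<equiv> complex_of_real (Qb b / 2)" and "\<kappa> \<equiv> complex_of_real (((Qb b)\<^sup>2 + 1) / 6 - (Qb b / 2)\<^sup>2)"
    and "v \<equiv> (w + of_real (pi * b\<^sup>2)) / of_real (2 * pi * b)"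
    and "Y1 \<equiv> \<i> * complex_of_real y1 / of_real (2 * pi * b)" and "Y2 \<equiv> \<i> * complex_of_real y2 / of_real (2 * pi * b)"
    and "Y3 \<equiv> \<i> * complex_of_real y3 / of_real (2 * pi * b)"
  shows "of_real pi * \<i> / 4 * (- 2 * ((v + Y1)\<^sup>2 + (v + Y2)\<^sup>2 + (v + Y3)\<^sup>2) - 4 * h * v + 2 * h\<^sup>2 + 2 * \<kappa>
      + 6 * (Y1\<^sup>2 + Y2\<^sup>2 + Y3\<^sup>2) - 2 * (Y1 + Y2 + Y3)\<^sup>2)
    = Kc y1 y2 y3 e - \<i> / of_real (8 * pi * e) * ((w + \<i> * of_real y1)\<^sup>2 + (w + \<i> * of_real y2)\<^sup>2 + (w + \<i> * of_real y3)\<^sup>2)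
     - \<i> * w / of_real (4 * e) - \<i> * w"
proof -
  define c where "c = complex_of_real b"
  define P where "P = complex_of_real pi"
  have nz: "c \<noteq> 0" "P \<noteq> 0" using b by (auto simp: c_def P_def)
  have h: "h = (c\<^sup>2 + 1) / (2 * c)" and k: "h\<^sup>2 + \<kappa> = (((c\<^sup>2 + 1) / c)\<^sup>2 + 1) / 6"
    using b by (simp_all add: h_def \<kappa>_def c_def Qb_def field_simps power2_eq_square)
  have vY: "v + Y1 = (w + P * c\<^sup>2 + \<i> * of_real y1) / (2 * P * c)" "v + Y2 = (w + P * c\<^sup>2 + \<i> * of_real y2) / (2 * P * c)"
    "v + Y3 = (w + P * c\<^sup>2 + \<i> * of_real y3) / (2 * P * c)" "v = (w + P * c\<^sup>2) / (2 * P * c)"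
    by (simp_all add: v_def Y1_def Y2_def Y3_def P_def c_def add_divide_distrib)
  have i4: "\<i> * \<i> = -1" by simp
  have Q: "6 * (Y1\<^sup>2 + Y2\<^sup>2 + Y3\<^sup>2) - 2 * (Y1 + Y2 + Y3)\<^sup>2 = - (2 / (P\<^sup>2 * c\<^sup>2)) * of_real (quadJ y1 y2 y3)"
  proof -
    define g where "g = \<i> / (2 * P * c)"
    have Y: "Y1 = g * of_real y1" "Y2 = g * of_real y2" "Y3 = g * of_real y3"
      by (simp_all add: Y1_def Y2_def Y3_def P_def c_def g_def)
    have g2: "g\<^sup>2 = - (1 / (4 * P\<^sup>2 * c\<^sup>2))" by (simp add: g_def power_divide power_mult_distrib)
    have "6 * (Y1\<^sup>2 + Y2\<^sup>2 + Y3\<^sup>2) - 2 * (Y1 + Y2 + Y3)\<^sup>2 = g\<^sup>2 * of_real (6 * (y1\<^sup>2 + y2\<^sup>2 + y3\<^sup>2) - 2 * (y1 + y2 + y3)\<^sup>2)"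
      unfolding Y by (simp add: power2_eq_square algebra_simps)
    also have "\<dots> = - (1 / (4 * P\<^sup>2 * c\<^sup>2)) * of_real (6 * (y1\<^sup>2 + y2\<^sup>2 + y3\<^sup>2) - 2 * (y1 + y2 + y3)\<^sup>2)"
      unfolding g2 ..
    also have "6 * (y1\<^sup>2 + y2\<^sup>2 + y3\<^sup>2) - 2 * (y1 + y2 + y3)\<^sup>2 = 8 * quadJ y1 y2 y3" by (simp add: quadJ_def)
    finally show ?thesis by simp
  qed
  define C R q where "C = inverse (c\<^sup>2)" and "R = inverse P" and "q = complex_of_real (quadJ y1 y2 y3)"
  have T1: "P * \<i> / 4 * (- 2 * ((z + P * c\<^sup>2 + x) / (2 * P * c))\<^sup>2) = - (\<i> / 8) * R * C * (z + x)\<^sup>2 - \<i> / 4 * (z + x) - \<i> / 8 * P * c\<^sup>2" for z x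
  proof -
    have "z + P * c\<^sup>2 + x = (z + x) + P * c\<^sup>2" by simp
    then show ?thesis unfolding C_def R_def using nz by (simp add: divide_simps) (simp add: power2_eq_square algebra_simps)
  qed
  have cC: "c\<^sup>2 * C = 1" using nz by (simp add: C_def)
  have PR: "P * R = 1" using nz by (simp add: R_def)
  have T2: "P * \<i> / 4 * (- 4 * h * v) = - (\<i> / 4) * w - \<i> / 4 * C * w - \<i> / 4 * P * c\<^sup>2 - \<i> / 4 * P"
  proof -
    have hv: "P * (h * v) = (c\<^sup>2 + 1) * (w + P * c\<^sup>2) * C / 4"
      unfolding vY(4) h C_def using nz by (simp add: power2_eq_square inverse_eq_divide)
    have "P * \<i> / 4 * (- 4 * h * v) = - \<i> * (P * (h * v))" by simp
    also have "\<dots> = - \<i> / 4 * ((c\<^sup>2 * C) * w + w * C + P * c\<^sup>2 * (c\<^sup>2 * C) + P * (c\<^sup>2 * C))"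
      unfolding hv by (simp add: algebra_simps add_divide_distrib diff_divide_distrib)
    finally show ?thesis unfolding cC by (simp add: algebra_simps add_divide_distrib diff_divide_distrib)
  qed
  have T3: "P * \<i> / 4 * (2 * (h\<^sup>2 + \<kappa>)) = \<i> / 12 * P * (c\<^sup>2 + 3 + C)"
  proof -
    have "((c\<^sup>2 + 1) / c)\<^sup>2 = (c\<^sup>2 + 1)\<^sup>2 * C" unfolding C_def power_divide by (rule divide_inverse)
    also have "\<dots> = c\<^sup>2 * (c\<^sup>2 * C) + 2 * (c\<^sup>2 * C) + C" by (simp add: power2_eq_square algebra_simps)
    finally have "((c\<^sup>2 + 1) / c)\<^sup>2 = c\<^sup>2 + 2 + C" unfolding cC by simp
    then show ?thesis unfolding k by (simp add: algebra_simps add_divide_distrib diff_divide_distrib)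
  qed
  have T4: "P * \<i> / 4 * (- (2 / (P\<^sup>2 * c\<^sup>2)) * q) = - (\<i> / 2) * R * C * q"
  proof -
    have "2 / (P\<^sup>2 * c\<^sup>2) = 2 * R * R * C" by (simp add: R_def C_def divide_inverse power2_eq_square)
    then have "P * \<i> / 4 * (- (2 / (P\<^sup>2 * c\<^sup>2)) * q) = - (\<i> / 2) * (P * R) * R * C * q" by simp
    then show ?thesis unfolding PR by simp
  qed
  have K: "Kc y1 y2 y3 e = of_real (y1 + y2 + y3) / 4 + \<i> * C * (P / 12 - q * R / 2) - \<i> * 13 / 24 * P * c\<^sup>2"
  proof -
    have "\<i> / complex_of_real e = \<i> * C" unfolding e_def C_def c_def by (simp add: divide_inverse)
    moreover have "complex_of_real (pi / 12 - quadJ y1 y2 y3 / (2 * pi)) = P / 12 - q * R / 2"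
      unfolding R_def q_def P_def by (simp add: inverse_eq_divide)
    moreover have "complex_of_real (13 * pi / 24 * e) = 13 / 24 * P * c\<^sup>2" unfolding e_def P_def c_def by simp
    ultimately show ?thesis unfolding Kc_def by simp
  qed
  have E: "\<i> / of_real (8 * pi * e) = \<i> / 8 * R * C" "\<i> * w / of_real (4 * e) = \<i> / 4 * C * w"
    unfolding e_def C_def R_def P_def c_def by (simp_all add: inverse_eq_divide)
  have "P * \<i> / 4 * (- 2 * ((v + Y1)\<^sup>2 + (v + Y2)\<^sup>2 + (v + Y3)\<^sup>2) - 4 * h * v + 2 * h\<^sup>2 + 2 * \<kappa>
      + 6 * (Y1\<^sup>2 + Y2\<^sup>2 + Y3\<^sup>2) - 2 * (Y1 + Y2 + Y3)\<^sup>2)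
    = P * \<i> / 4 * (- 2 * (v + Y1)\<^sup>2) + P * \<i> / 4 * (- 2 * (v + Y2)\<^sup>2) + P * \<i> / 4 * (- 2 * (v + Y3)\<^sup>2) + P * \<i> / 4 * (- 4 * h * v)
      + P * \<i> / 4 * (2 * (h\<^sup>2 + \<kappa>)) + P * \<i> / 4 * (6 * (Y1\<^sup>2 + Y2\<^sup>2 + Y3\<^sup>2) - 2 * (Y1 + Y2 + Y3)\<^sup>2)"
    by (simp add: algebra_simps)
  also have "\<dots> = Kc y1 y2 y3 e - \<i> / of_real (8 * pi * e) * ((w + \<i> * of_real y1)\<^sup>2 + (w + \<i> * of_real y2)\<^sup>2 + (w + \<i> * of_real y3)\<^sup>2)
     - \<i> * w / of_real (4 * e) - \<i> * w"
    unfolding Q q_def[symmetric] T4 T2 T3 vY(1-3) T1 K E by (simp add: algebra_simps add_divide_distrib diff_divide_distrib)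
  finally show ?thesis unfolding P_def .
qed

text \<open>For Im w tending to - infinity the integrand decays at rate 1 / e + 1. For Im w tending
  to + infinity the rate is (pi - 2 pi e - 3 Re w) / (2 pi e), positive precisely when Re w < (pi -
  2 pi e) / 3, which is the image of the bound 11 Q / 6. The lower bound - pi e is the edge of the
  strip of \<open>Theta e\<close>.\<close>

lemma Sexp_integral_shift:
  assumes e: "0 < e" "e \<le> 1" and u: "- pi * e < u" "u < (pi - 2 * pi * e) / 3" and v: "- pi * e < v" "v < (pi - 2 * pi * e) / 3"
  shows "(LINT t|lborel. exp (Sexp y1 y2 y3 e (Complex u t))) = (LINT t|lborel. exp (Sexp y1 y2 y3 e (Complex v t)))"
proof -
  have main: "(LINT t|lborel. exp (Sexp y1 y2 y3 e (Complex u t))) = (LINT t|lborel. exp (Sexp y1 y2 y3 e (Complex v t)))"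
    if u: "- pi * e < u" and uv: "u \<le> v" and v: "v < (pi - 2 * pi * e) / 3" for u v
  proof -
    have pe: "pi * e > 0" using e by simp
    have pe1: "pi * e \<le> pi" using e by simp
    have v': "v < pi * (2 - 2 * e)" "v \<le> pi"
    proof -
      define X where "X = pi * e"
      have "3 * v < pi - 2 * X" "pi * (2 - 2 * e) = 2 * pi - 2 * X" using v unfolding X_def by (simp_all add: algebra_simps)
      with pe pe1 pi_gt_zero show "v < pi * (2 - 2 * e)" "v \<le> pi" unfolding X_def[symmetric] by simp_all
    qed
    obtain M1 where M1: "M1 > 0" "\<And>w. u \<le> Re w \<Longrightarrow> Re w \<le> v \<Longrightarrow> norm (exp (Sig e y1 w)) \<le> M1 * exp (- (\<bar>Im w\<bar> * (pi - Re w) / (4 * pi * e)))"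
      using norm_exp_Sig_le[OF e u v'] by blast
    obtain M2 where M2: "M2 > 0" "\<And>w. u \<le> Re w \<Longrightarrow> Re w \<le> v \<Longrightarrow> norm (exp (Sig e y2 w)) \<le> M2 * exp (- (\<bar>Im w\<bar> * (pi - Re w) / (4 * pi * e)))"
      using norm_exp_Sig_le[OF e u v'] by blast
    obtain M3 where M3: "M3 > 0" "\<And>w. u \<le> Re w \<Longrightarrow> Re w \<le> v \<Longrightarrow> norm (exp (Sig e y3 w)) \<le> M3 * exp (- (\<bar>Im w\<bar> * (pi - Re w) / (4 * pi * e)))"
      using norm_exp_Sig_le[OF e u v'] by blast
    define Y where "Y = y1 + y2 + y3"
    \<comment> \<open>The worst upward rate on the strip occurs at its right edge v. Capping it by 1
      makes it a valid downward rate too.\<close>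
    define D where "D = min 1 ((pi - 2 * pi * e - 3 * v) / (2 * pi * e))"
    have D: "D > 0" using v pe by (simp add: D_def)
    define M where "M = M1 * M2 * M3 * exp ((\<bar>u\<bar> + \<bar>v\<bar>) * \<bar>Y\<bar> / (4 * pi * e))"
    show ?thesis
    proof (rule vertical_integral_shift[OF _ u uv _ D, where b = "pi * (2 + e)" and M = M])
      show "(\<lambda>w. exp (Sexp y1 y2 y3 e w)) holomorphic_on {w. - pi * e < Re w \<and> Re w < pi * (2 + e)}"
        unfolding Sexp_def using e by (intro holomorphic_intros Sig_holomorphic) auto
      show "v < pi * (2 + e)" unfolding distrib_left using v' pe pi_gt_zero by linarith
      fix w assume w: "u \<le> Re w" "Re w \<le> v"
      define x \<eta> where "x = Re w" and "\<eta> = Im w"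
      have sq: "Re (\<i> / of_real (8 * pi * e) * (w + \<i> * of_real y)\<^sup>2) = - (x * (\<eta> + y) / (4 * pi * e))" for y
      proof -
        have "\<i> / of_real (8 * pi * e) * (w + \<i> * of_real y)\<^sup>2 = (\<i> * (w + \<i> * of_real y)\<^sup>2) / of_real (8 * pi * e)" by simp
        then have "Re (\<i> / of_real (8 * pi * e) * (w + \<i> * of_real y)\<^sup>2) = Re (\<i> * (w + \<i> * of_real y)\<^sup>2) / (8 * pi * e)"
          by (simp only: Re_divide_of_real)
        also have "Re (\<i> * (w + \<i> * of_real y)\<^sup>2) = - (2 * x * (\<eta> + y))" by (simp add: x_def \<eta>_def power2_eq_square)
        finally show ?thesis using e by (simp add: field_simps)
      qed
      have d: "exp (Sexp y1 y2 y3 e w) = exp (Sig e y1 w) * exp (Sig e y2 w) * exp (Sig e y3 w) *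
         exp (- (\<i> / of_real (8 * pi * e) * (w + \<i> * of_real y1)\<^sup>2 + \<i> / of_real (8 * pi * e) * (w + \<i> * of_real y2)\<^sup>2 + \<i> / of_real (8 * pi * e) * (w + \<i> * of_real y3)\<^sup>2)
           - \<i> * w / of_real (4 * e) - \<i> * w)"
        unfolding exp_add[symmetric] Sexp_def by (simp add: algebra_simps)
      have "norm (exp (Sexp y1 y2 y3 e w)) \<le> (M1 * exp (- (\<bar>Im w\<bar> * (pi - Re w) / (4 * pi * e)))) * (M2 * exp (- (\<bar>Im w\<bar> * (pi - Re w) / (4 * pi * e))))
         * (M3 * exp (- (\<bar>Im w\<bar> * (pi - Re w) / (4 * pi * e)))) * exp (x * (\<eta> + y1) / (4 * pi * e) + x * (\<eta> + y2) / (4 * pi * e) + x * (\<eta> + y3) / (4 * pi * e) + \<eta> / (4 * e) + \<eta>)"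
        unfolding d norm_mult norm_exp_eq_Re[of "- _ - _ - _"] minus_complex.sel uminus_complex.sel plus_complex.sel sq
        using M1 M2 M3 w by (intro mult_mono mult_nonneg_nonneg) (auto simp: \<eta>_def Re_divide_of_real)
      also have "\<dots> = M1 * M2 * M3 * exp (x * Y / (4 * pi * e) + (- 3 * \<bar>\<eta>\<bar> * (pi - x) / (4 * pi * e) + 3 * x * \<eta> / (4 * pi * e) + \<eta> / (4 * e) + \<eta>))"
      proof -
        have "exp (- (\<bar>\<eta>\<bar> * (pi - x) / (4 * pi * e))) * exp (- (\<bar>\<eta>\<bar> * (pi - x) / (4 * pi * e))) * exp (- (\<bar>\<eta>\<bar> * (pi - x) / (4 * pi * e)))
           * exp (x * (\<eta> + y1) / (4 * pi * e) + x * (\<eta> + y2) / (4 * pi * e) + x * (\<eta> + y3) / (4 * pi * e) + \<eta> / (4 * e) + \<eta>)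
          = exp (x * Y / (4 * pi * e) + (- 3 * \<bar>\<eta>\<bar> * (pi - x) / (4 * pi * e) + 3 * x * \<eta> / (4 * pi * e) + \<eta> / (4 * e) + \<eta>))"
          unfolding exp_add[symmetric] exp_inj_iff Y_def using e by (simp add: field_simps)
        then show ?thesis by (simp add: x_def \<eta>_def mult_ac)
      qed
      also have "\<dots> \<le> M1 * M2 * M3 * exp ((\<bar>u\<bar> + \<bar>v\<bar>) * \<bar>Y\<bar> / (4 * pi * e) + - (D * \<bar>\<eta>\<bar>))"
      proof -
        have "x * Y \<le> \<bar>x\<bar> * \<bar>Y\<bar>" by (metis abs_ge_self abs_mult)
        also have "\<dots> \<le> (\<bar>u\<bar> + \<bar>v\<bar>) * \<bar>Y\<bar>" using w by (intro mult_right_mono) (auto simp: x_def)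
        finally have 1: "x * Y / (4 * pi * e) \<le> (\<bar>u\<bar> + \<bar>v\<bar>) * \<bar>Y\<bar> / (4 * pi * e)" using e by (intro divide_right_mono) auto
        have 2: "- 3 * \<bar>\<eta>\<bar> * (pi - x) / (4 * pi * e) + 3 * x * \<eta> / (4 * pi * e) + \<eta> / (4 * e) + \<eta> \<le> - (D * \<bar>\<eta>\<bar>)"
        proof (cases "\<eta> \<ge> 0")
          case True
          have "- 3 * \<bar>\<eta>\<bar> * (pi - x) / (4 * pi * e) + 3 * x * \<eta> / (4 * pi * e) + \<eta> / (4 * e) + \<eta> = - ((pi - 2 * pi * e - 3 * x) / (2 * pi * e) * \<eta>)"
            using True e by (simp add: field_simps)
          moreover have "D * \<eta> \<le> (pi - 2 * pi * e - 3 * x) / (2 * pi * e) * \<eta>"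
          proof (rule mult_right_mono[OF _ True])
            have "D \<le> (pi - 2 * pi * e - 3 * v) / (2 * pi * e)" by (simp add: D_def)
            also have "\<dots> \<le> (pi - 2 * pi * e - 3 * x) / (2 * pi * e)" using w e by (intro divide_right_mono) (auto simp: x_def)
            finally show "D \<le> (pi - 2 * pi * e - 3 * x) / (2 * pi * e)" .
          qed
          ultimately show ?thesis using True by simp
        next
          case False
          then have n: "\<bar>\<eta>\<bar> = - \<eta>" "\<eta> < 0" by auto
          have "- 3 * \<bar>\<eta>\<bar> * (pi - x) / (4 * pi * e) + 3 * x * \<eta> / (4 * pi * e) + \<eta> / (4 * e) + \<eta> = - ((1 / e + 1) * \<bar>\<eta>\<bar>)"
            unfolding n(1) using e by (simp add: field_simps)
          moreover have "D * \<bar>\<eta>\<bar> \<le> (1 / e + 1) * \<bar>\<eta>\<bar>"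
            using e by (intro mult_right_mono) (auto simp: D_def min_le_iff_disj)
          ultimately show ?thesis by simp
        qed
        show ?thesis using M1(1) M2(1) M3(1) by (intro mult_left_mono iffD2[OF exp_le_cancel_iff] add_mono 1 2) auto
      qed
      also have "\<dots> = M * exp (- (D * \<bar>Im w\<bar>))" unfolding exp_add M_def \<eta>_def by (simp only: mult.assoc)
      finally show "norm (exp (Sexp y1 y2 y3 e w)) \<le> M * exp (- (D * \<bar>Im w\<bar>))" .
    qed
  qed
  show ?thesis
  proof (cases "u \<le> v")
    case True
    then show ?thesis using main[of u v] u v by simp
  next
    case False
    then show ?thesis using main[of v u] u v by simp
  qed
qed

text \<open>The substitution w = 2 pi b (2Q - u) - pi b^2 carries the line Re u = c to Re w = T. It
  is affine with factor - 2 pi b in Im u, and for an integral over the whole line only the modulus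
  of this factor matters. No approximation is made.\<close>

lemma ideal_sixj_eq_saddle_integral:
  fixes x :: "nat \<Rightarrow> real"
  assumes b: "0 < b" "b < 1" and c: "11 * Qb b / 6 < c" "c < 2 * Qb b"
  defines "T \<equiv> 2 * pi * b * (2 * Qb b - c) - pi * b\<^sup>2"
    and "y1 \<equiv> x 1 + x 2 + x 4 + x 5" and "y2 \<equiv> x 1 + x 3 + x 4 + x 6" and "y3 \<equiv> x 2 + x 3 + x 5 + x 6"
  shows "- pi * b\<^sup>2 < T" "T < (pi - 2 * pi * b\<^sup>2) / 3"
    and "ideal_sixj c b (\<lambda>k. of_real (Qb b / 2) + \<i> * of_real (x k / (2 * pi * b))) =
      exp (Kc y1 y2 y3 (b\<^sup>2)) / of_real (2 * pi * b) * (LINT t|lborel. exp (Sexp y1 y2 y3 (b\<^sup>2) (Complex T t)))"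
proof -
  have pb: "pi * b > 0" using b by simp
  have "0 < 2 * Qb b - c" "2 * Qb b - c < Qb b / 6" using c by auto
  then have *: "0 < pi * b * (2 * Qb b - c)" "pi * b * (2 * Qb b - c) < pi * b * (Qb b / 6)"
    using pb b by (auto intro!: mult_pos_pos mult_strict_left_mono simp del: zero_less_mult_iff mult_less_cancel_left)
  have Q: "pi * b * (Qb b / 6) = (pi * b\<^sup>2 + pi) / 6" using b by (simp add: Qb_def field_simps power2_eq_square)
  have T: "T = 2 * (pi * b * (2 * Qb b - c)) - pi * b\<^sup>2" by (simp add: T_def)
  show "- pi * b\<^sup>2 < T" "T < (pi - 2 * pi * b\<^sup>2) / 3" unfolding T using *[unfolded Q] by (simp_all)
  define a where "a = (\<lambda>k. of_real (Qb b / 2) + \<i> * complex_of_real (x k / (2 * pi * b)))"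
  define h where "h = complex_of_real (Qb b / 2)"
  define K where "K = complex_of_real (((Qb b)\<^sup>2 + 1) / 6 - (Qb b / 2)\<^sup>2)"
  define Y1 Y2 Y3 where "Y1 = \<i> * complex_of_real y1 / of_real (2 * pi * b)" and "Y2 = \<i> * complex_of_real y2 / of_real (2 * pi * b)"
    and "Y3 = \<i> * complex_of_real y3 / of_real (2 * pi * b)"
  define p where "p k = \<i> * complex_of_real (x k / (2 * pi * b))" for k
  have a: "a k = h + p k" for k by (simp add: a_def h_def p_def)
  have Y: "Y1 = p 1 + p 2 + p 4 + p 5" "Y2 = p 1 + p 3 + p 4 + p 6" "Y3 = p 2 + p 3 + p 5 + p 6"
    by (simp_all add: Y1_def Y2_def Y3_def p_def y1_def y2_def y3_def add_divide_distrib algebra_simps)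
  define E where "E z = (z - h)\<^sup>2 + K" for z
  define \<alpha> where "\<alpha> = complex_of_real pi * \<i> / 4"
  have Tb: "Tb b z = exp (\<alpha> * (- 2 * E z))" for z
    unfolding Tb_def tb_exponent h_def[symmetric] K_def[symmetric] E_def[symmetric] \<alpha>_def by (rule arg_cong[where f = exp]) simp
  have Tbs: "Tb_sqrt b z = exp (\<alpha> * (- E z))" for z
    unfolding Tb_sqrt_def tb_exponent h_def[symmetric] K_def[symmetric] E_def[symmetric] \<alpha>_def by (rule arg_cong[where f = exp]) simp
  have h4: "complex_of_real (2 * Qb b) = 4 * h" by (simp add: h_def)
  have integrand: "((\<Prod>t\<leftarrow>sixj_t a. Tb_sqrt b (of_real (2 * Qb b) - t)) /
     (\<Prod>t\<leftarrow>sixj_t a. \<Prod>q\<leftarrow>sixj_q a. Tb_sqrt b (q - t))) *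
      (let u = Complex c s in
          (\<Prod>t\<leftarrow>sixj_t a. Tb b (u - t)) / Tb b (of_real (2 * Qb b) - u) *
          (\<Prod>q\<leftarrow>sixj_q a. Sb b (q - u))) = exp (Kc y1 y2 y3 (b\<^sup>2)) * exp (Sexp y1 y2 y3 (b\<^sup>2) (Complex T (0 + (- (2 * pi * b)) * s)))" for s
  proof -
    define u where "u = Complex c s"
    define w where "w = Complex T (0 + (- (2 * pi * b)) * s)"
    define v where "v = (w + of_real (pi * b\<^sup>2)) / of_real (2 * pi * b)"
    have "of_real (2 * pi * b) * (4 * h - u) = w + of_real (pi * b\<^sup>2)"
      by (simp add: complex_eq_iff w_def h_def u_def T_def)
    then have v: "v = 4 * h - u" unfolding v_def using b by (auto simp: divide_simps mult_ac)
    have Sb: "Sb b (4 * h + \<i> * of_real y / of_real (2 * pi * b) - u) = exp (Sig (b\<^sup>2) y w)" for y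
    proof -
      define z where "z = v + \<i> * of_real y / of_real (2 * pi * b)"
      have "Re z = Re v" by (simp add: z_def Re_divide_of_real)
      also have "\<dots> = 2 * Qb b - c" by (simp add: v u_def h_def)
      finally have rz: "0 < Re z" "Re z < Qb b" using c by (simp_all)
      have "complex_of_real (2 * b) * z = (w + of_real (pi * b\<^sup>2) + \<i> * of_real y) / of_real pi"
        unfolding z_def v_def using b by (simp add: field_simps)
      also have "\<dots> = (w + \<i> * of_real y) / of_real pi + of_real (b\<^sup>2)" by (simp add: field_simps)
      finally have "of_real (1 + b\<^sup>2) - complex_of_real (2 * b) * z = 1 - (w + \<i> * of_real y) / of_real pi" by simp
      moreover have "4 * h + \<i> * of_real y / of_real (2 * pi * b) - u = z" by (simp add: z_def v)
      ultimately show ?thesis unfolding Sig_def using Sb_eq_Theta[OF b rz] by (simp only: of_real_power)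
    qed
    have q: "(h + p 1) + (h + p 2) + (h + p 4) + (h + p 5) - u = 4 * h + \<i> * of_real y1 / of_real (2 * pi * b) - u"
      "(h + p 1) + (h + p 3) + (h + p 4) + (h + p 6) - u = 4 * h + \<i> * of_real y2 / of_real (2 * pi * b) - u"
      "(h + p 2) + (h + p 3) + (h + p 5) + (h + p 6) - u = 4 * h + \<i> * of_real y3 / of_real (2 * pi * b) - u"
      unfolding Y1_def[symmetric] Y2_def[symmetric] Y3_def[symmetric] Y by simp_all
    have S: "Sb b (h + p 1 + (h + p 2) + (h + p 4) + (h + p 5) - u) *
       (Sb b (h + p 1 + (h + p 3) + (h + p 4) + (h + p 6) - u) * Sb b (h + p 2 + (h + p 3) + (h + p 5) + (h + p 6) - u))
      = exp (Sig (b\<^sup>2) y1 w + Sig (b\<^sup>2) y2 w + Sig (b\<^sup>2) y3 w)"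
      unfolding q Sb by (simp add: exp_add)
    have I: "\<alpha> * (- (E (4 * h - (h + p 1 + (h + p 2) + (h + p 3))) + E (4 * h - (h + p 1 + (h + p 5) + (h + p 6)))
        + E (4 * h - (h + p 2 + (h + p 4) + (h + p 6))) + E (4 * h - (h + p 3 + (h + p 4) + (h + p 5))))
      + (E (h + p 1 + (h + p 2) + (h + p 4) + (h + p 5) - (h + p 1 + (h + p 2) + (h + p 3)))
        + E (h + p 1 + (h + p 3) + (h + p 4) + (h + p 6) - (h + p 1 + (h + p 2) + (h + p 3)))
        + E (h + p 2 + (h + p 3) + (h + p 5) + (h + p 6) - (h + p 1 + (h + p 2) + (h + p 3)))
        + E (h + p 1 + (h + p 2) + (h + p 4) + (h + p 5) - (h + p 1 + (h + p 5) + (h + p 6)))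
        + E (h + p 1 + (h + p 3) + (h + p 4) + (h + p 6) - (h + p 1 + (h + p 5) + (h + p 6)))
        + E (h + p 2 + (h + p 3) + (h + p 5) + (h + p 6) - (h + p 1 + (h + p 5) + (h + p 6)))
        + E (h + p 1 + (h + p 2) + (h + p 4) + (h + p 5) - (h + p 2 + (h + p 4) + (h + p 6)))
        + E (h + p 1 + (h + p 3) + (h + p 4) + (h + p 6) - (h + p 2 + (h + p 4) + (h + p 6)))
        + E (h + p 2 + (h + p 3) + (h + p 5) + (h + p 6) - (h + p 2 + (h + p 4) + (h + p 6)))
        + E (h + p 1 + (h + p 2) + (h + p 4) + (h + p 5) - (h + p 3 + (h + p 4) + (h + p 5)))
        + E (h + p 1 + (h + p 3) + (h + p 4) + (h + p 6) - (h + p 3 + (h + p 4) + (h + p 5)))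
        + E (h + p 2 + (h + p 3) + (h + p 5) + (h + p 6) - (h + p 3 + (h + p 4) + (h + p 5))))
      - 2 * (E (u - (h + p 1 + (h + p 2) + (h + p 3))) + E (u - (h + p 1 + (h + p 5) + (h + p 6)))
        + E (u - (h + p 2 + (h + p 4) + (h + p 6))) + E (u - (h + p 3 + (h + p 4) + (h + p 5)))) + 2 * E (4 * h - u))
      + (Sig (b\<^sup>2) y1 w + Sig (b\<^sup>2) y2 w + Sig (b\<^sup>2) y3 w) = Kc y1 y2 y3 (b\<^sup>2) + Sexp y1 y2 y3 (b\<^sup>2) w"
      unfolding E_def tb_exponent_identity
      unfolding Y[symmetric] v[symmetric] \<alpha>_def
        scaled_exponent_identity[OF order.strict_implies_not_eq[OF b(1), symmetric], of w y1 y2 y3, folded h_def K_def v_def Y1_def Y2_def Y3_def] Sexp_def by simp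
    have combine: "exp A / exp B * (exp C / exp D * S) = exp (A - B + C - D) * S" for A B C D S :: complex
      by (simp add: exp_add exp_diff)
    show ?thesis
      unfolding Let_def u_def[symmetric] w_def[symmetric] sixj_t_def sixj_q_def list.map prod_list.Cons prod_list.Nil mult_1_right Tb Tbs h4
        exp_add[symmetric] distrib_left[symmetric] a S combine right_diff_distrib[symmetric]
      unfolding exp_add[symmetric] I[symmetric] by (rule arg_cong[where f = exp]) simp
  qed
  have "ideal_sixj c b a = (LINT s|lborel. exp (Kc y1 y2 y3 (b\<^sup>2)) * exp (Sexp y1 y2 y3 (b\<^sup>2) (Complex T (0 + (- (2 * pi * b)) * s))))"
    unfolding ideal_sixj_def integrand[symmetric] by simp
  also have "\<dots> = exp (Kc y1 y2 y3 (b\<^sup>2)) * (LINT s|lborel. exp (Sexp y1 y2 y3 (b\<^sup>2) (Complex T (0 + (- (2 * pi * b)) * s))))"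
    by simp
  also have "(LINT s|lborel. exp (Sexp y1 y2 y3 (b\<^sup>2) (Complex T (0 + (- (2 * pi * b)) * s)))) =
     (LINT t|lborel. exp (Sexp y1 y2 y3 (b\<^sup>2) (Complex T t))) / of_real (2 * pi * b)"
    using lborel_integral_real_affine[of "- (2 * pi * b)" "\<lambda>t. exp (Sexp y1 y2 y3 (b\<^sup>2) (Complex T t))" 0] b
    by (simp add: scaleR_conv_of_real)
  finally show "ideal_sixj c b (\<lambda>k. of_real (Qb b / 2) + \<i> * of_real (x k / (2 * pi * b))) =
      exp (Kc y1 y2 y3 (b\<^sup>2)) / of_real (2 * pi * b) * (LINT t|lborel. exp (Sexp y1 y2 y3 (b\<^sup>2) (Complex T t)))"
    unfolding a_def by simp
qed

section \<open>Second derivative at the critical point\<close>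

text \<open>Expresses the cotangent through exp (- i w), which is the quantity known at the critical
  point.\<close>

lemma phi2_exp:
  assumes "sin (w / 2) \<noteq> 0" and z: "exp (- (\<i> * w)) = 1 + r" "r \<noteq> 0"
  shows "phi2 w = - (\<i> / of_real (2 * pi)) * (1 + 1 / r)"
proof -
  define q where "q = exp (- (\<i> * (w / 2)))"
  have q: "q \<noteq> 0" and q2: "q * q = 1 + r"
    unfolding q_def z(1)[symmetric] exp_add[symmetric] by (auto intro!: arg_cong[where f = exp] simp: field_simps)
  have c: "cos (w / 2) = (1 / q + q) / 2" and s: "sin (w / 2) = - \<i> * (1 / q - q) / 2"
    by (simp_all add: cos_exp_eq sin_exp_eq q_def exp_minus inverse_eq_divide)
  have "1 / q + q = (2 + r) / q" "1 / q - q = - r / q"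
    using q q2 by (simp_all add: field_simps)
  then have "cos (w / 2) / sin (w / 2) = ((2 + r) / q) / (\<i> * (r / q))" unfolding c s by simp
  also have "\<dots> = - \<i> * (2 + r) / r" using q z(2) by (simp add: field_simps)
  also have "\<dots> = - \<i> * (1 + 2 / r)" using z(2) by (simp add: field_simps)
  finally have X: "cos (w / 2) / sin (w / 2) = - \<i> * (1 + 2 * (1 / r))" by simp
  have "(- \<i> * (1 + 2 * s) - \<i>) / of_real (4 * pi) = - (\<i> / of_real (2 * pi)) * (1 + s)" for s
    by (simp add: field_simps)
  then show ?thesis unfolding phi2_def X .
qed

text \<open>The trigonometric identity that makes the second derivative at the critical point a
  positive multiple of a square. With the third angle eliminated, its real and imaginary parts are
  polynomial consequences of sin^2 + cos^2 = 1 for the other two.\<close>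

lemma critN_square:
  assumes t: "tri A B C"
  shows "(critN A B C)\<^sup>2 = - (\<i> / 2) * (of_real (3 * (sin A * sin B * sin C)) + of_real ((sin A) ^ 3) * cis A
     + of_real ((sin B) ^ 3) * cis B + of_real ((sin C) ^ 3) * cis C)"
proof -
  have g: "C = pi - (A + B)" using t by (simp add: tri_def)
  have sg: "sin C = sin A * cos B + cos A * sin B" "cos C = sin A * sin B - cos A * cos B"
    unfolding g by (simp_all add: sin_add cos_add)
  have p: "sin A * sin A + cos A * cos A = 1" "sin B * sin B + cos B * cos B = 1"
    by (metis power2_eq_square sin_cos_squared_add)+
  obtain a b c d r k where abcd: "a = sin A" "b = cos A" "c = sin B" "d = cos B" "r = sin C" "k = cos C" by blast
  note p' = p[folded abcd] sg[folded abcd]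
  have re: "(1 + b * d * k) * (1 + b * d * k) - (- (a * c * r)) * (- (a * c * r)) = (a * a * a * a + c * c * c * c + r * r * r * r) / 2"
  proof -
    have "2 * ((1 + b * d * k) * (1 + b * d * k) - (a * c * r) * (a * c * r)) = a * a * a * a + c * c * c * c + r * r * r * r"
      using p' by algebra
    then show ?thesis by simp
  qed
  have im: "(1 + b * d * k) * (- (a * c * r)) + - (a * c * r) * (1 + b * d * k) = - ((3 * (a * c * r) + a * a * a * b + c * c * c * d + r * r * r * k) / 2)"
  proof -
    have "4 * (1 + b * d * k) * (a * c * r) = 3 * (a * c * r) + a * a * a * b + c * c * c * d + r * r * r * k"
      using p' by algebra
    then show ?thesis by (simp add: algebra_simps)
  qed
  show ?thesis
    unfolding critN_def abcd[symmetric] power2_eq_square complex_eq_iff times_complex.sel complex.sel re im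
    by (simp add: abcd[symmetric] power3_eq_cube algebra_simps add_divide_distrib)
qed

text \<open>Selects the branch of the square root of the second derivative.\<close>

lemma Re_critN_pos:
  assumes "tri a b c" shows "Re (critN a b c) > 0"
proof -
  have s: "sin a > 0" using tri_sin_pos[OF assms] by auto
  have "(cos a)\<^sup>2 < 1" using s by (simp add: cos_squared_eq)
  then have "\<bar>cos a\<bar> < 1" by (simp add: abs_square_less_1)
  moreover have "\<bar>cos b * cos c\<bar> \<le> 1" by (simp add: abs_mult mult_le_one)
  ultimately have "\<bar>cos a\<bar> * \<bar>cos b * cos c\<bar> < 1"
    by (metis abs_ge_zero mult_left_le order_le_less_trans)
  then have "\<bar>cos a * cos b * cos c\<bar> < 1" by (simp add: abs_mult)
  then show ?thesis by (simp add: critN_def)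
qed

section \<open>The leading term in triangle coordinates\<close>

context
  fixes \<alpha> \<beta> \<gamma> \<kappa> l1 l2 l3 y1 y2 y3 :: real and w0 :: complex and P W :: real
  assumes t: "tri \<alpha> \<beta> \<gamma>" and l: "l1 = \<kappa> + lsin \<alpha>" "l2 = \<kappa> + lsin \<beta>" "l3 = \<kappa> + lsin \<gamma>"
    and y: "y1 = l1 + l2" "y2 = l1 + l3" "y3 = l2 + l3" and w0: "w0 = critw \<alpha> \<beta> \<gamma> - \<i> * of_real (2 * \<kappa>)"
    and P: "P = sin \<alpha> * sin \<beta> * sin \<gamma>" and W_def: "W = Lob \<alpha> + Lob \<beta> + Lob \<gamma> + 1 / 2 * (\<alpha> * l1 + \<beta> * l2 + \<gamma> * l3)"
begin

private lemma P_pos: "P > 0" using tri_sin_pos[OF t] unfolding P by auto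

private lemma w0_shift:
  "w0 + \<i> * of_real y1 = critw \<alpha> \<beta> \<gamma> + \<i> * of_real (lsin \<alpha> + lsin \<beta>)"
  "w0 + \<i> * of_real y2 = critw \<alpha> \<beta> \<gamma> + \<i> * of_real (lsin \<alpha> + lsin \<gamma>)"
  "w0 + \<i> * of_real y3 = critw \<alpha> \<beta> \<gamma> + \<i> * of_real (lsin \<beta> + lsin \<gamma>)"
  unfolding w0 y l by (simp_all add: algebra_simps)

private lemma crit_pieces:
  "Ln (2 * sin ((w0 + \<i> * of_real y1) / 2)) - \<i> * (w0 + \<i> * of_real y1) / 2 = of_real (ln (rho \<alpha> \<beta> \<gamma>)) + \<i> * of_real (pi / 2 - \<gamma>)"
  "Ln (2 * sin ((w0 + \<i> * of_real y2) / 2)) - \<i> * (w0 + \<i> * of_real y2) / 2 = of_real (ln (rho \<gamma> \<alpha> \<beta>)) + \<i> * of_real (pi / 2 - \<beta>)"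
  "Ln (2 * sin ((w0 + \<i> * of_real y3) / 2)) - \<i> * (w0 + \<i> * of_real y3) / 2 = of_real (ln (rho \<beta> \<gamma> \<alpha>)) + \<i> * of_real (pi / 2 - \<alpha>)"
  "exp (- (\<i> * (w0 + \<i> * of_real y1))) = 1 + of_real (rho \<alpha> \<beta> \<gamma>) * cis (- \<gamma>)"
  "exp (- (\<i> * (w0 + \<i> * of_real y2))) = 1 + of_real (rho \<gamma> \<alpha> \<beta>) * cis (- \<beta>)"
  "exp (- (\<i> * (w0 + \<i> * of_real y3))) = 1 + of_real (rho \<beta> \<gamma> \<alpha>) * cis (- \<alpha>)"
  "0 < Re (critw \<alpha> \<beta> \<gamma>)" "Re (critw \<alpha> \<beta> \<gamma>) < \<gamma>" "Re (critw \<alpha> \<beta> \<gamma>) < \<beta>" "Re (critw \<alpha> \<beta> \<gamma>) < \<alpha>"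
proof -
  note t2 = tri_rot[OF t] note t3 = tri_rot[OF t2]
  have c: "critw \<beta> \<gamma> \<alpha> = critw \<alpha> \<beta> \<gamma>" "critw \<gamma> \<alpha> \<beta> = critw \<alpha> \<beta> \<gamma>" by (metis critw_rot)+
  have s: "lsin \<alpha> + lsin \<gamma> = lsin \<gamma> + lsin \<alpha>" by simp
  note C = crit_point[folded lsin_def]
  show "Ln (2 * sin ((w0 + \<i> * of_real y1) / 2)) - \<i> * (w0 + \<i> * of_real y1) / 2 = of_real (ln (rho \<alpha> \<beta> \<gamma>)) + \<i> * of_real (pi / 2 - \<gamma>)"
    "exp (- (\<i> * (w0 + \<i> * of_real y1))) = 1 + of_real (rho \<alpha> \<beta> \<gamma>) * cis (- \<gamma>)"
    unfolding w0_shift by (rule C(4)[OF t], rule C(5)[OF t])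
  show "Ln (2 * sin ((w0 + \<i> * of_real y2) / 2)) - \<i> * (w0 + \<i> * of_real y2) / 2 = of_real (ln (rho \<gamma> \<alpha> \<beta>)) + \<i> * of_real (pi / 2 - \<beta>)"
    "exp (- (\<i> * (w0 + \<i> * of_real y2))) = 1 + of_real (rho \<gamma> \<alpha> \<beta>) * cis (- \<beta>)"
    unfolding w0_shift s by (rule C(4)[OF t3, unfolded c], rule C(5)[OF t3, unfolded c])
  show "Ln (2 * sin ((w0 + \<i> * of_real y3) / 2)) - \<i> * (w0 + \<i> * of_real y3) / 2 = of_real (ln (rho \<beta> \<gamma> \<alpha>)) + \<i> * of_real (pi / 2 - \<alpha>)"
    "exp (- (\<i> * (w0 + \<i> * of_real y3))) = 1 + of_real (rho \<beta> \<gamma> \<alpha>) * cis (- \<alpha>)"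
    unfolding w0_shift by (rule C(4)[OF t2, unfolded c], rule C(5)[OF t2, unfolded c])
  show "0 < Re (critw \<alpha> \<beta> \<gamma>)" "Re (critw \<alpha> \<beta> \<gamma>) < \<gamma>" "Re (critw \<alpha> \<beta> \<gamma>) < \<beta>" "Re (critw \<alpha> \<beta> \<gamma>) < \<alpha>"
    using C(1,2)[OF t] C(1,2)[OF t2] C(1,2)[OF t3] unfolding c by auto
qed

text \<open>The real part lies below each of the three angles, hence below their mean pi /
  3.\<close>

private lemma Re_w0: "0 < Re w0" "Re w0 < pi / 3"
  using crit_pieces(7-10) t unfolding w0 tri_def by auto

text \<open>Real part: the logarithms of the three ratios \<open>rho\<close> sum to 0. Imaginary
  part: 3 pi / 2 minus the angle sum pi is pi / 2, which after division by 2 pi is the 1/4 to be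
  cancelled.\<close>

private lemma Vf1_w0: "Vf1 y1 y2 y3 w0 = 0"
proof -
  note t2 = tri_rot[OF t] note t3 = tri_rot[OF t2]
  have "ln (rho \<alpha> \<beta> \<gamma>) + ln (rho \<gamma> \<alpha> \<beta>) + ln (rho \<beta> \<gamma> \<alpha>) = 0"
    unfolding crit_equation[OF t] crit_equation[OF t2] crit_equation[OF t3] by simp
  then have r: "complex_of_real (ln (rho \<alpha> \<beta> \<gamma>)) + of_real (ln (rho \<gamma> \<alpha> \<beta>)) + of_real (ln (rho \<beta> \<gamma> \<alpha>)) = 0"
    by (metis of_real_0 of_real_add)
  have "(pi / 2 - \<gamma>) + (pi / 2 - \<beta>) + (pi / 2 - \<alpha>) = pi / 2" using t by (simp add: tri_def)
  then have a: "complex_of_real (pi / 2 - \<gamma>) + of_real (pi / 2 - \<beta>) + of_real (pi / 2 - \<alpha>) = of_real pi / 2"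
    by (metis of_real_add of_real_divide of_real_numeral)
  have "Vf1 y1 y2 y3 w0 = ((of_real (ln (rho \<alpha> \<beta> \<gamma>)) + of_real (ln (rho \<gamma> \<alpha> \<beta>)) + of_real (ln (rho \<beta> \<gamma> \<alpha>)))
    + \<i> * (of_real (pi / 2 - \<gamma>) + of_real (pi / 2 - \<beta>) + of_real (pi / 2 - \<alpha>))) / of_real (2 * pi) - \<i> / 4"
    unfolding Vf1_def phi1_def crit_pieces(1-3) by (simp only: add_divide_distrib[symmetric] distrib_left) (simp only: add_ac)
  also have "\<dots> = 0" unfolding r a by simp
  finally show ?thesis .
qed

private lemma Vf_w0: "Vf y1 y2 y3 w0 = critJ \<alpha> \<beta> \<gamma> - of_real (\<kappa> / 2)"
proof -
  have "- \<i> * w0 / 4 = - \<i> * critw \<alpha> \<beta> \<gamma> / 4 - of_real (\<kappa> / 2)"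
    unfolding w0 by (simp add: right_diff_distrib diff_divide_distrib)
  then show ?thesis unfolding critV_eq_critJ[OF t, symmetric] Vf_def w0_shift critV_def by simp
qed

text \<open>At each shifted point \<open>phi2_exp\<close> gives 1 + (sin)^3 cis / P for the
  corresponding angle, and the sum is the right-hand side of \<open>critN_square\<close> divided by
  pi P.\<close>

private lemma Vf2_w0: "Vf2 y1 y2 y3 w0 = (critN \<alpha> \<beta> \<gamma>)\<^sup>2 / of_real (pi * P)"
proof -
  have s: "sin \<alpha> > 0" "sin \<beta> > 0" "sin \<gamma> > 0" using tri_sin_pos[OF t] by auto
  have r: "1 / (complex_of_real (rho a b c) * cis (- c)) = of_real ((sin c) ^ 3 / (sin a * sin b * sin c)) * cis c"
    if "sin a > 0" "sin b > 0" "sin c > 0" for a b c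
  proof -
    have "1 / (complex_of_real (rho a b c) * cis (- c)) = of_real (1 / rho a b c) * cis c"
      by (simp add: cis_inverse[symmetric] field_simps)
    also have "1 / rho a b c = (sin c) ^ 3 / (sin a * sin b * sin c)"
      unfolding rho_def using that by (simp add: field_simps power2_eq_square power3_eq_cube)
    finally show ?thesis .
  qed
  have nz: "sin ((w0 + \<i> * of_real y) / 2) \<noteq> 0" for y
    using sin_half_plane[of "w0 + \<i> * of_real y"] Re_w0 pi_gt_zero by auto
  have rp: "rho \<alpha> \<beta> \<gamma> \<noteq> 0" "rho \<gamma> \<alpha> \<beta> \<noteq> 0" "rho \<beta> \<gamma> \<alpha> \<noteq> 0" using s by (auto simp: rho_def)
  have PP: "sin \<gamma> * sin \<alpha> * sin \<beta> = P" "sin \<beta> * sin \<gamma> * sin \<alpha> = P" "sin \<alpha> * sin \<beta> * sin \<gamma> = P" unfolding P by auto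
  have ph: "phi2 (w0 + \<i> * of_real y1) = - (\<i> / of_real (2 * pi)) * (1 + of_real ((sin \<gamma>) ^ 3 / P) * cis \<gamma>)"
    "phi2 (w0 + \<i> * of_real y2) = - (\<i> / of_real (2 * pi)) * (1 + of_real ((sin \<beta>) ^ 3 / P) * cis \<beta>)"
    "phi2 (w0 + \<i> * of_real y3) = - (\<i> / of_real (2 * pi)) * (1 + of_real ((sin \<alpha>) ^ 3 / P) * cis \<alpha>)"
    using phi2_exp[OF nz crit_pieces(4)] phi2_exp[OF nz crit_pieces(5)] phi2_exp[OF nz crit_pieces(6)] s rp
    by (simp_all add: r PP)
  have "Vf2 y1 y2 y3 w0 = - (\<i> / 2) * (of_real (3 * P) + of_real ((sin \<alpha>) ^ 3) * cis \<alpha>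
     + of_real ((sin \<beta>) ^ 3) * cis \<beta> + of_real ((sin \<gamma>) ^ 3) * cis \<gamma>) / of_real (pi * P)"
    unfolding Vf2_def ph using P_pos by (simp add: field_simps)
  then show ?thesis unfolding critN_square[OF t] PP .
qed

private lemma exp_w0: "exp (- (\<i> * w0)) = critN \<alpha> \<beta> \<gamma> / of_real (P\<^sup>2) * of_real (exp (- 2 * \<kappa>))"
proof -
  have nz: "critN \<alpha> \<beta> \<gamma> / of_real (P\<^sup>2) \<noteq> 0" using Re_critN_pos[OF t] P_pos by force
  have "- (\<i> * w0) = Ln (critN \<alpha> \<beta> \<gamma> / of_real (P\<^sup>2)) + of_real (- 2 * \<kappa>)"
    unfolding w0 critw_def P[symmetric] by (simp add: algebra_simps)
  then show ?thesis by (simp only: exp_add exp_Ln[OF nz] exp_of_real)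
qed

text \<open>Of the two roots, \<open>critN\<close> rather than its negative is principal because its
  real part is positive.\<close>

private lemma csqrt_w0: "csqrt (Vf2 y1 y2 y3 w0 / 2) = critN \<alpha> \<beta> \<gamma> / of_real (sqrt (2 * pi * P))"
proof (rule csqrt_unique)
  show "(critN \<alpha> \<beta> \<gamma> / of_real (sqrt (2 * pi * P)))\<^sup>2 = Vf2 y1 y2 y3 w0 / 2"
    unfolding Vf2_w0 power_divide of_real_power[symmetric] using P_pos by (simp add: field_simps)
  have "Re (critN \<alpha> \<beta> \<gamma> / of_real (sqrt (2 * pi * P))) > 0"
    unfolding Re_divide_of_real using Re_critN_pos[OF t] P_pos by simp
  then show "0 < Re (critN \<alpha> \<beta> \<gamma> / of_real (sqrt (2 * pi * P))) \<or> Re (critN \<alpha> \<beta> \<gamma> / of_real (sqrt (2 * pi * P))) = 0 \<and>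
    0 \<le> Im (critN \<alpha> \<beta> \<gamma> / of_real (sqrt (2 * pi * P)))" by simp
qed

text \<open>Three cancellations: \<open>quadJ\<close> and pi / 12 between \<open>Kc\<close> and the
  critical value, \<open>critN\<close> between exp (- i w0) and the square root of the second
  derivative, and the powers of b. The parameter kappa enters W through the angle sum pi, and the
  phase exp (- 13 i pi b^2 / 24) is all that separates the result from the asserted main
  term.\<close>

private lemma leading_term:
  assumes b: "b > 0"
  shows "exp (Kc y1 y2 y3 (b\<^sup>2)) / of_real (2 * pi * b) * (exp (Vf y1 y2 y3 w0 / of_real (b\<^sup>2) - \<i> * w0) *
     (of_real (sqrt (b\<^sup>2)) * (of_real (sqrt pi) / csqrt (Vf2 y1 y2 y3 w0 / 2))))
   = of_real (1 / 2 * (exp (- W / (pi * b\<^sup>2)) / sqrt (exp \<kappa> * P / 2))) * exp (- \<i> * of_real (13 * pi / 24 * b\<^sup>2))"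
proof -
  have s: "sin \<alpha> > 0" "sin \<beta> > 0" "sin \<gamma> > 0" using tri_sin_pos[OF t] by auto
  have W: "W = covJ \<alpha> \<beta> \<gamma> + pi * \<kappa> / 2"
  proof -
    have "pi * \<kappa> = (\<alpha> + \<beta> + \<gamma>) * \<kappa>" using t by (simp add: tri_def)
    then show ?thesis unfolding W_def covJ_def l by (simp add: algebra_simps)
  qed
  have qJ: "quadJ (lsin \<alpha> + lsin \<beta>) (lsin \<alpha> + lsin \<gamma>) (lsin \<beta> + lsin \<gamma>) = quadJ y1 y2 y3"
    unfolding quadJ_def y l by (simp add: power2_eq_square algebra_simps)
  have Y: "(y1 + y2 + y3) / 4 = 3 / 2 * \<kappa> + ln P"
    unfolding y l lsin_def P using s by (simp add: ln_mult)
  have "Kc y1 y2 y3 (b\<^sup>2) + Vf y1 y2 y3 w0 / of_real (b\<^sup>2) = of_real (3 / 2 * \<kappa> + ln P - W / (pi * b\<^sup>2)) - \<i> * of_real (13 * pi / 24 * b\<^sup>2)"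
    unfolding Kc_def Vf_w0 critJ_def qJ Y W using b by (simp add: field_simps)
  then have 1: "exp (Kc y1 y2 y3 (b\<^sup>2)) * exp (Vf y1 y2 y3 w0 / of_real (b\<^sup>2) - \<i> * w0)
    = of_real (exp (3 / 2 * \<kappa>) * P * exp (- W / (pi * b\<^sup>2))) * exp (- \<i> * of_real (13 * pi / 24 * b\<^sup>2)) *
      (critN \<alpha> \<beta> \<gamma> / of_real (P\<^sup>2) * of_real (exp (- 2 * \<kappa>)))"
    (is "?l = ?r")
  proof -
    assume *: "Kc y1 y2 y3 (b\<^sup>2) + Vf y1 y2 y3 w0 / of_real (b\<^sup>2) = of_real (3 / 2 * \<kappa> + ln P - W / (pi * b\<^sup>2)) - \<i> * of_real (13 * pi / 24 * b\<^sup>2)"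
    have "?l = exp (Kc y1 y2 y3 (b\<^sup>2) + Vf y1 y2 y3 w0 / of_real (b\<^sup>2)) * exp (- (\<i> * w0))"
      by (simp add: exp_add exp_diff exp_minus divide_inverse)
    also have "\<dots> = of_real (exp (3 / 2 * \<kappa> + ln P - W / (pi * b\<^sup>2))) * exp (- \<i> * of_real (13 * pi / 24 * b\<^sup>2)) *
      (critN \<alpha> \<beta> \<gamma> / of_real (P\<^sup>2) * of_real (exp (- 2 * \<kappa>)))"
      unfolding * exp_w0 by (simp only: exp_of_real[symmetric] exp_add[symmetric]) simp
    also have "exp (3 / 2 * \<kappa> + ln P - W / (pi * b\<^sup>2)) = exp (3 / 2 * \<kappa>) * P * exp (- W / (pi * b\<^sup>2))"
      by (simp only: exp_diff exp_add exp_ln[OF P_pos]) (simp add: exp_minus field_simps)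
    finally show ?thesis .
  qed
  have nz: "critN \<alpha> \<beta> \<gamma> \<noteq> 0" using Re_critN_pos[OF t] by force
  have k: "exp (3 / 2 * \<kappa>) * exp (- 2 * \<kappa>) = 1 / sqrt (exp \<kappa>)"
  proof -
    have "exp (3 / 2 * \<kappa>) * exp (- 2 * \<kappa>) = exp (- (\<kappa> / 2))" unfolding exp_add[symmetric] by simp
    also have "\<dots> = 1 / sqrt (exp \<kappa>)"
      by (simp add: exp_minus inverse_eq_divide real_sqrt_unique[of "exp (\<kappa> / 2)" "exp \<kappa>", unfolded power2_eq_square, folded exp_add])
    finally show ?thesis .
  qed
  \<comment> \<open>To be used with the square roots of pi, P and 2 for s, p, r, so that only a
    rational identity has to be checked.\<close>
  have gen: "u * (p * p) / (p * p)\<^sup>2 * v / (2 * (s * s) * b) * (b * (s * (r * s * p))) = (u * v) * (1 / p) * (r / 2)"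
    if "s > 0" "p > 0" for u v s p r :: real using that b by (simp add: field_simps power2_eq_square)
  have sq: "sqrt pi * sqrt pi = pi" "sqrt P * sqrt P = P" "sqrt (2 * pi * P) = sqrt 2 * sqrt pi * sqrt P"
    using P_pos by (simp_all add: real_sqrt_mult)
  have "exp (3 / 2 * \<kappa>) * P / P\<^sup>2 * exp (- 2 * \<kappa>) / (2 * pi * b) * (b * (sqrt pi * sqrt (2 * pi * P)))
     = (1 / sqrt (exp \<kappa>)) * (1 / sqrt P) * (sqrt 2 / 2)"
    using gen[of "sqrt pi" "sqrt P" "exp (3 / 2 * \<kappa>)" "exp (- 2 * \<kappa>)" "sqrt 2"] P_pos unfolding sq k by simp
  also have "\<dots> = 1 / 2 / sqrt (exp \<kappa> * P / 2)" by (simp add: real_sqrt_mult real_sqrt_divide field_simps)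
  finally have 2: "exp (3 / 2 * \<kappa>) * P / P\<^sup>2 * exp (- 2 * \<kappa>) / (2 * pi * b) * (b * (sqrt pi * sqrt (2 * pi * P))) = 1 / 2 / sqrt (exp \<kappa> * P / 2)" .
  have sb: "sqrt (b\<^sup>2) = b" using b by simp
  have "exp (Kc y1 y2 y3 (b\<^sup>2)) / of_real (2 * pi * b) * (exp (Vf y1 y2 y3 w0 / of_real (b\<^sup>2) - \<i> * w0) *
     (of_real (sqrt (b\<^sup>2)) * (of_real (sqrt pi) / csqrt (Vf2 y1 y2 y3 w0 / 2))))
    = of_real (exp (3 / 2 * \<kappa>) * P / P\<^sup>2 * exp (- 2 * \<kappa>) / (2 * pi * b) * (b * (sqrt pi * sqrt (2 * pi * P))))
      * of_real (exp (- W / (pi * b\<^sup>2))) * exp (- \<i> * of_real (13 * pi / 24 * b\<^sup>2))"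
    (is "?A / ?B * (?C * ?D) = _")
  proof -
    have "A / B * (C * D) = (A * C) * D / B" for A B C D :: complex by simp
    note this[of ?A ?B ?C ?D]
    then show ?thesis unfolding 1 csqrt_w0 sb using nz by simp
  qed
  then show ?thesis unfolding 2 by simp
qed

text \<open>For small b the given line is moved to the one through w0; the relative error of
  \<open>saddle_integral\<close> and the deviation of the phase from 1 are both O(b^2).\<close>

lemma sixj_saddle_asymptotics:
  fixes c :: "real \<Rightarrow> real" and x :: "nat \<Rightarrow> real"
  assumes x: "x 1 + x 4 = l1" "x 2 + x 5 = l2" "x 3 + x 6 = l3"
    and line: "\<And>b. b \<in> {0<..<1} \<Longrightarrow> 11 * Qb b / 6 < c b \<and> c b < 2 * Qb b"
  shows "\<exists>E. E \<in> O[at_right 0](\<lambda>b. complex_of_real (b\<^sup>2)) \<and>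
    (\<forall>b\<in>{0<..<1}. ideal_sixj (c b) b (\<lambda>k. of_real (Qb b / 2) + \<i> * of_real (x k / (2 * pi * b))) =
       of_real (1 / 2 * (exp (- W / (pi * b\<^sup>2)) / sqrt (exp \<kappa> * P / 2))) * (1 + E b))"
proof -
  define F where "F b = ideal_sixj (c b) b (\<lambda>k. of_real (Qb b / 2) + \<i> * of_real (x k / (2 * pi * b)))" for b
  define m where "m b = complex_of_real (1 / 2 * (exp (- W / (pi * b\<^sup>2)) / sqrt (exp \<kappa> * P / 2)))" for b
  have m: "m b \<noteq> 0" for b using P_pos by (simp add: m_def)
  \<comment> \<open>Defined as an exact quotient, so the product formula holds for every b, and the
    asymptotic statement reduces to a bound on E near 0.\<close>
  define E where "E b = F b / m b - 1" for b
  define A where "A = of_real (sqrt pi) / csqrt (Vf2 y1 y2 y3 w0 / 2)"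
  have "A \<noteq> 0" using Re_critN_pos[OF t] P_pos unfolding A_def csqrt_w0 by force
  then have A: "norm A > 0" by simp
  obtain K e1 where e1: "e1 > 0" and K: "\<And>e. 0 < e \<Longrightarrow> e < e1 \<Longrightarrow>
    norm ((LINT t|lborel. exp (Sexp y1 y2 y3 e (w0 + \<i> * of_real t))) - exp (Vf y1 y2 y3 w0 / of_real e - \<i> * w0) * (of_real (sqrt e) * A))
      \<le> norm (exp (Vf y1 y2 y3 w0 / of_real e - \<i> * w0)) * (K * (e * sqrt e))"
    using saddle_integral[OF Re_w0(1) _ Vf1_w0] Re_w0(2) pi_gt_zero unfolding A_def by auto
  \<comment> \<open>The third entry says that Re w0 < (pi - 2 pi e) / 3, the admissibility condition
    of the line through w0.\<close>
  define e2 where "e2 = min 1 (min e1 ((pi - 3 * Re w0) / (2 * pi)))"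
  have e2: "e2 > 0" using e1 Re_w0 by (simp add: e2_def)
  have yx: "x 1 + x 2 + x 4 + x 5 = y1" "x 1 + x 3 + x 4 + x 6 = y2" "x 2 + x 3 + x 5 + x 6 = y3" using x y by auto
  have bound: "norm (E b) \<le> (13 * pi / 24 + K / norm A) * norm (complex_of_real (b\<^sup>2))" if b: "0 < b" "b < sqrt e2" for b
  proof -
    define e where "e = b\<^sup>2"
    have "b\<^sup>2 < (sqrt e2)\<^sup>2" using b by (intro power_strict_mono) auto
    then have e: "0 < e" "e < e2" using b e2 by (auto simp: e_def)
    then have e': "e \<le> 1" "e < e1" "e < (pi - 3 * Re w0) / (2 * pi)" by (auto simp: e2_def)
    have se: "sqrt e = b" using b by (simp add: e_def)
    have b1: "b < 1" using e'(1) e(2) b unfolding e_def e2_def by (simp add: power_less_one_iff)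
    define \<theta> where "\<theta> = 2 * pi * b * (2 * Qb b - c b) - pi * b\<^sup>2"
    note S12 = ideal_sixj_eq_saddle_integral(1,2)[OF b(1) b1, of "c b", folded \<theta>_def e_def]
    note S3 = ideal_sixj_eq_saddle_integral(3)[OF b(1) b1, of "c b" x, unfolded yx, folded \<theta>_def e_def, folded F_def]
    have lc: "11 * Qb b / 6 < c b" "c b < 2 * Qb b" using line[of b] b b1 by auto
    define G where "G = exp (Vf y1 y2 y3 w0 / of_real e - \<i> * w0)"
    define I where "I = (LINT t|lborel. exp (Sexp y1 y2 y3 e (w0 + \<i> * of_real t)))"
    have w0t: "w0 + \<i> * of_real t = Complex (Re w0) (Im w0 + 1 * t)" for t by (simp add: complex_eq_iff)
    have pe: "0 < pi * e" using e by simp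
    have Rw: "- pi * e < Re w0" "Re w0 < (pi - 2 * pi * e) / 3"
      using Re_w0 pe e'(3) by (simp_all add: field_simps)
    have "(LINT t|lborel. exp (Sexp y1 y2 y3 e (Complex \<theta> t))) = (LINT t|lborel. exp (Sexp y1 y2 y3 e (Complex (Re w0) t)))"
      by (rule Sexp_integral_shift[OF e(1) e'(1) S12[OF lc] Rw])
    also have "\<dots> = I"
      unfolding I_def w0t using lborel_integral_real_affine[of 1 "\<lambda>t. exp (Sexp y1 y2 y3 e (Complex (Re w0) t))" "Im w0"] by simp
    finally have F: "F b = exp (Kc y1 y2 y3 e) / of_real (2 * pi * b) * I" using S3[OF lc] by simp
    define B where "B = exp (Kc y1 y2 y3 e) / of_real (2 * pi * b)"
    define q where "q = exp (- \<i> * of_real (13 * pi / 24 * e))"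
    have lead: "B * (G * (of_real b * A)) = m b * q"
      using leading_term[OF b(1)] se unfolding e_def[symmetric] B_def G_def A_def m_def q_def by simp
    have Gn: "G \<noteq> 0" by (simp add: G_def)
    have bA: "norm (of_real b * A) = b * norm A" using b by (simp add: norm_mult)
    have err: "norm (I - G * (of_real b * A)) \<le> norm G * (K * (e * b))"
      using K[OF e(1) e'(2)] unfolding I_def G_def se .
    define r where "r = (I - G * (of_real b * A)) / (G * (of_real b * A))"
    have "norm r \<le> norm G * (K * (e * b)) / (norm G * (b * norm A))"
      unfolding r_def norm_divide norm_mult[of G] bA by (intro divide_right_mono err) (use b in auto)
    also have "\<dots> = K / norm A * e" using Gn b by (simp add: field_simps)
    finally have r: "norm r \<le> K / norm A * e" .
    have "I = G * (of_real b * A) * (1 + r)" using Gn b \<open>A \<noteq> 0\<close> unfolding r_def by (simp add: field_simps)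
    then have "F b = (B * (G * (of_real b * A))) * (1 + r)" unfolding F B_def by (simp add: mult_ac)
    then have "E b = q * (1 + r) - 1" unfolding lead E_def using m by simp
    also have "\<dots> = (q - 1) + q * r" by (simp add: algebra_simps)
    finally have "norm (E b) \<le> norm (q - 1) + norm (q * r)" by (metis norm_triangle_ineq)
    also have "norm (q * r) = norm r" by (simp add: norm_mult q_def)
    also have "norm (q - 1) \<le> 13 * pi / 24 * e"
    proof -
      have "norm (exp (\<i> * of_real s) - 1) \<le> \<bar>s\<bar>" for s
      proof -
        have "norm (exp (\<i> * of_real s) - exp 0) \<le> 1 * norm (\<i> * of_real s - 0)"
          by (rule field_differentiable_bound[of "closed_segment 0 (\<i> * of_real s)" exp exp])
            (auto intro!: derivative_eq_intros simp: in_segment(1))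
        then show ?thesis by (simp add: norm_mult)
      qed
      from this[of "- (13 * pi / 24 * e)"] show ?thesis using e unfolding q_def by simp
    qed
    finally show ?thesis using r e by (simp add: e_def algebra_simps norm_power)
  qed
  have "E \<in> O[at_right 0](\<lambda>b. complex_of_real (b\<^sup>2))"
  proof (rule bigoI)
    have "eventually (\<lambda>b::real. b \<in> {0<..<sqrt e2}) (at_right 0)" using e2 by (intro eventually_at_right_real) simp
    then show "\<forall>\<^sub>F b in at_right 0. norm (E b) \<le> (13 * pi / 24 + K / norm A) * norm (complex_of_real (b\<^sup>2))"
      by eventually_elim (use bound in auto)
  qed
  moreover have "F b = m b * (1 + E b)" for b using m by (simp add: E_def)
  ultimately show ?thesis unfolding F_def m_def by blast
qed

end

section \<open>Lorentzian geometry of ideal tetrahedra\<close>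

text \<open>Only the nine fixed point free permutations contribute: three double transpositions give
  the squares, six 4-cycles the mixed products. The result is minus \<open>heron\<close> of the
  three products of opposite entries. The four indices are kept abstract so that they can be listed
  as 1, 2, 3, 0.\<close>

lemma det_4_zero_diagonal:
  fixes M :: "'n::finite \<Rightarrow> 'n \<Rightarrow> real"
  assumes U: "UNIV = {a, b, c, d::'n}" and ne: "a \<noteq> b" "a \<noteq> c" "a \<noteq> d" "b \<noteq> c" "b \<noteq> d" "c \<noteq> d"
    and diag: "\<And>i. M i i = 0" and sym: "M b a = M a b" "M c a = M a c" "M d a = M a d" "M c b = M b c" "M d b = M b d" "M d c = M c d"
  shows "det (\<chi> i j. M i j) = (M a b * M c d)\<^sup>2 + (M a c * M b d)\<^sup>2 + (M a d * M b c)\<^sup>2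
    - 2 * (M a b * M c d) * (M a c * M b d) - 2 * (M a b * M c d) * (M a d * M b c) - 2 * (M a c * M b d) * (M a d * M b c)"
proof -
  have f1234: "finite {b, c, d}" "a \<notin> {b, c, d}" using ne by auto
  have f234: "finite {c, d}" "b \<notin> {c, d}" using ne by auto
  have f34: "finite {d}" "c \<notin> {d}" using ne by auto
  note ne' = ne ne[symmetric]
  have sg: "sign (Transposition.transpose x y \<circ> q) = (if x = y then sign q else - sign q)" if "permutation q" for x y :: 'n and q
    using sign_compose[OF permutation_swap_id that, of x y] by (simp add: sign_swap_id)
  have pq: "permutation (Transposition.transpose x y \<circ> q)" if "permutation q" for x y :: 'n and q
    by (rule permutation_compose[OF permutation_swap_id that])
  show ?thesis
    unfolding det_def U
    unfolding sum_over_permutations_insert[OF f1234]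
    unfolding sum_over_permutations_insert[OF f234]
    unfolding sum_over_permutations_insert[OF f34]
    unfolding permutes_sing singleton_conv
    apply (simp only: sum.insert sum.empty prod.insert prod.empty finite.intros insert_iff empty_iff ne' simp_thms add_0_right mult_1_right)
    apply (simp only: sg pq permutation_id sign_id ne' if_False refl if_True Transposition.transpose_def comp_apply id_apply of_int_1 of_int_minus minus_minus)
    apply (simp only: vec_lambda_beta diag sym mult_zero_left mult_zero_right add_0_left add_0_right)
    by (simp add: power2_eq_square algebra_simps)
qed

lemma lor_commute: "lor x y = lor y x"
  by (simp add: lor_def inner_commute mult.commute)

lemma lor_simps [simp]:
  "lor (x + y) z = lor x z + lor y z" "lor z (x + y) = lor z x + lor z y"
  "lor (x - y) z = lor x z - lor y z" "lor z (x - y) = lor z x - lor z y"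
  "lor (- x) y = - lor x y" "lor x (- y) = - lor x y"
  "lor (a *\<^sub>R x) y = a * lor x y" "lor x (a *\<^sub>R y) = a * lor x y"
  "lor 0 x = 0" "lor x 0 = 0"
  by (simp_all add: lor_def algebra_simps)

lemma ideal_rep_norm: "ideal_rep p \<Longrightarrow> norm (fst p) = snd p"
  unfolding ideal_rep_def lor_def dot_square_norm power2_eq_square[symmetric]
  by (metis diff_eq_diff_eq diff_0_right norm_ge_zero order_less_imp_le power2_eq_iff_nonneg diff_self)

text \<open>Subtracting from n the multiple of p with the same time coordinate leaves a purely
  spatial vector y. As p is null and orthogonal to n, the Lorentz square of n is the Euclidean
  square of y.\<close>

lemma lor_orthogonal_ideal:
  assumes p: "ideal_rep p" and o: "lor n p = 0"
  shows "lor n n \<ge> 0" and "lor n n = 0 \<Longrightarrow> \<exists>c. n = c *\<^sub>R p"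
proof -
  have t: "norm (fst p) = snd p" "snd p > 0" using ideal_rep_norm[OF p] p by (auto simp: ideal_rep_def)
  have ip: "fst n \<bullet> fst p = snd n * snd p" using o by (simp add: lor_def)
  define y where "y = fst n - (snd n / snd p) *\<^sub>R fst p"
  have "y \<bullet> y = fst n \<bullet> fst n - 2 * (snd n / snd p) * (fst n \<bullet> fst p) + (snd n / snd p)\<^sup>2 * (fst p \<bullet> fst p)"
    by (simp add: y_def inner_commute algebra_simps power2_eq_square)
  also have "\<dots> = fst n \<bullet> fst n - snd n * snd n"
    unfolding ip dot_square_norm[of "fst p"] t(1) using t(2) by (simp add: field_simps power2_eq_square)
  finally have y: "lor n n = y \<bullet> y" by (simp add: lor_def)
  then show "lor n n \<ge> 0" by simp
  assume "lor n n = 0"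
  then have "y = 0" using y by simp
  then have "n = (snd n / snd p) *\<^sub>R p" using t(2) by (simp add: y_def prod_eq_iff)
  then show "\<exists>c. n = c *\<^sub>R p" by blast
qed

lemma lor_ideal_nonpos:
  assumes "ideal_rep p" "ideal_rep q"
  shows "lor p q \<le> 0" and "lor p q = 0 \<Longrightarrow> \<exists>c. q = c *\<^sub>R p"
proof -
  have "fst p \<bullet> fst q \<le> norm (fst p) * norm (fst q)" by (rule norm_cauchy_schwarz)
  then show "lor p q \<le> 0" using assms by (simp add: lor_def ideal_rep_norm)
  assume "lor p q = 0"
  then show "\<exists>c. q = c *\<^sub>R p"
    using lor_orthogonal_ideal(2)[OF assms(1), of q] assms(2) by (auto simp: lor_commute ideal_rep_def)
qed

text \<open>Three vectors do not span a space of dimension four; reversing the time coordinate turns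
  Euclidean into Lorentz orthogonality.\<close>

lemma exists_lor_orthogonal:
  fixes a b c :: minkowski
  obtains z where "z \<noteq> 0" "lor z a = 0" "lor z b = 0" "lor z c = 0"
proof -
  have "dim {a, b, c} \<le> card {a, b, c}" by (rule dim_le_card') auto
  also have "\<dots> < DIM(minkowski)" by (rule order_le_less_trans[of _ 3]) (auto simp: card_insert_if)
  finally obtain y :: minkowski where y: "y \<noteq> 0" "\<And>x. x \<in> span {a, b, c} \<Longrightarrow> orthogonal y x"
    using orthogonal_to_subspace_exists by blast
  have "inner y a = 0" "inner y b = 0" "inner y c = 0"
    by (auto intro!: y(2)[unfolded orthogonal_def] span_base)
  then show ?thesis using y(1) by (intro that[of "(fst y, - snd y)"]) (auto simp: lor_def inner_prod_def prod_eq_iff)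
qed

abbreviation ge :: "minkowski \<Rightarrow> minkowski \<Rightarrow> real" where "ge a b \<equiv> - lor a b"

text \<open>A normal of the hyperplane spanned by a, b, c. Up to a common sign its coefficients are
  the cofactors of the Gram matrix along the row of d, so all its products are polynomials in the
  entries of that matrix.\<close>

definition face_normal :: "minkowski \<Rightarrow> minkowski \<Rightarrow> minkowski \<Rightarrow> minkowski \<Rightarrow> minkowski" where
  "face_normal a b c d = (let A = ge a b * ge c d; B = ge a c * ge b d; C = ge a d * ge b c in
     (ge b c * (C - A - B)) *\<^sub>R a + (ge a c * (B - A - C)) *\<^sub>R b + (ge a b * (A - B - C)) *\<^sub>R c + (2 * ge a b * ge a c * ge b c) *\<^sub>R d)"

text \<open>Heron's polynomial: 16 times the squared area of a triangle whose sides have squares A,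
  B, C.\<close>

definition heron :: "real \<Rightarrow> real \<Rightarrow> real \<Rightarrow> real" where
  "heron A B C = 2 * A * B + 2 * A * C + 2 * B * C - A\<^sup>2 - B\<^sup>2 - C\<^sup>2"

locale ideal_tetrahedron =
  fixes a b c d :: minkowski
  assumes rep: "ideal_rep a" "ideal_rep b" "ideal_rep c" "ideal_rep d"
    and noncoplanar: "\<not> ideal_coplanar {a, b, c, d}"
begin

lemma no_common_normal:
  assumes "lor n a = 0" "lor n b = 0" "lor n c = 0" "lor n d = 0"
  shows "\<not> lor n n > 0"
  using assms noncoplanar unfolding ideal_coplanar_def by (metis insertE emptyE lor_commute)

text \<open>A nonzero n orthogonal to all four vertices is null by noncoplanarity, so all vertices
  are proportional to it. Then a nonzero spatial vector orthogonal to one of them is orthogonal to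
  all, and its plane would contain the four ideal points.\<close>

lemma lor_orthogonal_imp_0:
  assumes "lor n a = 0" "lor n b = 0" "lor n c = 0" "lor n d = 0"
  shows "n = 0"
proof (rule ccontr)
  assume n: "n \<noteq> 0"
  have "\<not> lor n n > 0" by (rule no_common_normal[OF assms])
  then have 0: "lor n n = 0" using lor_orthogonal_ideal(1)[OF rep(1) assms(1)] by simp
  then obtain k1 k2 k3 k4 where k: "n = k1 *\<^sub>R a" "n = k2 *\<^sub>R b" "n = k3 *\<^sub>R c" "n = k4 *\<^sub>R d"
    using lor_orthogonal_ideal(2) rep assms by metis
  obtain z where z: "z \<noteq> 0" "lor z a = 0" "lor z (1, 0) = 0" "lor z (0, 1) = 0"
    using exists_lor_orthogonal[of a "(1, 0)" "(0, 1)"] by metis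
  have "lor z n = 0" using k(1) z(2) by simp
  then have "lor z v = 0" if "n = k *\<^sub>R v" for k v using n that by auto
  then have "lor z b = 0" "lor z c = 0" "lor z d = 0" using k(2-4) by blast+
  moreover have "lor z z > 0" using z(1,4) by (auto simp: lor_def prod_eq_iff)
  ultimately show False using no_common_normal z(2) by blast
qed

lemma ge_ab_pos: "ge a b > 0"
proof (rule ccontr)
  assume "\<not> ?thesis"
  then have "lor a b = 0" using lor_ideal_nonpos(1)[OF rep(1,2)] by simp
  then obtain k where k: "b = k *\<^sub>R a" using lor_ideal_nonpos(2)[OF rep(1,2)] by blast
  obtain z where "z \<noteq> 0" "lor z a = 0" "lor z c = 0" "lor z d = 0" by (rule exists_lor_orthogonal)
  with lor_orthogonal_imp_0[of z] k show False by simp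
qed

lemma perm:
  "ideal_tetrahedron b a c d" "ideal_tetrahedron a c b d" "ideal_tetrahedron a b d c" "ideal_tetrahedron b c d a"
  "ideal_tetrahedron c b a d" "ideal_tetrahedron c d a b" "ideal_tetrahedron a d b c"
  using rep noncoplanar unfolding ideal_tetrahedron_def by (simp_all add: insert_commute)

lemma face_normal_abc: "lor (face_normal a b c d) a = 0" "lor (face_normal a b c d) b = 0" "lor (face_normal a b c d) c = 0"
  "lor (face_normal a b c d) d = heron (ge a b * ge c d) (ge a c * ge b d) (ge a d * ge b c)"
  using rep unfolding face_normal_def Let_def heron_def ideal_rep_def
  by (simp_all add: lor_commute[of b a] lor_commute[of c a] lor_commute[of d a] lor_commute[of c b] lor_commute[of d b] lor_commute[of d c])
    (simp_all add: algebra_simps power2_eq_square)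

lemma lor_face_normal:
  "lor (face_normal a b c d) (face_normal a b c d) = 2 * ge a b * ge a c * ge b c * heron (ge a b * ge c d) (ge a c * ge b d) (ge a d * ge b c)"
  "lor (face_normal a b c d) (face_normal a b d c) =
    ge a b * (ge a b * ge c d - ge a c * ge b d - ge a d * ge b c) * heron (ge a b * ge c d) (ge a c * ge b d) (ge a d * ge b c)"
proof -
  show "lor (face_normal a b c d) (face_normal a b c d) = 2 * ge a b * ge a c * ge b c * heron (ge a b * ge c d) (ge a c * ge b d) (ge a d * ge b c)"
    by (subst (2) face_normal_def) (simp add: face_normal_abc Let_def)
  show "lor (face_normal a b c d) (face_normal a b d c) =
    ge a b * (ge a b * ge c d - ge a c * ge b d - ge a d * ge b c) * heron (ge a b * ge c d) (ge a c * ge b d) (ge a d * ge b c)"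
    by (subst (2) face_normal_def) (simp add: face_normal_abc Let_def lor_commute[of d c])
qed

end

context ideal_tetrahedron begin

lemma ge_pos: "ge a b > 0" "ge a c > 0" "ge a d > 0" "ge b c > 0" "ge b d > 0" "ge c d > 0"
  using ideal_tetrahedron.ge_ab_pos[OF perm(1)] ge_ab_pos ideal_tetrahedron.ge_ab_pos[OF perm(2)]
   ideal_tetrahedron.ge_ab_pos[OF perm(4)]  ideal_tetrahedron.ge_ab_pos[OF perm(6)]  ideal_tetrahedron.ge_ab_pos[OF perm(7)]
   ideal_tetrahedron.ge_ab_pos[OF ideal_tetrahedron.perm(2)[OF perm(1)]]
   ideal_tetrahedron.ge_ab_pos[OF ideal_tetrahedron.perm(7)[OF perm(1)]]
  by simp_all

text \<open>\<open>face_normal\<close> is orthogonal to a null vector and so has nonnegative square,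
  a positive multiple of \<open>heron\<close>. If that were 0, the normal would be orthogonal to all
  vertices and hence zero, although its coefficient at d is positive and d is not in the span of the
  others.\<close>

lemma heron_pos: "heron (ge a b * ge c d) (ge a c * ge b d) (ge a d * ge b c) > 0" (is "?D > 0")
proof (rule ccontr)
  assume "\<not> ?D > 0"
  have "2 * ge a b * ge a c * ge b c * ?D \<ge> 0"
    using lor_orthogonal_ideal(1)[OF rep(1) face_normal_abc(1)] unfolding lor_face_normal .
  moreover have p: "2 * ge a b * ge a c * ge b c > 0" by (intro mult_pos_pos ge_pos) simp
  ultimately have "?D = 0" using \<open>\<not> ?D > 0\<close> by (metis linorder_neqE_linordered_idom mult_pos_neg not_le)
  then have 0: "face_normal a b c d = 0" using lor_orthogonal_imp_0 face_normal_abc by simp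
  obtain z where z: "z \<noteq> 0" "lor z a = 0" "lor z b = 0" "lor z c = 0" by (rule exists_lor_orthogonal)
  have "lor z (face_normal a b c d) = 2 * ge a b * ge a c * ge b c * lor z d"
    unfolding face_normal_def Let_def by (simp add: z)
  then have "2 * ge a b * ge a c * ge b c * lor z d = 0" unfolding 0 by (simp only: lor_simps)
  then have "lor z d = 0" using p by (metis mult_eq_0_iff less_irrefl)
  then show False using lor_orthogonal_imp_0[of z] z by simp
qed

lemma outward_normal_unique:
  "(THE n. lor n n = 1 \<and> lor n a = 0 \<and> lor n b = 0 \<and> lor n c = 0 \<and> lor n d < 0)
     = - (1 / sqrt (lor (face_normal a b c d) (face_normal a b c d))) *\<^sub>R face_normal a b c d"
    and "lor (face_normal a b c d) (face_normal a b c d) > 0"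
proof -
  define u where "u = face_normal a b c d"
  note ud = face_normal_abc[folded u_def]
  have uu: "lor u u > 0" unfolding u_def lor_face_normal by (intro mult_pos_pos ge_pos heron_pos) simp
  then show "lor (face_normal a b c d) (face_normal a b c d) > 0" by (simp add: u_def)
  have dd: "lor u d > 0" unfolding ud using heron_pos .
  show "(THE n. lor n n = 1 \<and> lor n a = 0 \<and> lor n b = 0 \<and> lor n c = 0 \<and> lor n d < 0)
     = - (1 / sqrt (lor (face_normal a b c d) (face_normal a b c d))) *\<^sub>R face_normal a b c d"
    unfolding u_def[symmetric]
  proof (rule the_equality)
    show "lor (- (1 / sqrt (lor u u)) *\<^sub>R u) (- (1 / sqrt (lor u u)) *\<^sub>R u) = 1 \<and> lor (- (1 / sqrt (lor u u)) *\<^sub>R u) a = 0 \<and>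
      lor (- (1 / sqrt (lor u u)) *\<^sub>R u) b = 0 \<and> lor (- (1 / sqrt (lor u u)) *\<^sub>R u) c = 0 \<and> lor (- (1 / sqrt (lor u u)) *\<^sub>R u) d < 0"
      using uu dd by (simp add: ud(1-3))
  next
    fix n assume n: "lor n n = 1 \<and> lor n a = 0 \<and> lor n b = 0 \<and> lor n c = 0 \<and> lor n d < 0"
    define k where "k = lor n d / lor u d"
    have "n - k *\<^sub>R u = 0" using n dd by (intro lor_orthogonal_imp_0) (simp_all add: ud(1-3) k_def)
    then have nk: "n = k *\<^sub>R u" by simp
    have k: "k < 0" using n dd by (simp add: k_def divide_neg_pos)
    have "(- k)\<^sup>2 * lor u u = 1" using n unfolding nk by (simp add: power2_eq_square)
    then have "sqrt ((- k)\<^sup>2) * sqrt (lor u u) = 1" by (metis real_sqrt_mult real_sqrt_one)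
    then have "- k * sqrt (lor u u) = 1" using k by simp
    then have "k = - (1 / sqrt (lor u u))" using uu by (simp add: field_simps)
    then show "n = - (1 / sqrt (lor u u)) *\<^sub>R u" using nk by simp
  qed
qed

end

text \<open>The law of cosines, with positivity of Heron's polynomial in place of the triangle
  inequalities. For the angle sum, sin (u + v) = sin w > 0 confines u + v to [0, pi], and there cos
  (u + v) = - cos w determines it.\<close>

lemma triangle_angles:
  fixes A B C :: real
  assumes "A > 0" "B > 0" "C > 0" "heron A B C > 0"
  defines "u \<equiv> arccos ((B + C - A) / (2 * sqrt (B * C)))" and "v \<equiv> arccos ((A + C - B) / (2 * sqrt (A * C)))"
    and "w \<equiv> arccos ((A + B - C) / (2 * sqrt (A * B)))"
  shows "tri u v w"
    and "sin u = sqrt (heron A B C) / (2 * sqrt (B * C))"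
    and "sin v = sqrt (heron A B C) / (2 * sqrt (A * C))"
    and "sin w = sqrt (heron A B C) / (2 * sqrt (A * B))"
proof -
  have gen: "cos (arccos ((B + C - A) / (2 * sqrt (B * C)))) = (B + C - A) / (2 * sqrt (B * C)) \<and>
     sin (arccos ((B + C - A) / (2 * sqrt (B * C)))) = sqrt (heron A B C) / (2 * sqrt (B * C)) \<and>
     0 < arccos ((B + C - A) / (2 * sqrt (B * C))) \<and> arccos ((B + C - A) / (2 * sqrt (B * C))) < pi"
    if "A > 0" "B > 0" "C > 0" "heron A B C > 0" for A B C :: real
  proof -
    define q where "q = (B + C - A) / (2 * sqrt (B * C))"
    have q2: "1 - q\<^sup>2 = heron A B C / (2 * sqrt (B * C))\<^sup>2"
      unfolding q_def heron_def using that by (simp add: power_divide power_mult_distrib field_simps) (simp add: power2_eq_square algebra_simps)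
    have "heron A B C / (2 * sqrt (B * C))\<^sup>2 > 0" using that by (intro divide_pos_pos) auto
    then have "q\<^sup>2 < 1" using q2 by simp
    then have q: "-1 < q" "q < 1" by (simp_all add: abs_square_less_1 abs_less_iff)
    have "sin (arccos q) = sqrt (1 - q\<^sup>2)" using q by (simp add: sin_arccos)
    also have "\<dots> = sqrt (heron A B C) / (2 * sqrt (B * C))" unfolding q2 real_sqrt_divide real_sqrt_abs using that by simp
    finally show ?thesis unfolding q_def[symmetric] using q arccos_lt_bounded[of q] by simp
  qed
  have h: "heron B A C = heron A B C" "heron C A B = heron A B C" by (simp_all add: heron_def)
  have a: "cos u = (B + C - A) / (2 * sqrt (B * C))" "sin u = sqrt (heron A B C) / (2 * sqrt (B * C))" "0 < u" "u < pi"
    using gen[of A B C] assms(1-4) unfolding u_def by auto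
  have b: "cos v = (A + C - B) / (2 * sqrt (A * C))" "sin v = sqrt (heron A B C) / (2 * sqrt (A * C))" "0 < v" "v < pi"
    using gen[of B A C] assms(1-4) unfolding v_def h by auto
  have c: "cos w = (A + B - C) / (2 * sqrt (A * B))" "sin w = sqrt (heron A B C) / (2 * sqrt (A * B))" "0 < w" "w < pi"
    using gen[of C A B] assms(1-4) unfolding w_def h by auto
  show "sin u = sqrt (heron A B C) / (2 * sqrt (B * C))" "sin v = sqrt (heron A B C) / (2 * sqrt (A * C))"
    "sin w = sqrt (heron A B C) / (2 * sqrt (A * B))" by (rule a b c)+
  obtain x y z where xyz: "x > 0" "y > 0" "z > 0" "A = x * x" "B = y * y" "C = z * z" "sqrt A = x" "sqrt B = y" "sqrt C = z"
    by (rule that[of "sqrt A" "sqrt B" "sqrt C"]) (use assms(1-3) in simp_all)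
  define h where "h = sqrt (heron A B C)"
  have hh: "h * h = heron A B C" using assms(4) by (simp add: h_def)
  have "sin (u + v) = sin w"
  proof -
    have "h / (2 * (y * z)) * ((A + C - B) / (2 * (x * z))) + (B + C - A) / (2 * (y * z)) * (h / (2 * (x * z)))
      = h * ((A + C - B) + (B + C - A)) / (4 * (x * y * (z * z)))"
      using xyz(1-3) by (simp add: field_simps)
    also have "\<dots> = h / (2 * (x * y))" unfolding xyz(6) using xyz(1-3) by (simp add: field_simps)
    finally show ?thesis unfolding sin_add a b c real_sqrt_mult xyz(7-9) h_def .
  qed
  then have "sin (u + v) > 0" using sin_gt_zero[OF c(3,4)] by simp
  then have le: "u + v \<le> pi" using a(3,4) b(3,4) sin_le_zero[of "u + v"] by (cases "u + v \<le> pi") auto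
  have "cos u * cos v - sin u * sin v = ((B + C - A) * (A + C - B) - heron A B C) / (4 * x * y * (z * z))"
  proof -
    have "(B + C - A) / (2 * (y * z)) * ((A + C - B) / (2 * (x * z))) - h / (2 * (y * z)) * (h / (2 * (x * z)))
       = ((B + C - A) * (A + C - B) - h * h) / (4 * x * y * (z * z))"
      using xyz(1-3) by (simp add: divide_simps)
    then show ?thesis unfolding a b real_sqrt_mult xyz(7-9) hh unfolding h_def .
  qed
  also have "(B + C - A) * (A + C - B) - heron A B C = - (2 * (A + B - C) * (z * z))"
    unfolding heron_def xyz(6)[symmetric] by (simp add: power2_eq_square algebra_simps)
  also have "\<dots> / (4 * x * y * (z * z)) = - cos w"
    unfolding c real_sqrt_mult xyz(7-9) using xyz(1-3) by (simp add: divide_simps)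
  finally have "cos (u + v) = cos (pi - w)" by (simp add: cos_add)
  from cos_inj_pi[OF _ le _ _ this] have "u + v = pi - w" using a(3,4) b(3,4) c(3,4) by linarith
  then show "tri u v w" using a(3) b(3) c(3) by (simp add: tri_def)
qed

section \<open>Horospheres and signed edge lengths\<close>

lemma snd_pos:
  assumes "lor x x < 0" "ideal_rep p" "lor x p < 0"
  shows "snd x > 0"
proof (rule ccontr)
  assume "\<not> snd x > 0"
  have "norm (fst x) ^ 2 < \<bar>snd x\<bar>\<^sup>2" using assms(1) unfolding lor_def dot_square_norm power2_eq_square by simp
  then have n: "norm (fst x) < \<bar>snd x\<bar>" using power2_less_imp_less by fastforce
  have "- (fst x \<bullet> fst p) \<le> norm (fst x) * norm (fst p)" using norm_cauchy_schwarz[of "- fst x" "fst p"] by simp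
  also have "\<dots> = norm (fst x) * snd p" using ideal_rep_norm[OF assms(2)] by simp
  also have "\<dots> \<le> \<bar>snd x\<bar> * snd p" using n assms(2) by (intro mult_right_mono) (auto simp: ideal_rep_def)
  finally show False using assms(3) \<open>\<not> snd x > 0\<close> by (simp add: lor_def abs_if split: if_splits)
qed

lemma geodesic_horosphere:
  assumes p: "ideal_rep p" and q: "ideal_rep q" and g: "ge p q > 0" and r: "r > 0"
  shows "ideal_geodesic p q \<inter> {x \<in> H3. lor x p = - r} = {(1 / (2 * r)) *\<^sub>R p + (r / ge p q) *\<^sub>R q}"
proof -
  have pp: "lor p p = 0" "lor q q = 0" "lor q p = lor p q" "snd p > 0" "snd q > 0" using p q by (auto simp: ideal_rep_def lor_commute)
  have l: "lor (s *\<^sub>R p + t *\<^sub>R q) (s *\<^sub>R p + t *\<^sub>R q) = - (2 * s * t * ge p q)" "lor (s *\<^sub>R p + t *\<^sub>R q) p = - (t * ge p q)" for s t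
    by (simp_all add: pp)
  define X where "X = (1 / (2 * r)) *\<^sub>R p + (r / ge p q) *\<^sub>R q"
  have XX: "lor X X = - 1" "lor X p = - r" unfolding X_def l using g r by (simp_all add: field_simps)
  have sX: "snd X > 0" unfolding X_def snd_add snd_scaleR real_scaleR_def by (intro add_pos_pos mult_pos_pos divide_pos_pos pp g r) simp_all
  have eX: "\<exists>s t. s > 0 \<and> t > 0 \<and> X = s *\<^sub>R p + t *\<^sub>R q"
    using g r by (intro exI[of _ "1 / (2 * r)"] exI[of _ "r / ge p q"]) (auto simp: X_def divide_pos_neg)
  moreover have "x = X" if gx: "x \<in> ideal_geodesic p q" and xp: "lor x p = - r" for x
  proof -
    obtain s t where st: "s > 0" "t > 0" "x = s *\<^sub>R p + t *\<^sub>R q" using gx unfolding ideal_geodesic_def by blast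
    have xx: "lor x x = - 1" using gx unfolding ideal_geodesic_def H3_def by (simp only: mem_Collect_eq)
    have "t * ge p q = r" using xp unfolding st(3) l by simp
    then have t: "t = r / ge p q" using g by (metis nonzero_eq_divide_eq less_irrefl)
    have "2 * s * t * ge p q = 1" using xx unfolding st(3) l by simp
    then have "2 * s * (t * ge p q) = 1" by (simp only: mult.assoc)
    then have "2 * s * r = 1" unfolding \<open>t * ge p q = r\<close> .
    then have "s = 1 / (2 * r)" using r by (simp add: field_simps)
    then show ?thesis unfolding st(3) t X_def by simp
  qed
  moreover have "X \<in> H3" unfolding H3_def mem_Collect_eq using XX sX by blast
  moreover from this have "X \<in> ideal_geodesic p q" unfolding ideal_geodesic_def mem_Collect_eq using eX by blast
  ultimately show ?thesis unfolding X_def[symmetric] using XX by blast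
qed

text \<open>Any vector with the prescribed products is m + y, with m in the plane of p and q and y
  orthogonal to both, hence of nonnegative square. Since m has square - 1 / M, a point of the
  hyperboloid requires y to have square 1 / M - 1, which is impossible for M > 1 and attainable for
  M < 1.\<close>

lemma horospheres_disjoint:
  assumes p: "ideal_rep p" and q: "ideal_rep q" and g: "ge p q > 0" and r: "r > 0" "r' > 0"
  defines "M \<equiv> ge p q / (2 * r * r')"
  shows "M > 1 \<Longrightarrow> {x \<in> H3. lor x p = - r} \<inter> {x \<in> H3. lor x q = - r'} = {}"
    and "M < 1 \<Longrightarrow> {x \<in> H3. lor x p = - r} \<inter> {x \<in> H3. lor x q = - r'} \<noteq> {}"
proof -
  have pp: "lor p p = 0" "lor q q = 0" "lor q p = lor p q" "snd p > 0" "snd q > 0" using p q by (auto simp: ideal_rep_def lor_commute)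
  define m where "m = (r' / ge p q) *\<^sub>R p + (r / ge p q) *\<^sub>R q"
  have m: "lor m p = - r" "lor m q = - r'" "lor p m = - r" "lor q m = - r'" using g by (simp_all add: m_def pp)
  have L: "M > 0" "2 * r * r' / ge p q = 1 / M" using g r unfolding M_def by (simp_all add: divide_neg_pos)
  have "lor m x = (r' / ge p q) * lor p x + (r / ge p q) * lor q x" for x unfolding m_def by simp
  note this[of m]
  also have "(r' / ge p q) * lor p m + (r / ge p q) * lor q m = - (2 * r * r' / ge p q)" unfolding m by simp
  finally have mm: "lor m m = - (1 / M)" using L by simp
  have ym: "lor y m = 0" if "lor y p = 0" "lor y q = 0" for y using that by (simp add: m_def)
  show "{x \<in> H3. lor x p = - r} \<inter> {x \<in> H3. lor x q = - r'} = {}" if "M > 1"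
  proof (rule ccontr)
    assume "\<not> ?thesis"
    then obtain x where x: "lor x x = -1" "lor x p = - r" "lor x q = - r'" by (auto simp: H3_def)
    define y where "y = x - m"
    have y: "lor y p = 0" "lor y q = 0" by (simp_all add: y_def x m)
    have "x = y + m" by (simp add: y_def)
    then have "lor y y = - 1 + 1 / M" using x(1) mm ym[OF y] lor_commute[of m y] by simp
    moreover have "lor y y \<ge> 0" by (rule lor_orthogonal_ideal(1)[OF p y(1)])
    moreover have "1 / M < 1" using that by simp
    ultimately show False by simp
  qed
  show "{x \<in> H3. lor x p = - r} \<inter> {x \<in> H3. lor x q = - r'} \<noteq> {}" if "M < 1"
  proof -
    obtain z where z: "z \<noteq> 0" "lor z p = 0" "lor z q = 0" using exists_lor_orthogonal[of p q q] by metis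
    have "lor z z \<noteq> 0"
    proof
      assume "lor z z = 0"
      then obtain k where "z = k *\<^sub>R p" using lor_orthogonal_ideal(2)[OF p z(2)] by blast
      then show False using z g by simp
    qed
    then have zz: "lor z z > 0" using lor_orthogonal_ideal(1)[OF p z(2)] by simp
    define y where "y = sqrt ((1 / M - 1) / lor z z) *\<^sub>R z"
    have y: "lor y p = 0" "lor y q = 0" by (simp_all add: y_def z)
    have "(1 / M - 1) / lor z z \<ge> 0" using that L(1) zz by (simp add: field_simps)
    then have "lor y y = 1 / M - 1" using zz unfolding y_def by (simp add: field_simps)
    then have "lor (y + m) (y + m) = -1" using mm ym[OF y] lor_commute[of m y] by simp
    moreover have k: "lor (y + m) p = - r" "lor (y + m) q = - r'" using y m by simp_all
    moreover have "snd (y + m) > 0"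
      by (rule snd_pos[OF _ p]) (use r in \<open>simp_all only: k calculation(1) neg_less_0_iff_less zero_less_one\<close>)
    ultimately show ?thesis unfolding H3_def by blast
  qed
qed

text \<open>The two feet on the geodesic have distance |ln M|, and by
  \<open>horospheres_disjoint\<close> the sign convention agrees with the sign of ln M. In the
  tangent case M = 1 both branches give 0.\<close>

lemma signed_distance:
  assumes p: "ideal_rep p" and q: "ideal_rep q" and g: "ge p q > 0" and r: "r > 0" "r' > 0"
    and S: "S = {x \<in> H3. lor x p = - r}" "S' = {x \<in> H3. lor x q = - r'}"
  shows "(let d = hdist (the_elem (ideal_geodesic p q \<inter> S)) (the_elem (ideal_geodesic p q \<inter> S')) in if S \<inter> S' = {} then d else - d)
    = ln (ge p q / (2 * r * r'))"
proof -
  define M where "M = ge p q / (2 * r * r')"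
  have L: "M > 0" using g r unfolding M_def by (simp add: divide_neg_pos)
  have pp: "lor p p = 0" "lor q q = 0" "lor q p = lor p q" using p q by (auto simp: ideal_rep_def lor_commute)
  have sub: "ideal_geodesic p q \<subseteq> ideal_geodesic q p" for p q
  proof
    fix x assume "x \<in> ideal_geodesic p q"
    then obtain s t where h: "x \<in> H3" "s > 0" "t > 0" "x = s *\<^sub>R p + t *\<^sub>R q" unfolding ideal_geodesic_def by blast
    then show "x \<in> ideal_geodesic q p" unfolding ideal_geodesic_def using trans[OF h(4) add.commute] by blast
  qed
  have sym: "ideal_geodesic q p = ideal_geodesic p q" by (rule antisym[OF sub sub])
  have g': "ge q p > 0" using g pp by simp
  have e: "the_elem (ideal_geodesic p q \<inter> S) = (1 / (2 * r)) *\<^sub>R p + (r / ge p q) *\<^sub>R q"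
    unfolding S geodesic_horosphere[OF p q g r(1)] by simp
  have e': "the_elem (ideal_geodesic p q \<inter> S') = (1 / (2 * r')) *\<^sub>R q + (r' / ge p q) *\<^sub>R p"
    using geodesic_horosphere[OF q p g' r(2)] unfolding S sym by (simp add: pp)
  have "lor ((1 / (2 * r)) *\<^sub>R p + (r / ge p q) *\<^sub>R q) ((1 / (2 * r')) *\<^sub>R q + (r' / ge p q) *\<^sub>R p) = - ((M + inverse M) / 2)"
    unfolding M_def using g r by (simp add: pp field_simps)
  also have "(M + inverse M) / 2 = cosh \<bar>ln M\<bar>" using cosh_ln_real[OF L] by (simp add: abs_if)
  finally have d: "hdist (the_elem (ideal_geodesic p q \<inter> S)) (the_elem (ideal_geodesic p q \<inter> S')) = \<bar>ln M\<bar>"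
    unfolding hdist_def e e' by (simp only: minus_minus arcosh_cosh_real abs_ge_zero)
  consider "M > 1" | "M = 1" | "M < 1" by linarith
  then show ?thesis
  proof cases
    case 1
    then show ?thesis using horospheres_disjoint(1)[OF p q g r, folded S M_def] unfolding Let_def d M_def[symmetric] by simp
  next
    case 2
    then show ?thesis unfolding Let_def d M_def[symmetric] by simp
  next
    case 3
    then show ?thesis using horospheres_disjoint(2)[OF p q g r, folded S M_def] L unfolding Let_def d M_def[symmetric] by simp
  qed
qed

lemma heron_commute: "heron A C B = heron A B C" "heron B A C = heron A B C"
  by (simp_all add: heron_def)

section \<open>Edge lengths, dihedral angles and Gram determinant\<close>

text \<open>Products over the pairs of opposite edges; \<open>p 0\<close> is the fourth vertex,
  because 4 = 0 in the index type.\<close>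

definition pairA :: "(4 \<Rightarrow> minkowski) \<Rightarrow> real" where "pairA p = ge (p 1) (p 2) * ge (p 3) (p 0)"
definition pairB :: "(4 \<Rightarrow> minkowski) \<Rightarrow> real" where "pairB p = ge (p 1) (p 3) * ge (p 2) (p 0)"
definition pairC :: "(4 \<Rightarrow> minkowski) \<Rightarrow> real" where "pairC p = ge (p 1) (p 0) * ge (p 2) (p 3)"

context
  fixes p :: "4 \<Rightarrow> minkowski" and H :: "4 \<Rightarrow> minkowski set" and r :: "4 \<Rightarrow> real"
  assumes rep: "\<And>i. ideal_rep (p i)" and nc: "\<not> ideal_coplanar (range p)"
    and r: "\<And>i. r i > 0" and H: "\<And>i. H i = {x \<in> H3. lor x (p i) = - r i}"
begin

context
  fixes i j k l :: 4
  assumes U: "UNIV = {i, j, k, l}" and ne: "i \<noteq> j" "i \<noteq> k" "i \<noteq> l" "j \<noteq> k" "j \<noteq> l" "k \<noteq> l"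
begin

lemma tetrahedron_ijkl: "ideal_tetrahedron (p i) (p j) (p k) (p l)"
  using rep nc unfolding ideal_tetrahedron_def U by simp

lemma edge_length_ij: "edge_length p H i j = ln (ge (p i) (p j) / (2 * r i * r j))"
  unfolding edge_length_def
  by (rule signed_distance[OF rep rep ideal_tetrahedron.ge_ab_pos[OF tetrahedron_ijkl] r r H H])

lemma outward_normal_l:
  "outward_normal p l = - (1 / sqrt (lor (face_normal (p i) (p j) (p k) (p l)) (face_normal (p i) (p j) (p k) (p l)))) *\<^sub>R face_normal (p i) (p j) (p k) (p l)"
proof -
  have "(\<forall>m. m \<noteq> l \<longrightarrow> lor n (p m) = 0) \<longleftrightarrow> lor n (p i) = 0 \<and> lor n (p j) = 0 \<and> lor n (p k) = 0" for n
  proof -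
    have "(\<forall>m. m \<noteq> l \<longrightarrow> lor n (p m) = 0) \<longleftrightarrow> (\<forall>m\<in>{i, j, k, l}. m \<noteq> l \<longrightarrow> lor n (p m) = 0)" unfolding U[symmetric] by simp
    then show ?thesis using ne by auto
  qed
  then show ?thesis unfolding outward_normal_def ideal_tetrahedron.outward_normal_unique(1)[OF tetrahedron_ijkl, symmetric] by simp
qed

end

lemma outward_normals_lor:
  assumes U: "UNIV = {i, j, k, l}" and ne: "i \<noteq> j" "i \<noteq> k" "i \<noteq> l" "j \<noteq> k" "j \<noteq> l" "k \<noteq> l"
  defines "A \<equiv> ge (p i) (p j) * ge (p k) (p l)" and "B \<equiv> ge (p i) (p k) * ge (p j) (p l)" and "C \<equiv> ge (p i) (p l) * ge (p j) (p k)"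
  shows "lor (outward_normal p l) (outward_normal p k) = - ((B + C - A) / (2 * sqrt (B * C)))"
proof -
  have U': "UNIV = {i, j, l, k}" using U by auto
  note T = tetrahedron_ijkl[OF U ne]
  note T' = ideal_tetrahedron.perm(3)[OF T]
  define u where "u = face_normal (p i) (p j) (p k) (p l)"
  define v where "v = face_normal (p i) (p j) (p l) (p k)"
  define D where "D = heron A B C"
  have pos: "ge (p i) (p j) > 0" "ge (p i) (p k) > 0" "ge (p i) (p l) > 0" "ge (p j) (p k) > 0" "ge (p j) (p l) > 0" "ge (p k) (p l) > 0"
    by (rule ideal_tetrahedron.ge_pos[OF T])+
  have D: "D > 0" unfolding D_def A_def B_def C_def by (rule ideal_tetrahedron.heron_pos[OF T])
  have BC: "B > 0" "C > 0" unfolding B_def C_def by (intro mult_pos_pos pos)+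
  have D': "heron (ge (p i) (p j) * ge (p l) (p k)) (ge (p i) (p l) * ge (p j) (p k)) (ge (p i) (p k) * ge (p j) (p l)) = D"
    unfolding D_def A_def B_def C_def lor_commute[of "p l" "p k"] by (rule heron_commute(1))
  have uu: "lor u u = 2 * ge (p i) (p j) * ge (p i) (p k) * ge (p j) (p k) * D"
    unfolding u_def ideal_tetrahedron.lor_face_normal(1)[OF T] D_def A_def B_def C_def ..
  have vv: "lor v v = 2 * ge (p i) (p j) * ge (p i) (p l) * ge (p j) (p l) * D"
    unfolding v_def ideal_tetrahedron.lor_face_normal(1)[OF T'] D' ..
  have uv: "lor u v = ge (p i) (p j) * (A - B - C) * D"
    unfolding u_def v_def ideal_tetrahedron.lor_face_normal(2)[OF T] D_def A_def B_def C_def ..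
  have "sqrt (lor u u) * sqrt (lor v v) = sqrt ((2 * ge (p i) (p j) * D)\<^sup>2 * (B * C))"
    unfolding real_sqrt_mult[symmetric] uu vv B_def C_def by (simp add: power2_eq_square mult_ac)
  also have "\<dots> = 2 * ge (p i) (p j) * D * sqrt (B * C)"
  proof -
    have "2 * ge (p i) (p j) * D > 0" by (intro mult_pos_pos pos D) simp
    then show ?thesis unfolding real_sqrt_mult[of _ "B * C"] real_sqrt_abs by (simp only: abs_of_pos)
  qed
  finally have s: "sqrt (lor u u) * sqrt (lor v v) = 2 * ge (p i) (p j) * D * sqrt (B * C)" .
  have "lor (outward_normal p l) (outward_normal p k) = lor u v / (sqrt (lor u u) * sqrt (lor v v))"
    unfolding outward_normal_l[OF U ne] outward_normal_l[OF U' ne(1,3,2,5,4) ne(6)[symmetric]] u_def[symmetric] v_def[symmetric]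
    by simp
  also have "\<dots> = - ((B + C - A) / (2 * sqrt (B * C)))"
    unfolding s uv using pos(1) D BC by (simp add: field_simps)
  finally show ?thesis .
qed

text \<open>The dihedral angle is the angle opposite the side sqrt A in the Euclidean triangle with
  sides sqrt A, sqrt B, sqrt C. As A belongs to a pair of opposite edges, both edges have the same
  angle.\<close>

lemma dihedral_angle_ij:
  assumes U: "UNIV = {i, j, k, l}" and ne: "i \<noteq> j" "i \<noteq> k" "i \<noteq> l" "j \<noteq> k" "j \<noteq> l" "k \<noteq> l"
  defines "A \<equiv> ge (p i) (p j) * ge (p k) (p l)" and "B \<equiv> ge (p i) (p k) * ge (p j) (p l)" and "C \<equiv> ge (p i) (p l) * ge (p j) (p k)"
  shows "dihedral_angle p i j = arccos ((B + C - A) / (2 * sqrt (B * C)))"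
proof -
  define q where "q = (B + C - A) / (2 * sqrt (B * C))"
  note T = tetrahedron_ijkl[OF U ne]
  have D: "heron A B C > 0" unfolding A_def B_def C_def by (rule ideal_tetrahedron.heron_pos[OF T])
  have BC: "B > 0" "C > 0" unfolding B_def C_def by (intro mult_pos_pos ideal_tetrahedron.ge_pos[OF T])+
  have "(B + C - A)\<^sup>2 \<le> 4 * B * C" using D by (simp add: heron_def power2_eq_square algebra_simps)
  then have "q\<^sup>2 \<le> 1" unfolding q_def power_divide power_mult_distrib using BC by (simp add: divide_le_eq)
  then have q: "- 1 \<le> q" "q \<le> 1" by (simp_all add: abs_square_le_1 abs_le_iff)
  have lk: "lor (outward_normal p l) (outward_normal p k) = - q"
    unfolding q_def A_def B_def C_def by (rule outward_normals_lor[OF U ne])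
  have S: "- {i, j} = {k, l}" using U ne by auto
  have ang: "pi - arccos (- q) = arccos q" using arccos_minus[OF q] by simp
  show ?thesis unfolding dihedral_angle_def S q_def[symmetric]
  proof (rule the_equality)
    show "\<exists>ka la. ka \<noteq> la \<and> {ka, la} = {k, l} \<and> arccos q = pi - arccos (lor (outward_normal p ka) (outward_normal p la))"
      using ne(6) lk ang by (intro exI[of _ l] exI[of _ k]) auto
    fix \<theta> assume "\<exists>ka la. ka \<noteq> la \<and> {ka, la} = {k, l} \<and> \<theta> = pi - arccos (lor (outward_normal p ka) (outward_normal p la))"
    then obtain ka la where "ka \<noteq> la" "{ka, la} = {k, l}" and \<theta>: "\<theta> = pi - arccos (lor (outward_normal p ka) (outward_normal p la))" by blast
    then have "ka = l \<and> la = k \<or> ka = k \<and> la = l" by (auto simp: doubleton_eq_iff)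
    then have "lor (outward_normal p ka) (outward_normal p la) = - q" using lk lor_commute by metis
    then show "\<theta> = arccos q" using ang \<theta> by simp
  qed
qed

private lemma zero_4: "(4 :: 4) = 0" by simp

private lemma UN: "UNIV = {1, 2, 3, 0 :: 4}" unfolding UNIV_4 zero_4 ..

private lemma NE: "(1::4) \<noteq> 2" "(1::4) \<noteq> 3" "(1::4) \<noteq> 0" "(2::4) \<noteq> 3" "(2::4) \<noteq> 0" "(3::4) \<noteq> 0" by simp_all

text \<open>In the order of the index type the fourth vertex is 0 and comes first, so the pairs in
  the covolume sum are not those of the usual listing.\<close>

lemma less_4: "{(i::4, j). i < j} = {(0,1), (0,2), (0,3), (1,2), (1,3), (2,3)}"
proof -
  have "(i::4) < j \<longleftrightarrow> (i,j) \<in> {(0,1),(0,2),(0,3),(1,2),(1,3),(2,3)}" for i j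
    using exhaust_4[of i] exhaust_4[of j] unfolding zero_4
    by (elim disjE; simp add: less_bit0_def bit0.Rep_numeral bit0.Rep_0 bit0.Rep_1)
  then show ?thesis by auto
qed

text \<open>By \<open>signed_distance\<close> the two lengths over a pair of opposite edges add up
  to the logarithm of the pair product divided by a constant R. In the triangle of
  \<open>triangle_angles\<close> the law of sines then makes each sum equal to kappa + 2 ln sin of
  the opposite angle, and the Gram determinant is - D / (16 R^2) with D the Heron
  polynomial.\<close>

lemma tetrahedron_geometry:
  defines "\<alpha> \<equiv> arccos ((pairB p + pairC p - pairA p) / (2 * sqrt (pairB p * pairC p)))" and "\<beta> \<equiv> arccos ((pairA p + pairC p - pairB p) / (2 * sqrt (pairA p * pairC p)))"
    and "\<gamma> \<equiv> arccos ((pairA p + pairB p - pairC p) / (2 * sqrt (pairA p * pairB p)))"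
  defines "x \<equiv> edge_lengths p H"
  obtains \<kappa> where "x 1 + x 4 = \<kappa> + lsin \<alpha>" "x 2 + x 5 = \<kappa> + lsin \<beta>" "x 3 + x 6 = \<kappa> + lsin \<gamma>"
    "root 4 (- det (gram p H)) = sqrt (exp \<kappa> * (sin \<alpha> * sin \<beta> * sin \<gamma>) / 2)"
    "covolume p H = hvolume (ideal_hull (range p)) + 1 / 2 * (\<alpha> * (x 1 + x 4) + \<beta> * (x 2 + x 5) + \<gamma> * (x 3 + x 6))"
    "tri \<alpha> \<beta> \<gamma>"
proof -
  note T = tetrahedron_ijkl[OF UN NE]
  note pos = ideal_tetrahedron.ge_pos[OF T]
  define D where "D = heron (pairA p) (pairB p) (pairC p)"
  have ABC: "pairA p > 0" "pairB p > 0" "pairC p > 0" unfolding pairA_def pairB_def pairC_def by (intro mult_pos_pos pos)+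
  have D: "D > 0" unfolding D_def pairA_def pairB_def pairC_def by (rule ideal_tetrahedron.heron_pos[OF T])
  note tri = triangle_angles[OF ABC D[unfolded D_def], folded D_def \<alpha>_def \<beta>_def \<gamma>_def]
  \<comment> \<open>The product of the normalisations 2 r_i r_j over two opposite edges, the same
    for all three pairs.\<close>
  define R where "R = 4 * (r 0 * r 1 * r 2 * r 3)"
  have R: "R > 0" unfolding R_def by (intro mult_pos_pos r) simp
  \<comment> \<open>Its exponential is the squared circumdiameter of the triangle, divided by
    R.\<close>
  define \<kappa> where "\<kappa> = ln (4 * (pairA p * pairB p * pairC p) / (R * D))"
  have comm: "lor (p 2) (p 1) = lor (p 1) (p 2)" "lor (p 3) (p 1) = lor (p 1) (p 3)" "lor (p 0) (p 1) = lor (p 1) (p 0)"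
     "lor (p 3) (p 2) = lor (p 2) (p 3)" "lor (p 0) (p 2) = lor (p 2) (p 0)" "lor (p 0) (p 3) = lor (p 3) (p 0)"
    by (rule lor_commute)+
  have el: "edge_length p H i j = ln (ge (p i) (p j) / (2 * r i * r j))" if "i \<noteq> j" for i j
  proof -
    have "\<exists>k l. UNIV = {i, j, k, l} \<and> i \<noteq> k \<and> i \<noteq> l \<and> j \<noteq> k \<and> j \<noteq> l \<and> k \<noteq> l"
    proof -
      have "card (UNIV - {i, j}) = 2" using that by (simp add: card_Diff_subset)
      then obtain k l where kl: "UNIV - {i, j} = {k, l}" "k \<noteq> l" unfolding card_2_iff by blast
      have "UNIV = {i, j, k, l}" using kl(1) by blast
      moreover have "k \<in> UNIV - {i, j}" "l \<in> UNIV - {i, j}" unfolding kl(1) by simp_all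
      ultimately show ?thesis using kl(2) by blast
    qed
    then show ?thesis using edge_length_ij that by blast
  qed
  have gp: "ge (p i) (p j) / (2 * r i * r j) > 0" if "ge (p i) (p j) > 0" for i j
    using that r[of i] r[of j] by (intro divide_pos_pos mult_pos_pos) auto
  have x: "x 1 = ln (ge (p 1) (p 2) / (2 * r 1 * r 2))" "x 2 = ln (ge (p 1) (p 3) / (2 * r 1 * r 3))" "x 3 = ln (ge (p 2) (p 3) / (2 * r 2 * r 3))"
    "x 4 = ln (ge (p 3) (p 0) / (2 * r 3 * r 0))" "x 5 = ln (ge (p 2) (p 0) / (2 * r 2 * r 0))" "x 6 = ln (ge (p 1) (p 0) / (2 * r 1 * r 0))"
    unfolding x_def edge_lengths_def zero_4 by (simp_all add: el)
  have sums: "x 1 + x 4 = ln (pairA p / R)" "x 2 + x 5 = ln (pairB p / R)" "x 3 + x 6 = ln (pairC p / R)"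
  proof -
    have e: "g / (2 * a * b) * (h / (2 * c * d)) = g * h / (4 * (a * b * c * d))" for g h a b c d :: real by simp
    have "x 1 + x 4 = ln (ge (p 1) (p 2) / (2 * r 1 * r 2) * (ge (p 3) (p 0) / (2 * r 3 * r 0)))"
      unfolding x by (rule ln_mult_pos[symmetric]) (intro gp pos)+
    then show "x 1 + x 4 = ln (pairA p / R)" unfolding e pairA_def R_def by (simp only: mult_ac)
    have "x 2 + x 5 = ln (ge (p 1) (p 3) / (2 * r 1 * r 3) * (ge (p 2) (p 0) / (2 * r 2 * r 0)))"
      unfolding x by (rule ln_mult_pos[symmetric]) (intro gp pos)+
    then show "x 2 + x 5 = ln (pairB p / R)" unfolding e pairB_def R_def by (simp only: mult_ac)
    have "x 3 + x 6 = ln (ge (p 2) (p 3) / (2 * r 2 * r 3) * (ge (p 1) (p 0) / (2 * r 1 * r 0)))"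
      unfolding x by (rule ln_mult_pos[symmetric]) (intro gp pos)+
    then show "x 3 + x 6 = ln (pairC p / R)" unfolding e pairC_def R_def by (simp only: mult_ac)
  qed
  have ls: "ln (X / R) = \<kappa> + lsin a" if "sin a = sqrt D / (2 * sqrt (Y * Z))" "X > 0" "Y > 0" "Z > 0" "X * (Y * Z) = pairA p * pairB p * pairC p" for a X Y Z
  proof -
    have sp: "sin a > 0" unfolding that(1) using D that by simp
    have "\<kappa> + lsin a = \<kappa> + ln ((sin a)\<^sup>2)" using sp by (simp add: lsin_def ln_realpow)
    also have "(sin a)\<^sup>2 = D / (4 * (Y * Z))" unfolding that(1) power_divide power_mult_distrib using D that by simp
    also have "\<kappa> + ln (D / (4 * (Y * Z))) = ln (4 * (pairA p * pairB p * pairC p) / (R * D) * (D / (4 * (Y * Z))))"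
      unfolding \<kappa>_def using ABC R D that by (intro ln_mult_pos[symmetric] divide_pos_pos mult_pos_pos) auto
    also have "4 * (pairA p * pairB p * pairC p) / (R * D) * (D / (4 * (Y * Z))) = X / R"
      unfolding that(5)[symmetric] using R D that by (simp add: field_simps)
    finally show ?thesis ..
  qed
  have L: "x 1 + x 4 = \<kappa> + lsin \<alpha>" "x 2 + x 5 = \<kappa> + lsin \<beta>" "x 3 + x 6 = \<kappa> + lsin \<gamma>"
    unfolding sums by (rule ls[OF tri(2)], use ABC in simp_all, rule ls[OF tri(3)], use ABC in simp_all, rule ls[OF tri(4)], use ABC in simp_all)
  have "det (gram p H) = - (D / (16 * R\<^sup>2))"
  proof -
    define M where "M i j = (if i = j then 0 else - exp (edge_length p H i j) / 2)" for i j
    have g: "gram p H = (\<chi> i j. M i j)" unfolding gram_def M_def ..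
    have M: "M i j = - (ge (p i) (p j) / (4 * r i * r j))" if "i \<noteq> j" "ge (p i) (p j) > 0" for i j
      using that gp[OF that(2)] by (simp add: M_def el)
    have Mv: "M 1 2 = - (ge (p 1) (p 2) / (4 * r 1 * r 2))" "M 1 3 = - (ge (p 1) (p 3) / (4 * r 1 * r 3))" "M 1 0 = - (ge (p 1) (p 0) / (4 * r 1 * r 0))"
      "M 2 3 = - (ge (p 2) (p 3) / (4 * r 2 * r 3))" "M 2 0 = - (ge (p 2) (p 0) / (4 * r 2 * r 0))" "M 3 0 = - (ge (p 3) (p 0) / (4 * r 3 * r 0))"
      by (intro M NE pos)+
    have sym: "M j i = M i j" if "i \<noteq> j" for i j
      using that by (simp add: M_def el lor_commute[of "p j" "p i"] mult_ac)
    have pr: "M 1 2 * M 3 0 = pairA p / (4 * R)" "M 1 3 * M 2 0 = pairB p / (4 * R)" "M 1 0 * M 2 3 = pairC p / (4 * R)"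
      unfolding Mv pairA_def pairB_def pairC_def R_def by (simp_all add: mult_ac)
    have "det (gram p H) = (pairA p / (4 * R))\<^sup>2 + (pairB p / (4 * R))\<^sup>2 + (pairC p / (4 * R))\<^sup>2
      - 2 * (pairA p / (4 * R)) * (pairB p / (4 * R)) - 2 * (pairA p / (4 * R)) * (pairC p / (4 * R)) - 2 * (pairB p / (4 * R)) * (pairC p / (4 * R))"
      unfolding g pr[symmetric] by (rule det_4_zero_diagonal[OF UN NE]) (simp_all add: sym[OF NE(1)] sym[OF NE(2)] sym[OF NE(3)] sym[OF NE(4)] sym[OF NE(5)] sym[OF NE(6)] M_def[of i i for i])
    also have "\<dots> = - (D / (16 * R\<^sup>2))" unfolding D_def heron_def using R by (simp add: field_simps power2_eq_square)
    finally show ?thesis .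
  qed
  moreover have "root 4 (D / (16 * R\<^sup>2)) = sqrt (exp \<kappa> * (sin \<alpha> * sin \<beta> * sin \<gamma>) / 2)"
  proof -
    obtain u v w h where uvw: "u > 0" "v > 0" "w > 0" "pairA p = u * u" "pairB p = v * v" "pairC p = w * w" "sqrt (pairA p) = u" "sqrt (pairB p) = v" "sqrt (pairC p) = w"
      and h: "h > 0" "D = h * h" "sqrt D = h"
      by (rule that[of "sqrt (pairA p)" "sqrt (pairB p)" "sqrt (pairC p)" "sqrt D"]) (use ABC D in simp_all)
    have "exp \<kappa> * (sin \<alpha> * sin \<beta> * sin \<gamma>) / 2 = 4 * (pairA p * pairB p * pairC p) / (R * D) * (sin \<alpha> * sin \<beta> * sin \<gamma>) / 2"
      unfolding \<kappa>_def using ABC R D by simp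
    also have "\<dots> = h / (4 * R)"
      unfolding tri(2-4) real_sqrt_mult uvw(7-9) h(3) uvw(4-6) h(2) using uvw(1-3) h(1) R by (simp add: field_simps)
    finally have e: "exp \<kappa> * (sin \<alpha> * sin \<beta> * sin \<gamma>) / 2 = h / (4 * R)" .
    have "(sqrt (h / (4 * R))) ^ 4 = ((sqrt (h / (4 * R)))\<^sup>2)\<^sup>2" by simp
    also have "\<dots> = D / (16 * R\<^sup>2)" using h R by (simp add: power_divide power2_eq_square)
    finally have "root 4 (D / (16 * R\<^sup>2)) = sqrt (h / (4 * R))"
      using h R by (intro real_root_pos_unique) auto
    then show ?thesis unfolding e .
  qed
  ultimately have Rt: "root 4 (- det (gram p H)) = sqrt (exp \<kappa> * (sin \<alpha> * sin \<beta> * sin \<gamma>) / 2)" by simp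
  have dh: "dihedral_angle p 1 2 = \<alpha>" "dihedral_angle p 0 3 = \<alpha>" "dihedral_angle p 1 3 = \<beta>" "dihedral_angle p 0 2 = \<beta>"
     "dihedral_angle p 0 1 = \<gamma>" "dihedral_angle p 2 3 = \<gamma>"
  proof -
    have U: "UNIV = {1, 2, 3, 0 :: 4}" "UNIV = {0, 3, 2, 1 :: 4}" "UNIV = {1, 3, 2, 0 :: 4}" "UNIV = {0, 2, 3, 1 :: 4}" "UNIV = {0, 1, 2, 3 :: 4}" "UNIV = {2, 3, 1, 0 :: 4}"
      using UN by auto
    show "dihedral_angle p 1 2 = \<alpha>" "dihedral_angle p 0 3 = \<alpha>" "dihedral_angle p 1 3 = \<beta>" "dihedral_angle p 0 2 = \<beta>"
     "dihedral_angle p 0 1 = \<gamma>" "dihedral_angle p 2 3 = \<gamma>"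
      unfolding \<alpha>_def \<beta>_def \<gamma>_def pairA_def pairB_def pairC_def
      by (subst dihedral_angle_ij[OF U(1)] dihedral_angle_ij[OF U(2)] dihedral_angle_ij[OF U(3)] dihedral_angle_ij[OF U(4)] dihedral_angle_ij[OF U(5)] dihedral_angle_ij[OF U(6)];
         (simp; fail)?; simp add: comm mult_ac add_ac)+
  qed
  \<comment> \<open>Symmetry of the length reconciles pairs beginning with 0 with the listing in
    \<open>edge_lengths\<close>, where the fourth vertex comes last.\<close>
  have es: "edge_length p H 0 1 = x 6" "edge_length p H 0 2 = x 5" "edge_length p H 0 3 = x 4" "edge_length p H 1 2 = x 1" "edge_length p H 1 3 = x 2" "edge_length p H 2 3 = x 3"
    unfolding x by (simp_all add: el comm mult_ac)
  have "(\<Sum>(i, j)\<in>{(i, j). i < j}. dihedral_angle p i j * edge_length p H i j) = \<gamma> * x 6 + \<beta> * x 5 + \<alpha> * x 4 + \<alpha> * x 1 + \<beta> * x 2 + \<gamma> * x 3"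
    unfolding less_4 by (simp add: dh es)
  then have C: "covolume p H = hvolume (ideal_hull (range p)) + 1 / 2 * (\<alpha> * (x 1 + x 4) + \<beta> * (x 2 + x 5) + \<gamma> * (x 3 + x 6))"
    unfolding covolume_def by (simp add: algebra_simps)
  show ?thesis by (rule that[OF L Rt C tri(1)])
qed

end

section \<open>Linear coordinates adapted to the vertices\<close>

text \<open>Transports Lebesgue measure between different types modelling the same space:
  determinants live on \<open>real^4\<close>, whereas iterated integration uses nested pairs. A
  linear map matching the standard bases preserves volumes of boxes.\<close>

lemma lborel_distr_basis:
  fixes f :: "'a::euclidean_space \<Rightarrow> 'b::euclidean_space"
  assumes lin: "linear f" and bij: "bij_betw f Basis Basis"
  shows "distr lborel borel f = lborel"
proof (rule lborel_eqI[symmetric])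
  show "sets (distr lborel borel f) = sets borel" by simp
  fix l u :: 'b assume lu: "\<And>b. b \<in> Basis \<Longrightarrow> l \<bullet> b \<le> u \<bullet> b"
  have ip: "f x \<bullet> f b = x \<bullet> b" if b: "b \<in> Basis" for x b
  proof -
    have fb: "f b \<in> Basis" using bij b by (auto simp: bij_betw_def)
    have "f x = f (\<Sum>b\<in>Basis. (x \<bullet> b) *\<^sub>R b)" by (simp add: euclidean_representation)
    also have "\<dots> = (\<Sum>b\<in>Basis. (x \<bullet> b) *\<^sub>R f b)" by (simp add: linear_sum[OF lin] linear_cmul[OF lin])
    finally have "f x \<bullet> f b = (\<Sum>b'\<in>Basis. (x \<bullet> b') * (f b' \<bullet> f b))" by (simp add: inner_sum_left)
    also have "\<dots> = (\<Sum>b'\<in>Basis. if b' = b then x \<bullet> b else 0)"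
    proof (intro sum.cong refl)
      fix b' :: 'a assume b': "b' \<in> Basis"
      then have "f b' \<in> Basis" "f b' = f b \<longleftrightarrow> b' = b" using bij b by (auto simp: bij_betw_def inj_on_def)
      then show "(x \<bullet> b') * (f b' \<bullet> f b) = (if b' = b then x \<bullet> b else 0)" using fb by (simp add: inner_Basis)
    qed
    finally show ?thesis using b by simp
  qed
  define g where "g y = (\<Sum>b\<in>Basis. (y \<bullet> f b) *\<^sub>R b)" for y
  have g: "g y \<bullet> b = y \<bullet> f b" if "b \<in> Basis" for y b using that by (simp add: g_def inner_sum_left_Basis)
  have all: "(\<forall>b\<in>Basis. P b) \<longleftrightarrow> (\<forall>b\<in>Basis. P (f b))" for P :: "'b \<Rightarrow> bool"
    using bij by (auto simp: bij_betw_def) (metis imageE)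
  have "f -` box l u = box (g l) (g u)"
    by (auto simp: mem_box all[of "\<lambda>i. l \<bullet> i < f _ \<bullet> i \<and> f _ \<bullet> i < u \<bullet> i"] ip g)
  then have "emeasure (distr lborel borel f) (box l u) = emeasure lborel (box (g l) (g u))"
    using borel_measurable_continuous_onI[OF linear_continuous_on[OF linear_conv_bounded_linear[THEN iffD1, OF lin]]]
    by (subst emeasure_distr) auto
  also have "\<dots> = (\<Prod>b\<in>Basis. (g u - g l) \<bullet> b)"
  proof (rule emeasure_lborel_box)
    fix b :: 'a assume "b \<in> Basis"
    then show "g l \<bullet> b \<le> g u \<bullet> b" using lu[of "f b"] bij by (auto simp: g bij_betw_def)
  qed
  also have "(\<Prod>b\<in>Basis. (g u - g l) \<bullet> b) = (\<Prod>b\<in>Basis. (u - l) \<bullet> f b)"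
    by (intro prod.cong refl) (simp add: g inner_diff_left)
  also have "\<dots> = (\<Prod>b\<in>Basis. (u - l) \<bullet> b)" by (rule prod.reindex_bij_betw[OF bij])
  finally show "emeasure (distr lborel borel f) (box l u) = (\<Prod>b\<in>Basis. (u - l) \<bullet> b)" .
qed

lemma nn_integral_basis_map:
  fixes f :: "'a::euclidean_space \<Rightarrow> 'b::euclidean_space"
  assumes lin: "linear f" and bij: "bij_betw f Basis Basis" and [measurable]: "h \<in> borel_measurable borel"
  shows "(\<integral>\<^sup>+x. h x \<partial>lborel) = (\<integral>\<^sup>+x. h (f x) \<partial>lborel)"
proof -
  have [measurable]: "f \<in> borel_measurable borel"
    using borel_measurable_continuous_onI[OF linear_continuous_on[OF linear_conv_bounded_linear[THEN iffD1, OF lin]]] .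
  show ?thesis by (subst lborel_distr_basis[OF lin bij, symmetric]) (simp add: nn_integral_distr)
qed

lemma nn_integral_matrix:
  fixes M :: "real^'n::{finite,wellorder}^'n::_"
  assumes d: "det M \<noteq> 0" and [measurable]: "h \<in> borel_measurable borel"
  shows "(\<integral>\<^sup>+x. h x \<partial>lborel) = ennreal \<bar>det M\<bar> * (\<integral>\<^sup>+x. h (M *v x) \<partial>lborel)"
proof -
  obtain N where N: "M ** N = mat 1" "N ** M = mat 1" using d by (metis invertible_def invertible_det_nz)
  define S where "S = (\<lambda>x. N *v x)"
  have SM: "S (M *v x) = x" "M *v S x = x" for x by (simp_all add: S_def matrix_vector_mul_assoc N)
  have [measurable]: "S \<in> borel_measurable borel" "(\<lambda>x. M *v x) \<in> borel_measurable borel"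
    unfolding S_def by (auto intro!: borel_measurable_continuous_onI linear_continuous_on)
  have "lborel = density (distr lborel borel S) (\<lambda>_. ennreal (1 / \<bar>det M\<bar>))"
  proof (rule lborel_eqI)
    fix l u :: "real^'n::_" assume lu: "\<And>b. b \<in> Basis \<Longrightarrow> l \<bullet> b \<le> u \<bullet> b"
    have im: "S -` box l u = (\<lambda>x. M *v x) ` box l u"
    proof (intro set_eqI iffI)
      fix x assume "x \<in> S -` box l u"
      then show "x \<in> (\<lambda>x. M *v x) ` box l u" using SM(2)[of x] by (intro image_eqI[of _ _ "S x"]) auto
    qed (auto simp: SM)
    have Sb: "S -` box l u \<in> sets borel" using measurable_sets[of S borel borel "box l u"] by simp
    have lm: "(\<lambda>x. M *v x) ` box l u \<in> lmeasurable"
      by (rule measurable_linear_image) auto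
    have "emeasure lborel (S -` box l u) = emeasure lebesgue (S -` box l u)" using Sb by simp
    also have "\<dots> = ennreal (measure lebesgue (S -` box l u))" using lm unfolding im by (rule emeasure_eq_measure2)
    also have "measure lebesgue (S -` box l u) = \<bar>det M\<bar> * measure lebesgue (box l u)"
      unfolding im by (subst measure_linear_image) auto
    also have "measure lebesgue (box l u) = (\<Prod>b\<in>Basis. (u - l) \<bullet> b)"
      using measure_lborel_box[OF lu] by (simp add: measure_completion)
    finally have e: "emeasure lborel (S -` box l u) = ennreal (\<bar>det M\<bar> * (\<Prod>b\<in>Basis. (u - l) \<bullet> b))" .
    have "emeasure (density (distr lborel borel S) (\<lambda>_. ennreal (1 / \<bar>det M\<bar>))) (box l u)
       = ennreal (1 / \<bar>det M\<bar>) * emeasure lborel (S -` box l u)"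
      by (subst emeasure_density_const) (auto simp: emeasure_distr)
    also have "\<dots> = ennreal (\<Prod>b\<in>Basis. (u - l) \<bullet> b)" unfolding e using d by (simp add: ennreal_mult'[symmetric])
    finally show "emeasure (density (distr lborel borel S) (\<lambda>_. ennreal (1 / \<bar>det M\<bar>))) (box l u) = (\<Prod>b\<in>Basis. (u - l) \<bullet> b)" .
  qed simp
  then have "(\<integral>\<^sup>+x. h (M *v x) \<partial>lborel) = (\<integral>\<^sup>+x. h (M *v x) \<partial>density (distr lborel borel S) (\<lambda>_. ennreal (1 / \<bar>det M\<bar>)))" by simp
  also have "\<dots> = ennreal (1 / \<bar>det M\<bar>) * (\<integral>\<^sup>+x. h x \<partial>lborel)"
    by (simp add: nn_integral_density nn_integral_distr SM nn_integral_cmult)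
  finally have "ennreal \<bar>det M\<bar> * (\<integral>\<^sup>+x. h (M *v x) \<partial>lborel) = ennreal (\<bar>det M\<bar> * (1 / \<bar>det M\<bar>)) * (\<integral>\<^sup>+x. h x \<partial>lborel)"
    by (simp only: ennreal_mult' abs_ge_zero mult.assoc)
  then show ?thesis using d by simp
qed

text \<open>Only a relabelling of coordinates; the index 0, that is 4, carries the time coordinate,
  and in \<open>quad_vec\<close> the last parameter.\<close>

definition mink_vec :: "minkowski \<Rightarrow> real^4" where
  "mink_vec x = (\<chi> i. if i = 1 then vec_nth (fst x) 1 else if i = 2 then vec_nth (fst x) 2 else if i = 3 then vec_nth (fst x) 3 else snd x)"

definition quad_vec :: "(real \<times> real \<times> real) \<times> real \<Rightarrow> real^4" where
  "quad_vec x = (\<chi> i. if i = 1 then fst (fst x) else if i = 2 then fst (snd (fst x)) else if i = 3 then snd (snd (fst x)) else snd x)"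

lemma linear_mink_vec: "linear mink_vec" "linear quad_vec"
  by (auto intro!: linearI simp: mink_vec_def quad_vec_def vec_eq_iff)

lemma exhaust_0123: "i = 1 \<or> i = 2 \<or> i = 3 \<or> i = (0 :: 4)"
proof -
  have "(4 :: 4) = 0" by simp
  then show ?thesis using exhaust_4[of i] by (simp only:)
qed

lemma bij_mink_vec: "bij_betw mink_vec Basis Basis" "bij_betw quad_vec Basis Basis"
proof -
  have U: "(\<Union>i. {axis i (1::real)}) = {axis 1 1, axis 2 1, axis 3 1, axis (0::4) 1}"
    using exhaust_0123 by (auto; metis)
  have n: "(0::4) \<noteq> 1" "(0::4) \<noteq> 2" "(0::4) \<noteq> 3" by simp_all
  have v1: "mink_vec (axis 1 1, 0) = axis 1 1" "mink_vec (axis 2 1, 0) = axis 2 1" "mink_vec (axis 3 1, 0) = axis 3 1" "mink_vec (0, 1) = axis 0 1"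
    using exhaust_0123 by (auto simp: mink_vec_def axis_def vec_eq_iff)
  have v2: "quad_vec ((1, 0, 0), 0) = axis 1 1" "quad_vec ((0, 1, 0), 0) = axis 2 1" "quad_vec ((0, 0, 1), 0) = axis 3 1" "quad_vec (0, 1) = axis 0 1"
    using exhaust_0123 by (auto simp: quad_vec_def axis_def vec_eq_iff)
  have a: "axis i (1::real) = axis j 1 \<longleftrightarrow> i = j" for i j :: 4 by (auto simp: axis_eq_axis)
  have B: "(Basis :: minkowski set) = {(axis 1 1, 0), (axis 2 1, 0), (axis 3 1, 0), (0, 1)}"
    unfolding Basis_prod_def Basis_vec_def Basis_real_def UNIV_3 by auto
  have B2: "(Basis :: ((real \<times> real \<times> real) \<times> real) set) = {((1, 0, 0), 0), ((0, 1, 0), 0), ((0, 0, 1), 0), (0, 1)}"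
    unfolding Basis_prod_def Basis_real_def by (auto simp: zero_prod_def)
  have B4: "(Basis :: (real^4) set) = {axis 1 1, axis 2 1, axis 3 1, axis 0 1}"
    unfolding Basis_vec_def Basis_real_def using U by simp
  show "bij_betw mink_vec Basis Basis"
    unfolding bij_betw_def inj_on_def B B4 by (simp add: v1 a)
  show "bij_betw quad_vec Basis Basis"
    unfolding bij_betw_def inj_on_def B2 B4 by (simp add: v2 a)
qed

text \<open>With M the matrix of the vertices and J = diag (1, 1, 1, -1), the matrix of Lorentz
  products is the transpose of M times J M, whose determinant is - (det M)^2;
  \<open>det_4_zero_diagonal\<close> evaluates the same determinant as minus
  \<open>heron\<close>.\<close>

lemma heron_gram:
  fixes p :: "4 \<Rightarrow> minkowski"
  assumes "\<And>i. ideal_rep (p i)"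
  shows "(det (\<chi> i j. vec_nth (mink_vec (p j)) i))\<^sup>2 = heron (ge (p 1) (p 2) * ge (p 3) (p 0)) (ge (p 1) (p 3) * ge (p 2) (p 0)) (ge (p 1) (p 0) * ge (p 2) (p 3))"
proof -
  define M :: "real^4^4" where "M = (\<chi> i j. vec_nth (mink_vec (p j)) i)"
  define N :: "real^4^4" where "N = (\<chi> i. (if i = 0 then -1 else 1) *s vec_nth M i)"
  have Z: "(4::4) = 0" by simp
  have U: "UNIV = {1, 2, 3, 0 :: 4}" unfolding UNIV_4 Z ..
  have N: "det N = - det M"
  proof -
    have "det N = (\<Prod>i\<in>UNIV. if i = (0::4) then -1 else 1) * det M"
      unfolding N_def det_rows_mul vec_lambda_eta ..
    also have "(\<Prod>i\<in>UNIV. if i = (0::4) then -1 else 1) = (-1 :: real)" unfolding U by simp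
    finally show ?thesis by simp
  qed
  have "transpose M ** N = (\<chi> i j. lor (p i) (p j))"
    unfolding matrix_matrix_mult_def vec_eq_iff vec_lambda_beta transpose_def
    by (simp add: sum_4 Z N_def M_def mink_vec_def lor_def inner_vec_def sum_3 vector_scalar_mult_def)
  then have "det M * det N = det (\<chi> i j. lor (p i) (p j))" by (metis det_mul det_transpose)
  also have "\<dots> = (lor (p 1) (p 2) * lor (p 3) (p 0))\<^sup>2 + (lor (p 1) (p 3) * lor (p 2) (p 0))\<^sup>2 + (lor (p 1) (p 0) * lor (p 2) (p 3))\<^sup>2
    - 2 * (lor (p 1) (p 2) * lor (p 3) (p 0)) * (lor (p 1) (p 3) * lor (p 2) (p 0)) - 2 * (lor (p 1) (p 2) * lor (p 3) (p 0)) * (lor (p 1) (p 0) * lor (p 2) (p 3))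
    - 2 * (lor (p 1) (p 3) * lor (p 2) (p 0)) * (lor (p 1) (p 0) * lor (p 2) (p 3))"
    by (rule det_4_zero_diagonal[OF U]) (use assms in \<open>auto simp: ideal_rep_def intro: lor_commute\<close>)
  finally show ?thesis unfolding N M_def[symmetric] heron_def by (simp add: power2_eq_square)
qed

text \<open>Linear change of variables with the four vertices as basis; by \<open>heron_gram\<close>
  the Jacobian is sqrt D.\<close>

lemma nn_integral_cone_coordinates:
  fixes p :: "4 \<Rightarrow> minkowski" and h :: "minkowski \<Rightarrow> ennreal"
  assumes rep: "\<And>i. ideal_rep (p i)" and [measurable]: "h \<in> borel_measurable borel"
    and D: "D = heron (ge (p 1) (p 2) * ge (p 3) (p 0)) (ge (p 1) (p 3) * ge (p 2) (p 0)) (ge (p 1) (p 0) * ge (p 2) (p 3))" "D > 0"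
  shows "(\<integral>\<^sup>+X. h X \<partial>lborel) = ennreal (sqrt D) * (\<integral>\<^sup>+s. h (fst (fst s) *\<^sub>R p 1 + fst (snd (fst s)) *\<^sub>R p 2 + snd (snd (fst s)) *\<^sub>R p 3 + snd s *\<^sub>R p 0) \<partial>lborel)"
proof -
  define M :: "real^4^4" where "M = (\<chi> i j. vec_nth (mink_vec (p j)) i)"
  have "D = (det M)\<^sup>2" unfolding D(1) M_def by (rule heron_gram[OF rep, symmetric])
  then have dM: "\<bar>det M\<bar> = sqrt D" by simp
  then have M0: "det M \<noteq> 0" using D(2) by auto
  define g :: "real^4 \<Rightarrow> minkowski" where "g v = ((\<chi> i. if i = 1 then vec_nth v 1 else if i = 2 then vec_nth v 2 else vec_nth v 3), vec_nth v 0)" for v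
  have g: "g (mink_vec x) = x" for x
    using exhaust_3 by (auto simp: g_def mink_vec_def prod_eq_iff vec_eq_iff)
  have "continuous_on UNIV g" unfolding g_def
    by (intro continuous_on_Pair continuous_on_vec_lambda continuous_intros)
      (case_tac "i = 1"; case_tac "i = 2"; simp; intro continuous_intros)
  then have [measurable]: "g \<in> borel_measurable borel" by (rule borel_measurable_continuous_onI)
  have Z: "(4::4) = 0" by simp
  have T: "M *v quad_vec s = mink_vec (fst (fst s) *\<^sub>R p 1 + fst (snd (fst s)) *\<^sub>R p 2 + snd (snd (fst s)) *\<^sub>R p 3 + snd s *\<^sub>R p 0)" for s
    by (simp add: matrix_vector_mult_def M_def vec_eq_iff sum_4 Z quad_vec_def mink_vec_def mult_ac)
  have "(\<integral>\<^sup>+X. h X \<partial>lborel) = (\<integral>\<^sup>+X. h (g (mink_vec X)) \<partial>lborel)" unfolding g ..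
  also have "\<dots> = (\<integral>\<^sup>+v. h (g v) \<partial>lborel)" by (rule nn_integral_basis_map[OF linear_mink_vec(1) bij_mink_vec(1), symmetric]) simp
  also have "\<dots> = ennreal \<bar>det M\<bar> * (\<integral>\<^sup>+v. h (g (M *v v)) \<partial>lborel)" by (rule nn_integral_matrix[OF M0]) simp
  also have "(\<integral>\<^sup>+v. h (g (M *v v)) \<partial>lborel) = (\<integral>\<^sup>+s. h (g (M *v quad_vec s)) \<partial>lborel)"
  proof (rule nn_integral_basis_map[OF linear_mink_vec(2) bij_mink_vec(2)])
    have [measurable]: "(\<lambda>x. M *v x) \<in> borel_measurable borel" by (auto intro!: borel_measurable_continuous_onI linear_continuous_on)
    show "(\<lambda>x. h (g (M *v x))) \<in> borel_measurable borel" by measurable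
  qed
  finally show ?thesis unfolding T g dM .
qed

lemma ideal_coordinates_exist:
  fixes p :: "4 \<Rightarrow> minkowski"
  assumes rep: "\<And>i. ideal_rep (p i)"
    and D: "heron (ge (p 1) (p 2) * ge (p 3) (p 0)) (ge (p 1) (p 3) * ge (p 2) (p 0)) (ge (p 1) (p 0) * ge (p 2) (p 3)) > 0"
  obtains x y z t where "X = x *\<^sub>R p 1 + y *\<^sub>R p 2 + z *\<^sub>R p 3 + t *\<^sub>R p 0"
proof -
  define M :: "real^4^4" where "M = (\<chi> i j. vec_nth (mink_vec (p j)) i)"
  have "(det M)\<^sup>2 > 0" unfolding M_def heron_gram[OF rep] by (rule D)
  then have "det M \<noteq> 0" by auto
  then obtain N where N: "M ** N = mat 1" by (metis invertible_def invertible_det_nz)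
  define v where "v = N *v mink_vec X"
  have v: "M *v v = mink_vec X" by (simp add: v_def matrix_vector_mul_assoc N)
  have Z: "(4::4) = 0" by simp
  define Y where "Y = vec_nth v 1 *\<^sub>R p 1 + vec_nth v 2 *\<^sub>R p 2 + vec_nth v 3 *\<^sub>R p 3 + vec_nth v 0 *\<^sub>R p 0"
  have "mink_vec Y = mink_vec X"
    unfolding v[symmetric] by (simp add: matrix_vector_mult_def M_def vec_eq_iff sum_4 Z Y_def mink_vec_def mult_ac)
  then have e: "vec_nth (mink_vec Y) i = vec_nth (mink_vec X) i" for i by simp
  have "Y = X"
    using e[of 1] e[of 2] e[of 3] e[of 0] unfolding mink_vec_def by (simp add: prod_eq_iff vec_eq_iff forall_3)
  then show ?thesis using that unfolding Y_def by metis
qed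

section \<open>Hyperbolic volume as the measure of a truncated cone\<close>

lemma nn_integral_scale:
  fixes f :: "'a::euclidean_space \<Rightarrow> ennreal"
  assumes [measurable]: "f \<in> borel_measurable borel" and c: "c > 0"
  shows "(\<integral>\<^sup>+x. f x \<partial>lborel) = ennreal (c ^ DIM('a)) * (\<integral>\<^sup>+x. f (c *\<^sub>R x) \<partial>lborel)"
proof -
  have "(\<integral>\<^sup>+x. f x \<partial>lborel) = (\<integral>\<^sup>+x. f x \<partial>density (distr lborel borel (\<lambda>x. 0 + c *\<^sub>R x)) (\<lambda>_. \<bar>c\<bar>^DIM('a)))"
    using lborel_affine[of c "0::'a"] c by simp
  also have "\<dots> = ennreal (c ^ DIM('a)) * (\<integral>\<^sup>+x. f (c *\<^sub>R x) \<partial>lborel)"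
    using c by (simp add: nn_integral_density nn_integral_distr nn_integral_cmult)
  finally show ?thesis .
qed

lemma nn_integral_lborel_pair:
  fixes f :: "'a::euclidean_space \<times> 'b::euclidean_space \<Rightarrow> ennreal"
  assumes [measurable]: "f \<in> borel_measurable borel"
  shows "(\<integral>\<^sup>+x. f x \<partial>lborel) = (\<integral>\<^sup>+x. \<integral>\<^sup>+y. f (x, y) \<partial>lborel \<partial>lborel)"
    and "(\<integral>\<^sup>+x. f x \<partial>lborel) = (\<integral>\<^sup>+y. \<integral>\<^sup>+x. f (x, y) \<partial>lborel \<partial>lborel)"
proof -
  have m: "f \<in> borel_measurable (lborel \<Otimes>\<^sub>M lborel)" by (simp add: lborel_prod)
  have m': "(case_prod (\<lambda>x y. f (x, y))) \<in> borel_measurable (lborel \<Otimes>\<^sub>M lborel)" using m by simp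
  show 1: "(\<integral>\<^sup>+x. f x \<partial>lborel) = (\<integral>\<^sup>+x. \<integral>\<^sup>+y. f (x, y) \<partial>lborel \<partial>lborel)"
    using lborel.nn_integral_fst[OF m] by (simp add: lborel_prod)
  show "(\<integral>\<^sup>+x. f x \<partial>lborel) = (\<integral>\<^sup>+y. \<integral>\<^sup>+x. f (x, y) \<partial>lborel \<partial>lborel)"
    unfolding 1 using lborel_pair.Fubini'[OF m'] by simp
qed

text \<open>Polar coordinates in the future cone: Lebesgue measure is r^3 dr times hyperbolic
  volume, and r^3 integrates to 1 / 4 over [0, 1]. The proof replaces the time coordinate by q = r^2
  and rescales the space coordinates by sqrt q; in the variable q the radial density is q /
  2.\<close>

lemma cone_volume:
  fixes K :: "minkowski set"
  assumes K: "K \<in> sets borel" and cone: "\<And>X t. t > 0 \<Longrightarrow> t *\<^sub>R X \<in> K \<longleftrightarrow> X \<in> K"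
  shows "(\<integral>\<^sup>+X. indicator {X \<in> K. snd X > 0 \<and> 0 \<le> - lor X X \<and> - lor X X \<le> 1} X \<partial>lborel)
    = ennreal (1 / 4) * (\<integral>\<^sup>+y. indicator {y. (y, sqrt (1 + y \<bullet> y)) \<in> K} y * ennreal (1 / sqrt (1 + y \<bullet> y)) \<partial>lborel)"
proof -
  note [measurable] = K
  have [measurable]: "(\<lambda>X. lor X X) \<in> borel_measurable borel" unfolding lor_def
    by (intro borel_measurable_continuous_onI continuous_intros)
  define V where "V = (\<integral>\<^sup>+y. indicator {y. (y, sqrt (1 + y \<bullet> y)) \<in> K} y * ennreal (1 / sqrt (1 + y \<bullet> y)) \<partial>(lborel :: (real^3) measure))"
  have [measurable]: "(\<lambda>y. (y, sqrt (1 + y \<bullet> y))) \<in> borel_measurable (borel :: (real^3) measure)"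
    by (intro borel_measurable_continuous_onI continuous_intros)
  have [measurable]: "(\<lambda>z :: (real^3) \<times> real. (fst z, sqrt (snd z + fst z \<bullet> fst z))) \<in> borel_measurable borel"
    by (intro borel_measurable_continuous_onI continuous_intros)
  have [measurable]: "(\<lambda>z :: (real^3) \<times> real. sqrt (snd z + fst z \<bullet> fst z)) \<in> borel_measurable borel"
    by (intro borel_measurable_continuous_onI continuous_intros)
  define G where "G z = indicator K (fst z, sqrt (snd z + fst z \<bullet> fst z)) * ennreal (1 / (2 * sqrt (snd z + fst z \<bullet> fst z))) * indicator {0..1} (snd z)" for z :: "(real^3) \<times> real"
  have snd_m[measurable]: "(snd :: (real^3) \<times> real \<Rightarrow> real) \<in> borel_measurable borel"
    by (intro borel_measurable_continuous_onI continuous_intros)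
  have G[measurable]: "G \<in> borel_measurable borel" unfolding G_def by measurable
  have inner: "(\<integral>\<^sup>+T. indicator {X \<in> K. snd X > 0 \<and> 0 \<le> - lor X X \<and> - lor X X \<le> 1} (Y, T) \<partial>lborel) = (\<integral>\<^sup>+q. G (Y, q) \<partial>lborel)"
    if Y: "Y \<noteq> 0" for Y
  proof -
    have YY: "Y \<bullet> Y > 0" using Y by simp
    have [measurable]: "(\<lambda>T. (Y, T)) \<in> borel_measurable borel" by (intro borel_measurable_continuous_onI continuous_intros)
    define g where "g q = sqrt (q + Y \<bullet> Y)" for q
    have eq: "indicator {X \<in> K. snd X > 0 \<and> 0 \<le> - lor X X \<and> - lor X X \<le> 1} (Y, T) = (indicator K (Y, T) * indicator {g 0..g 1} T :: ennreal)" for T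
    proof -
      have "0 < T \<and> 0 \<le> - lor (Y, T) (Y, T) \<and> - lor (Y, T) (Y, T) \<le> 1 \<longleftrightarrow> g 0 \<le> T \<and> T \<le> g 1"
      proof -
        have l: "- lor (Y, T) (Y, T) = T\<^sup>2 - Y \<bullet> Y" by (simp add: lor_def power2_eq_square)
        have g0: "g 0 > 0" using YY by (simp add: g_def)
        show ?thesis
        proof (cases "T > 0")
          case True
          then have "g 0 \<le> T \<longleftrightarrow> Y \<bullet> Y \<le> T\<^sup>2" "T \<le> g 1 \<longleftrightarrow> T\<^sup>2 \<le> 1 + Y \<bullet> Y"
            unfolding g_def using real_le_rsqrt real_sqrt_le_iff[of "Y \<bullet> Y" "T\<^sup>2"] real_sqrt_le_iff[of "T\<^sup>2" "1 + Y \<bullet> Y"] by simp_all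
          then show ?thesis unfolding l using True by auto
        next
          case False
          then show ?thesis using g0 by auto
        qed
      qed
      then show ?thesis by (auto simp: indicator_def)
    qed
    have "(\<integral>\<^sup>+T. indicator K (Y, T) * indicator {g 0..g 1} T \<partial>lborel) = (\<integral>\<^sup>+q. indicator K (Y, g q) * ennreal (1 / (2 * g q)) * indicator {0..1} q \<partial>lborel)"
    proof (rule nn_integral_substitution_aux)
      show "(\<lambda>T. indicator K (Y, T)) \<in> borel_measurable borel" by measurable
      fix q :: real assume q: "q \<in> {0..1}"
      have qY: "q + Y \<bullet> Y > 0" using q by (intro add_nonneg_pos YY) auto
      show "(g has_real_derivative 1 / (2 * g q)) (at q)"
        unfolding g_def[abs_def] using qY by (auto intro!: derivative_eq_intros simp: inverse_eq_divide)
      show "1 / (2 * g q) \<ge> 0" using qY by (simp add: g_def)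
    next
      show "continuous_on {0..1} (\<lambda>q. 1 / (2 * g q))" unfolding g_def using YY by (intro continuous_intros) (force simp: add_nonneg_eq_0_iff)
    qed auto
    then show ?thesis unfolding eq G_def g_def fst_conv snd_conv .
  qed
  have outer: "(\<integral>\<^sup>+Y. G (Y, q) \<partial>lborel) = V * ennreal (q / 2) * indicator {0..1} q" if q: "q \<noteq> 0" for q
  proof (cases "q \<in> {0..1}")
    case True
    then have q0: "q > 0" using q by auto
    have [measurable]: "(\<lambda>Y. (Y, q)) \<in> borel_measurable (borel :: (real^3) measure)" by (intro borel_measurable_continuous_onI continuous_intros)
    have h: "sqrt (q + (sqrt q *\<^sub>R y) \<bullet> (sqrt q *\<^sub>R y)) = sqrt q * sqrt (1 + y \<bullet> y)" for y :: "real^3"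
    proof -
      have "q + (sqrt q *\<^sub>R y) \<bullet> (sqrt q *\<^sub>R y) = q * (1 + y \<bullet> y)" using q0 by (simp add: algebra_simps)
      then show ?thesis by (simp add: real_sqrt_mult)
    qed
    have "(\<integral>\<^sup>+Y. G (Y, q) \<partial>lborel) = ennreal (sqrt q ^ 3) * (\<integral>\<^sup>+y. G (sqrt q *\<^sub>R y, q) \<partial>lborel)"
      using q0 by (subst nn_integral_scale[of _ "sqrt q"]) simp_all
    also have "(\<integral>\<^sup>+y. G (sqrt q *\<^sub>R y, q) \<partial>lborel) = (\<integral>\<^sup>+y. ennreal (1 / (2 * sqrt q)) * (indicator {y. (y, sqrt (1 + y \<bullet> y)) \<in> K} y * ennreal (1 / sqrt (1 + y \<bullet> y))) \<partial>lborel)"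
    proof (rule nn_integral_cong)
      fix y :: "real^3"
      have "(sqrt q *\<^sub>R y, sqrt q * sqrt (1 + y \<bullet> y)) \<in> K \<longleftrightarrow> (y, sqrt (1 + y \<bullet> y)) \<in> K"
        using cone[of "sqrt q" "(y, sqrt (1 + y \<bullet> y))"] q0 by simp
      then have "G (sqrt q *\<^sub>R y, q) = indicator {y. (y, sqrt (1 + y \<bullet> y)) \<in> K} y * ennreal (1 / (2 * sqrt q) * (1 / sqrt (1 + y \<bullet> y)))"
        unfolding G_def fst_conv snd_conv h using True by (simp add: indicator_def)
      also have "ennreal (1 / (2 * sqrt q) * (1 / sqrt (1 + y \<bullet> y))) = ennreal (1 / (2 * sqrt q)) * ennreal (1 / sqrt (1 + y \<bullet> y))"
        using q0 by (intro ennreal_mult) auto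
      finally show "G (sqrt q *\<^sub>R y, q) = ennreal (1 / (2 * sqrt q)) * (indicator {y. (y, sqrt (1 + y \<bullet> y)) \<in> K} y * ennreal (1 / sqrt (1 + y \<bullet> y)))"
        by (simp add: mult_ac)
    qed
    also have "\<dots> = ennreal (1 / (2 * sqrt q)) * V" unfolding V_def by (rule nn_integral_cmult) measurable
    also have "ennreal (sqrt q ^ 3) * (ennreal (1 / (2 * sqrt q)) * V) = ennreal (sqrt q ^ 3 * (1 / (2 * sqrt q))) * V"
      using q0 by (subst ennreal_mult) (auto simp: mult.assoc)
    also have "sqrt q ^ 3 * (1 / (2 * sqrt q)) = q / 2" using q0 by (simp add: power3_eq_cube)
    finally show ?thesis using True by (simp add: mult.commute)
  next
    case False
    then show ?thesis by (simp add: G_def)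
  qed
  have "(\<integral>\<^sup>+X. indicator {X \<in> K. snd X > 0 \<and> 0 \<le> - lor X X \<and> - lor X X \<le> 1} X \<partial>lborel)
    = (\<integral>\<^sup>+Y. \<integral>\<^sup>+T. indicator {X \<in> K. snd X > 0 \<and> 0 \<le> - lor X X \<and> - lor X X \<le> 1} (Y, T) \<partial>lborel \<partial>lborel)"
    by (rule nn_integral_lborel_pair(1)) measurable
  also have "\<dots> = (\<integral>\<^sup>+Y. \<integral>\<^sup>+q. G (Y, q) \<partial>lborel \<partial>lborel)"
    by (intro nn_integral_cong_AE, rule eventually_mono[OF AE_lborel_singleton[of 0]]) (rule inner)
  also have "\<dots> = (\<integral>\<^sup>+q. \<integral>\<^sup>+Y. G (Y, q) \<partial>lborel \<partial>lborel)"
    unfolding nn_integral_lborel_pair(1)[OF G, symmetric] by (rule nn_integral_lborel_pair(2)[OF G])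
  also have "\<dots> = (\<integral>\<^sup>+q. V * (ennreal (q / 2) * indicator {0..1} q) \<partial>lborel)"
    using AE_lborel_singleton[of "0::real"] by (intro nn_integral_cong_AE) (auto elim!: eventually_mono simp: outer mult.assoc)
  also have "\<dots> = V * (\<integral>\<^sup>+q. ennreal (q / 2) * indicator {0..1} q \<partial>lborel)" by (rule nn_integral_cmult) measurable
  also have "(\<integral>\<^sup>+q. ennreal (q / 2) * indicator {0..1} q \<partial>lborel) = ennreal (1\<^sup>2 / 4 - 0\<^sup>2 / 4)"
    by (rule nn_integral_FTC_Icc[where F = "\<lambda>q. q\<^sup>2 / 4"])
      (auto intro!: derivative_eq_intros simp: has_real_derivative_iff_has_vector_derivative[symmetric])
  finally show ?thesis unfolding V_def by (simp add: mult.commute)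
qed

text \<open>The same truncated cone with its rays parametrised by the points whose last coefficient
  is 1. Along such a ray the Jacobian is t^3 and the truncation is t <= 1 / sqrt Q with Q = - lor of
  the base point, which gives 1 / (4 Q^2).\<close>

lemma cone_parameter_integral:
  fixes T :: "(real \<times> real \<times> real) \<times> real \<Rightarrow> minkowski" and S :: "(real \<times> real \<times> real) set"
  assumes lin: "\<And>c x. T (c *\<^sub>R x) = c *\<^sub>R T x" and [measurable]: "T \<in> borel_measurable borel"
    and K: "K \<in> sets borel" and S[measurable]: "S \<in> sets borel"
    and TK: "\<And>s t. T (s, t) \<in> K \<Longrightarrow> t \<ge> 0" "\<And>s. T (s, 1) \<in> K \<longleftrightarrow> s \<in> S"
    and cone: "\<And>X t. t > 0 \<Longrightarrow> t *\<^sub>R X \<in> K \<longleftrightarrow> X \<in> K"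
    and pos: "\<And>s. s \<in> S \<Longrightarrow> s \<noteq> 0 \<Longrightarrow> snd (T (s, 1)) > 0 \<and> - lor (T (s, 1)) (T (s, 1)) > 0"
  shows "(\<integral>\<^sup>+s. indicator {X \<in> K. snd X > 0 \<and> 0 \<le> - lor X X \<and> - lor X X \<le> 1} (T s) \<partial>lborel)
    = (\<integral>\<^sup>+s. indicator S s * ennreal (1 / (4 * (lor (T (s, 1)) (T (s, 1)))\<^sup>2)) \<partial>lborel)"
proof -
  note [measurable] = K
  have [measurable]: "(\<lambda>X. lor X X) \<in> borel_measurable borel" unfolding lor_def
    by (intro borel_measurable_continuous_onI continuous_intros)
  have snd_m[measurable]: "(snd :: (real^3) \<times> real \<Rightarrow> real) \<in> borel_measurable borel"
    by (intro borel_measurable_continuous_onI continuous_intros)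
  have [measurable]: "(\<lambda>x :: (real \<times> real \<times> real) \<times> real. (snd x *\<^sub>R fst x, snd x)) \<in> borel_measurable borel"
    by (intro borel_measurable_continuous_onI continuous_intros)
  have snd_m2[measurable]: "(snd :: (real \<times> real \<times> real) \<times> real \<Rightarrow> real) \<in> borel_measurable borel"
    by (intro borel_measurable_continuous_onI continuous_intros)
  define I :: "minkowski \<Rightarrow> ennreal" where "I = indicator {X \<in> K. snd X > 0 \<and> 0 \<le> - lor X X \<and> - lor X X \<le> 1}"
  have [measurable]: "I \<in> borel_measurable borel" unfolding I_def by measurable
  have [measurable]: "(\<lambda>s. (s, t)) \<in> borel_measurable (borel :: (real \<times> real \<times> real) measure)" for t :: real
    by (intro borel_measurable_continuous_onI continuous_intros)
  define G where "G x = ennreal (snd x ^ 3) * indicator {0<..} (snd x) * I (T (snd x *\<^sub>R fst x, snd x))" for x :: "(real \<times> real \<times> real) \<times> real"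
  have G[measurable]: "G \<in> borel_measurable borel" unfolding G_def by measurable
  have inner: "(\<integral>\<^sup>+s. I (T (s, t)) \<partial>lborel) = (\<integral>\<^sup>+s. G (s, t) \<partial>lborel)" if "t \<noteq> 0" for t
  proof (cases "t > 0")
    case True
    then have "(\<integral>\<^sup>+s. I (T (s, t)) \<partial>lborel) = ennreal (t ^ 3) * (\<integral>\<^sup>+s. I (T (t *\<^sub>R s, t)) \<partial>lborel)"
      by (subst nn_integral_scale[of _ t]) (simp_all add: power3_eq_cube mult.assoc)
    also have "\<dots> = (\<integral>\<^sup>+s. ennreal (t ^ 3) * I (T (t *\<^sub>R s, t)) \<partial>lborel)"
      by (rule nn_integral_cmult[symmetric]) measurable
    finally show ?thesis using True by (simp add: G_def)
  next
    case False
    then have "I (T (s, t)) = 0" for s using TK(1)[of s t] that by (auto simp: I_def indicator_def)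
    then show ?thesis using False by (simp add: G_def)
  qed
  have outer: "(\<integral>\<^sup>+t. G (s, t) \<partial>lborel) = indicator S s * ennreal (1 / (4 * (lor (T (s, 1)) (T (s, 1)))\<^sup>2))" if s: "s \<noteq> 0" for s
  proof (cases "s \<in> S")
    case True
    define Q where "Q = - lor (T (s, 1)) (T (s, 1))"
    have Q: "Q > 0" "snd (T (s, 1)) > 0" using pos[OF True s] by (auto simp: Q_def)
    have "G (s, t) = ennreal (t ^ 3) * indicator {0..1 / sqrt Q} t" for t
    proof (cases "t > 0")
      case t: True
      have e: "T (t *\<^sub>R s, t) = t *\<^sub>R T (s, 1)" using lin[of t "(s, 1)"] by simp
      have "t\<^sup>2 * Q \<ge> 0" using Q by (intro mult_nonneg_nonneg) auto
      moreover have "t * (t * lor (T (s, 1)) (T (s, 1))) = - (t\<^sup>2 * Q)" by (simp add: Q_def power2_eq_square)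
      moreover have "t\<^sup>2 * Q \<le> 1 \<longleftrightarrow> t \<le> 1 / sqrt Q"
      proof -
        have "t \<le> 1 / sqrt Q \<longleftrightarrow> t * sqrt Q \<le> 1" using Q by (simp add: field_simps)
        also have "\<dots> \<longleftrightarrow> sqrt (t\<^sup>2 * Q) \<le> sqrt 1" using t by (simp add: real_sqrt_mult)
        finally show ?thesis by (simp only: real_sqrt_le_iff)
      qed
      ultimately show ?thesis using t Q True cone[OF t, of "T (s, 1)"] TK(2)[of s] unfolding G_def I_def fst_conv snd_conv e by (simp add: indicator_def)
    next
      case False
      then show ?thesis by (cases "t = 0") (auto simp: G_def indicator_def)
    qed
    then have "(\<integral>\<^sup>+t. G (s, t) \<partial>lborel) = (\<integral>\<^sup>+t. ennreal (t ^ 3) * indicator {0..1 / sqrt Q} t \<partial>lborel)" by simp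
    also have "\<dots> = ennreal ((1 / sqrt Q) ^ 4 / 4 - 0 ^ 4 / 4)"
      using Q by (intro nn_integral_FTC_Icc[where F = "\<lambda>q. q ^ 4 / 4"])
        (auto intro!: derivative_eq_intros simp: has_real_derivative_iff_has_vector_derivative[symmetric])
    also have "(1 / sqrt Q) ^ 4 = 1 / Q\<^sup>2"
    proof -
      have "(1 / sqrt Q) ^ 4 = 1 / ((sqrt Q)\<^sup>2)\<^sup>2" unfolding power_divide by simp
      then show ?thesis using Q by simp
    qed
    finally show ?thesis using True by (simp add: Q_def)
  next
    case False
    have "G (s, t) = 0" for t
    proof (cases "t > 0")
      case t: True
      have "T (t *\<^sub>R s, t) = t *\<^sub>R T (s, 1)" using lin[of t "(s, 1)"] by simp
      then show ?thesis using False cone[OF t, of "T (s, 1)"] TK(2)[of s] by (simp add: G_def I_def)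
    qed (simp add: G_def)
    then show ?thesis using False by simp
  qed
  have "(\<integral>\<^sup>+s. I (T s) \<partial>lborel) = (\<integral>\<^sup>+t. \<integral>\<^sup>+s. I (T (s, t)) \<partial>lborel \<partial>lborel)"
    by (rule nn_integral_lborel_pair(2)) measurable
  also have "\<dots> = (\<integral>\<^sup>+t. \<integral>\<^sup>+s. G (s, t) \<partial>lborel \<partial>lborel)"
    by (intro nn_integral_cong_AE, rule eventually_mono[OF AE_lborel_singleton[of 0]]) (rule inner)
  also have "\<dots> = (\<integral>\<^sup>+s. \<integral>\<^sup>+t. G (s, t) \<partial>lborel \<partial>lborel)"
    unfolding nn_integral_lborel_pair(2)[OF G, symmetric] by (rule nn_integral_lborel_pair(1)[OF G])
  also have "\<dots> = (\<integral>\<^sup>+s. indicator S s * ennreal (1 / (4 * (lor (T (s, 1)) (T (s, 1)))\<^sup>2)) \<partial>lborel)"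
    by (intro nn_integral_cong_AE, rule eventually_mono[OF AE_lborel_singleton[of 0]]) (rule outer)
  finally show ?thesis unfolding I_def .
qed

section \<open>Evaluation of the volume by the Lobachevsky function\<close>

lemma nn_integral_FTC_positive:
  fixes F f :: "real \<Rightarrow> real"
  assumes d: "\<And>x. x > 0 \<Longrightarrow> (F has_real_derivative f x) (at x)" and c: "\<And>x. x > 0 \<Longrightarrow> isCont f x"
    and nn: "\<And>x. x > 0 \<Longrightarrow> f x \<ge> 0" and A: "(F \<longlongrightarrow> A) (at_right 0)" and B: "(F \<longlongrightarrow> B) at_top"
  shows "(\<integral>\<^sup>+x. indicator {0<..} x * ennreal (f x) \<partial>lborel) = ennreal (B - A)" and "A \<le> B"
proof -
  have e: "einterval 0 \<infinity> = {0::real<..}" by (auto simp: einterval_def)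
  have A': "((F \<circ> real_of_ereal) \<longlongrightarrow> A) (at_right 0)" using A unfolding zero_ereal_def ereal_tendsto_simps .
  have B': "((F \<circ> real_of_ereal) \<longlongrightarrow> B) (at_left \<infinity>)" using B unfolding ereal_tendsto_simps .
  note I = interval_integral_FTC_nonneg[of 0 \<infinity> F f A B, OF _ _ _ _ A' B']
  have i: "set_integrable lborel {0<..} f" and v: "(LBINT x=0..\<infinity>. f x) = B - A"
    using I d c nn unfolding e by auto
  have "(LBINT x=0..\<infinity>. f x) = (LINT x|lborel. indicator {0<..} x *\<^sub>R f x)"
    unfolding interval_lebesgue_integral_def set_lebesgue_integral_def e by simp
  then have v': "(LINT x|lborel. indicator {0<..} x *\<^sub>R f x) = B - A" using v by simp
  have "(\<integral>\<^sup>+x. indicator {0<..} x * ennreal (f x) \<partial>lborel) = (\<integral>\<^sup>+x. ennreal (indicator {0<..} x *\<^sub>R f x) \<partial>lborel)"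
    by (intro nn_integral_cong) (simp add: indicator_def)
  also have "\<dots> = ennreal (LINT x|lborel. indicator {0<..} x *\<^sub>R f x)"
    using i nn unfolding set_integrable_def by (intro nn_integral_eq_integral) (auto simp: indicator_def)
  finally show "(\<integral>\<^sup>+x. indicator {0<..} x * ennreal (f x) \<partial>lborel) = ennreal (B - A)" unfolding v' .
  have "0 \<le> (LINT x|lborel. indicator {0<..} x *\<^sub>R f x)" by (rule Bochner_Integration.integral_nonneg) (simp add: indicator_def nn)
  then show "A \<le> B" unfolding v' by simp
qed

lemma integral_inverse_quadratic:
  assumes "M > 0" "N > 0"
  shows "(\<integral>\<^sup>+z. indicator {0<..} z * ennreal (1 / (16 * (M * z + N)\<^sup>2)) \<partial>lborel) = ennreal (1 / (16 * M * N))"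
proof -
  have p: "M * z + N > 0" if "z > 0" for z using assms that by (intro add_pos_pos mult_pos_pos)
  have "(\<integral>\<^sup>+z. indicator {0<..} z * ennreal (1 / (16 * (M * z + N)\<^sup>2)) \<partial>lborel) = ennreal (0 - (- 1 / (16 * M * N)))"
  proof (rule nn_integral_FTC_positive(1)[where F = "\<lambda>z. - 1 / (16 * M * (M * z + N))"])
    fix z :: real assume z: "z > 0"
    show "((\<lambda>z. - 1 / (16 * M * (M * z + N))) has_real_derivative 1 / (16 * (M * z + N)\<^sup>2)) (at z)"
    proof -
      have "((\<lambda>z. M * z + N) has_real_derivative M) (at z)" by (auto intro!: derivative_eq_intros)
      from DERIV_cmult[OF DERIV_inverse_fun[OF this], of "- (1 / (16 * M))"] p[OF z]
      have "((\<lambda>z. - (1 / (16 * M)) * inverse (M * z + N)) has_real_derivative - (1 / (16 * M)) * - (M * inverse ((M * z + N) ^ Suc (Suc 0)))) (at z)"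
        by simp
      also have "- (1 / (16 * M)) * - (M * inverse ((M * z + N) ^ Suc (Suc 0))) = 1 / (16 * (M * z + N)\<^sup>2)"
        using assms by (simp add: inverse_eq_divide power2_eq_square)
      also have "(\<lambda>z. - (1 / (16 * M)) * inverse (M * z + N)) = (\<lambda>z. - 1 / (16 * M * (M * z + N)))"
        by (simp add: inverse_eq_divide)
      finally show ?thesis .
    qed
    show "isCont (\<lambda>z. 1 / (16 * (M * z + N)\<^sup>2)) z" using p[OF z] by (intro continuous_intros) auto
  next
    have "((\<lambda>z. - 1 / (16 * M * (M * z + N))) \<longlongrightarrow> - 1 / (16 * M * (M * 0 + N))) (at_right 0)"
      using assms by (intro tendsto_intros) auto
    then show "((\<lambda>z. - 1 / (16 * M * (M * z + N))) \<longlongrightarrow> - 1 / (16 * M * N)) (at_right 0)" by simp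
    show "((\<lambda>z. - 1 / (16 * M * (M * z + N))) \<longlongrightarrow> 0) at_top" using assms by real_asymp
  qed auto
  then show ?thesis by simp
qed

lemma integral_inverse_product:
  assumes "P > 0" "G > 0" "R > 0" "T > 0" and d: "P * T - G * R > 0"
  shows "(\<integral>\<^sup>+x. indicator {0<..} x * ennreal (1 / (16 * ((P * x + G) * (R * x + T)))) \<partial>lborel) = ennreal (ln (P * T / (G * R)) / (16 * (P * T - G * R)))"
proof -
  define K where "K = 16 * (P * T - G * R)"
  have K: "K > 0" using d by (simp add: K_def)
  have p: "P * x + G > 0" "R * x + T > 0" if "x > 0" for x using assms that by (auto intro!: add_pos_pos mult_pos_pos)
  have "(\<integral>\<^sup>+x. indicator {0<..} x * ennreal (1 / (16 * ((P * x + G) * (R * x + T)))) \<partial>lborel) = ennreal ((ln P - ln R) / K - (ln G - ln T) / K)"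
  proof (rule nn_integral_FTC_positive(1)[where F = "\<lambda>x. (ln (P * x + G) - ln (R * x + T)) / K"])
    fix x :: real assume x: "x > 0"
    have e: "P / (P * x + G) - R / (R * x + T) = (P * T - G * R) / ((P * x + G) * (R * x + T))"
      using p[OF x] by (simp add: field_simps)
    have "((\<lambda>x. (ln (P * x + G) - ln (R * x + T)) / K) has_real_derivative (P / (P * x + G) - R / (R * x + T)) / K) (at x)"
      using p[OF x] by (auto intro!: derivative_eq_intros simp: divide_inverse mult_ac)
    also have "(P / (P * x + G) - R / (R * x + T)) / K = 1 / (16 * ((P * x + G) * (R * x + T)))"
      unfolding e K_def using d p[OF x] by (simp add: divide_simps) (simp add: algebra_simps)
    finally show "((\<lambda>x. (ln (P * x + G) - ln (R * x + T)) / K) has_real_derivative 1 / (16 * ((P * x + G) * (R * x + T)))) (at x)" .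
    show "isCont (\<lambda>x. 1 / (16 * ((P * x + G) * (R * x + T)))) x" using p[OF x] by (intro continuous_intros) auto
    show "0 \<le> 1 / (16 * ((P * x + G) * (R * x + T)))" using p[OF x] by simp
  next
    have "((\<lambda>x. (ln (P * x + G) - ln (R * x + T)) / K) \<longlongrightarrow> (ln (P * 0 + G) - ln (R * 0 + T)) / K) (at_right 0)"
      using assms K by (intro tendsto_intros) auto
    then show "((\<lambda>x. (ln (P * x + G) - ln (R * x + T)) / K) \<longlongrightarrow> (ln G - ln T) / K) (at_right 0)" by simp
    show "((\<lambda>x. (ln (P * x + G) - ln (R * x + T)) / K) \<longlongrightarrow> (ln P - ln R) / K) at_top"
    proof (rule tendsto_divide[OF _ tendsto_const])
      show "((\<lambda>x. ln (P * x + G) - ln (R * x + T)) \<longlongrightarrow> ln P - ln R) at_top" using assms by real_asymp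
    qed (use K in simp)
  qed
  also have "(ln P - ln R) / K - (ln G - ln T) / K = ln (P * T / (G * R)) / K"
    using assms by (simp add: ln_div ln_mult diff_divide_distrib add_divide_distrib)
  finally show ?thesis unfolding K_def .
qed

lemma Lob_isCont: "0 < x \<Longrightarrow> x < pi \<Longrightarrow> isCont Lob x"
  by (rule DERIV_isCont[OF Lob_deriv])

text \<open>The substitution of an angle x for n turns the rational weight into dx, and ln W into a
  signed sum of four terms ln (2 sin), whose primitive is a combination of values of
  \<open>Lob\<close>. Between x = 0 and x = A the reflection law makes the two boundary values
  opposite, each with modulus the sum over the three angles.\<close>

lemma Lob_angle_integral:
  assumes t: "tri A B C" and c: "c > 0"
    and W: "\<And>n. n > 0 \<Longrightarrow> W n = (sin C * n + sin B) * (sin B * n + sin C) / ((sin A)\<^sup>2 * n)" and W1: "\<And>n. n > 0 \<Longrightarrow> W n \<ge> 1"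
  shows "(\<integral>\<^sup>+n. indicator {0<..} n * ennreal (c * (sin A * ln (W n) / (n\<^sup>2 + 2 * cos A * n + 1))) \<partial>lborel) = ennreal (2 * c * (Lob A + Lob B + Lob C))"
    and "0 \<le> Lob A + Lob B + Lob C"
proof -
  have s: "sin A > 0" "sin B > 0" "sin C > 0" using tri_sin_pos[OF t] by auto
  have rng: "0 < A" "0 < B" "0 < C" "A + B + C = pi" using t by (auto simp: tri_def)
  define T where "T n = arctan ((n + cos A) / sin A)" for n
  \<comment> \<open>The angle with n = sin (F n) / sin (A - F n); it runs from 0 to A as n runs
    through the positive numbers.\<close>
  define F where "F n = T n - (pi / 2 - A)" for n
  \<comment> \<open>The primitive of ln (2 sin (B + x)) + ln (2 sin (C + x)) - ln (2 sin x) - ln (2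
    sin (A - x)).\<close>
  define P where "P x = - Lob (B + x) - Lob (C + x) + Lob x - Lob (A - x)" for x
  have th0: "arctan (cos A / sin A) = pi / 2 - A"
  proof -
    have "tan (pi / 2 - A) = cos A / sin A" by (simp add: tan_def sin_diff cos_diff)
    moreover have "- (pi / 2) < pi / 2 - A" "pi / 2 - A < pi / 2" using rng by auto
    ultimately show ?thesis using arctan_tan[of "pi / 2 - A"] by simp
  qed
  have Phi: "0 < F n" "F n < A" if n: "n > 0" for n
  proof -
    have "arctan (cos A / sin A) < T n" unfolding T_def arctan_less_iff using n s by (intro divide_strict_right_mono) auto
    then show "0 < F n" by (simp add: F_def th0)
    show "F n < A" using arctan_ubound[of "(n + cos A) / sin A"] by (simp add: F_def T_def)
  qed
  have quad: "n\<^sup>2 + 2 * cos A * n + 1 = (n + cos A)\<^sup>2 + (sin A)\<^sup>2" for n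
    by (simp add: power2_sum sin_squared_eq algebra_simps)
  have quad0: "n\<^sup>2 + 2 * cos A * n + 1 > 0" for n unfolding quad using s by (intro add_nonneg_pos) auto
  have dphi: "(F has_real_derivative sin A / (n\<^sup>2 + 2 * cos A * n + 1)) (at n)" for n
  proof -
    have "((\<lambda>n. (n + cos A) / sin A) has_real_derivative 1 / sin A) (at n)"
      using s by (auto intro!: derivative_eq_intros)
    from DERIV_diff[OF DERIV_chain'[OF this DERIV_arctan] DERIV_const, of "pi / 2 - A"]
    have "(F has_real_derivative inverse (1 + ((n + cos A) / sin A)\<^sup>2) * (1 / sin A)) (at n)"
      unfolding F_def[abs_def] T_def[abs_def] by simp
    also have "inverse (1 + ((n + cos A) / sin A)\<^sup>2) * (1 / sin A) = sin A / (n\<^sup>2 + 2 * cos A * n + 1)"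
    proof -
      have "1 + ((n + cos A) / sin A)\<^sup>2 = (n\<^sup>2 + 2 * cos A * n + 1) / (sin A)\<^sup>2"
        unfolding quad power_divide using s by (simp add: add_divide_distrib)
      then show ?thesis using s by (simp add: power2_eq_square)
    qed
    finally show ?thesis .
  qed
  have lnW: "ln (2 * sin (B + F n)) + ln (2 * sin (C + F n)) - ln (2 * sin (F n)) - ln (2 * sin (A - F n)) = ln (W n)" if n: "n > 0" for n
  proof -
    define u where "u = (n + cos A) / sin A"
    define q where "q = cos (T n)"
    have q: "q > 0" unfolding q_def T_def by (rule cos_gt_zero_pi[OF arctan_lbound arctan_ubound])
    have su: "sin (T n) = u * q" using tan_arctan[of u] q unfolding tan_def q_def T_def u_def by (simp add: field_simps)
    have us: "u * sin A = n + cos A" using s by (simp add: u_def)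
    have ph: "F n = T n + A - pi / 2" by (simp add: F_def)
    have e1: "sin (A - F n) = q" unfolding ph q_def by (simp add: sin_diff)
    have e2: "sin (F n) = n * q"
    proof -
      have "sin (F n) = - cos (T n + A)" unfolding ph by (simp add: sin_diff)
      also have "\<dots> = q * (u * sin A - cos A)" unfolding cos_add su q_def[symmetric] by (simp add: algebra_simps)
      finally show ?thesis unfolding us by simp
    qed
    have key: "sin (b + F n) * sin A = q * (sin c * n + sin b)" if "A + b + c = pi" for b c
    proof -
      have "b + F n = pi / 2 + (T n - c)" using that unfolding ph by simp
      then have "sin (b + F n) = cos (T n - c)" by (simp only: sin_add) simp
      also have "\<dots> = q * (cos c + u * sin c)" unfolding cos_diff su q_def[symmetric] by (simp add: algebra_simps)
      finally have "sin (b + F n) * sin A = q * (cos c * sin A + (u * sin A) * sin c)" by (simp add: algebra_simps)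
      also have "\<dots> = q * (sin c * n + (sin A * cos c + cos A * sin c))" unfolding us by (simp add: algebra_simps)
      also have "sin A * cos c + cos A * sin c = sin (A + c)" by (simp add: sin_add)
      also have "A + c = pi - b" using that by simp
      finally show ?thesis by simp
    qed
    have k1: "sin (B + F n) * sin A = q * (sin C * n + sin B)" by (rule key) (use rng in simp)
    have k2: "sin (C + F n) * sin A = q * (sin B * n + sin C)" by (rule key) (use rng in simp)
    have p: "sin C * n + sin B > 0" "sin B * n + sin C > 0" using s n by (auto intro!: add_pos_pos mult_pos_pos)
    have b1: "sin (B + F n) = q * (sin C * n + sin B) / sin A" "sin (C + F n) = q * (sin B * n + sin C) / sin A"
      using k1 k2 s by (simp_all add: field_simps)
    show ?thesis unfolding W[OF n] b1 e1 e2 using s p q n by (simp add: ln_mult ln_div power2_eq_square)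
  qed
  have lim0: "((\<lambda>n. c * P (F n)) \<longlongrightarrow> c * (- Lob B - Lob C + 0 - Lob A)) (at_right 0)"
  proof -
    have "(F \<longlongrightarrow> F 0) (at_right 0)" using DERIV_isCont[OF dphi[of 0]] unfolding isCont_def by (rule filterlim_at_split[THEN iffD1, THEN conjunct2])
    then have f0: "(F \<longlongrightarrow> 0) (at_right 0)" by (simp add: F_def T_def th0)
    moreover have "eventually (\<lambda>n. F n > 0) (at_right 0)" using Phi(1) by (auto simp: eventually_at_right_field intro: exI[of _ 1])
    ultimately have f: "filterlim F (at_right 0) (at_right 0)" by (auto simp: filterlim_at elim: eventually_mono)
    have 1: "((\<lambda>n. Lob (F n)) \<longlongrightarrow> 0) (at_right 0)" by (rule filterlim_compose[OF Lob_tendsto_0 f])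
    have 2: "((\<lambda>n. Lob (x + F n)) \<longlongrightarrow> Lob x) (at_right 0)" if "0 < x" "x < pi" for x
      using isCont_tendsto_compose[OF Lob_isCont[OF that], of "\<lambda>n. x + F n"] tendsto_add[OF tendsto_const f0, of x] by simp
    have 3: "((\<lambda>n. Lob (A - F n)) \<longlongrightarrow> Lob A) (at_right 0)"
      using isCont_tendsto_compose[OF Lob_isCont, of A "\<lambda>n. A - F n"] tendsto_diff[OF tendsto_const f0, of A] rng by simp
    show ?thesis unfolding P_def using rng by (intro tendsto_intros 1 2 3) auto
  qed
  have limtop: "((\<lambda>n. c * P (F n)) \<longlongrightarrow> c * (Lob C + Lob B + Lob A - 0)) at_top"
  proof -
    have "filterlim (\<lambda>n. (n + cos A) / sin A) at_top at_top" using s by real_asymp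
    then have "(T \<longlongrightarrow> pi / 2) at_top" unfolding T_def[abs_def] by (rule filterlim_compose[OF tendsto_arctan_at_top])
    then have f0: "(F \<longlongrightarrow> A) at_top" unfolding F_def[abs_def] using tendsto_diff[OF _ tendsto_const, of T "pi / 2" at_top "pi / 2 - A"] by simp
    then have d0: "((\<lambda>n. A - F n) \<longlongrightarrow> 0) at_top" using tendsto_diff[OF tendsto_const f0, of A] by simp
    have "eventually (\<lambda>n. A - F n > 0) at_top" using eventually_gt_at_top[of 0] by eventually_elim (use Phi(2) in simp)
    then have f: "filterlim (\<lambda>n. A - F n) (at_right 0) at_top" using d0 by (auto simp: filterlim_at elim: eventually_mono)
    have 1: "((\<lambda>n. Lob (A - F n)) \<longlongrightarrow> 0) at_top" by (rule filterlim_compose[OF Lob_tendsto_0 f])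
    have 2: "((\<lambda>n. Lob (x + F n)) \<longlongrightarrow> Lob (x + A)) at_top" if "0 < x + A" "x + A < pi" for x
      using isCont_tendsto_compose[OF Lob_isCont[OF that], of "\<lambda>n. x + F n"] tendsto_add[OF tendsto_const f0, of x] by simp
    have 3: "((\<lambda>n. Lob (F n)) \<longlongrightarrow> Lob A) at_top" using 2[of 0] rng by simp
    have ba: "B + A = pi - C" "C + A = pi - B" using rng by auto
    have "Lob (B + A) = - Lob C" "Lob (C + A) = - Lob B" unfolding ba using rng by (simp_all add: Lob_reflect)
    then have e: "c * (Lob C + Lob B + Lob A - 0) = c * (- Lob (B + A) - Lob (C + A) + Lob A - 0)" by simp
    show ?thesis unfolding e P_def using rng by (intro tendsto_intros 1 2 3) auto
  qed
  define f where "f n = c * (sin A * ln (W n) / (n\<^sup>2 + 2 * cos A * n + 1))" for n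
  have facts: "((\<lambda>n. c * P (F n)) has_real_derivative f n) (at n)" "0 \<le> f n" "isCont f n" if n: "n > 0" for n
    unfolding f_def f_def[abs_def]
  proof -
    have r: "0 < B + F n" "B + F n < pi" "0 < C + F n" "C + F n < pi" "0 < F n" "F n < pi" "0 < A - F n" "A - F n < pi"
      using Phi[OF n] rng by auto
    have "(P has_real_derivative ln (2 * sin (B + F n)) + ln (2 * sin (C + F n)) - ln (2 * sin (F n)) - ln (2 * sin (A - F n))) (at (F n))"
    proof -
      have i: "((\<lambda>x. Lob (b + x)) has_real_derivative - ln (2 * sin (b + F n)) * (0 + 1)) (at (F n))" if "0 < b + F n" "b + F n < pi" for b
        by (rule DERIV_chain'[OF DERIV_add[OF DERIV_const DERIV_ident] Lob_deriv[OF that]])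
      have ii: "((\<lambda>x. Lob (A - x)) has_real_derivative - ln (2 * sin (A - F n)) * (0 - 1)) (at (F n))"
        by (rule DERIV_chain'[OF DERIV_diff[OF DERIV_const DERIV_ident] Lob_deriv[OF r(7,8)]])
      show ?thesis unfolding P_def[abs_def]
        by (rule DERIV_cong[OF DERIV_diff[OF DERIV_add[OF DERIV_diff[OF DERIV_minus[OF i[OF r(1,2)]] i[OF r(3,4)]] Lob_deriv[OF r(5,6)]] ii]]) simp
    qed
    from DERIV_cmult[OF DERIV_chain'[OF dphi this], of c]
    show "((\<lambda>n. c * P (F n)) has_real_derivative c * (sin A * ln (W n) / (n\<^sup>2 + 2 * cos A * n + 1))) (at n)"
      unfolding lnW[OF n] by (simp add: mult_ac)
    show "0 \<le> c * (sin A * ln (W n) / (n\<^sup>2 + 2 * cos A * n + 1))"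
      using c s quad0[of n] W1[OF n] by (intro mult_nonneg_nonneg divide_nonneg_pos) auto
    have "isCont (\<lambda>n. c * (sin A * ln ((sin C * n + sin B) * (sin B * n + sin C) / ((sin A)\<^sup>2 * n)) / (n\<^sup>2 + 2 * cos A * n + 1))) n"
    proof -
      have "sin C * n + sin B > 0" "sin B * n + sin C > 0" using s n by (auto intro!: add_pos_pos mult_pos_pos)
      then show ?thesis using s n quad0[of n] by (intro continuous_intros) auto
    qed
    moreover have "eventually (\<lambda>n. c * (sin A * ln (W n) / (n\<^sup>2 + 2 * cos A * n + 1)) = c * (sin A * ln ((sin C * n + sin B) * (sin B * n + sin C) / ((sin A)\<^sup>2 * n)) / (n\<^sup>2 + 2 * cos A * n + 1))) (nhds n)"
      using eventually_nhds_in_open[of "{0<..}" n] n by (auto elim!: eventually_mono simp: W)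
    ultimately show "isCont (\<lambda>n. c * (sin A * ln (W n) / (n\<^sup>2 + 2 * cos A * n + 1))) n"
      using isCont_cong by fast
  qed
  note I = nn_integral_FTC_positive[OF facts(1,3,2) lim0 limtop, unfolded f_def]
  have e: "c * (Lob C + Lob B + Lob A - 0) - c * (- Lob B - Lob C + 0 - Lob A) = 2 * c * (Lob A + Lob B + Lob C)"
    by (simp add: algebra_simps)
  show "(\<integral>\<^sup>+n. indicator {0<..} n * ennreal (c * (sin A * ln (W n) / (n\<^sup>2 + 2 * cos A * n + 1))) \<partial>lborel) = ennreal (2 * c * (Lob A + Lob B + Lob C))"
    using I(1) unfolding e by simp
  have "0 \<le> 2 * c * (Lob A + Lob B + Lob C)" using I(2) unfolding e[symmetric] by simp
  then show "0 \<le> Lob A + Lob B + Lob C" using c by (simp add: zero_le_mult_iff)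
qed

text \<open>The integral over z is elementary. Setting y = x m makes the x-integrand the reciprocal
  of a product of two linear factors, so it yields a logarithm over m. A last rescaling m = k n
  brings the remaining integral to the form of \<open>Lob_angle_integral\<close>.\<close>

lemma octant_integral:
  fixes g12 g13 g14 g23 g24 g34 :: real
  assumes g: "g12 > 0" "g13 > 0" "g14 > 0" "g23 > 0" "g24 > 0" "g34 > 0"
    and ABC: "A = g12 * g34" "B = g13 * g24" "C = g14 * g23" and D: "heron A B C > 0"
  defines "\<alpha> \<equiv> arccos ((B + C - A) / (2 * sqrt (B * C)))" and "\<beta> \<equiv> arccos ((A + C - B) / (2 * sqrt (A * C)))"
    and "\<gamma> \<equiv> arccos ((A + B - C) / (2 * sqrt (A * B)))"
  shows "(\<integral>\<^sup>+x. \<integral>\<^sup>+y. \<integral>\<^sup>+z. indicator {0<..} x * (indicator {0<..} y * (indicator {0<..} z *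
      ennreal (1 / (16 * ((g13 * x + g23 * y + g34) * z + (g12 * x * y + g14 * x + g24 * y))\<^sup>2)))) \<partial>lborel \<partial>lborel \<partial>lborel)
    = ennreal ((Lob \<alpha> + Lob \<beta> + Lob \<gamma>) / (4 * sqrt (heron A B C)))"
    and "0 \<le> Lob \<alpha> + Lob \<beta> + Lob \<gamma>"
proof -
  have p: "A > 0" "B > 0" "C > 0" unfolding ABC by (intro mult_pos_pos g)+
  note tri = triangle_angles[OF p D, folded \<alpha>_def \<beta>_def \<gamma>_def]
  have s: "sin \<alpha> > 0" using tri_sin_pos[OF tri(1)] by simp
  define a b c h where "a = sqrt A" and "b = sqrt B" and "c = sqrt C" and "h = sqrt (heron A B C)"
  have abc: "a > 0" "b > 0" "c > 0" "h > 0" "A = a * a" "B = b * b" "C = c * c" using p D by (simp_all add: a_def b_def c_def h_def)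
  have sines: "sin \<alpha> = h / (2 * (b * c))" "sin \<beta> = h / (2 * (a * c))" "sin \<gamma> = h / (2 * (a * b))"
    using tri(2-4) by (simp_all add: real_sqrt_mult a_def b_def c_def h_def)
  have quad: "n\<^sup>2 + 2 * cos \<alpha> * n + 1 > 0" for n
  proof -
    have "n\<^sup>2 + 2 * cos \<alpha> * n + 1 = (n + cos \<alpha>)\<^sup>2 + (sin \<alpha>)\<^sup>2" by (simp add: power2_sum sin_squared_eq algebra_simps)
    also have "\<dots> > 0" using s by (intro add_nonneg_pos) auto
    finally show ?thesis .
  qed
  have cosa: "2 * cos \<alpha> * (b * c) = B + C - A"
  proof -
    have "(B + C - A)\<^sup>2 \<le> 4 * B * C" using D by (simp add: heron_def power2_eq_square algebra_simps)
    then have sq: "((B + C - A) / (2 * sqrt (B * C)))\<^sup>2 \<le> 1" unfolding power_divide power_mult_distrib using p by (simp add: divide_le_eq)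
    have "- 1 \<le> r \<and> r \<le> 1" if "r\<^sup>2 \<le> 1" for r :: real using that by (simp add: abs_square_le_1 abs_le_iff)
    from this[OF sq] have "cos \<alpha> = (B + C - A) / (2 * sqrt (B * C))" unfolding \<alpha>_def by (intro cos_arccos) auto
    then show ?thesis using abc(2,3) by (simp add: real_sqrt_mult b_def[symmetric] c_def[symmetric] field_simps)
  qed
  define W where "W n = (c * n + b) * (b * n + c) / (a * a * n)" for n
  have Wm1: "(c * n + b) * (b * n + c) - a * a * n = b * c * (n\<^sup>2 + 2 * cos \<alpha> * n + 1)" for n
  proof -
    have "b * c * (n\<^sup>2 + 2 * cos \<alpha> * n + 1) = b * c * n\<^sup>2 + (2 * cos \<alpha> * (b * c)) * n + b * c" by (simp add: algebra_simps)
    then show ?thesis unfolding cosa abc(5-7) by (simp add: power2_eq_square algebra_simps)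
  qed
  have W1: "W n \<ge> 1" if "n > 0" for n
  proof -
    have "0 < b * c * (n\<^sup>2 + 2 * cos \<alpha> * n + 1)" by (intro mult_pos_pos abc quad)
    then show ?thesis unfolding W_def Wm1[symmetric] using that abc by (simp add: le_divide_eq)
  qed
  have Wsin: "W n = (sin \<gamma> * n + sin \<beta>) * (sin \<beta> * n + sin \<gamma>) / ((sin \<alpha>)\<^sup>2 * n)" if "n > 0" for n
  proof -
    define q where "q = h / (2 * (a * b * c))"
    have q: "q > 0" using abc by (simp add: q_def)
    have "sin \<alpha> = q * a" "sin \<beta> = q * b" "sin \<gamma> = q * c" unfolding sines q_def using abc by simp_all
    then have "(sin \<gamma> * n + sin \<beta>) * (sin \<beta> * n + sin \<gamma>) / ((sin \<alpha>)\<^sup>2 * n) = (q * q) * ((c * n + b) * (b * n + c)) / ((q * q) * (a * a * n))"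
      by (simp add: power2_eq_square algebra_simps)
    then show ?thesis unfolding W_def using q by simp
  qed
  \<comment> \<open>With this scale the individual g_ij drop out of the argument of the logarithm,
    which becomes \<open>W n\<close> and depends on A, B, C only.\<close>
  define k where "k = b * c / (g23 * g24)"
  have k: "k > 0" using abc g by (simp add: k_def)
  define P T R where "P m = g13 + g23 * m" and "T m = g14 + g24 * m" and "R m = g12 * m" for m
  have PTR: "P m > 0" "T m > 0" "R m > 0" if "m > 0" for m
    unfolding P_def T_def R_def using g that by (auto intro!: add_pos_pos mult_pos_pos)
  have Pk: "P (k * n) = b * (c * n + b) / g24" "T (k * n) = c * (b * n + c) / g23" "g34 * R (k * n) = b * c * (a * a * n) / (g23 * g24)" for n
  proof -
    have "g13 = b * b / g24" "g14 = c * c / g23" "g34 * g12 = a * a" using ABC abc g by (simp_all add: field_simps)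
    then show "P (k * n) = b * (c * n + b) / g24" "T (k * n) = c * (b * n + c) / g23" "g34 * R (k * n) = b * c * (a * a * n) / (g23 * g24)"
      unfolding P_def T_def R_def k_def using g by (simp_all add: field_simps)
  qed
  have PT: "P (k * n) * T (k * n) - g34 * R (k * n) = b * c * (b * c * (n\<^sup>2 + 2 * cos \<alpha> * n + 1)) / (g23 * g24)" for n
    unfolding Pk Wm1[symmetric] using g by (simp add: field_simps)
  \<comment> \<open>Nondegeneracy of the triangle enters here: n^2 + 2 n cos \<alpha> + 1 has no
    real zero because sin \<alpha> > 0.\<close>
  have pos: "P m * T m - g34 * R m > 0" for m
  proof -
    have "0 < b * c * (b * c * ((m / k)\<^sup>2 + 2 * cos \<alpha> * (m / k) + 1)) / (g23 * g24)"
      by (intro divide_pos_pos mult_pos_pos abc g quad)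
    then show ?thesis unfolding PT[symmetric] using k by simp
  qed
  define q where "q = 1 / (8 * h)"
  have S4: "ennreal k * ennreal (ln (P (k * n) * T (k * n) / (g34 * R (k * n))) / (16 * (P (k * n) * T (k * n) - g34 * R (k * n))))
    = ennreal (q * (sin \<alpha> * ln (W n) / (n\<^sup>2 + 2 * cos \<alpha> * n + 1)))" if "n > 0" for n
  proof -
    have "(b * u / g24 * (c * v / g23)) / (b * c * w / (g23 * g24)) = u * v / w" for u v w
      using abc g by (simp add: divide_simps)
    then have e: "P (k * n) * T (k * n) / (g34 * R (k * n)) = W n" unfolding Pk W_def .
    define X where "X = n\<^sup>2 + 2 * cos \<alpha> * n + 1"
    have X: "X > 0" unfolding X_def by (rule quad)
    have "k * (ln (W n) / (16 * (b * c * (b * c * X) / (g23 * g24)))) = q * (sin \<alpha> * ln (W n) / X)"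
      unfolding k_def q_def sines using abc g X by (simp add: field_simps)
    then show ?thesis unfolding e PT X_def[symmetric] using k by (simp add: ennreal_mult'[symmetric])
  qed
  define h1 where "h1 x y = indicator {0<..} x * (indicator {0<..} y * ennreal (1 / (16 * (g13 * x + g23 * y + g34) * (g12 * x * y + g14 * x + g24 * y))))" for x y :: real
  have h1: "(\<integral>\<^sup>+z. indicator {0<..} x * (indicator {0<..} y * (indicator {0<..} z *
      ennreal (1 / (16 * ((g13 * x + g23 * y + g34) * z + (g12 * x * y + g14 * x + g24 * y))\<^sup>2)))) \<partial>lborel) = h1 x y" for x y
  proof (cases "x > 0 \<and> y > 0")
    case True
    then have "g13 * x + g23 * y + g34 > 0" "g12 * x * y + g14 * x + g24 * y > 0" using g by (auto intro!: add_pos_pos mult_pos_pos)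
    from integral_inverse_quadratic[OF this] True show ?thesis by (simp add: h1_def)
  qed (auto simp: h1_def)
  define h2 where "h2 x m = indicator {0<..} x * (indicator {0<..} m * ennreal (1 / (16 * ((P m * x + g34) * (R m * x + T m)))))" for x m :: real
  have h2: "(\<integral>\<^sup>+y. h1 x y \<partial>lborel) = (\<integral>\<^sup>+m. h2 x m \<partial>lborel)" for x
  proof (cases "x > 0")
    case x: True
    have "(\<integral>\<^sup>+y. h1 x y \<partial>lborel) = ennreal (x ^ DIM(real)) * (\<integral>\<^sup>+m. h1 x (x *\<^sub>R m) \<partial>lborel)"
      by (rule nn_integral_scale[OF _ x]) (simp add: h1_def)
    also have "\<dots> = (\<integral>\<^sup>+m. ennreal x * h1 x (x *\<^sub>R m) \<partial>lborel)" by (subst nn_integral_cmult) (simp_all add: h1_def)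
    also have "\<dots> = (\<integral>\<^sup>+m. h2 x m \<partial>lborel)"
    proof (intro nn_integral_cong)
      fix m :: real
      show "ennreal x * h1 x (x *\<^sub>R m) = h2 x m"
      proof (cases "m > 0")
        case m: True
        have "x * (1 / (16 * (g13 * x + g23 * (x * m) + g34) * (g12 * x * (x * m) + g14 * x + g24 * (x * m)))) = 1 / (16 * ((P m * x + g34) * (R m * x + T m)))"
        proof -
          have e1: "g13 * x + g23 * (x * m) + g34 = P m * x + g34" by (simp add: P_def algebra_simps)
          have e2: "g12 * x * (x * m) + g14 * x + g24 * (x * m) = x * (R m * x + T m)" by (simp add: R_def T_def algebra_simps)
          show ?thesis unfolding e1 e2 using x by simp
        qed
        then show ?thesis using x m by (simp add: h1_def h2_def ennreal_mult'[symmetric])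
      next
        case False
        then show ?thesis using x by (simp add: h1_def h2_def zero_less_mult_iff)
      qed
    qed
    finally show ?thesis .
  qed (simp add: h1_def h2_def)
  have m2: "(\<lambda>z. h2 (fst z) (snd z)) \<in> borel_measurable borel"
  proof -
    have [measurable]: "(fst :: real \<times> real \<Rightarrow> real) \<in> borel_measurable borel" "(snd :: real \<times> real \<Rightarrow> real) \<in> borel_measurable borel"
      by (intro borel_measurable_continuous_onI continuous_intros)+
    show ?thesis unfolding h2_def P_def R_def T_def by measurable
  qed
  define h3 where "h3 m = indicator {0<..} m * ennreal (ln (P m * T m / (g34 * R m)) / (16 * (P m * T m - g34 * R m)))" for m :: real
  have h3: "(\<integral>\<^sup>+x. h2 x m \<partial>lborel) = h3 m" for m
  proof (cases "m > 0")
    case True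
    then show ?thesis
      using integral_inverse_product[OF PTR(1)[OF True] g(6) PTR(3)[OF True] PTR(2)[OF True] pos] by (simp add: h2_def h3_def)
  qed (simp add: h2_def h3_def)
  have "(\<integral>\<^sup>+x. \<integral>\<^sup>+m. h2 x m \<partial>lborel \<partial>lborel) = (\<integral>\<^sup>+m. \<integral>\<^sup>+x. h2 x m \<partial>lborel \<partial>lborel)"
    using nn_integral_lborel_pair[OF m2] by simp
  also have "\<dots> = (\<integral>\<^sup>+m. h3 m \<partial>lborel)" unfolding h3 ..
  also have "\<dots> = ennreal (k ^ DIM(real)) * (\<integral>\<^sup>+n. h3 (k *\<^sub>R n) \<partial>lborel)"
    by (rule nn_integral_scale[OF _ k]) (simp add: h3_def P_def T_def R_def)
  also have "\<dots> = (\<integral>\<^sup>+n. ennreal k * h3 (k *\<^sub>R n) \<partial>lborel)"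
    by (subst nn_integral_cmult) (simp_all add: h3_def P_def T_def R_def)
  also have "\<dots> = (\<integral>\<^sup>+n. indicator {0<..} n * ennreal (q * (sin \<alpha> * ln (W n) / (n\<^sup>2 + 2 * cos \<alpha> * n + 1))) \<partial>lborel)"
  proof (intro nn_integral_cong)
    fix n :: real
    show "ennreal k * h3 (k *\<^sub>R n) = indicator {0<..} n * ennreal (q * (sin \<alpha> * ln (W n) / (n\<^sup>2 + 2 * cos \<alpha> * n + 1)))"
      using k S4[of n] by (cases "n > 0") (simp_all add: h3_def zero_less_mult_iff)
  qed
  also have "\<dots> = ennreal (2 * q * (Lob \<alpha> + Lob \<beta> + Lob \<gamma>))"
    by (rule Lob_angle_integral(1)[OF tri(1) _ Wsin W1]) (use abc in \<open>simp_all add: q_def\<close>)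
  also have "2 * q * (Lob \<alpha> + Lob \<beta> + Lob \<gamma>) = (Lob \<alpha> + Lob \<beta> + Lob \<gamma>) / (4 * sqrt (heron A B C))"
    by (simp add: q_def h_def)
  finally show "(\<integral>\<^sup>+x. \<integral>\<^sup>+y. \<integral>\<^sup>+z. indicator {0<..} x * (indicator {0<..} y * (indicator {0<..} z *
      ennreal (1 / (16 * ((g13 * x + g23 * y + g34) * z + (g12 * x * y + g14 * x + g24 * y))\<^sup>2)))) \<partial>lborel \<partial>lborel \<partial>lborel)
    = ennreal ((Lob \<alpha> + Lob \<beta> + Lob \<gamma>) / (4 * sqrt (heron A B C)))" unfolding h1 h2 .
  show "0 \<le> Lob \<alpha> + Lob \<beta> + Lob \<gamma>" by (rule Lob_angle_integral(2)[OF tri(1) zero_less_one Wsin W1])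
qed

lemma (in ideal_tetrahedron) dual_vector:
  obtains n where "lor n a = 0" "lor n b = 0" "lor n c = 0" "lor n d = 1"
proof (rule that)
  let ?D = "heron (ge a b * ge c d) (ge a c * ge b d) (ge a d * ge b c)"
  show "lor ((1 / ?D) *\<^sub>R face_normal a b c d) a = 0" "lor ((1 / ?D) *\<^sub>R face_normal a b c d) b = 0"
    "lor ((1 / ?D) *\<^sub>R face_normal a b c d) c = 0" "lor ((1 / ?D) *\<^sub>R face_normal a b c d) d = 1"
    using heron_pos face_normal_abc by (simp_all only: lor_simps mult_zero_right) simp
qed

text \<open>The cone over the tetrahedron, truncated at Lorentz norm 1, is measured twice:
  \<open>cone_volume\<close> gives a quarter of the hyperbolic volume, and vertex coordinates give
  sqrt D times an integral that \<open>octant_integral\<close> evaluates with 4 sqrt D in the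
  denominator.\<close>

lemma tetrahedron_volume:
  fixes p :: "4 \<Rightarrow> minkowski"
  assumes rep: "\<And>i. ideal_rep (p i)" and nc: "\<not> ideal_coplanar (range p)"
  defines "A \<equiv> ge (p 1) (p 2) * ge (p 3) (p 0)" and "B \<equiv> ge (p 1) (p 3) * ge (p 2) (p 0)" and "C \<equiv> ge (p 1) (p 0) * ge (p 2) (p 3)"
  shows "hvolume (ideal_hull (range p)) = Lob (arccos ((B + C - A) / (2 * sqrt (B * C)))) + Lob (arccos ((A + C - B) / (2 * sqrt (A * C)))) + Lob (arccos ((A + B - C) / (2 * sqrt (A * B))))"
    (is "_ = ?L")
proof -
  have Z: "(4::4) = 0" by simp
  have U: "UNIV = {1, 2, 3, 0 :: 4}" unfolding UNIV_4 Z ..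
  have ran: "range p = {p 1, p 2, p 3, p 0}" unfolding U by simp
  have T: "ideal_tetrahedron (p 1) (p 2) (p 3) (p 0)" "ideal_tetrahedron (p 2) (p 3) (p 0) (p 1)"
     "ideal_tetrahedron (p 3) (p 0) (p 1) (p 2)" "ideal_tetrahedron (p 0) (p 1) (p 2) (p 3)"
    using rep nc unfolding ideal_tetrahedron_def ran by (simp_all add: insert_commute)
  obtain n0 where n0: "lor n0 (p 1) = 0" "lor n0 (p 2) = 0" "lor n0 (p 3) = 0" "lor n0 (p 0) = 1" by (rule ideal_tetrahedron.dual_vector[OF T(1)])
  obtain n1 where n1: "lor n1 (p 2) = 0" "lor n1 (p 3) = 0" "lor n1 (p 0) = 0" "lor n1 (p 1) = 1" by (rule ideal_tetrahedron.dual_vector[OF T(2)])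
  obtain n2 where n2: "lor n2 (p 3) = 0" "lor n2 (p 0) = 0" "lor n2 (p 1) = 0" "lor n2 (p 2) = 1" by (rule ideal_tetrahedron.dual_vector[OF T(3)])
  obtain n3 where n3: "lor n3 (p 0) = 0" "lor n3 (p 1) = 0" "lor n3 (p 2) = 0" "lor n3 (p 3) = 1" by (rule ideal_tetrahedron.dual_vector[OF T(4)])
  note pos = ideal_tetrahedron.ge_pos[OF T(1)]
  have ps: "snd (p i) > 0" "lor (p i) (p i) = 0" for i using rep[of i] by (auto simp: ideal_rep_def)
  define D where "D = heron A B C"
  have D: "D > 0" unfolding D_def A_def B_def C_def by (rule ideal_tetrahedron.heron_pos[OF T(1)])
  define t where "t s = fst (fst s) *\<^sub>R p 1 + fst (snd (fst s)) *\<^sub>R p 2 + snd (snd (fst s)) *\<^sub>R p 3 + snd s *\<^sub>R p 0" for s :: "(real \<times> real \<times> real) \<times> real"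
  have nt: "lor n1 (t s) = fst (fst s)" "lor n2 (t s) = fst (snd (fst s))" "lor n3 (t s) = snd (snd (fst s))" "lor n0 (t s) = snd s" for s
    unfolding t_def by (simp_all add: n0 n1 n2 n3)
  \<comment> \<open>The cone over the ideal tetrahedron as an intersection of half spaces: the
    products with the dual vectors n_i are the coordinates in the basis of vertices.\<close>
  define K where "K = {X. 0 \<le> lor n1 X \<and> 0 \<le> lor n2 X \<and> 0 \<le> lor n3 X \<and> 0 \<le> lor n0 X}"
  have cl: "continuous_on UNIV (lor n)" for n unfolding lor_def by (intro continuous_intros)
  have "closed K" unfolding K_def by (intro closed_Collect_conj closed_Collect_le continuous_on_const cl)
  then have K[measurable]: "K \<in> sets borel" by simp
  have cone: "c *\<^sub>R X \<in> K \<longleftrightarrow> X \<in> K" if "c > 0" for c X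
    using that by (simp add: K_def zero_le_mult_iff)
  define S where "S = {s :: real \<times> real \<times> real. 0 \<le> fst s \<and> 0 \<le> fst (snd s) \<and> 0 \<le> snd (snd s)}"
  have "closed S" unfolding S_def by (intro closed_Collect_conj closed_Collect_le continuous_intros)
  then have S[measurable]: "S \<in> sets borel" by simp
  have tm[measurable]: "t \<in> borel_measurable borel" unfolding t_def[abs_def] by (intro borel_measurable_continuous_onI continuous_intros)
  have tK: "t s \<in> K \<longleftrightarrow> fst s \<in> S \<and> 0 \<le> snd s" for s unfolding K_def S_def by (auto simp: nt)
  define q where "q x y z = (ge (p 1) (p 3) * x + ge (p 2) (p 3) * y + ge (p 3) (p 0)) * z + (ge (p 1) (p 2) * x * y + ge (p 1) (p 0) * x + ge (p 2) (p 0) * y)" for x y z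
  have lt: "lor (t ((x, y, z), 1)) (t ((x, y, z), 1)) = - 2 * q x y z" for x y z
    unfolding t_def q_def
    by (simp add: ps lor_commute[of "p 2" "p 1"] lor_commute[of "p 3" "p 1"] lor_commute[of "p 0" "p 1"] lor_commute[of "p 3" "p 2"] lor_commute[of "p 0" "p 2"] lor_commute[of "p 0" "p 3"])
      (simp add: algebra_simps)
  have qpos: "q x y z > 0" if "x \<ge> 0" "y \<ge> 0" "z \<ge> 0" "x > 0 \<or> y > 0 \<or> z > 0" for x y z
  proof -
    have M: "ge (p 1) (p 3) * x + ge (p 2) (p 3) * y + ge (p 3) (p 0) > 0"
      using that(1,2) pos(2,4,6) by (intro add_nonneg_pos add_nonneg_nonneg mult_nonneg_nonneg) auto
    have e: "0 \<le> ge (p 1) (p 2) * x * y" "0 \<le> ge (p 1) (p 0) * x" "0 \<le> ge (p 2) (p 0) * y"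
      using that(1,2) pos(1,3,5) by (intro mult_nonneg_nonneg; simp)+
    have z: "0 \<le> (ge (p 1) (p 3) * x + ge (p 2) (p 3) * y + ge (p 3) (p 0)) * z" using M that(3) by (intro mult_nonneg_nonneg) auto
    from that(4) show ?thesis
    proof (elim disjE)
      assume "x > 0"
      then have "0 < ge (p 1) (p 0) * x" by (intro mult_pos_pos pos)
      then show ?thesis unfolding q_def using e z by linarith
    next
      assume "y > 0"
      then have "0 < ge (p 2) (p 0) * y" by (intro mult_pos_pos pos)
      then show ?thesis unfolding q_def using e z by linarith
    next
      assume "z > 0"
      then have "0 < (ge (p 1) (p 3) * x + ge (p 2) (p 3) * y + ge (p 3) (p 0)) * z" by (intro mult_pos_pos M)
      then show ?thesis unfolding q_def using e by linarith
    qed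
  qed
  have H: "(y, sqrt (1 + y \<bullet> y)) \<in> ideal_hull (range p) \<longleftrightarrow> (y, sqrt (1 + y \<bullet> y)) \<in> K" for y
  proof -
    define X where "X = (y, sqrt (1 + y \<bullet> y))"
    have "1 + y \<bullet> y > 0" by (intro add_pos_nonneg) auto
    then have X: "X \<in> H3" "snd X > 0" by (simp_all add: X_def H3_def lor_def)
    have "X \<in> K" if "s > 0" "s *\<^sub>R X \<in> convex hull (range p)" for s
    proof -
      have "convex K" unfolding K_def convex_def by (auto intro!: add_nonneg_nonneg mult_nonneg_nonneg)
      moreover have "range p \<subseteq> K" unfolding ran K_def by (simp add: n0 n1 n2 n3)
      ultimately have "convex hull (range p) \<subseteq> K" by (intro hull_minimal)
      then show ?thesis using that cone by blast
    qed
    moreover have "\<exists>s>0. s *\<^sub>R X \<in> convex hull (range p)" if XK: "X \<in> K"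
    proof -
      obtain x1 x2 x3 x0 where "X = x1 *\<^sub>R p 1 + x2 *\<^sub>R p 2 + x3 *\<^sub>R p 3 + x0 *\<^sub>R p 0"
        by (rule ideal_coordinates_exist[OF rep D[unfolded D_def A_def B_def C_def]])
      then have Xt: "X = t ((x1, x2, x3), x0)" by (simp add: t_def)
      have nn: "x1 \<ge> 0" "x2 \<ge> 0" "x3 \<ge> 0" "x0 \<ge> 0" using XK unfolding Xt tK S_def by auto
      define w where "w i = (if i = 1 then x1 else if i = 2 then x2 else if i = 3 then x3 else x0)" for i :: 4
      have w: "X = (\<Sum>i\<in>UNIV. w i *\<^sub>R p i)" unfolding Xt t_def sum_4 Z by (simp add: w_def)
      define \<sigma> where "\<sigma> = (\<Sum>i\<in>UNIV. w i)"
      have \<sigma>: "\<sigma> \<ge> 0" unfolding \<sigma>_def using nn by (intro sum_nonneg) (simp add: w_def)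
      have "\<sigma> \<noteq> 0"
      proof
        assume "\<sigma> = 0"
        then have "x1 + x2 + x3 + x0 = 0" unfolding \<sigma>_def sum_4 Z by (simp add: w_def)
        then have "x1 = 0" "x2 = 0" "x3 = 0" "x0 = 0" using nn by linarith+
        then have "X = 0" unfolding Xt t_def by simp
        then show False using X(2) by simp
      qed
      with \<sigma> have s: "\<sigma> > 0" by simp
      have "(\<Sum>i\<in>UNIV. (w i / \<sigma>) *\<^sub>R p i) \<in> convex hull (range p)"
      proof (rule convex_sum)
        show "(\<Sum>i\<in>UNIV. w i / \<sigma>) = 1" unfolding sum_divide_distrib[symmetric] using s by (simp add: \<sigma>_def)
        show "0 \<le> w i / \<sigma>" for i using nn s by (simp add: w_def)
      qed (auto intro: hull_inc)
      moreover have "(\<Sum>i\<in>UNIV. (w i / \<sigma>) *\<^sub>R p i) = (1 / \<sigma>) *\<^sub>R X" unfolding w scaleR_sum_right by simp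
      ultimately show ?thesis using s by (intro exI[of _ "1 / \<sigma>"]) simp
    qed
    ultimately show ?thesis unfolding ideal_hull_def X_def[symmetric] mem_Collect_eq using X by blast
  qed
  define V where "V = (\<integral>\<^sup>+y. indicator {y. (y, sqrt (1 + y \<bullet> y)) \<in> K} y * ennreal (1 / sqrt (1 + y \<bullet> y)) \<partial>(lborel :: (real^3) measure))"
  define I :: "minkowski \<Rightarrow> ennreal" where "I = indicator {X \<in> K. snd X > 0 \<and> 0 \<le> - lor X X \<and> - lor X X \<le> 1}"
  have [measurable]: "(\<lambda>X. lor X X) \<in> borel_measurable borel" unfolding lor_def
    by (intro borel_measurable_continuous_onI continuous_intros)
  have [measurable]: "(snd :: (real^3) \<times> real \<Rightarrow> real) \<in> borel_measurable borel"
    by (intro borel_measurable_continuous_onI continuous_intros)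
  have [measurable]: "I \<in> borel_measurable borel" unfolding I_def by measurable
  define F where "F s = indicator S s * ennreal (1 / (4 * (lor (t (s, 1)) (t (s, 1)))\<^sup>2))" for s
  have "ennreal (1 / 4) * V = (\<integral>\<^sup>+X. I X \<partial>lborel)" unfolding V_def I_def by (rule cone_volume[OF K cone, symmetric])
  also have "\<dots> = ennreal (sqrt D) * (\<integral>\<^sup>+s. I (t s) \<partial>lborel)"
    unfolding t_def by (rule nn_integral_cone_coordinates[OF rep]) (use D in \<open>simp_all only: D_def A_def B_def C_def, simp\<close>)
  also have "(\<integral>\<^sup>+s. I (t s) \<partial>lborel) = (\<integral>\<^sup>+s. F s \<partial>lborel)"
    unfolding I_def F_def
  proof (rule cone_parameter_integral[OF _ tm K S _ _ cone])
    show "t (c *\<^sub>R x) = c *\<^sub>R t x" for c x by (simp add: t_def scaleR_add_right)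
    show "t (s, u) \<in> K \<Longrightarrow> u \<ge> 0" for s u by (simp add: tK)
    show "t (s, 1) \<in> K \<longleftrightarrow> s \<in> S" for s by (simp add: tK)
    show "snd (t (s, 1)) > 0 \<and> - lor (t (s, 1)) (t (s, 1)) > 0" if s: "s \<in> S" "s \<noteq> 0" for s
    proof -
      obtain x y z where xyz: "s = (x, y, z)" by (cases s)
      have nn: "x \<ge> 0" "y \<ge> 0" "z \<ge> 0" "x > 0 \<or> y > 0 \<or> z > 0" using s unfolding S_def xyz by (auto simp: zero_prod_def)
      have "snd (t (s, 1)) > 0"
        unfolding xyz t_def using nn ps(1) by (simp add: add_nonneg_pos order_less_imp_le)
      then show ?thesis unfolding xyz lt using qpos[OF nn] by simp
    qed
  qed
  also have "(\<integral>\<^sup>+s. F s \<partial>lborel) = ennreal (?L / (4 * sqrt D))"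
  proof -
    \<comment> \<open>Passing to the open octant changes the integrand only on coordinate planes,
      which are null sets; the factor 16 is 4 times the square of the 2 in the quadratic
      form.\<close>
    define G where "G x y z = indicator {0<..} x * (indicator {0<..} y * (indicator {0<..} z * ennreal (1 / (16 * (q x y z)\<^sup>2))))" for x y z :: real
    have F: "F (x, y, z) = G x y z" if "x \<noteq> 0" "y \<noteq> 0" "z \<noteq> 0" for x y z
    proof -
      have "4 * (- 2 * q x y z)\<^sup>2 = 16 * (q x y z)\<^sup>2" by (simp add: power2_eq_square)
      then show ?thesis using that unfolding F_def lt G_def S_def by (auto simp: indicator_def)
    qed
    have [measurable]: "(\<lambda>s. t (s, 1)) \<in> borel_measurable borel" unfolding t_def by (intro borel_measurable_continuous_onI continuous_intros)
    have Fm[measurable]: "F \<in> borel_measurable borel" unfolding F_def by measurable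
    have [measurable]: "(\<lambda>y. (x, y)) \<in> borel_measurable (borel :: (real \<times> real) measure)" for x :: real
      by (intro borel_measurable_continuous_onI continuous_intros)
    have "(\<integral>\<^sup>+s. F s \<partial>lborel) = (\<integral>\<^sup>+x. \<integral>\<^sup>+s. F (x, s) \<partial>lborel \<partial>lborel)" by (rule nn_integral_lborel_pair(1)[OF Fm])
    also have "\<dots> = (\<integral>\<^sup>+x. \<integral>\<^sup>+y. \<integral>\<^sup>+z. F (x, y, z) \<partial>lborel \<partial>lborel \<partial>lborel)"
    proof (intro nn_integral_cong)
      fix x
      show "(\<integral>\<^sup>+s. F (x, s) \<partial>lborel) = (\<integral>\<^sup>+y. \<integral>\<^sup>+z. F (x, y, z) \<partial>lborel \<partial>lborel)"
        by (rule nn_integral_lborel_pair(1)[of "\<lambda>s. F (x, s)"]) measurable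
    qed
    also have "\<dots> = (\<integral>\<^sup>+x. \<integral>\<^sup>+y. \<integral>\<^sup>+z. G x y z \<partial>lborel \<partial>lborel \<partial>lborel)"
      by (intro nn_integral_cong_AE, rule eventually_mono[OF AE_lborel_singleton[of 0]],
          intro nn_integral_cong_AE, rule eventually_mono[OF AE_lborel_singleton[of 0]],
          intro nn_integral_cong_AE, rule eventually_mono[OF AE_lborel_singleton[of 0]]) (rule F)
    also have "\<dots> = ennreal (?L / (4 * sqrt D))"
      unfolding G_def q_def D_def by (rule octant_integral(1)[OF pos A_def[THEN meta_eq_to_obj_eq] B_def[THEN meta_eq_to_obj_eq] C_def[THEN meta_eq_to_obj_eq] D[unfolded D_def]])
    finally show ?thesis .
  qed
  finally have V4: "ennreal (1 / 4) * V = ennreal (?L / 4)" using D by (simp add: ennreal_mult'[symmetric])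
  have L: "?L \<ge> 0" by (rule octant_integral(2)[OF pos A_def[THEN meta_eq_to_obj_eq] B_def[THEN meta_eq_to_obj_eq] C_def[THEN meta_eq_to_obj_eq] D[unfolded D_def]])
  have "ennreal 4 * ennreal (1 / 4) = ennreal (4 * (1 / 4))" by (rule ennreal_mult'[symmetric]) simp
  then have "V = ennreal 4 * (ennreal (1 / 4) * V)" unfolding mult.assoc[symmetric] by simp
  also have "\<dots> = ennreal (4 * (?L / 4))" unfolding V4 by (rule ennreal_mult'[symmetric]) simp
  also have "4 * (?L / 4) = ?L"
  proof -
    have "4 * (r / 4) = r" for r :: real by simp
    then show ?thesis .
  qed
  finally have V: "V = ennreal ?L" .
  have [measurable]: "(\<lambda>y. (y, sqrt (1 + y \<bullet> y))) \<in> borel_measurable (borel :: (real^3) measure)"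
    by (intro borel_measurable_continuous_onI continuous_intros)
  have "hvolume (ideal_hull (range p)) = (LINT y|lborel. indicator {y. (y, sqrt (1 + y \<bullet> y)) \<in> K} y *\<^sub>R (1 / sqrt (1 + y \<bullet> y)))"
    unfolding hvolume_def H set_lebesgue_integral_def ..
  also have "\<dots> = enn2real (\<integral>\<^sup>+y. ennreal (indicator {y. (y, sqrt (1 + y \<bullet> y)) \<in> K} y *\<^sub>R (1 / sqrt (1 + y \<bullet> y))) \<partial>lborel)"
    by (rule integral_eq_nn_integral) (auto simp: add_nonneg_nonneg)
  also have "(\<integral>\<^sup>+y. ennreal (indicator {y. (y, sqrt (1 + y \<bullet> y)) \<in> K} y *\<^sub>R (1 / sqrt (1 + y \<bullet> y))) \<partial>lborel) = V"
    unfolding V_def by (intro nn_integral_cong) (simp add: indicator_def)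
  finally show ?thesis unfolding V using L by simp
qed

section \<open>Conclusion: volume, triangle coordinates and saddle point combined\<close>

theorem theorem1p2:
  fixes p :: "4 \<Rightarrow> minkowski" and H :: "4 \<Rightarrow> minkowski set"
    and x :: "nat \<Rightarrow> real" and c :: "real \<Rightarrow> real"
  assumes tetrahedron: "decorated_ideal_tetrahedron p H"
    and lengths: "\<And>k. k \<in> {1..6} \<Longrightarrow> x k = edge_lengths p H k"
    and line: "\<And>b. b \<in> {0<..<1} \<Longrightarrow> 11 * Qb b / 6 < c b \<and> c b < 2 * Qb b"
  shows "\<exists>E. E \<in> O[at_right 0](\<lambda>b. complex_of_real (b\<^sup>2)) \<and>
    (\<forall>b\<in>{0<..<1}.
       ideal_sixj (c b) b (\<lambda>k. of_real (Qb b / 2) + \<i> * of_real (x k / (2 * pi * b))) =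
       of_real (1 / 2 * (exp (- covolume p H / (pi * b\<^sup>2)) / root 4 (- det (gram p H)))) *
         (1 + E b))"
proof -
  have rep: "\<And>i. ideal_rep (p i)" and nc: "\<not> ideal_coplanar (range p)" and h: "\<forall>i. \<exists>r>0. H i = {x \<in> H3. lor x (p i) = - r}"
    using tetrahedron unfolding decorated_ideal_tetrahedron_def horosphere_at_def by auto
  obtain r where r: "\<And>i. r i > 0" and H: "\<And>i. H i = {x \<in> H3. lor x (p i) = - r i}" using h by metis
  have xs: "x 1 = edge_lengths p H 1" "x 2 = edge_lengths p H 2" "x 3 = edge_lengths p H 3"
    "x 4 = edge_lengths p H 4" "x 5 = edge_lengths p H 5" "x 6 = edge_lengths p H 6" by (simp_all add: lengths)
  define \<alpha> where "\<alpha> = arccos ((pairB p + pairC p - pairA p) / (2 * sqrt (pairB p * pairC p)))"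
  define \<beta> where "\<beta> = arccos ((pairA p + pairC p - pairB p) / (2 * sqrt (pairA p * pairC p)))"
  define \<gamma> where "\<gamma> = arccos ((pairA p + pairB p - pairC p) / (2 * sqrt (pairA p * pairB p)))"
  obtain \<kappa> where k: "x 1 + x 4 = \<kappa> + lsin \<alpha>" "x 2 + x 5 = \<kappa> + lsin \<beta>" "x 3 + x 6 = \<kappa> + lsin \<gamma>"
    and root: "root 4 (- det (gram p H)) = sqrt (exp \<kappa> * (sin \<alpha> * sin \<beta> * sin \<gamma>) / 2)"
    and cov: "covolume p H = hvolume (ideal_hull (range p)) + 1 / 2 * (\<alpha> * (x 1 + x 4) + \<beta> * (x 2 + x 5) + \<gamma> * (x 3 + x 6))"
    and tri: "tri \<alpha> \<beta> \<gamma>"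
    unfolding xs \<alpha>_def \<beta>_def \<gamma>_def by (rule tetrahedron_geometry[OF rep nc r H])
  have vol: "hvolume (ideal_hull (range p)) = Lob \<alpha> + Lob \<beta> + Lob \<gamma>"
    unfolding \<alpha>_def \<beta>_def \<gamma>_def pairA_def pairB_def pairC_def by (rule tetrahedron_volume[OF rep nc])
  show ?thesis
    unfolding root
    by (rule sixj_saddle_asymptotics[OF tri k refl refl refl refl refl cov[unfolded vol] refl refl refl line])
qed

end
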